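(* There exists a universal constant $\Gamma>0$ such that the following holds. Let $f\in L^2_{rad}(\mathbb{R}^2)$, $f\neq 0$, and let $u(x,t)$, $(x,t)\in\mathbb{R}^2\times\mathbb{R}$, be the solution of the Schrödinger equation $\partial_t u = i\Delta u$ with initial data $u(x,0)=f(x)$. Then $$\|u\|_{L^4(\mathbb{R}^2\times\mathbb{R})}\leq \frac{1}{\sqrt{2}}\, \|f\|_{L^2(\mathbb{R}^2)}\left[1-\Gamma\, \frac{\mathrm{Dist}^2_{L^2(\mathbb{R}^2)}\left(f,\mathcal{G}\right)}{\|f\|^2_{L^2(\mathbb{R}^2)}}\right]^{1/4},$$ where $\mathcal{G}=\{a e^{-b|x|^2}: a,b\in\mathbb{C},\ \mathrm{Re}\, b>0\}$ is the set of radial Gaussians on $\mathbb{R}^2$.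
   Context: Functions are complex-valued. A function on $\mathbb{R}^d$ is radial if it depends only on the Euclidean norm $|x|$ of its argument; $L^2_{rad}(\mathbb{R}^d)$ is the space of radial functions in $L^2(\mathbb{R}^d)$. For $g\in L^2(\mathbb{R}^d)$ and a family $\mathcal{F}\subset L^2(\mathbb{R}^d)$, $\mathrm{Dist}_{L^2(\mathbb{R}^d)}(g,\mathcal{F})=\inf\{\|g-h\|_{L^2(\mathbb{R}^d)}: h\in\mathcal{F}\}$. The solution of the Schrödinger equation with initial data $f\in L^2$ is $u(\cdot,t)=e^{it\Delta}f$. *)

theory Defs
  imports "HOL-Analysis.Analysis"
begin

text \<open>
  Elements of \<open>L\<^sup>p\<close> are represented by functions; the quantities below depend only on the
  class modulo null sets. \<open>Lp_norm\<close> is meaningful only on \<open>Lp_space\<close>: elsewhere the Bochner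
  integral may default to 0.
\<close>

definition Lp_space :: "real \<Rightarrow> 'a measure \<Rightarrow> ('a \<Rightarrow> complex) set" where
  "Lp_space p M = {f \<in> borel_measurable M. integrable M (\<lambda>x. cmod (f x) powr p)}"

definition Lp_norm :: "real \<Rightarrow> 'a measure \<Rightarrow> ('a \<Rightarrow> complex) \<Rightarrow> real" where
  "Lp_norm p M f = (\<integral>x. cmod (f x) powr p \<partial>M) powr (1 / p)"

abbreviation L2 :: "('a::euclidean_space \<Rightarrow> complex) set" where
  "L2 \<equiv> Lp_space 2 lebesgue"

abbreviation L2_norm :: "('a::euclidean_space \<Rightarrow> complex) \<Rightarrow> real" where
  "L2_norm f \<equiv> Lp_norm 2 lebesgue f"

definition radial :: "('a::euclidean_space \<Rightarrow> complex) \<Rightarrow> bool" where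
  "radial f \<longleftrightarrow> (\<forall>x y. norm x = norm y \<longrightarrow> f x = f y)"

definition L2_rad :: "('a::euclidean_space \<Rightarrow> complex) set" where
  "L2_rad = {f \<in> L2. radial f}"

definition L2_Dist ::
  "('a::euclidean_space \<Rightarrow> complex) \<Rightarrow> ('a \<Rightarrow> complex) set \<Rightarrow> real" where
  "L2_Dist g F = (INF h\<in>F. L2_norm (\<lambda>x. g x - h x))"

definition radial_gaussians :: "('a::euclidean_space \<Rightarrow> complex) set" where
  "radial_gaussians =
     {(\<lambda>x. a * exp (- b * complex_of_real ((norm x)\<^sup>2))) | a b. Re b > 0}"

definition fourier_L1 :: "('a::euclidean_space \<Rightarrow> complex) \<Rightarrow> 'a \<Rightarrow> complex" where
  "fourier_L1 f \<xi> = (\<integral>x. cis (- (x \<bullet> \<xi>)) * f x \<partial>lebesgue)"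

text \<open>
  \<open>has_L2_fourier f F\<close>: the class of \<open>F\<close> is the Fourier-Plancherel transform of \<open>f\<close>, i.e. the
  \<open>L\<^sup>2\<close>-limit of the Fourier integrals of the truncations of \<open>f\<close> to balls (which lie in
  \<open>L\<^sup>1\<close> and \<open>L\<^sup>2\<close>).
\<close>

definition has_L2_fourier ::
  "('a::euclidean_space \<Rightarrow> complex) \<Rightarrow> ('a \<Rightarrow> complex) \<Rightarrow> bool" where
  "has_L2_fourier f F \<longleftrightarrow> f \<in> L2 \<and> F \<in> L2 \<and>
     (\<lambda>n. \<integral>\<^sup>+\<xi>. ennreal ((cmod (F \<xi> -
            fourier_L1 (\<lambda>x. indicator (cball 0 (real n)) x * f x) \<xi>))\<^sup>2) \<partial>lebesgue)
       \<longlonglongrightarrow> 0"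

text \<open>
  \<open>schroedinger_propagator t f g\<close> expresses \<open>g = e\<^bsup>it\<Delta>\<^esup> f\<close> in \<open>L\<^sup>2\<close>: with the above normalisation
  of the Fourier transform, \<open>\<Delta>\<close> has symbol \<open>- |\<xi>|\<^sup>2\<close>.
\<close>

definition schroedinger_propagator ::
  "real \<Rightarrow> ('a::euclidean_space \<Rightarrow> complex) \<Rightarrow> ('a \<Rightarrow> complex) \<Rightarrow> bool" where
  "schroedinger_propagator t f g \<longleftrightarrow>
     (\<exists>F. has_L2_fourier f F \<and> has_L2_fourier g (\<lambda>\<xi>. cis (- t * (norm \<xi>)\<^sup>2) * F \<xi>))"

text \<open>
  Each time slice of a solution is determined up to a null set; joint measurability makes \<open>u\<close>
  unique up to a null set of space-time. The case \<open>t = 0\<close> is the initial condition.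
\<close>

definition schroedinger_solution ::
  "('a::euclidean_space \<Rightarrow> complex) \<Rightarrow> ('a \<times> real \<Rightarrow> complex) \<Rightarrow> bool" where
  "schroedinger_solution f u \<longleftrightarrow> u \<in> borel_measurable lebesgue \<and>
     (\<forall>t. schroedinger_propagator t f (\<lambda>x. u (x, t)))"

end

theory Submission
  imports Defs "HOL-Probability.Probability"
begin

text \<open>
  Write the Fourier transform of \<open>f\<close> as \<open>\<phi> (\<bar>\<xi>\<bar>\<^sup>2)\<close>. Applying Plancherel to \<open>u\<^sup>2\<close> in \<open>x\<close> and then in \<open>t\<close> turns
  the \<open>L\<^sup>4\<close> norm of \<open>u\<close> into the \<open>L\<^sup>2\<close> norm of the averages of \<open>\<phi> (\<bar>\<xi>\<bar>\<^sup>2) * \<phi> (\<bar>\<eta>\<bar>\<^sup>2)\<close> over the circles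
  \<open>\<xi> + \<eta> = w\<close>, \<open>\<bar>\<xi>\<bar>\<^sup>2 + \<bar>\<eta>\<bar>\<^sup>2 = S\<close>. Bounding the squared average by the average of the square gives the
  sharp constant, and the discarded variances dominate a constant times
  \<open>\<integral> 1 / S * (\<integral>\<integral> \<bar>\<phi> r * \<phi> (S - r) - \<phi> r' * \<phi> (S - r')\<bar>\<^sup>2 dr dr') dS\<close>.

  This defect bounds \<open>\<integral>\<integral> \<bar>\<phi> (r + h) * \<phi> s - \<phi> r * \<phi> (s + h)\<bar>\<^sup>2 dr ds\<close> for every \<open>h \<ge> 0\<close>. Taking a Laplace
  transform in \<open>h\<close> shows that \<open>\<phi>\<close> is nearly proportional to its resolvent \<open>w\<close>, which solves
  \<open>w' = z * w - \<phi>\<close>; hence \<open>\<phi>\<close> is close in \<open>L\<^sup>2\<close> to an exponential, with an error linear in the square root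
  of the defect. The general case follows by approximating \<open>\<phi>\<close> by continuous functions of bounded
  support and Fatou's lemma.
\<close>

section \<open>Square-integrable functions\<close>

text \<open>Exponentials in \<open>r\<close> form a family invariant under dilation and under
  multiplication by \<open>exp (\<i> * \<tau> * r)\<close>, a time shift of \<open>u\<close>. So
  neither the scale nor the phase of the nearest one is known, and the parameter \<open>z\<close> of
  the resolvent must be read off from \<open>\<phi>\<close>. The quantity that selects it is
  \<open>Re z * (cmod (laplace z))\<^sup>2\<close>. For \<open>\<phi>\<close> of norm 1 the
  Cauchy-Schwarz inequality bounds it by 1/2, with equality only for multiples of
  \<open>exp (- cnj z * r)\<close>. A small defect forces it above an explicit constant for some
  \<open>z\<close>, and this lower bound is all that the closeness argument asks for: no compactness
  enters, and every constant is explicit. The sharp constant survives because, after averaging over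
  all circles with the same \<open>S\<close>, their arcsine laws add up to the uniform law on
  \<open>{0<..<S}\<close>, so the second moments are computed exactly. Only for the variances is one
  density replaced by its lower bound \<open>1 / S\<close>.\<close>

lemma cnj_borel_measurable [measurable]: "cnj \<in> borel_measurable borel"
  by (intro borel_measurable_continuous_onI continuous_intros)

lemma cis_borel_measurable [measurable]: "cis \<in> borel_measurable borel"
  by (intro borel_measurable_continuous_onI continuous_intros)

text \<open>Stated with the natural power 2 and for any measure, so that the same Hilbert space
  facts serve \<open>lborel\<close> and the half-line; \<open>L2_representative\<close> connects it
  with the real power in \<open>Lp_space\<close>.\<close>

definition sqint :: "'a measure \<Rightarrow> ('a \<Rightarrow> complex) \<Rightarrow> bool" where
  "sqint M f \<longleftrightarrow> f \<in> borel_measurable M \<and> integrable M (\<lambda>x. (cmod (f x))\<^sup>2)"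

definition nrm2 :: "'a measure \<Rightarrow> ('a \<Rightarrow> complex) \<Rightarrow> real" where
  "nrm2 M f = sqrt (\<integral>x. (cmod (f x))\<^sup>2 \<partial>M)"

lemma sqint_measurable [measurable_dest]: "sqint M f \<Longrightarrow> f \<in> borel_measurable M"
  by (simp add: sqint_def)

lemma sqint_integrable: "sqint M f \<Longrightarrow> integrable M (\<lambda>x. (cmod (f x))\<^sup>2)"
  by (simp add: sqint_def)

lemma nrm2_nonneg [simp]: "nrm2 M f \<ge> 0"
  by (simp add: nrm2_def)

lemma nrm2_sq: "(nrm2 M f)\<^sup>2 = (\<integral>x. (cmod (f x))\<^sup>2 \<partial>M)"
  by (simp add: nrm2_def)

lemma sqint_mult_integrable:
  assumes "sqint M f" "sqint M g"
  shows "integrable M (\<lambda>x. f x * g x)"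
proof (rule Bochner_Integration.integrable_bound)
  show "integrable M (\<lambda>x. (cmod (f x))\<^sup>2 + (cmod (g x))\<^sup>2)"
    using assms by (auto simp: sqint_def)
  show "(\<lambda>x. f x * g x) \<in> borel_measurable M"
    using assms by (auto simp: sqint_def)
  have "cmod (f x) * cmod (g x) \<le> (cmod (f x))\<^sup>2 + (cmod (g x))\<^sup>2" for x
  proof -
    have "0 \<le> cmod (f x) * cmod (g x)" by simp
    then show ?thesis using sum_squares_bound[of "cmod (f x)" "cmod (g x)"] by linarith
  qed
  then show "AE x in M. norm (f x * g x) \<le> norm ((cmod (f x))\<^sup>2 + (cmod (g x))\<^sup>2)"
    by (auto simp: norm_mult)
qed

lemma sqint_cmult: "sqint M f \<Longrightarrow> sqint M (\<lambda>x. c * f x)"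
  by (auto simp: sqint_def norm_mult power_mult_distrib)

lemma sqint_cnj: "sqint M f \<Longrightarrow> sqint M (\<lambda>x. cnj (f x))"
  unfolding sqint_def by (auto intro: measurable_compose[OF _ cnj_borel_measurable])

lemma sqint_add:
  assumes "sqint M f" "sqint M g"
  shows "sqint M (\<lambda>x. f x + g x)"
proof -
  have 1: "integrable M (\<lambda>x. 2 * (cmod (f x))\<^sup>2 + 2 * (cmod (g x))\<^sup>2)"
    using assms by (auto simp: sqint_def)
  have 2: "(\<lambda>x. f x + g x) \<in> borel_measurable M" "(\<lambda>x. (cmod (f x + g x))\<^sup>2) \<in> borel_measurable M"
    using assms by (auto simp: sqint_def)
  have "(cmod (f x + g x))\<^sup>2 \<le> 2 * (cmod (f x))\<^sup>2 + 2 * (cmod (g x))\<^sup>2" for x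
  proof -
    have "(cmod (f x + g x))\<^sup>2 \<le> (cmod (f x) + cmod (g x))\<^sup>2"
      by (simp add: norm_triangle_ineq power_mono)
    then show ?thesis
      using sum_squares_bound[of "cmod (f x)" "cmod (g x)"] by (simp add: power2_sum)
  qed
  then have "AE x in M. norm ((cmod (f x + g x))\<^sup>2) \<le> norm (2 * (cmod (f x))\<^sup>2 + 2 * (cmod (g x))\<^sup>2)"
    by auto
  from Bochner_Integration.integrable_bound[OF 1 2(2) this] 2(1) show ?thesis
    by (simp add: sqint_def)
qed

lemma sqint_diff: "sqint M f \<Longrightarrow> sqint M g \<Longrightarrow> sqint M (\<lambda>x. f x - g x)"
  using sqint_add[of M f "\<lambda>x. - g x"] sqint_cmult[of M g "-1"] by simp

lemma sqint_zero [simp]: "sqint M (\<lambda>x. 0)"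
  by (simp add: sqint_def)

lemma nrm2_cmult: "nrm2 M (\<lambda>x. c * f x) = cmod c * nrm2 M f"
  by (simp add: nrm2_def norm_mult power_mult_distrib real_sqrt_mult)

lemma nrm2_minus_commute: "nrm2 M (\<lambda>x. f x - g x) = nrm2 M (\<lambda>x. g x - f x)"
  by (simp add: nrm2_def norm_minus_commute)

lemma sqint_eq_0_AE:
  assumes "sqint M f" "nrm2 M f = 0"
  shows "AE x in M. f x = 0"
  using assms integral_nonneg_eq_0_iff_AE[of M "\<lambda>x. (cmod (f x))\<^sup>2"]
  by (auto simp: sqint_def nrm2_def)

lemma cauchy_schwarz_abs:
  assumes f: "sqint M f" and g: "sqint M g"
  shows "(\<integral>x. cmod (f x) * cmod (g x) \<partial>M) \<le> nrm2 M f * nrm2 M g"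
proof (cases "nrm2 M f = 0 \<or> nrm2 M g = 0")
  case True
  then have "AE x in M. f x = 0 \<or> g x = 0"
    using sqint_eq_0_AE[OF f] sqint_eq_0_AE[OF g] by auto
  then have "(\<integral>x. cmod (f x) * cmod (g x) \<partial>M) = (\<integral>x. 0 \<partial>M)"
    using f g by (intro integral_cong_AE) (auto simp: sqint_def)
  then show ?thesis by simp
next
  case False
  define A where "A = nrm2 M f"
  define B where "B = nrm2 M g"
  have pos: "A > 0" "B > 0"
    using False nrm2_nonneg[of M f] nrm2_nonneg[of M g] unfolding A_def B_def by linarith+
  have int: "integrable M (\<lambda>x. cmod (f x) * cmod (g x))"
    using integrable_norm[OF sqint_mult_integrable[OF f g]] by (simp add: norm_mult)
  \<comment> \<open>Weighting crosswise with the two norms makes both square terms equal to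
    \<open>A\<^sup>2 * B\<^sup>2\<close>; the inequality remains after division by
    \<open>A * B\<close>.\<close>
  have "0 \<le> (\<integral>x. (B * cmod (f x) - A * cmod (g x))\<^sup>2 \<partial>M)"
    by (intro integral_nonneg_AE) auto
  also have "\<dots> = (\<integral>x. B\<^sup>2 * (cmod (f x))\<^sup>2 + A\<^sup>2 * (cmod (g x))\<^sup>2
      - 2 * A * B * (cmod (f x) * cmod (g x)) \<partial>M)"
    by (intro Bochner_Integration.integral_cong) (auto simp: power2_eq_square algebra_simps)
  also have "\<dots> = B\<^sup>2 * A\<^sup>2 + A\<^sup>2 * B\<^sup>2 - 2 * A * B * (\<integral>x. cmod (f x) * cmod (g x) \<partial>M)"
    using f g int by (simp add: sqint_def A_def B_def nrm2_sq)
  finally have "A * B * (\<integral>x. cmod (f x) * cmod (g x) \<partial>M) \<le> A * B * (A * B)"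
    by (simp add: power2_eq_square algebra_simps)
  then show ?thesis
    using pos by (simp add: A_def B_def)
qed

lemma cauchy_schwarz:
  assumes f: "sqint M f" and g: "sqint M g"
  shows "cmod (\<integral>x. f x * g x \<partial>M) \<le> nrm2 M f * nrm2 M g"
proof -
  have "cmod (\<integral>x. f x * g x \<partial>M) \<le> (\<integral>x. cmod (f x * g x) \<partial>M)"
    by (rule integral_norm_bound)
  then show ?thesis
    using cauchy_schwarz_abs[OF f g] by (simp add: norm_mult)
qed

lemma nrm2_diff_sq:
  assumes f: "sqint M f" and g: "sqint M g"
  shows "(nrm2 M (\<lambda>x. f x - g x))\<^sup>2
    = (nrm2 M f)\<^sup>2 - 2 * Re (\<integral>x. f x * cnj (g x) \<partial>M) + (nrm2 M g)\<^sup>2"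
proof -
  have int: "integrable M (\<lambda>x. f x * cnj (g x))"
    by (intro sqint_mult_integrable f sqint_cnj g)
  have "(cmod (f x - g x))\<^sup>2 = (cmod (f x))\<^sup>2 - 2 * Re (f x * cnj (g x)) + (cmod (g x))\<^sup>2" for x
    unfolding cmod_power2 by (simp add: power2_eq_square algebra_simps)
  then show ?thesis
    unfolding nrm2_sq using f g int integrable_Re[OF int] integral_Re[OF int]
    by (simp add: sqint_def del: times_complex.sel)
qed

lemma nrm2_triangle:
  assumes f: "sqint M f" and g: "sqint M g"
  shows "nrm2 M (\<lambda>x. f x + g x) \<le> nrm2 M f + nrm2 M g"
proof (rule power2_le_imp_le)
  have g': "sqint M (\<lambda>x. - g x)" using sqint_cmult[OF g, of "-1"] by simp
  have "(nrm2 M (\<lambda>x. f x + g x))\<^sup>2 = (nrm2 M f)\<^sup>2 + 2 * Re (\<integral>x. f x * cnj (g x) \<partial>M) + (nrm2 M g)\<^sup>2"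
    using nrm2_diff_sq[OF f g'] nrm2_cmult[of M "-1" g] by simp
  moreover have "Re (\<integral>x. f x * cnj (g x) \<partial>M) \<le> nrm2 M f * nrm2 M g"
    using cauchy_schwarz[OF f sqint_cnj[OF g]] complex_Re_le_cmod[of "\<integral>x. f x * cnj (g x) \<partial>M"]
    by (simp add: nrm2_def[of M "\<lambda>x. cnj (g x)"] nrm2_def[of M g])
  ultimately show "(nrm2 M (\<lambda>x. f x + g x))\<^sup>2 \<le> (nrm2 M f + nrm2 M g)\<^sup>2"
    by (simp add: power2_sum)
qed simp

lemma nrm2_triangle_diff:
  assumes "sqint M f" "sqint M g" "sqint M h"
  shows "nrm2 M (\<lambda>x. f x - h x) \<le> nrm2 M (\<lambda>x. f x - g x) + nrm2 M (\<lambda>x. g x - h x)"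
  using nrm2_triangle[OF sqint_diff[OF assms(1,2)] sqint_diff[OF assms(2,3)]] by simp

lemma nrm2_diff_abs:
  assumes "sqint M f" "sqint M g"
  shows "\<bar>nrm2 M f - nrm2 M g\<bar> \<le> nrm2 M (\<lambda>x. f x - g x)"
  using nrm2_triangle_diff[OF assms(1,2) sqint_zero] nrm2_triangle_diff[OF assms(2,1) sqint_zero]
    nrm2_minus_commute[of M f g] by simp

lemma sqint_iff_nn:
  "sqint M f \<longleftrightarrow> f \<in> borel_measurable M \<and> (\<integral>\<^sup>+x. ennreal ((cmod (f x))\<^sup>2) \<partial>M) < \<infinity>"
  by (auto simp: sqint_def integrable_iff_bounded)

lemma nn_integral_sqint:
  "sqint M f \<Longrightarrow> (\<integral>\<^sup>+x. ennreal ((cmod (f x))\<^sup>2) \<partial>M) = ennreal ((nrm2 M f)\<^sup>2)"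
  unfolding nrm2_sq by (intro nn_integral_eq_integral) (auto simp: sqint_def)

text \<open>Fatou's lemma and Fubini produce bounds on extended integrals; a finite one yields
  square integrability and the norm bound at the same time.\<close>

lemma nrm2_le_nnI:
  assumes "(\<integral>\<^sup>+x. ennreal ((cmod (f x))\<^sup>2) \<partial>M) \<le> ennreal (c\<^sup>2)" "f \<in> borel_measurable M" "c \<ge> 0"
  shows "sqint M f" "nrm2 M f \<le> c"
proof -
  show *: "sqint M f" unfolding sqint_iff_nn using assms by (auto simp: le_less_trans)
  have "ennreal ((nrm2 M f)\<^sup>2) \<le> ennreal (c\<^sup>2)" using assms nn_integral_sqint[OF *] by simp
  then show "nrm2 M f \<le> c" using assms by (simp add: power2_le_iff_abs_le ennreal_le_iff)
qed

section \<open>Gaussians\<close>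

lemma abs_pow_gauss_integrable:
  assumes "c > (0::real)"
  shows "integrable lborel (\<lambda>x. \<bar>x\<bar>^k * exp (- c * x\<^sup>2))"
proof -
  \<comment> \<open>This variance turns the exponent of \<open>normal_density\<close> into
    \<open>- c * x\<^sup>2\<close>.\<close>
  define \<sigma> where "\<sigma> = sqrt (1 / (2 * c))"
  have s: "\<sigma> > 0" "\<sigma>\<^sup>2 = 1 / (2*c)" using assms by (auto simp: \<sigma>_def)
  have "integrable lborel (\<lambda>x. sqrt (2 * pi * \<sigma>\<^sup>2) * (normal_density 0 \<sigma> x * \<bar>x - 0\<bar>^k))"
    by (intro integrable_mult_right integrable_normal_moment_abs s)
  also have "(\<lambda>x. sqrt (2 * pi * \<sigma>\<^sup>2) * (normal_density 0 \<sigma> x * \<bar>x - 0\<bar>^k))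
     = (\<lambda>x. \<bar>x\<bar>^k * exp (- c * x\<^sup>2))"
    using assms by (auto simp: normal_density_def s fun_eq_iff)
  finally show ?thesis .
qed

lemma pow_gauss_cis_integrable:
  assumes "Re b > 0"
  shows "integrable lborel (\<lambda>x::real. complex_of_real (x^k) * (exp (- b * complex_of_real (x\<^sup>2)) * cis (- (x * \<xi>))))"
  by (rule Bochner_Integration.integrable_bound[OF abs_pow_gauss_integrable[OF assms, of k]])
     (auto simp: norm_mult power_abs cis_conv_exp simp flip: of_real_power)

text \<open>The root of \<open>pi / b\<close> with positive real part, left unevaluated for complex
  \<open>b\<close> so that no branch has to be chosen. Its value enters only for real
  \<open>b\<close>, through \<open>gauss_const_real\<close>.\<close>

definition gauss_const :: "complex \<Rightarrow> complex" where
  "gauss_const b = (\<integral>x. exp (- b * complex_of_real (x\<^sup>2)) \<partial>lborel)"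

text \<open>Differentiation under the integral brings down \<open>- \<i> * x\<close>. The
  \<open>x\<close>-derivative of the integrand integrates to 0 over the line, and this expresses the
  first moment through \<open>G\<close> itself. For complex \<open>b\<close> the resulting
  differential equation replaces a shift of contour.\<close>

lemma gauss_ft_ode:
  fixes b :: complex
  assumes b: "Re b > 0"
  defines "G \<equiv> \<lambda>\<xi>::real. \<integral>x. exp (- b * complex_of_real (x\<^sup>2)) * cis (- (x * \<xi>)) \<partial>lborel"
  shows "(G has_vector_derivative - (complex_of_real \<xi> / (2 * b)) * G \<xi>) (at \<xi>)"
proof -
  define e where "e \<eta> x = exp (- b * complex_of_real (x\<^sup>2)) * cis (- (x * \<eta>))" for \<eta> x :: real
  have b0: "b \<noteq> 0" using b by auto
  have int: "integrable lborel (\<lambda>x. complex_of_real (x^k) * e \<eta> x)" for k \<eta>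
    unfolding e_def by (rule pow_gauss_cis_integrable[OF b])
  have int0: "integrable lborel (e \<eta>)" for \<eta> using int[of 0 \<eta>] by simp
  have int1: "integrable lborel (\<lambda>x. complex_of_real x * e \<eta> x)" for \<eta> using int[of 1 \<eta>] by simp
  define M where "M = (\<integral>x. \<bar>x\<bar>^2 * exp (- Re b * x\<^sup>2) \<partial>lborel)"
  have M0: "M \<ge> 0" unfolding M_def by simp
  define G1 where "G1 = (\<integral>x. - \<i> * (complex_of_real x * e \<xi> x) \<partial>lborel)"
  \<comment> \<open>Second-order Taylor bound for \<open>cis\<close>: the remainder is dominated by
    the second moment \<open>M\<close> of the Gaussian, uniformly in \<open>\<xi>\<close>.\<close>
  have est: "cmod (G (\<xi> + h) - G \<xi> - h *\<^sub>R G1) \<le> h\<^sup>2 / 2 * M" for h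
  proof -
    have "G (\<xi> + h) - G \<xi> - h *\<^sub>R G1 = (\<integral>x. e (\<xi> + h) x - e \<xi> x - h *\<^sub>R (- \<i> * (complex_of_real x * e \<xi> x)) \<partial>lborel)"
      unfolding G_def G1_def e_def[symmetric]
      using int0[of "\<xi>+h"] int0[of \<xi>] int1[of \<xi>] by simp
    also have "cmod \<dots> \<le> (\<integral>x. h\<^sup>2 / 2 * (\<bar>x\<bar>^2 * exp (- Re b * x\<^sup>2)) \<partial>lborel)"
    proof (rule Bochner_Integration.integral_norm_bound_integral)
      show "integrable lborel (\<lambda>x. e (\<xi> + h) x - e \<xi> x - h *\<^sub>R (- \<i> * (complex_of_real x * e \<xi> x)))"
        using int0[of "\<xi>+h"] int0[of \<xi>] int1[of \<xi>] by (intro Bochner_Integration.integrable_diff integrable_scaleR_right integrable_mult_right)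
      show "integrable lborel (\<lambda>x. h\<^sup>2 / 2 * (\<bar>x\<bar>^2 * exp (- Re b * x\<^sup>2)))"
        by (intro integrable_mult_right abs_pow_gauss_integrable b)
      fix x :: real
      have "e (\<xi> + h) x - e \<xi> x - h *\<^sub>R (- \<i> * (complex_of_real x * e \<xi> x))
          = e \<xi> x * (cis (- (x * h)) - (1 + \<i> * complex_of_real (- (x * h))))"
        proof -
          have "cis (- (x * (\<xi> + h))) = cis (- (x * \<xi>)) * cis (- (x * h))"
            by (simp add: cis_mult algebra_simps)
          then show ?thesis unfolding e_def by (simp add: algebra_simps scaleR_conv_of_real)
        qed
      also have "cmod \<dots> \<le> exp (- Re b * x\<^sup>2) * (\<bar>- (x * h)\<bar>^2 / 2)"
        unfolding norm_mult
      proof (rule mult_mono)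
        show "cmod (e \<xi> x) \<le> exp (- Re b * x\<^sup>2)" unfolding e_def by (simp add: norm_mult)
        have "cmod (iexp (- (x*h)) - (\<Sum>k \<le> 1. (\<i> * complex_of_real (- (x*h)))^k / fact k)) \<le> \<bar>- (x*h)\<bar>^(Suc 1) / fact (Suc 1)"
          by (rule iexp_approx1)
        then show "cmod (cis (- (x * h)) - (1 + \<i> * complex_of_real (- (x * h)))) \<le> \<bar>- (x * h)\<bar>^2 / 2"
          by (simp add: cis_conv_exp numeral_2_eq_2 mult.commute)
      qed auto
      finally show "cmod (e (\<xi> + h) x - e \<xi> x - h *\<^sub>R (- \<i> * (complex_of_real x * e \<xi> x)))
          \<le> h\<^sup>2 / 2 * (\<bar>x\<bar>^2 * exp (- Re b * x\<^sup>2))"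
        by (simp add: power_mult_distrib abs_mult field_simps)
    qed
    also have "\<dots> = h\<^sup>2 / 2 * M" unfolding M_def by simp
    finally show ?thesis .
  qed
  have der: "(G has_vector_derivative G1) (at \<xi>)"
    unfolding has_vector_derivative_def has_derivative_at
  proof (intro conjI bounded_linear_scaleR_left)
    show "(\<lambda>h. norm (G (\<xi> + h) - G \<xi> - h *\<^sub>R G1) / norm h) \<midarrow>0\<rightarrow> 0"
    proof (rule Lim_null_comparison)
      show "\<forall>\<^sub>F h in at 0. norm (norm (G (\<xi> + h) - G \<xi> - h *\<^sub>R G1) / norm h) \<le> \<bar>h\<bar> / 2 * M"
        unfolding eventually_at_filter
      proof (intro always_eventually allI impI)
        fix h :: real assume "h \<noteq> 0"
        then show "norm (norm (G (\<xi> + h) - G \<xi> - h *\<^sub>R G1) / norm h) \<le> \<bar>h\<bar> / 2 * M"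
          using est[of h] by (simp add: field_simps power2_eq_square flip: abs_mult)
      qed
      show "((\<lambda>h. \<bar>h\<bar> / 2 * M) \<longlongrightarrow> 0) (at 0)"
        by (auto intro!: tendsto_eq_intros)
    qed
  qed
  \<comment> \<open>The integrand is the derivative of \<open>e \<xi>\<close>, which tends to 0 at
    both ends.\<close>
  have zero: "(\<integral>x. - 2 * b * (complex_of_real x * e \<xi> x) - \<i> * complex_of_real \<xi> * e \<xi> x \<partial>lborel) = 0"
  proof -
    have bd: "((\<lambda>x::real. exp (- Re b * x\<^sup>2)) \<longlongrightarrow> 0) at_top" "((\<lambda>x::real. exp (- Re b * x\<^sup>2)) \<longlongrightarrow> 0) at_bot"
      using b by real_asymp+
    have ce: "cmod (e \<xi> x) \<le> exp (- Re b * x\<^sup>2)" for x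
      by (simp add: e_def norm_mult)
    have "(LBINT x=-\<infinity>..\<infinity>. - 2 * b * (complex_of_real x * e \<xi> x) - \<i> * complex_of_real \<xi> * e \<xi> x) = 0 - 0"
    proof (rule interval_integral_FTC_integrable[where F="e \<xi>"])
      fix x :: real
      have "((\<lambda>x. exp (- b * complex_of_real (x\<^sup>2)) * exp (\<i> * complex_of_real (- (x * \<xi>)))) has_vector_derivative
        - 2 * b * (complex_of_real x * e \<xi> x) - \<i> * complex_of_real \<xi> * e \<xi> x) (at x)"
        unfolding e_def cis_conv_exp
        by (rule derivative_eq_intros refl has_vector_derivative_real_field | simp)+
      then show "(e \<xi> has_vector_derivative - 2 * b * (complex_of_real x * e \<xi> x) - \<i> * complex_of_real \<xi> * e \<xi> x) (at x)"
        unfolding e_def cis_conv_exp .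
      show "isCont (\<lambda>x. - 2 * b * (complex_of_real x * e \<xi> x) - \<i> * complex_of_real \<xi> * e \<xi> x) x"
        unfolding e_def cis_conv_exp by (intro continuous_intros)
    next
      show "set_integrable lborel (einterval (- \<infinity>) \<infinity>) (\<lambda>x. - 2 * b * (complex_of_real x * e \<xi> x) - \<i> * complex_of_real \<xi> * e \<xi> x)"
        using int0 int1 by (simp add: set_integrable_def einterval_def)
      show "((e \<xi> \<circ> real_of_ereal) \<longlongrightarrow> 0) (at_right (- \<infinity>))"
        unfolding ereal_tendsto_simps by (rule Lim_null_comparison[OF _ bd(2)]) (use ce in auto)
      show "((e \<xi> \<circ> real_of_ereal) \<longlongrightarrow> 0) (at_left \<infinity>)"
        unfolding ereal_tendsto_simps by (rule Lim_null_comparison[OF _ bd(1)]) (use ce in auto)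
    qed simp
    then show ?thesis
      by (simp add: interval_lebesgue_integral_def set_lebesgue_integral_def einterval_def)
  qed
  have "G1 = - (complex_of_real \<xi> / (2 * b)) * G \<xi>"
  proof -
    have "- 2 * b * (\<integral>x. complex_of_real x * e \<xi> x \<partial>lborel) - \<i> * complex_of_real \<xi> * G \<xi> = 0"
      using zero int0[of \<xi>] int1[of \<xi>] unfolding G_def e_def[symmetric] by simp
    then have "(\<integral>x. complex_of_real x * e \<xi> x \<partial>lborel) = - \<i> * complex_of_real \<xi> * G \<xi> / (2*b)"
      using b0 by (simp add: field_simps) (metis add.commute add_eq_0_iff)
    moreover have "G1 = - \<i> * (\<integral>x. complex_of_real x * e \<xi> x \<partial>lborel)"
      unfolding G1_def by simp
    ultimately show ?thesis by (simp add: mult.assoc[symmetric])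
  qed
  with der show ?thesis by simp
qed

text \<open>Multiplication by the reciprocal of the expected Gaussian gives a function whose
  derivative vanishes by \<open>gauss_ft_ode\<close>.\<close>

lemma gauss_ft_1d:
  assumes b: "Re b > 0"
  shows "(\<integral>x. exp (- b * complex_of_real (x\<^sup>2)) * cis (- (x * \<xi>)) \<partial>lborel)
    = gauss_const b * exp (- complex_of_real (\<xi>\<^sup>2) / (4 * b))"
proof -
  define G where "G = (\<lambda>\<xi>::real. \<integral>x. exp (- b * complex_of_real (x\<^sup>2)) * cis (- (x * \<xi>)) \<partial>lborel)"
  have b0: "b \<noteq> 0" using b by auto
  define P where "P \<xi> = G \<xi> * exp (complex_of_real (\<xi>\<^sup>2) / (4 * b))" for \<xi>
  have E: "((\<lambda>t::real. exp (complex_of_real (t\<^sup>2) / (4 * b))) has_vector_derivative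
      complex_of_real x / (2*b) * exp (complex_of_real (x\<^sup>2) / (4 * b))) (at x)" for x
    by (rule derivative_eq_intros refl has_vector_derivative_real_field | simp add: b0)+
  have "(P has_vector_derivative 0) (at x)" for x
  proof -
    have "(P has_vector_derivative (G x * (complex_of_real x / (2*b) * exp (complex_of_real (x\<^sup>2) / (4 * b)))
        + (- (complex_of_real x / (2 * b)) * G x) * exp (complex_of_real (x\<^sup>2) / (4 * b)))) (at x)"
      unfolding P_def
      by (rule has_vector_derivative_mult[OF _ E]) (use gauss_ft_ode[OF b, of x] in \<open>simp only: G_def\<close>)
    then show ?thesis by (simp add: algebra_simps)
  qed
  then have "(P has_derivative (\<lambda>h. 0)) (at x)" for x
    by (simp add: has_vector_derivative_def)
  then have "P \<xi> = P 0"
    by (intro has_derivative_zero_unique[of UNIV P]) (auto intro: has_derivative_at_withinI)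
  then have "G \<xi> = G 0 * exp (- complex_of_real (\<xi>\<^sup>2) / (4 * b))"
    unfolding P_def by (simp add: exp_minus field_simps)
  then show ?thesis by (simp add: G_def gauss_const_def)
qed

lemma gauss_const_real:
  assumes "c > 0"
  shows "gauss_const (complex_of_real c) = complex_of_real (sqrt (pi / c))"
proof -
  define \<sigma> where "\<sigma> = sqrt (1 / (2 * c))"
  have s: "\<sigma> > 0" "\<sigma>\<^sup>2 = 1 / (2*c)" using assms by (auto simp: \<sigma>_def)
  have "sqrt (2 * pi * \<sigma>\<^sup>2) * (\<integral>x. normal_density 0 \<sigma> x \<partial>lborel) = sqrt (pi / c)"
    using s by (simp add: integral_normal_density)
  moreover have "sqrt (2 * pi * \<sigma>\<^sup>2) * (\<integral>x. normal_density 0 \<sigma> x \<partial>lborel) = (\<integral>x. exp (- c * x\<^sup>2) \<partial>lborel)"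
    using s assms by (simp add: normal_density_def mult.commute)
  ultimately have "(\<integral>x. exp (- c * x\<^sup>2) \<partial>lborel) = sqrt (pi / c)" by simp
  moreover have "(\<lambda>x::real. exp (- complex_of_real c * complex_of_real (x\<^sup>2))) = (\<lambda>x. complex_of_real (exp (- c * x\<^sup>2)))"
    by (auto simp: fun_eq_iff exp_of_real[symmetric])
  ultimately show ?thesis
    unfolding gauss_const_def by (metis integral_complex_of_real)
qed

lemma norm_sq_basis: "(norm (x::'a::euclidean_space))\<^sup>2 = (\<Sum>b\<in>Basis. (x \<bullet> b)\<^sup>2)"
  by (metis (no_types, lifting) euclidean_inner power2_norm_eq_inner power2_eq_square sum.cong)

text \<open>The Gaussian and the character both factor over the coordinates, and
  \<open>lborel\<close> is the image of the product of one-dimensional Lebesgue measures.\<close>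

lemma gauss_ft:
  fixes \<xi> :: "'a::euclidean_space"
  assumes b: "Re b > 0"
  shows "integrable lborel (\<lambda>x::'a. exp (- b * complex_of_real ((norm x)\<^sup>2)) * cis (- (x \<bullet> \<xi>)))" (is ?I)
    and "(\<integral>x. exp (- b * complex_of_real ((norm (x::'a))\<^sup>2)) * cis (- (x \<bullet> \<xi>)) \<partial>lborel)
      = gauss_const b ^ DIM('a) * exp (- complex_of_real ((norm \<xi>)\<^sup>2) / (4 * b))" (is ?E)
proof -
  interpret product_sigma_finite "\<lambda>_::'a. lborel :: real measure" ..
  define f where "f i x = exp (- b * complex_of_real (x\<^sup>2)) * cis (- (x * (\<xi> \<bullet> i)))" for i :: 'a and x :: real
  define T where "T g = (\<Sum>i\<in>Basis. g i *\<^sub>R i)" for g :: "'a \<Rightarrow> real"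
  have T[measurable]: "T \<in> measurable (\<Pi>\<^sub>M i\<in>(Basis::'a set). (lborel::real measure)) borel"
    unfolding T_def by measurable
  have int: "integrable lborel (f i)" for i
    unfolding f_def using pow_gauss_cis_integrable[OF b, of 0 "\<xi> \<bullet> i"] by simp
  have *: "exp (- b * complex_of_real ((norm (T g))\<^sup>2)) * cis (- (T g \<bullet> \<xi>)) = (\<Prod>i\<in>Basis. f i (g i))" for g
  proof -
    have c: "T g \<bullet> i = g i" if "i \<in> Basis" for i using that by (simp add: T_def)
    have 1: "(norm (T g))\<^sup>2 = (\<Sum>i\<in>Basis. (g i)\<^sup>2)"
      unfolding norm_sq_basis by (intro sum.cong) (auto simp: c)
    have 2: "T g \<bullet> \<xi> = (\<Sum>i\<in>Basis. g i * (\<xi> \<bullet> i))"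
      unfolding euclidean_inner[of "T g" \<xi>] by (intro sum.cong) (auto simp: c)
    have 3: "exp (- b * complex_of_real (\<Sum>i\<in>(Basis::'a set). (g i)\<^sup>2)) = (\<Prod>i\<in>(Basis::'a set). exp (- b * complex_of_real ((g i)\<^sup>2)))"
      unfolding of_real_sum sum_distrib_left by (rule exp_sum) simp
    have 4: "cis (- (\<Sum>i\<in>(Basis::'a set). g i * (\<xi> \<bullet> i))) = (\<Prod>i\<in>(Basis::'a set). cis (- (g i * (\<xi> \<bullet> i))))"
      unfolding cis_conv_exp sum_negf[symmetric] of_real_sum sum_distrib_left by (rule exp_sum) simp
    show ?thesis unfolding 1 2 3 4 f_def by (rule prod.distrib[symmetric])
  qed
  have m: "(\<lambda>x::'a. exp (- b * complex_of_real ((norm x)\<^sup>2)) * cis (- (x \<bullet> \<xi>))) \<in> borel_measurable borel"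
    unfolding cis_conv_exp by measurable
  have L: "(lborel :: 'a measure) = distr (\<Pi>\<^sub>M i\<in>(Basis::'a set). (lborel::real measure)) borel T"
    unfolding T_def by (rule lborel_eq)
  show ?I
    by (subst L, subst integrable_distr_eq[OF T m]) (simp only: *, intro product_integrable_prod int, auto)
  have "(\<integral>x. exp (- b * complex_of_real ((norm (x::'a))\<^sup>2)) * cis (- (x \<bullet> \<xi>)) \<partial>lborel) = (\<Prod>i\<in>Basis. integral\<^sup>L lborel (f i))"
    by (subst L, subst integral_distr[OF T m]) (simp only: *, intro product_integral_prod int, auto)
  also have "\<dots> = (\<Prod>i\<in>(Basis::'a set). gauss_const b * exp (- complex_of_real ((\<xi> \<bullet> i)\<^sup>2) / (4 * b)))"
    unfolding f_def gauss_ft_1d[OF b] ..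
  also have "\<dots> = gauss_const b ^ DIM('a) * exp (- complex_of_real ((norm \<xi>)\<^sup>2) / (4 * b))"
  proof -
    have "- complex_of_real ((norm \<xi>)\<^sup>2) / (4 * b) = (\<Sum>i\<in>(Basis::'a set). - complex_of_real ((\<xi> \<bullet> i)\<^sup>2) / (4 * b))"
      unfolding norm_sq_basis of_real_sum sum_divide_distrib[symmetric] sum_negf[symmetric] ..
    then show ?thesis by (simp only: exp_sum[OF finite_Basis] prod.distrib prod_constant)
  qed
  finally show ?E .
qed

section \<open>The Fourier transform and Plancherel's theorem\<close>

lemma integrable_prod_pair:
  fixes f :: "'a::euclidean_space \<Rightarrow> complex" and g :: "'b::euclidean_space \<Rightarrow> complex"
  assumes f: "integrable lborel f" and g: "integrable lborel g"
  shows "integrable (lborel \<Otimes>\<^sub>M lborel) (\<lambda>(x, y). f x * g y)"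
proof -
  have [measurable]: "f \<in> borel_measurable borel" "g \<in> borel_measurable borel"
    using f g by (auto dest: borel_measurable_integrable)
  show ?thesis
    using f g
    by (intro lborel_pair.Fubini_integrable) (auto simp: norm_mult)
qed

lemma integral_affine:
  fixes f :: "'a::euclidean_space \<Rightarrow> complex"
  assumes [measurable]: "f \<in> borel_measurable borel" and c: "c > 0"
  shows "(\<integral>x. f x \<partial>lborel) = c ^ DIM('a) *\<^sub>R (\<integral>x. f (t + c *\<^sub>R x) \<partial>lborel)"
  using c by (subst lborel_affine[of c t]) (simp_all add: integral_density integral_distr)

lemma nn_integral_affine:
  fixes f :: "'a::euclidean_space \<Rightarrow> ennreal"
  assumes [measurable]: "f \<in> borel_measurable borel" and c: "c \<noteq> 0"
  shows "(\<integral>\<^sup>+x. f x \<partial>lborel) = ennreal (\<bar>c\<bar> ^ DIM('a)) * (\<integral>\<^sup>+x. f (t + c *\<^sub>R x) \<partial>lborel)"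
  using c by (subst lborel_affine[of c t]) (simp_all add: nn_integral_density nn_integral_distr nn_integral_cmult)

lemma nn_integral_translate:
  fixes f :: "'a::euclidean_space \<Rightarrow> ennreal"
  assumes [measurable]: "f \<in> borel_measurable borel"
  shows "(\<integral>\<^sup>+x. f (x + t) \<partial>lborel) = (\<integral>\<^sup>+x. f x \<partial>lborel)"
  using nn_integral_affine[of f 1 t] by (simp add: add.commute)

section \<open>Gaussian weights and the Fourier integral\<close>

definition gauss_weight :: "'a::euclidean_space \<Rightarrow> real" where
  "gauss_weight v = exp (- (norm v)\<^sup>2)"

lemma gauss_weight_measurable [measurable]: "gauss_weight \<in> borel_measurable borel"
  unfolding gauss_weight_def by measurable

lemma gauss_weight_nonneg [simp]: "gauss_weight v \<ge> 0"
  by (simp add: gauss_weight_def)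

lemma gauss_real_integral:
  assumes "c > 0"
  shows "integrable lborel (\<lambda>x::'a::euclidean_space. exp (- c * (norm x)\<^sup>2))"
    and "(\<integral>x. exp (- c * (norm (x::'a))\<^sup>2) \<partial>lborel) = sqrt (pi / c) ^ DIM('a)"
proof -
  have e: "(\<lambda>x::'a. exp (- complex_of_real c * complex_of_real ((norm x)\<^sup>2)) * cis (- (x \<bullet> 0)))
    = (\<lambda>x. complex_of_real (exp (- c * (norm x)\<^sup>2)))"
    by (auto simp: fun_eq_iff exp_of_real[symmetric])
  have b: "Re (complex_of_real c) > 0" using assms by simp
  show "integrable lborel (\<lambda>x::'a. exp (- c * (norm x)\<^sup>2))"
    using gauss_ft(1)[OF b, of "0::'a"] unfolding e complex_of_real_integrable_eq .
  have "complex_of_real (\<integral>x. exp (- c * (norm (x::'a))\<^sup>2) \<partial>lborel) = complex_of_real (sqrt (pi / c) ^ DIM('a))"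
    using gauss_ft(2)[OF b, of "0::'a"] gauss_const_real[OF assms] unfolding e by simp
  then show "(\<integral>x. exp (- c * (norm (x::'a))\<^sup>2) \<partial>lborel) = sqrt (pi / c) ^ DIM('a)"
    using of_real_eq_iff by blast
qed

lemma gauss_weight_integrable: "integrable lborel (gauss_weight :: 'a::euclidean_space \<Rightarrow> real)"
  and gauss_weight_integral: "(\<integral>x. gauss_weight (x::'a) \<partial>lborel) = sqrt pi ^ DIM('a)"
  using gauss_real_integral[where 'a='a, of 1] by (simp_all add: gauss_weight_def[abs_def])

lemma gauss_weight_nn_integral: "(\<integral>\<^sup>+x. ennreal (gauss_weight (x::'a::euclidean_space)) \<partial>lborel) = ennreal (sqrt pi ^ DIM('a))"
  by (subst nn_integral_eq_integral[OF gauss_weight_integrable]) (simp_all add: gauss_weight_integral)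

text \<open>\<open>fourier_L1\<close> with \<open>lborel\<close> in place of
  \<open>lebesgue\<close>, so that Fubini applies to Borel integrands;
  \<open>fourier_L1_truncation\<close> relates the two.\<close>

definition FT :: "('a::euclidean_space \<Rightarrow> complex) \<Rightarrow> 'a \<Rightarrow> complex" where
  "FT h \<xi> = (\<integral>x. cis (- (x \<bullet> \<xi>)) * h x \<partial>lborel)"

lemma cis_mult_integrable:
  assumes "integrable M h" "\<theta> \<in> borel_measurable M"
  shows "integrable M (\<lambda>x. cis (\<theta> x) * h x)"
  by (rule Bochner_Integration.integrable_bound[OF assms(1)])
     (use assms borel_measurable_integrable[OF assms(1)] in
       \<open>auto simp: norm_mult intro!: borel_measurable_times measurable_compose[OF _ cis_borel_measurable]\<close>)

lemma FT_integrable: "integrable lborel h \<Longrightarrow> integrable lborel (\<lambda>x. cis (- (x \<bullet> \<xi>)) * h x)"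
  by (rule cis_mult_integrable) auto

lemma FT_measurable [measurable]:
  assumes [measurable]: "h \<in> borel_measurable borel"
  shows "FT h \<in> borel_measurable borel"
  unfolding FT_def[abs_def]
  by (rule lborel.borel_measurable_lebesgue_integral) measurable

lemma FT_bound: "integrable lborel h \<Longrightarrow> cmod (FT h \<xi>) \<le> (\<integral>x. cmod (h x) \<partial>lborel)"
  unfolding FT_def
  by (rule order_trans[OF integral_norm_bound]) (simp add: norm_mult)

lemma FT_continuous:
  assumes h: "integrable lborel h"
  shows "continuous_on UNIV (FT h)"
proof (rule continuous_at_imp_continuous_on, intro ballI)
  fix \<xi> :: 'a
  have [measurable]: "h \<in> borel_measurable borel"
    using h by (auto dest: borel_measurable_integrable)
  show "isCont (FT h) \<xi>"
    unfolding continuous_at_sequentially comp_def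
  proof (intro allI impI)
    fix X :: "nat \<Rightarrow> 'a" assume X: "X \<longlonglongrightarrow> \<xi>"
    show "(\<lambda>n. FT h (X n)) \<longlonglongrightarrow> FT h \<xi>"
      unfolding FT_def
    proof (rule integral_dominated_convergence[where w="\<lambda>x. cmod (h x)"])
      show "AE x in lborel. (\<lambda>i. cis (- (x \<bullet> X i)) * h x) \<longlonglongrightarrow> cis (- (x \<bullet> \<xi>)) * h x"
        using X by (intro AE_I2 tendsto_intros)
    qed (use h in \<open>auto simp: norm_mult\<close>)
  qed
qed

lemma FT_diff:
  assumes "integrable lborel f" "integrable lborel g"
  shows "FT (\<lambda>x. f x - g x) \<xi> = FT f \<xi> - FT g \<xi>"
  using FT_integrable[OF assms(1)] FT_integrable[OF assms(2)]
  unfolding FT_def by (simp add: right_diff_distrib)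

text \<open>The damping factor makes the integral of the squared transform absolutely convergent.
  Fubini then replaces the damping by its own transform, again a Gaussian, of width
  \<open>s\<close>. The right side is a Gaussian average of products of nearby values of
  \<open>h\<close>; formally it tends to \<open>(2 * pi) ^ DIM('a)\<close> times the squared norm as
  \<open>s\<close> tends to 0.\<close>

lemma FT_gauss_regularized:
  fixes h :: "'a::euclidean_space \<Rightarrow> complex"
  assumes h: "integrable lborel h" and s: "s > 0"
  shows "complex_of_real (\<integral>\<xi>. (cmod (FT h \<xi>))\<^sup>2 * exp (- (s\<^sup>2 / 4) * (norm \<xi>)\<^sup>2) \<partial>lborel)
    = complex_of_real ((2 * sqrt pi) ^ DIM('a)) * (\<integral>y. (\<integral>v. h y * cnj (h (y + s *\<^sub>R v)) * complex_of_real (gauss_weight v) \<partial>lborel) \<partial>lborel)"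
proof -
  have hm[measurable]: "h \<in> borel_measurable borel"
    using h by (auto dest: borel_measurable_integrable)
  have hc: "integrable lborel (\<lambda>x. cnj (h x))"
    using h by (rule integrable_cnj)
  define \<delta> where "\<delta> = s\<^sup>2 / 4"
  have d: "\<delta> > 0" using s by (simp add: \<delta>_def)
  define Q where "Q p = (case p of (y, z) \<Rightarrow> h y * cnj (h z))" for p :: "'a \<times> 'a"
  have Qi: "integrable lborel Q"
    using integrable_prod_pair[OF h hc] unfolding Q_def[abs_def] lborel_prod by simp
  have Qm[measurable]: "Q \<in> borel_measurable borel"
    using Qi by (auto dest: borel_measurable_integrable)
  have sq: "complex_of_real ((cmod (FT h \<xi>))\<^sup>2) = (\<integral>p. cis (- ((fst p - snd p) \<bullet> \<xi>)) * Q p \<partial>lborel)" for \<xi>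
  proof -
    have i1: "integrable lborel (\<lambda>x. cis (- (x \<bullet> \<xi>)) * h x)" by (rule FT_integrable[OF h])
    have i2: "integrable lborel (\<lambda>x. cnj (cis (- (x \<bullet> \<xi>)) * h x))" using i1 by (rule integrable_cnj)
    have "complex_of_real ((cmod (FT h \<xi>))\<^sup>2) = FT h \<xi> * cnj (FT h \<xi>)"
      by (rule complex_norm_square)
    also have "\<dots> = (\<integral>y. (\<integral>z. (cis (- (y \<bullet> \<xi>)) * h y) * cnj (cis (- (z \<bullet> \<xi>)) * h z) \<partial>lborel) \<partial>lborel)"
    proof -
      have "cnj (FT h \<xi>) = (\<integral>z. cnj (cis (- (z \<bullet> \<xi>)) * h z) \<partial>lborel)"
        unfolding FT_def by (rule Bochner_Integration.integral_cnj[symmetric])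
      then show ?thesis
        unfolding FT_def[of h] by (simp only: integral_mult_right_zero integral_mult_left_zero)
    qed
    also have "\<dots> = (\<integral>p. (case p of (y, z) \<Rightarrow> (cis (- (y \<bullet> \<xi>)) * h y) * cnj (cis (- (z \<bullet> \<xi>)) * h z)) \<partial>(lborel \<Otimes>\<^sub>M lborel))"
      by (rule trans[OF _ lborel_pair.integral_fst'[OF integrable_prod_pair[OF i1 i2]]]) simp
    also have "\<dots> = (\<integral>p. cis (- ((fst p - snd p) \<bullet> \<xi>)) * Q p \<partial>lborel)"
      unfolding lborel_prod
    proof (rule Bochner_Integration.integral_cong[OF refl])
      fix p :: "'a \<times> 'a"
      have "cis (- (fst p \<bullet> \<xi>)) * cnj (cis (- (snd p \<bullet> \<xi>))) = cis (- ((fst p - snd p) \<bullet> \<xi>))"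
        by (simp add: cis_cnj cis_mult inner_diff_left)
      moreover have "(case p of (y, z) \<Rightarrow> cis (- (y \<bullet> \<xi>)) * h y * cnj (cis (- (z \<bullet> \<xi>)) * h z))
        = (cis (- (fst p \<bullet> \<xi>)) * cnj (cis (- (snd p \<bullet> \<xi>)))) * Q p"
        by (simp add: Q_def case_prod_beta mult_ac)
      ultimately show "(case p of (y, z) \<Rightarrow> cis (- (y \<bullet> \<xi>)) * h y * cnj (cis (- (z \<bullet> \<xi>)) * h z))
        = cis (- ((fst p - snd p) \<bullet> \<xi>)) * Q p" by simp
    qed
    finally show ?thesis .
  qed
  have gi: "integrable lborel (\<lambda>\<xi>::'a. complex_of_real (exp (- \<delta> * (norm \<xi>)\<^sup>2)))"
    using gauss_real_integral(1)[OF d, where 'a='a] unfolding complex_of_real_integrable_eq .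
  have inner: "(\<integral>\<xi>. complex_of_real (exp (- \<delta> * (norm \<xi>)\<^sup>2)) * cis (- (x \<bullet> \<xi>)) \<partial>lborel)
      = complex_of_real (sqrt (pi / \<delta>) ^ DIM('a) * exp (- (norm x)\<^sup>2 / s\<^sup>2))" for x :: 'a
  proof -
    have "(\<lambda>\<xi>. complex_of_real (exp (- \<delta> * (norm \<xi>)\<^sup>2)) * cis (- (x \<bullet> \<xi>)))
      = (\<lambda>\<xi>. exp (- complex_of_real \<delta> * complex_of_real ((norm \<xi>)\<^sup>2)) * cis (- (\<xi> \<bullet> x)))"
      by (simp add: fun_eq_iff inner_commute exp_of_real[symmetric])
    then have "(\<integral>\<xi>. complex_of_real (exp (- \<delta> * (norm \<xi>)\<^sup>2)) * cis (- (x \<bullet> \<xi>)) \<partial>lborel)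
      = gauss_const (complex_of_real \<delta>) ^ DIM('a) * exp (- complex_of_real ((norm x)\<^sup>2) / (4 * complex_of_real \<delta>))"
      using gauss_ft(2)[of "complex_of_real \<delta>" x] d by simp
    also have "\<dots> = complex_of_real (sqrt (pi / \<delta>) ^ DIM('a) * exp (- (norm x)\<^sup>2 / s\<^sup>2))"
      unfolding gauss_const_real[OF d] by (simp add: exp_of_real[symmetric] \<delta>_def)
    finally show ?thesis .
  qed
  define K where "K = sqrt (pi / \<delta>) ^ DIM('a)"
  have "complex_of_real (\<integral>\<xi>. (cmod (FT h \<xi>))\<^sup>2 * exp (- (s\<^sup>2 / 4) * (norm \<xi>)\<^sup>2) \<partial>lborel)
    = (\<integral>\<xi>. complex_of_real ((cmod (FT h \<xi>))\<^sup>2) * complex_of_real (exp (- \<delta> * (norm \<xi>)\<^sup>2)) \<partial>lborel)"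
    unfolding integral_complex_of_real[symmetric] \<delta>_def by simp
  also have "\<dots> = (\<integral>\<xi>. (\<integral>p. complex_of_real (exp (- \<delta> * (norm \<xi>)\<^sup>2)) * (cis (- ((fst p - snd p) \<bullet> \<xi>)) * Q p) \<partial>lborel) \<partial>lborel)"
    unfolding sq by (simp add: mult.commute)
  also have "\<dots> = (\<integral>p. (\<integral>\<xi>. complex_of_real (exp (- \<delta> * (norm \<xi>)\<^sup>2)) * (cis (- ((fst p - snd p) \<bullet> \<xi>)) * Q p) \<partial>lborel) \<partial>lborel)"
  proof (rule lborel_pair.Fubini_integral[symmetric])
    have "integrable (lborel \<Otimes>\<^sub>M lborel) (\<lambda>q. cis (- ((fst (snd q) - snd (snd q)) \<bullet> fst q)) * (case q of (x, y) \<Rightarrow> complex_of_real (exp (- \<delta> * (norm x)\<^sup>2)) * Q y))"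
      unfolding lborel_prod
      by (intro cis_mult_integrable integrable_prod_pair[OF gi Qi, unfolded lborel_prod])
         (auto intro!: borel_measurable_continuous_onI continuous_intros)
    then show "integrable (lborel \<Otimes>\<^sub>M lborel) (\<lambda>(\<xi>, p). complex_of_real (exp (- \<delta> * (norm \<xi>)\<^sup>2)) * (cis (- ((fst p - snd p) \<bullet> \<xi>)) * Q p))"
      by (simp add: case_prod_beta' mult_ac)
  qed
  also have "\<dots> = (\<integral>p. complex_of_real K * (Q p * complex_of_real (exp (- (norm (fst p - snd p))\<^sup>2 / s\<^sup>2))) \<partial>lborel)"
  proof (rule Bochner_Integration.integral_cong[OF refl])
    fix p :: "'a \<times> 'a"
    have "(\<integral>\<xi>. complex_of_real (exp (- \<delta> * (norm \<xi>)\<^sup>2)) * (cis (- ((fst p - snd p) \<bullet> \<xi>)) * Q p) \<partial>lborel)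
      = (\<integral>\<xi>. (complex_of_real (exp (- \<delta> * (norm \<xi>)\<^sup>2)) * cis (- ((fst p - snd p) \<bullet> \<xi>))) * Q p \<partial>lborel)"
      by (simp only: mult.assoc)
    also have "\<dots> = (\<integral>\<xi>. (complex_of_real (exp (- \<delta> * (norm \<xi>)\<^sup>2)) * cis (- ((fst p - snd p) \<bullet> \<xi>))) \<partial>lborel) * Q p"
      by (rule integral_mult_left_zero)
    finally show "(\<integral>\<xi>. complex_of_real (exp (- \<delta> * (norm \<xi>)\<^sup>2)) * (cis (- ((fst p - snd p) \<bullet> \<xi>)) * Q p) \<partial>lborel)
       = complex_of_real K * (Q p * complex_of_real (exp (- (norm (fst p - snd p))\<^sup>2 / s\<^sup>2)))"
      unfolding inner by (simp add: K_def mult_ac)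
  qed
  also have "\<dots> = complex_of_real K * (\<integral>p. Q p * complex_of_real (exp (- (norm (fst p - snd p))\<^sup>2 / s\<^sup>2)) \<partial>lborel)"
    by (rule integral_mult_right_zero)
  also have "(\<integral>p. Q p * complex_of_real (exp (- (norm (fst p - snd p))\<^sup>2 / s\<^sup>2)) \<partial>lborel)
    = (\<integral>y. (\<integral>z. h y * cnj (h z) * complex_of_real (exp (- (norm (y - z))\<^sup>2 / s\<^sup>2)) \<partial>lborel) \<partial>lborel)"
  proof -
    have "integrable lborel (\<lambda>p. Q p * complex_of_real (exp (- (norm (fst p - snd p))\<^sup>2 / s\<^sup>2)))"
    proof (rule Bochner_Integration.integrable_bound[OF Qi])
      have "(\<lambda>p::'a \<times> 'a. complex_of_real (exp (- (norm (fst p - snd p))\<^sup>2 / s\<^sup>2))) \<in> borel_measurable borel"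
        using s by (intro borel_measurable_continuous_onI continuous_intros) auto
      then show "(\<lambda>p. Q p * complex_of_real (exp (- (norm (fst p - snd p))\<^sup>2 / s\<^sup>2))) \<in> borel_measurable lborel"
        by simp
    qed (auto simp: norm_mult mult_left_le)
    then have "integrable (lborel \<Otimes>\<^sub>M lborel) (\<lambda>p. Q p * complex_of_real (exp (- (norm (fst p - snd p))\<^sup>2 / s\<^sup>2)))"
      by (simp add: lborel_prod)
    from lborel_pair.integral_fst'[OF this] show ?thesis
      by (simp add: lborel_prod Q_def)
  qed
  also have "\<dots> = (\<integral>y. complex_of_real (s ^ DIM('a)) * (\<integral>v. h y * cnj (h (y + s *\<^sub>R v)) * complex_of_real (gauss_weight v) \<partial>lborel) \<partial>lborel)"
  proof (rule Bochner_Integration.integral_cong[OF refl])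
    fix y :: 'a
    have "(\<integral>z. h y * cnj (h z) * complex_of_real (exp (- (norm (y - z))\<^sup>2 / s\<^sup>2)) \<partial>lborel)
      = s ^ DIM('a) *\<^sub>R (\<integral>v. h y * cnj (h (y + s *\<^sub>R v)) * complex_of_real (exp (- (norm (y - (y + s *\<^sub>R v)))\<^sup>2 / s\<^sup>2)) \<partial>lborel)"
      by (rule integral_affine[OF _ s]) measurable
    moreover have "exp (- (norm (y - (y + s *\<^sub>R v)))\<^sup>2 / s\<^sup>2) = gauss_weight v" for v
      using s by (simp add: gauss_weight_def power_mult_distrib)
    ultimately show "(\<integral>z. h y * cnj (h z) * complex_of_real (exp (- (norm (y - z))\<^sup>2 / s\<^sup>2)) \<partial>lborel)
       = complex_of_real (s ^ DIM('a)) * (\<integral>v. h y * cnj (h (y + s *\<^sub>R v)) * complex_of_real (gauss_weight v) \<partial>lborel)"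
      by (simp add: scaleR_conv_of_real)
  qed
  also have "complex_of_real K * \<dots> = complex_of_real (K * s ^ DIM('a)) * (\<integral>y. (\<integral>v. h y * cnj (h (y + s *\<^sub>R v)) * complex_of_real (gauss_weight v) \<partial>lborel) \<partial>lborel)"
    by (simp add: mult.assoc)
  \<comment> \<open>\<open>K\<close> is the Gaussian integral for
    \<open>\<delta> = s\<^sup>2 / 4\<close>, and \<open>s ^ DIM('a)\<close> comes from the
    substitution \<open>z = y + s *\<^sub>R v\<close>. The powers of \<open>s\<close> cancel, which
    is why a finite limit is possible.\<close>
  also have "K * s ^ DIM('a) = (2 * sqrt pi) ^ DIM('a)"
  proof -
    have "sqrt (pi / \<delta>) * s = 2 * sqrt pi"
      using s by (simp add: \<delta>_def real_sqrt_divide real_sqrt_mult field_simps)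
    then show ?thesis unfolding K_def by (metis power_mult_distrib)
  qed
  finally show ?thesis .
qed

section \<open>Continuity of translations in the mean\<close>

lemma nn_integral_pair_gauss:
  fixes a :: "'a::euclidean_space \<Rightarrow> ennreal"
  assumes [measurable]: "a \<in> borel_measurable borel"
  shows "(\<integral>\<^sup>+y. \<integral>\<^sup>+v. a y * ennreal (gauss_weight (v::'a)) \<partial>lborel \<partial>lborel) = (\<integral>\<^sup>+y. a y \<partial>lborel) * ennreal (sqrt pi ^ DIM('a))"
    and "(\<integral>\<^sup>+y. \<integral>\<^sup>+v. a (y + s *\<^sub>R v) * ennreal (gauss_weight (v::'a)) \<partial>lborel \<partial>lborel) = (\<integral>\<^sup>+y. a y \<partial>lborel) * ennreal (sqrt pi ^ DIM('a))"
proof -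
  show "(\<integral>\<^sup>+y. \<integral>\<^sup>+v. a y * ennreal (gauss_weight (v::'a)) \<partial>lborel \<partial>lborel) = (\<integral>\<^sup>+y. a y \<partial>lborel) * ennreal (sqrt pi ^ DIM('a))"
    by (simp add: nn_integral_cmult nn_integral_multc gauss_weight_nn_integral)
  have "(\<integral>\<^sup>+y. \<integral>\<^sup>+v. a (y + s *\<^sub>R v) * ennreal (gauss_weight (v::'a)) \<partial>lborel \<partial>lborel)
     = (\<integral>\<^sup>+v. \<integral>\<^sup>+y. a (y + s *\<^sub>R v) * ennreal (gauss_weight v) \<partial>lborel \<partial>lborel)"
    by (rule lborel_pair.Fubini') measurable
  also have "\<dots> = (\<integral>\<^sup>+v. (\<integral>\<^sup>+y. a y \<partial>lborel) * ennreal (gauss_weight (v::'a)) \<partial>lborel)"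
    by (simp add: nn_integral_multc nn_integral_translate)
  finally show "(\<integral>\<^sup>+y. \<integral>\<^sup>+v. a (y + s *\<^sub>R v) * ennreal (gauss_weight (v::'a)) \<partial>lborel \<partial>lborel) = (\<integral>\<^sup>+y. a y \<partial>lborel) * ennreal (sqrt pi ^ DIM('a))"
    by (simp add: nn_integral_cmult gauss_weight_nn_integral)
qed

text \<open>The \<open>L\<^sup>1\<close> modulus of continuity, averaged over the shifts
  \<open>s *\<^sub>R v\<close> with Gaussian weight. It is the error that appears when
  \<open>FT_gauss_regularized\<close> is compared with its limit.\<close>

definition gauss_osc :: "real \<Rightarrow> ('a::euclidean_space \<Rightarrow> complex) \<Rightarrow> ennreal" where
  "gauss_osc s h = (\<integral>\<^sup>+y. \<integral>\<^sup>+v. ennreal (cmod (h (y + s *\<^sub>R v) - h y)) * ennreal (gauss_weight v) \<partial>lborel \<partial>lborel)"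

lemma gauss_osc_triangle:
  fixes f g :: "'a::euclidean_space \<Rightarrow> complex"
  assumes [measurable]: "f \<in> borel_measurable borel" "g \<in> borel_measurable borel"
  shows "gauss_osc s (\<lambda>x. f x + g x) \<le> gauss_osc s f + gauss_osc s g"
proof -
  have "gauss_osc s (\<lambda>x. f x + g x) \<le> (\<integral>\<^sup>+y. \<integral>\<^sup>+v. ennreal (cmod (f (y + s *\<^sub>R v) - f y)) * ennreal (gauss_weight v)
      + ennreal (cmod (g (y + s *\<^sub>R v) - g y)) * ennreal (gauss_weight v) \<partial>lborel \<partial>lborel)"
    unfolding gauss_osc_def
  proof (intro nn_integral_mono)
    fix y v :: 'a
    have "cmod (f (y + s *\<^sub>R v) + g (y + s *\<^sub>R v) - (f y + g y)) \<le> cmod (f (y + s *\<^sub>R v) - f y) + cmod (g (y + s *\<^sub>R v) - g y)"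
      by (metis add_diff_add norm_triangle_ineq)
    then show "ennreal (cmod (f (y + s *\<^sub>R v) + g (y + s *\<^sub>R v) - (f y + g y))) * ennreal (gauss_weight v)
      \<le> ennreal (cmod (f (y + s *\<^sub>R v) - f y)) * ennreal (gauss_weight v) + ennreal (cmod (g (y + s *\<^sub>R v) - g y)) * ennreal (gauss_weight v)"
      by (simp add: distrib_right[symmetric] mult_right_mono flip: ennreal_plus)
  qed
  also have "\<dots> = gauss_osc s f + gauss_osc s g"
    unfolding gauss_osc_def by (simp add: nn_integral_add)
  finally show ?thesis .
qed

lemma gauss_osc_le:
  fixes f :: "'a::euclidean_space \<Rightarrow> complex"
  assumes [measurable]: "f \<in> borel_measurable borel"
  shows "gauss_osc s f \<le> 2 * ennreal (sqrt pi ^ DIM('a)) * (\<integral>\<^sup>+y. ennreal (cmod (f y)) \<partial>lborel)"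
proof -
  have "gauss_osc s f \<le> (\<integral>\<^sup>+y. \<integral>\<^sup>+v. ennreal (cmod (f (y + s *\<^sub>R v))) * ennreal (gauss_weight v)
      + ennreal (cmod (f y)) * ennreal (gauss_weight v) \<partial>lborel \<partial>lborel)"
    unfolding gauss_osc_def
  proof (intro nn_integral_mono)
    fix y v :: 'a
    have "cmod (f (y + s *\<^sub>R v) - f y) \<le> cmod (f (y + s *\<^sub>R v)) + cmod (f y)"
      by (rule norm_triangle_ineq4)
    then show "ennreal (cmod (f (y + s *\<^sub>R v) - f y)) * ennreal (gauss_weight v)
      \<le> ennreal (cmod (f (y + s *\<^sub>R v))) * ennreal (gauss_weight v) + ennreal (cmod (f y)) * ennreal (gauss_weight v)"
      by (simp add: distrib_right[symmetric] mult_right_mono flip: ennreal_plus)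
  qed
  also have "\<dots> = (\<integral>\<^sup>+y. \<integral>\<^sup>+v. ennreal (cmod (f (y + s *\<^sub>R v))) * ennreal (gauss_weight v) \<partial>lborel \<partial>lborel)
    + (\<integral>\<^sup>+y. \<integral>\<^sup>+v. ennreal (cmod (f y)) * ennreal (gauss_weight (v::'a)) \<partial>lborel \<partial>lborel)"
  proof -
    have "(\<integral>\<^sup>+y. \<integral>\<^sup>+v. ennreal (cmod (f (y + s *\<^sub>R v))) * ennreal (gauss_weight v)
      + ennreal (cmod (f y)) * ennreal (gauss_weight v) \<partial>lborel \<partial>lborel)
      = (\<integral>\<^sup>+y. (\<integral>\<^sup>+v. ennreal (cmod (f (y + s *\<^sub>R v))) * ennreal (gauss_weight v) \<partial>lborel)
        + (\<integral>\<^sup>+v. ennreal (cmod (f y)) * ennreal (gauss_weight (v::'a)) \<partial>lborel) \<partial>lborel)"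
      by (rule nn_integral_cong, rule nn_integral_add) measurable
    also have "\<dots> = (\<integral>\<^sup>+y. \<integral>\<^sup>+v. ennreal (cmod (f (y + s *\<^sub>R v))) * ennreal (gauss_weight v) \<partial>lborel \<partial>lborel)
      + (\<integral>\<^sup>+y. \<integral>\<^sup>+v. ennreal (cmod (f y)) * ennreal (gauss_weight (v::'a)) \<partial>lborel \<partial>lborel)"
      by (rule nn_integral_add) measurable
    finally show ?thesis .
  qed
  also have "\<dots> = 2 * ennreal (sqrt pi ^ DIM('a)) * (\<integral>\<^sup>+y. ennreal (cmod (f y)) \<partial>lborel)"
    by (subst nn_integral_pair_gauss(1), measurable, subst nn_integral_pair_gauss(2), measurable) (simp add: mult_2[symmetric] mult_ac)
  finally show ?thesis .
qed

lemma tendsto_zero_le_ennreal: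
  fixes f g :: "nat \<Rightarrow> ennreal"
  assumes "g \<longlonglongrightarrow> 0" "\<And>n. f n \<le> g n"
  shows "f \<longlonglongrightarrow> 0"
  by (rule tendsto_sandwich[of "\<lambda>_. 0" f sequentially g 0]) (use assms in auto)

lemma tendsto_zero_ennrealI:
  fixes f :: "nat \<Rightarrow> ennreal"
  assumes "\<And>e. e > 0 \<Longrightarrow> \<exists>g. g \<longlonglongrightarrow> 0 \<and> (\<forall>n. f n \<le> g n + ennreal e)"
  shows "f \<longlonglongrightarrow> 0"
proof (rule order_tendstoI)
  fix a :: ennreal assume a: "0 < a"
  \<comment> \<open>An infinite threshold cannot be halved; any positive number serves
    there.\<close>
  define e where "e = (if a = \<top> then 1 else enn2real a / 2)"
  have e: "e > 0" "ennreal e + ennreal e \<le> a"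
  proof -
    show "e > 0" using a unfolding e_def by (auto simp: enn2real_positive_iff less_top)
    show "ennreal e + ennreal e \<le> a"
      using a unfolding e_def by (auto simp: less_top simp flip: ennreal_plus)
  qed
  obtain g where g: "g \<longlonglongrightarrow> 0" "\<And>n. f n \<le> g n + ennreal e" using assms[OF e(1)] by blast
  have "eventually (\<lambda>n. g n < ennreal e) sequentially"
    using order_tendstoD(2)[OF g(1), of "ennreal e"] e(1) by simp
  then show "eventually (\<lambda>n. f n < a) sequentially"
  proof eventually_elim
    case (elim n)
    have "f n \<le> g n + ennreal e" by (rule g)
    also have "\<dots> < ennreal e + ennreal e" using elim by (simp add: ennreal_add_left_cancel_less add.commute)
    also have "\<dots> \<le> a" by (rule e)
    finally show ?case .
  qed
qed auto

text \<open>A point of an open set stays in it under small shifts, so by dominated convergence the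
  mass of the points leaving \<open>U\<close> tends to 0. The points entering \<open>U\<close> carry
  the same mass, by translation and the symmetry of the weight under \<open>v\<close> to
  \<open>- v\<close>.\<close>

lemma gauss_osc_open:
  fixes U :: "'a::euclidean_space set"
  assumes U: "open U" and fin: "emeasure lborel U < \<infinity>"
    and X: "X \<longlonglongrightarrow> (0::real)"
  shows "(\<lambda>n. gauss_osc (X n) (indicator U)) \<longlonglongrightarrow> 0"
proof -
  have [measurable]: "U \<in> sets borel" using U by simp
  define D where "D n = (\<integral>\<^sup>+p. ennreal (indicator U (fst p) * (1 - indicator U (fst p + X n *\<^sub>R snd p)) * gauss_weight (snd p)) \<partial>(lborel \<Otimes>\<^sub>M (lborel :: 'a measure)))" for n
  have wfin: "(\<integral>\<^sup>+p. ennreal (indicator U (fst p) * gauss_weight (snd p)) \<partial>(lborel \<Otimes>\<^sub>M (lborel :: 'a measure))) < \<infinity>"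
  proof -
    have "(\<integral>\<^sup>+p. ennreal (indicator U (fst p) * gauss_weight (snd p)) \<partial>(lborel \<Otimes>\<^sub>M (lborel :: 'a measure)))
      = (\<integral>\<^sup>+y. \<integral>\<^sup>+v. indicator U y * ennreal (gauss_weight (v::'a)) \<partial>lborel \<partial>lborel)"
      by (subst lborel.nn_integral_fst[symmetric]) (simp_all add: ennreal_mult ennreal_indicator)
    also have "\<dots> = emeasure lborel U * ennreal (sqrt pi ^ DIM('a))"
      by (subst nn_integral_pair_gauss) simp_all
    finally show ?thesis using fin by (simp add: ennreal_mult_less_top)
  qed
  have D0: "D \<longlonglongrightarrow> (\<integral>\<^sup>+p. 0 \<partial>((lborel :: 'a measure) \<Otimes>\<^sub>M (lborel :: 'a measure)))"
    unfolding D_def[abs_def]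
  proof (rule nn_integral_dominated_convergence[where w="\<lambda>p. ennreal (indicator U (fst p) * gauss_weight (snd p :: 'a))"])
    show "AE p in lborel \<Otimes>\<^sub>M (lborel :: 'a measure). (\<lambda>n. ennreal (indicator U (fst p) * (1 - indicator U (fst p + X n *\<^sub>R snd p)) * gauss_weight (snd p))) \<longlonglongrightarrow> 0"
    proof (intro AE_I2)
      fix p :: "'a \<times> 'a"
      show "(\<lambda>n. ennreal (indicator U (fst p) * (1 - indicator U (fst p + X n *\<^sub>R snd p)) * gauss_weight (snd p))) \<longlonglongrightarrow> 0"
      proof (cases "fst p \<in> U")
        case True
        have "(\<lambda>n. fst p + X n *\<^sub>R snd p) \<longlonglongrightarrow> fst p + 0 *\<^sub>R snd p"
          by (intro tendsto_intros X)
        then have "eventually (\<lambda>n. fst p + X n *\<^sub>R snd p \<in> U) sequentially"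
          using U True topological_tendstoD by fastforce
        then have "eventually (\<lambda>n. ennreal (indicator U (fst p) * (1 - indicator U (fst p + X n *\<^sub>R snd p)) * gauss_weight (snd p)) = 0) sequentially"
          by eventually_elim simp
        then show ?thesis by (rule tendsto_eventually)
      qed simp
    qed
  qed (use wfin in \<open>auto intro!: AE_I2 ennreal_leI mult_mono simp: mult_left_le split: split_indicator\<close>)
  have bound: "gauss_osc (X n) (indicator U) \<le> 2 * D n" for n
  proof -
    have D_it: "D n = (\<integral>\<^sup>+y. \<integral>\<^sup>+v. ennreal (indicator U y * (1 - indicator U (y + X n *\<^sub>R v)) * gauss_weight v) \<partial>lborel \<partial>lborel)"
      unfolding D_def by (subst lborel.nn_integral_fst[symmetric]) simp_all
    have D_it2: "D n = (\<integral>\<^sup>+y. \<integral>\<^sup>+v. ennreal (indicator U (y + X n *\<^sub>R v) * (1 - indicator U y) * gauss_weight v) \<partial>lborel \<partial>lborel)"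
    proof -
      have "(\<integral>\<^sup>+y. \<integral>\<^sup>+v. ennreal (indicator U (y + X n *\<^sub>R v) * (1 - indicator U y) * gauss_weight v) \<partial>lborel \<partial>lborel)
        = (\<integral>\<^sup>+v. \<integral>\<^sup>+y. ennreal (indicator U (y + X n *\<^sub>R v) * (1 - indicator U y) * gauss_weight v) \<partial>lborel \<partial>lborel)"
        by (rule lborel_pair.Fubini') measurable
      also have "\<dots> = (\<integral>\<^sup>+v. \<integral>\<^sup>+y. ennreal (indicator U y * (1 - indicator U (y + X n *\<^sub>R (- v))) * gauss_weight (- v)) \<partial>lborel \<partial>lborel)"
      proof (rule nn_integral_cong)
        fix v :: 'a
        show "(\<integral>\<^sup>+y. ennreal (indicator U (y + X n *\<^sub>R v) * (1 - indicator U y) * gauss_weight v) \<partial>lborel)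
          = (\<integral>\<^sup>+y. ennreal (indicator U y * (1 - indicator U (y + X n *\<^sub>R (- v))) * gauss_weight (- v)) \<partial>lborel)"
          using nn_integral_translate[of "\<lambda>y. ennreal (indicator U (y + X n *\<^sub>R v) * (1 - indicator U y) * gauss_weight v)" "- (X n *\<^sub>R v)"]
          by (simp add: gauss_weight_def)
      qed
      also have "\<dots> = (\<integral>\<^sup>+v. \<integral>\<^sup>+y. ennreal (indicator U y * (1 - indicator U (y + X n *\<^sub>R v)) * gauss_weight v) \<partial>lborel \<partial>lborel)"
        using nn_integral_affine[of "\<lambda>v::'a. \<integral>\<^sup>+y. ennreal (indicator U y * (1 - indicator U (y + X n *\<^sub>R v)) * gauss_weight v) \<partial>lborel" "-1" 0]
        by simp
      also have "\<dots> = D n"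
        unfolding D_it by (rule lborel_pair.Fubini'[symmetric]) measurable
      finally show ?thesis by simp
    qed
    have "gauss_osc (X n) (indicator U) = (\<integral>\<^sup>+y. \<integral>\<^sup>+v. ennreal (indicator U y * (1 - indicator U (y + X n *\<^sub>R v)) * gauss_weight v)
        + ennreal (indicator U (y + X n *\<^sub>R v) * (1 - indicator U y) * gauss_weight v) \<partial>lborel \<partial>lborel)"
      unfolding gauss_osc_def
      by (intro nn_integral_cong) (auto split: split_indicator)
    also have "\<dots> = D n + D n"
      by (subst D_it, subst D_it2) (simp add: nn_integral_add)
    finally show ?thesis by (simp add: mult_2)
  qed
  have "D \<longlonglongrightarrow> 0" using D0 by simp
  then have "(\<lambda>n. 2 * D n) \<longlonglongrightarrow> 2 * 0"
    by (intro ennreal_tendsto_cmult) auto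
  then show ?thesis
    by (intro tendsto_zero_le_ennreal[OF _ bound]) simp
qed

lemma gauss_osc_cmult:
  "f \<in> borel_measurable borel \<Longrightarrow> gauss_osc s (\<lambda>x. c * f x) = ennreal (cmod c) * gauss_osc s f" for f :: "'a::euclidean_space \<Rightarrow> complex"
proof -
  assume [measurable]: "f \<in> borel_measurable borel"
  have "cmod (c * a - c * b) = cmod c * cmod (a - b)" for a b
    by (simp add: norm_mult right_diff_distrib[symmetric])
  then show ?thesis
    unfolding gauss_osc_def by (simp add: ennreal_mult nn_integral_cmult mult.assoc)
qed

text \<open>Density argument: open sets, then Borel sets of finite measure by outer regularity, then
  sums and limits of simple functions. \<open>gauss_osc_triangle\<close> and
  \<open>gauss_osc_le\<close> make the oscillation stable under small \<open>L\<^sup>1\<close>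
  changes.\<close>

lemma gauss_osc_tendsto:
  fixes h :: "'a::euclidean_space \<Rightarrow> complex"
  assumes h: "integrable lborel h" and X: "X \<longlonglongrightarrow> (0::real)"
  shows "(\<lambda>n. gauss_osc (X n) h) \<longlonglongrightarrow> 0"
  using h
proof (induction rule: integrable_induct)
  case (base A c)
  have A[measurable]: "A \<in> sets borel" and Af: "emeasure lborel A < \<infinity>" using base by auto
  have "(\<lambda>n. gauss_osc (X n) (indicator A :: 'a \<Rightarrow> complex)) \<longlonglongrightarrow> 0"
  proof (rule tendsto_zero_ennrealI)
    fix e :: real assume e: "e > 0"
    \<comment> \<open>Cancels the factor in \<open>gauss_osc_le\<close>, so that the part of
      \<open>U\<close> outside \<open>A\<close> contributes at most \<open>e\<close>.\<close>
    define e' where "e' = e / (2 * sqrt pi ^ DIM('a))"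
    have e': "e' > 0" using e by (simp add: e'_def)
    obtain U where U: "open U" "A \<subseteq> U" "emeasure lborel (U - A) < ennreal e'"
      using outer_regular_lborel[OF A e'] by blast
    have [measurable]: "U \<in> sets borel" using U by simp
    have Ufin: "emeasure lborel U < \<infinity>"
    proof -
      have "emeasure lborel U \<le> emeasure lborel A + emeasure lborel (U - A)"
        using emeasure_subadditive[of A lborel "U - A"] U(2) by (simp add: Un_absorb1)
      also have "\<dots> < \<infinity>" using Af U(3) by (auto simp: less_top[symmetric])
      finally show ?thesis .
    qed
    have ieq: "(indicator A :: 'a \<Rightarrow> complex) = (\<lambda>x. indicator U x + (- 1) * indicator (U - A) x)"
      using U(2) by (auto simp: fun_eq_iff split: split_indicator)
    have "gauss_osc (X n) (indicator A :: 'a \<Rightarrow> complex) \<le> gauss_osc (X n) (indicator U :: 'a \<Rightarrow> complex) + ennreal e" for n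
    proof -
      have "gauss_osc (X n) (indicator A :: 'a \<Rightarrow> complex) \<le> gauss_osc (X n) (indicator U :: 'a \<Rightarrow> complex) + gauss_osc (X n) (\<lambda>x. (- 1) * indicator (U - A) x)"
        unfolding ieq by (rule gauss_osc_triangle) measurable
      also have "gauss_osc (X n) (\<lambda>x::'a. (- 1) * indicator (U - A) x) \<le> 2 * ennreal (sqrt pi ^ DIM('a)) * (\<integral>\<^sup>+y. ennreal (cmod ((-1) * indicator (U - A) y)) \<partial>lborel)"
        by (rule gauss_osc_le) measurable
      also have "(\<integral>\<^sup>+y. ennreal (cmod ((-1) * indicator (U - A) y)) \<partial>lborel) = emeasure lborel (U - A)"
      proof -
        have "(\<integral>\<^sup>+y. ennreal (cmod ((-1) * indicator (U - A) y)) \<partial>lborel) = (\<integral>\<^sup>+y. indicator (U - A) y \<partial>lborel)"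
          by (intro nn_integral_cong) (auto split: split_indicator)
        then show ?thesis by simp
      qed
      also have "2 * ennreal (sqrt pi ^ DIM('a)) * emeasure lborel (U - A) \<le> 2 * ennreal (sqrt pi ^ DIM('a)) * ennreal e'"
        using U(3) by (intro mult_left_mono) auto
      also have "\<dots> = ennreal e"
        using e by (simp add: e'_def ennreal_mult[symmetric] flip: ennreal_numeral)
      finally show ?thesis by (simp add: add_left_mono)
    qed
    then show "\<exists>g. g \<longlonglongrightarrow> 0 \<and> (\<forall>n. gauss_osc (X n) (indicator A :: 'a \<Rightarrow> complex) \<le> g n + ennreal e)"
      using gauss_osc_open[OF U(1) Ufin X] by blast
  qed
  then have "(\<lambda>n. ennreal (cmod c) * gauss_osc (X n) (indicator A :: 'a \<Rightarrow> complex)) \<longlonglongrightarrow> ennreal (cmod c) * 0"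
    by (intro ennreal_tendsto_cmult) auto
  moreover have "gauss_osc (X n) (\<lambda>x. indicator A x *\<^sub>R c) = ennreal (cmod c) * gauss_osc (X n) (indicator A :: 'a \<Rightarrow> complex)" for n
  proof -
    have "(\<lambda>x. indicator A x *\<^sub>R c) = (\<lambda>x. c * indicator A x)"
      by (auto split: split_indicator)
    then show ?thesis using gauss_osc_cmult[of "indicator A :: 'a \<Rightarrow> complex" "X n" c] by simp
  qed
  ultimately show ?case by simp
next
  case (add f g)
  have m: "f \<in> borel_measurable borel" "g \<in> borel_measurable borel"
    using add by (auto dest: borel_measurable_integrable)
  have "(\<lambda>n. gauss_osc (X n) f + gauss_osc (X n) g) \<longlonglongrightarrow> 0 + 0"
    by (intro tendsto_intros add)
  then show ?case
    by (intro tendsto_zero_le_ennreal[OF _ gauss_osc_triangle[OF m]]) simp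
next
  case (lim f s)
  have fint: "integrable lborel f" using lim by blast
  have bd: "cmod (s i x) \<le> 2 * cmod (f x)" for i x using lim by auto
  have lm: "(\<lambda>i. s i x) \<longlonglongrightarrow> f x" for x using lim by auto
  have IH: "(\<lambda>n. gauss_osc (X n) (s i)) \<longlonglongrightarrow> 0" for i using lim by blast
  have m[measurable]: "f \<in> borel_measurable borel" "\<And>i. s i \<in> borel_measurable borel"
    using lim by (auto dest: borel_measurable_integrable)
  have c: "(\<lambda>i. \<integral>\<^sup>+x. ennreal (cmod (f x - s i x)) \<partial>lborel) \<longlonglongrightarrow> (\<integral>\<^sup>+(x::'a). 0 \<partial>lborel)"
  proof (rule nn_integral_dominated_convergence[where w="\<lambda>x. ennreal (3 * cmod (f x))"])
    show "(\<integral>\<^sup>+x. ennreal (3 * cmod (f x)) \<partial>lborel) < \<infinity>"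
      using fint by (simp add: integrable_iff_bounded ennreal_mult nn_integral_cmult ennreal_mult_less_top)
    show "AE x in lborel. ennreal (cmod (f x - s i x)) \<le> ennreal (3 * cmod (f x))" for i
    proof (intro AE_I2 ennreal_leI)
      fix x
      have "cmod (f x - s i x) \<le> cmod (f x) + cmod (s i x)" by (rule norm_triangle_ineq4)
      also have "\<dots> \<le> 3 * cmod (f x)" using bd[of i x] by simp
      finally show "cmod (f x - s i x) \<le> 3 * cmod (f x)" .
    qed
    show "AE x in lborel. (\<lambda>i. ennreal (cmod (f x - s i x))) \<longlonglongrightarrow> 0"
    proof (intro AE_I2)
      fix x :: 'a
      have "(\<lambda>i. cmod (f x - s i x)) \<longlonglongrightarrow> cmod (f x - f x)"
        using lm[of x] by (intro tendsto_intros) auto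
      then show "(\<lambda>i. ennreal (cmod (f x - s i x))) \<longlonglongrightarrow> 0"
        by (metis diff_self norm_zero ennreal_0 tendsto_ennrealI)
    qed
  qed measurable
  show ?case
  proof (rule tendsto_zero_ennrealI)
    fix e :: real assume e: "e > 0"
    define e' where "e' = e / (2 * sqrt pi ^ DIM('a))"
    have e': "e' > 0" using e by (simp add: e'_def)
    have "eventually (\<lambda>i. (\<integral>\<^sup>+x. ennreal (cmod (f x - s i x)) \<partial>lborel) < ennreal e') sequentially"
      using c e' by (intro order_tendstoD(2)) auto
    then obtain i where i: "(\<integral>\<^sup>+x. ennreal (cmod (f x - s i x)) \<partial>lborel) < ennreal e'"
      by (auto simp: eventually_sequentially)
    have "gauss_osc (X n) f \<le> gauss_osc (X n) (s i) + ennreal e" for n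
    proof -
      have "gauss_osc (X n) f \<le> gauss_osc (X n) (s i) + gauss_osc (X n) (\<lambda>x. f x - s i x)"
        using gauss_osc_triangle[of "s i" "\<lambda>x. f x - s i x" "X n"] by simp
      also have "gauss_osc (X n) (\<lambda>x. f x - s i x) \<le> 2 * ennreal (sqrt pi ^ DIM('a)) * (\<integral>\<^sup>+y. ennreal (cmod (f y - s i y)) \<partial>lborel)"
        by (rule gauss_osc_le) measurable
      also have "\<dots> \<le> 2 * ennreal (sqrt pi ^ DIM('a)) * ennreal e'"
        using i by (intro mult_left_mono) auto
      also have "\<dots> = ennreal e"
        using e by (simp add: e'_def ennreal_mult[symmetric] flip: ennreal_numeral)
      finally show ?thesis by (simp add: add_left_mono)
    qed
    then show "\<exists>g. g \<longlonglongrightarrow> 0 \<and> (\<forall>n. gauss_osc (X n) f \<le> g n + ennreal e)"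
      using IH by blast
  qed
qed

text \<open>The Bochner integral of a function that is not integrable is 0, so the bound persists
  and no integrability has to be carried through iterated integrals.\<close>

lemma integral_norm_bound_ennreal_any:
  fixes f :: "'a \<Rightarrow> complex"
  shows "ennreal (cmod (integral\<^sup>L M f)) \<le> (\<integral>\<^sup>+x. ennreal (cmod (f x)) \<partial>M)"
  by (cases "integrable M f") (auto simp: integral_norm_bound_ennreal not_integrable_integral_eq)

text \<open>One half of Plancherel. In \<open>FT_gauss_regularized\<close> the product of two values
  of \<open>h\<close> is at most half the sum of their squares, and both halves integrate to the
  same number, whatever \<open>s\<close> is. Fatou's lemma as \<open>s\<close> tends to 0 removes
  the damping.\<close>

lemma FT_sq_le:
  fixes h :: "'a::euclidean_space \<Rightarrow> complex"
  assumes h: "integrable lborel h" and h2: "sqint lborel h"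
  shows "sqint lborel (FT h)" "(nrm2 lborel (FT h))\<^sup>2 \<le> (2 * pi) ^ DIM('a) * (nrm2 lborel h)\<^sup>2"
proof -
  have [measurable]: "h \<in> borel_measurable borel"
    using h by (auto dest: borel_measurable_integrable)
  define C where "C = (2 * pi) ^ DIM('a) * (nrm2 lborel h)\<^sup>2"
  have C0: "C \<ge> 0" by (simp add: C_def)
  have reg: "(\<integral>\<^sup>+\<xi>. ennreal ((cmod (FT h \<xi>))\<^sup>2 * exp (- (s\<^sup>2 / 4) * (norm \<xi>)\<^sup>2)) \<partial>lborel) \<le> ennreal C" if s: "s > 0" for s
  proof -
    have dom: "integrable lborel (\<lambda>\<xi>. (cmod (FT h \<xi>))\<^sup>2 * exp (- (s\<^sup>2 / 4) * (norm \<xi>)\<^sup>2))"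
    proof (rule Bochner_Integration.integrable_bound)
      show "integrable lborel (\<lambda>\<xi>::'a. (\<integral>x. cmod (h x) \<partial>lborel)\<^sup>2 * exp (- (s\<^sup>2 / 4) * (norm \<xi>)\<^sup>2))"
        using s by (intro integrable_mult_right gauss_real_integral) simp
      show "AE \<xi> in lborel. norm ((cmod (FT h \<xi>))\<^sup>2 * exp (- (s\<^sup>2 / 4) * (norm \<xi>)\<^sup>2))
          \<le> norm ((\<integral>x. cmod (h x) \<partial>lborel)\<^sup>2 * exp (- (s\<^sup>2 / 4) * (norm \<xi>)\<^sup>2))"
        by (intro AE_I2) (auto simp: abs_mult intro!: mult_right_mono power_mono FT_bound h)
    qed measurable
    define R where "R = (\<integral>\<xi>. (cmod (FT h \<xi>))\<^sup>2 * exp (- (s\<^sup>2 / 4) * (norm \<xi>)\<^sup>2) \<partial>lborel)"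
    define Z where "Z y v = h y * cnj (h (y + s *\<^sub>R v)) * complex_of_real (gauss_weight v)" for y v :: 'a
    have "\<bar>R\<bar> = cmod (complex_of_real R)" by simp
    also have "complex_of_real R = complex_of_real ((2 * sqrt pi) ^ DIM('a)) * (\<integral>y. (\<integral>v. Z y v \<partial>lborel) \<partial>lborel)"
      unfolding R_def Z_def by (rule FT_gauss_regularized[OF h s])
    also have "cmod \<dots> = (2 * sqrt pi) ^ DIM('a) * cmod (\<integral>y. (\<integral>v. Z y v \<partial>lborel) \<partial>lborel)"
      by (simp add: norm_mult norm_power)
    finally have "ennreal R \<le> ennreal ((2 * sqrt pi) ^ DIM('a)) * ennreal (cmod (\<integral>y. (\<integral>v. Z y v \<partial>lborel) \<partial>lborel))"
      by (metis abs_ge_self ennreal_leI ennreal_mult' norm_ge_zero ennreal_mult'')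
    also have "ennreal (cmod (\<integral>y. (\<integral>v. Z y v \<partial>lborel) \<partial>lborel)) \<le> (\<integral>\<^sup>+y. ennreal (cmod (\<integral>v. Z y v \<partial>lborel)) \<partial>lborel)"
      by (rule integral_norm_bound_ennreal_any)
    also have "\<dots> \<le> (\<integral>\<^sup>+y. \<integral>\<^sup>+v. ennreal (cmod (Z y v)) \<partial>lborel \<partial>lborel)"
      by (intro nn_integral_mono integral_norm_bound_ennreal_any)
    also have "\<dots> \<le> (\<integral>\<^sup>+y. \<integral>\<^sup>+v. ennreal ((cmod (h y))\<^sup>2 / 2) * ennreal (gauss_weight v) + ennreal ((cmod (h (y + s *\<^sub>R v)))\<^sup>2 / 2) * ennreal (gauss_weight (v::'a)) \<partial>lborel \<partial>lborel)"
    proof (intro nn_integral_mono)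
      fix y v :: 'a
      have "cmod (Z y v) \<le> ((cmod (h y))\<^sup>2 / 2 + (cmod (h (y + s *\<^sub>R v)))\<^sup>2 / 2) * gauss_weight v"
        using sum_squares_bound[of "cmod (h y)" "cmod (h (y + s *\<^sub>R v))"]
        by (auto simp: Z_def norm_mult intro!: mult_right_mono)
      then show "ennreal (cmod (Z y v)) \<le> ennreal ((cmod (h y))\<^sup>2 / 2) * ennreal (gauss_weight v) + ennreal ((cmod (h (y + s *\<^sub>R v)))\<^sup>2 / 2) * ennreal (gauss_weight v)"
        by (simp add: distrib_right ennreal_leI flip: ennreal_mult ennreal_plus)
    qed
    also have "\<dots> = (\<integral>\<^sup>+y. (\<integral>\<^sup>+v. ennreal ((cmod (h y))\<^sup>2 / 2) * ennreal (gauss_weight (v::'a)) \<partial>lborel) + (\<integral>\<^sup>+v. ennreal ((cmod (h (y + s *\<^sub>R v)))\<^sup>2 / 2) * ennreal (gauss_weight (v::'a)) \<partial>lborel) \<partial>lborel)"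
      by (rule nn_integral_cong, rule nn_integral_add) measurable
    also have "\<dots> = (\<integral>\<^sup>+y. \<integral>\<^sup>+v. ennreal ((cmod (h y))\<^sup>2 / 2) * ennreal (gauss_weight (v::'a)) \<partial>lborel \<partial>lborel)
      + (\<integral>\<^sup>+y. \<integral>\<^sup>+v. ennreal ((cmod (h (y + s *\<^sub>R v)))\<^sup>2 / 2) * ennreal (gauss_weight (v::'a)) \<partial>lborel \<partial>lborel)"
      by (rule nn_integral_add) measurable
    also have "\<dots> = 2 * ((\<integral>\<^sup>+y. ennreal ((cmod (h y))\<^sup>2 / 2) \<partial>lborel) * ennreal (sqrt pi ^ DIM('a)))"
      by (subst nn_integral_pair_gauss(1), measurable, subst nn_integral_pair_gauss(2)[of "\<lambda>y. ennreal ((cmod (h y))\<^sup>2 / 2)"], measurable) (simp add: mult_2)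
    also have "(\<integral>\<^sup>+y. ennreal ((cmod (h y))\<^sup>2 / 2) \<partial>lborel) = ennreal ((nrm2 lborel h)\<^sup>2 / 2)"
      using sqint_integrable[OF h2] by (subst nn_integral_eq_integral) (simp_all add: nrm2_sq)
    finally have "ennreal R \<le> ennreal ((2 * sqrt pi) ^ DIM('a)) * (2 * (ennreal ((nrm2 lborel h)\<^sup>2 / 2) * ennreal (sqrt pi ^ DIM('a))))"
      by (simp add: mult_left_mono)
    also have "\<dots> = ennreal C"
    proof -
      have "(2 * sqrt pi) ^ DIM('a) * sqrt pi ^ DIM('a) = (2 * pi) ^ DIM('a)"
        by (simp only: power_mult_distrib[symmetric] mult.assoc real_sqrt_mult_self abs_of_nonneg[OF pi_ge_zero])
      then have "C = (2 * sqrt pi) ^ DIM('a) * (2 * ((nrm2 lborel h)\<^sup>2 / 2 * sqrt pi ^ DIM('a)))"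
        unfolding C_def by (simp only: mult_ac) simp
      moreover have m: "ennreal (a * (2 * (b * c))) = ennreal a * (2 * (ennreal b * ennreal c))"
        if "a \<ge> 0" "b \<ge> 0" "c \<ge> 0" for a b c :: real
        using that by (simp add: ennreal_mult)
      have "ennreal ((2 * sqrt pi) ^ DIM('a) * (2 * ((nrm2 lborel h)\<^sup>2 / 2 * sqrt pi ^ DIM('a))))
        = ennreal ((2 * sqrt pi) ^ DIM('a)) * (2 * (ennreal ((nrm2 lborel h)\<^sup>2 / 2) * ennreal (sqrt pi ^ DIM('a))))"
        by (rule m) auto
      ultimately show ?thesis by simp
    qed
    finally have "ennreal R \<le> ennreal C" .
    then show ?thesis unfolding R_def by (subst nn_integral_eq_integral[OF dom]) auto
  qed
  have "(\<integral>\<^sup>+\<xi>. ennreal ((cmod (FT h \<xi>))\<^sup>2) \<partial>lborel)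
    \<le> (\<integral>\<^sup>+\<xi>. liminf (\<lambda>n. ennreal ((cmod (FT h \<xi>))\<^sup>2 * exp (- ((1 / real (Suc n))\<^sup>2 / 4) * (norm \<xi>)\<^sup>2))) \<partial>lborel)"
  proof (intro nn_integral_mono)
    fix \<xi> :: 'a
    have "(\<lambda>n. 1 / real (Suc n)) \<longlonglongrightarrow> 0" using LIMSEQ_inverse_real_of_nat by (simp add: inverse_eq_divide)
    then have "(\<lambda>n. (cmod (FT h \<xi>))\<^sup>2 * exp (- ((1 / real (Suc n))\<^sup>2 / 4) * (norm \<xi>)\<^sup>2)) \<longlonglongrightarrow> (cmod (FT h \<xi>))\<^sup>2 * exp (- ((0)\<^sup>2 / 4) * (norm \<xi>)\<^sup>2)"
      by (intro tendsto_intros) auto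
    then have "(\<lambda>n. ennreal ((cmod (FT h \<xi>))\<^sup>2 * exp (- ((1 / real (Suc n))\<^sup>2 / 4) * (norm \<xi>)\<^sup>2))) \<longlonglongrightarrow> ennreal ((cmod (FT h \<xi>))\<^sup>2)"
      by (intro tendsto_ennrealI) simp
    then show "ennreal ((cmod (FT h \<xi>))\<^sup>2) \<le> liminf (\<lambda>n. ennreal ((cmod (FT h \<xi>))\<^sup>2 * exp (- ((1 / real (Suc n))\<^sup>2 / 4) * (norm \<xi>)\<^sup>2)))"
      by (metis lim_imp_Liminf order_refl trivial_limit_sequentially)
  qed
  also have "\<dots> \<le> liminf (\<lambda>n. \<integral>\<^sup>+\<xi>. ennreal ((cmod (FT h \<xi>))\<^sup>2 * exp (- ((1 / real (Suc n))\<^sup>2 / 4) * (norm \<xi>)\<^sup>2)) \<partial>lborel)"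
    by (rule nn_integral_liminf) measurable
  also have "\<dots> \<le> limsup (\<lambda>n. \<integral>\<^sup>+\<xi>. ennreal ((cmod (FT h \<xi>))\<^sup>2 * exp (- ((1 / real (Suc n))\<^sup>2 / 4) * (norm \<xi>)\<^sup>2)) \<partial>lborel)"
    by (rule Liminf_le_Limsup) simp
  also have "\<dots> \<le> ennreal C"
    by (intro Limsup_bounded always_eventually allI reg) simp
  finally have fin: "(\<integral>\<^sup>+\<xi>. ennreal ((cmod (FT h \<xi>))\<^sup>2) \<partial>lborel) \<le> ennreal ((sqrt C)\<^sup>2)"
    using C0 by simp
  show "sqint lborel (FT h)" using nrm2_le_nnI(1)[OF fin] C0 by simp
  have "nrm2 lborel (FT h) \<le> sqrt C" using nrm2_le_nnI(2)[OF fin] C0 by simp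
  then have "(nrm2 lborel (FT h))\<^sup>2 \<le> (sqrt C)\<^sup>2" by (intro power_mono) auto
  then show "(nrm2 lborel (FT h))\<^sup>2 \<le> (2 * pi) ^ DIM('a) * (nrm2 lborel h)\<^sup>2" using C0 by (simp add: C_def)
qed

text \<open>For bounded \<open>h\<close> one factor of the product is at most \<open>B\<close>, so
  the regularised integral differs from its limit by at most a constant times
  \<open>gauss_osc\<close>, and the oscillation in \<open>L\<^sup>1\<close> is enough.\<close>

lemma FT_sq_eq_bounded:
  fixes h :: "'a::euclidean_space \<Rightarrow> complex"
  assumes h: "integrable lborel h" and B: "\<And>x. cmod (h x) \<le> B"
  shows "(nrm2 lborel (FT h))\<^sup>2 = (2 * pi) ^ DIM('a) * (nrm2 lborel h)\<^sup>2"
proof -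
  have [measurable]: "h \<in> borel_measurable borel"
    using h by (auto dest: borel_measurable_integrable)
  have B0: "B \<ge> 0" using B[of 0] norm_ge_zero order_trans by blast
  have h2: "sqint lborel h"
    unfolding sqint_def
  proof
    show "integrable lborel (\<lambda>x. (cmod (h x))\<^sup>2)"
      by (rule Bochner_Integration.integrable_bound[where f="\<lambda>x. B * cmod (h x)"])
         (use h B B0 in \<open>auto simp: power2_eq_square intro!: mult_right_mono\<close>)
  qed simp
  define s where "s n = 1 / real (Suc n)" for n
  have s0: "s \<longlonglongrightarrow> 0" unfolding s_def using LIMSEQ_inverse_real_of_nat by (simp add: inverse_eq_divide)
  have spos: "s n > 0" for n by (simp add: s_def)
  define R where "R n = (\<integral>\<xi>. (cmod (FT h \<xi>))\<^sup>2 * exp (- ((s n)\<^sup>2 / 4) * (norm \<xi>)\<^sup>2) \<partial>lborel)" for n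
  have "R \<longlonglongrightarrow> (\<integral>\<xi>. (cmod (FT h \<xi>))\<^sup>2 \<partial>lborel)"
    unfolding R_def
  proof (rule integral_dominated_convergence[where w="\<lambda>\<xi>. (cmod (FT h \<xi>))\<^sup>2"])
    show "AE \<xi> in lborel. (\<lambda>n. (cmod (FT h \<xi>))\<^sup>2 * exp (- ((s n)\<^sup>2 / 4) * (norm \<xi>)\<^sup>2)) \<longlonglongrightarrow> (cmod (FT h \<xi>))\<^sup>2"
    proof (intro AE_I2)
      fix \<xi> :: 'a
      have "(\<lambda>n. (cmod (FT h \<xi>))\<^sup>2 * exp (- ((s n)\<^sup>2 / 4) * (norm \<xi>)\<^sup>2)) \<longlonglongrightarrow> (cmod (FT h \<xi>))\<^sup>2 * exp (- (0\<^sup>2 / 4) * (norm \<xi>)\<^sup>2)"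
        by (intro tendsto_intros s0) auto
      then show "(\<lambda>n. (cmod (FT h \<xi>))\<^sup>2 * exp (- ((s n)\<^sup>2 / 4) * (norm \<xi>)\<^sup>2)) \<longlonglongrightarrow> (cmod (FT h \<xi>))\<^sup>2" by simp
    qed
  qed (use FT_sq_le(1)[OF h h2] in \<open>auto simp: sqint_def mult_left_le\<close>)
  then have R1: "R \<longlonglongrightarrow> (nrm2 lborel (FT h))\<^sup>2" by (simp add: nrm2_sq)
  define C where "C = (2 * pi) ^ DIM('a) * (nrm2 lborel h)\<^sup>2"
  define K where "K = (2 * sqrt pi) ^ DIM('a)"
  have K0: "K \<ge> 0" by (simp add: K_def)
  have est: "ennreal \<bar>R n - C\<bar> \<le> ennreal (K * B) * gauss_osc (s n) h" for n
  proof -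
    define Z where "Z y v = h y * cnj (h (y + s n *\<^sub>R v)) * complex_of_real (gauss_weight v)" for y v :: 'a
    define Y where "Y y v = h y * cnj (h y) * complex_of_real (gauss_weight v)" for y v :: 'a
    have Zm[measurable]: "(\<lambda>(y, v). Z y v) \<in> borel_measurable (lborel \<Otimes>\<^sub>M lborel)"
      unfolding Z_def by measurable
    have Yi: "integrable (lborel \<Otimes>\<^sub>M lborel) (\<lambda>(y, v). Y y v)"
    proof -
      have "integrable lborel (\<lambda>y. h y * cnj (h y))"
        by (intro sqint_mult_integrable sqint_cnj h2)
      moreover have "integrable lborel (\<lambda>v::'a. complex_of_real (gauss_weight v))"
        unfolding complex_of_real_integrable_eq by (rule gauss_weight_integrable)
      ultimately show ?thesis unfolding Y_def by (rule integrable_prod_pair)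
    qed
    have Zi: "integrable (lborel \<Otimes>\<^sub>M lborel) (\<lambda>(y, v). Z y v)"
    proof (rule Bochner_Integration.integrable_bound)
      have "integrable lborel (\<lambda>v::'a. complex_of_real (gauss_weight v))"
        unfolding complex_of_real_integrable_eq by (rule gauss_weight_integrable)
      from integrable_prod_pair[OF integrable_mult_right[OF h, of "complex_of_real B"] this]
      show "integrable (lborel \<Otimes>\<^sub>M lborel) (\<lambda>(y, v). complex_of_real B * h y * complex_of_real (gauss_weight (v::'a)))"
        by simp
      show "AE p in lborel \<Otimes>\<^sub>M lborel. norm (case p of (y, v) \<Rightarrow> Z y v) \<le> norm (case p of (y, v) \<Rightarrow> complex_of_real B * h y * complex_of_real (gauss_weight v))"
        using B B0 by (intro AE_I2) (auto simp: Z_def norm_mult mult.commute[of B] intro!: mult_left_mono mult_right_mono)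
    qed measurable
    have e1: "(\<integral>y. (\<integral>v. Z y v \<partial>lborel) \<partial>lborel) = (\<integral>p. (case p of (y, v) \<Rightarrow> Z y v) \<partial>(lborel \<Otimes>\<^sub>M lborel))"
      by (rule trans[OF _ lborel_pair.integral_fst'[OF Zi]]) simp
    have e2: "(\<integral>y. (\<integral>v. Y y v \<partial>lborel) \<partial>lborel) = (\<integral>p. (case p of (y, v) \<Rightarrow> Y y v) \<partial>(lborel \<Otimes>\<^sub>M lborel))"
      by (rule trans[OF _ lborel_pair.integral_fst'[OF Yi]]) simp
    have e3: "(\<integral>y. (\<integral>v. Y y v \<partial>lborel) \<partial>lborel) = complex_of_real (sqrt pi ^ DIM('a) * (nrm2 lborel h)\<^sup>2)"
    proof -
      have "(\<integral>y. (\<integral>v. Y y v \<partial>lborel) \<partial>lborel) = (\<integral>y. h y * cnj (h y) \<partial>lborel) * (\<integral>v. complex_of_real (gauss_weight (v::'a)) \<partial>lborel)"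
        unfolding Y_def by (simp only: integral_mult_right_zero integral_mult_left_zero)
      also have "(\<integral>y. h y * cnj (h y) \<partial>lborel) = complex_of_real ((nrm2 lborel h)\<^sup>2)"
        unfolding nrm2_sq complex_norm_square[symmetric] by (rule integral_complex_of_real)
      also have "(\<integral>v. complex_of_real (gauss_weight (v::'a)) \<partial>lborel) = complex_of_real (sqrt pi ^ DIM('a))"
        unfolding integral_complex_of_real gauss_weight_integral ..
      finally show ?thesis by (simp add: mult.commute)
    qed
    have "K * (sqrt pi ^ DIM('a) * (nrm2 lborel h)\<^sup>2) = C"
    proof -
      have "(2 * sqrt pi) ^ DIM('a) * sqrt pi ^ DIM('a) = (2 * pi) ^ DIM('a)"
        by (simp only: power_mult_distrib[symmetric] mult.assoc real_sqrt_mult_self abs_of_nonneg[OF pi_ge_zero])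
      then show ?thesis unfolding C_def K_def by (simp add: mult.assoc[symmetric])
    qed
    then have "complex_of_real (R n - C) = complex_of_real K * ((\<integral>y. (\<integral>v. Z y v \<partial>lborel) \<partial>lborel) - (\<integral>y. (\<integral>v. Y y v \<partial>lborel) \<partial>lborel))"
      unfolding e3 R_def Z_def K_def using FT_gauss_regularized[OF h spos, of n] by (simp add: right_diff_distrib of_real_diff flip: of_real_mult)
    also have "(\<integral>y. (\<integral>v. Z y v \<partial>lborel) \<partial>lborel) - (\<integral>y. (\<integral>v. Y y v \<partial>lborel) \<partial>lborel)
      = (\<integral>p. (case p of (y, v) \<Rightarrow> Z y v) - (case p of (y, v) \<Rightarrow> Y y v) \<partial>(lborel \<Otimes>\<^sub>M lborel))"
      unfolding e1 e2 by (rule Bochner_Integration.integral_diff[OF Zi Yi, symmetric])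
    finally have "\<bar>R n - C\<bar> = K * cmod (\<integral>p. (case p of (y, v) \<Rightarrow> Z y v) - (case p of (y, v) \<Rightarrow> Y y v) \<partial>(lborel \<Otimes>\<^sub>M lborel))"
      using K0 by (metis abs_of_nonneg norm_mult norm_of_real)
    then have "ennreal \<bar>R n - C\<bar> = ennreal K * ennreal (cmod (\<integral>p. (case p of (y, v) \<Rightarrow> Z y v) - (case p of (y, v) \<Rightarrow> Y y v) \<partial>(lborel \<Otimes>\<^sub>M lborel)))"
      using K0 by (simp add: ennreal_mult)
    also have "\<dots> \<le> ennreal K * (\<integral>\<^sup>+p. ennreal (cmod ((case p of (y, v) \<Rightarrow> Z y v) - (case p of (y, v) \<Rightarrow> Y y v))) \<partial>(lborel \<Otimes>\<^sub>M lborel))"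
      by (intro mult_left_mono integral_norm_bound_ennreal_any) simp
    also have "(\<integral>\<^sup>+p. ennreal (cmod ((case p of (y, v) \<Rightarrow> Z y v) - (case p of (y, v) \<Rightarrow> Y y v))) \<partial>(lborel \<Otimes>\<^sub>M lborel))
      = (\<integral>\<^sup>+y. \<integral>\<^sup>+v. ennreal (cmod (Z y v - Y y v)) \<partial>lborel \<partial>lborel)"
      using Yi by (subst lborel.nn_integral_fst[symmetric]) (auto dest: borel_measurable_integrable)
    also have "\<dots> \<le> (\<integral>\<^sup>+y. \<integral>\<^sup>+v. ennreal B * (ennreal (cmod (h (y + s n *\<^sub>R v) - h y)) * ennreal (gauss_weight (v::'a))) \<partial>lborel \<partial>lborel)"
    proof (intro nn_integral_mono)
      fix y v :: 'a
      have "cmod (Z y v - Y y v) = cmod (h y) * cmod (cnj (h (y + s n *\<^sub>R v) - h y)) * gauss_weight v"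
        unfolding Z_def Y_def by (simp add: left_diff_distrib[symmetric] right_diff_distrib[symmetric] norm_mult del: complex_mod_cnj flip: complex_cnj_diff)
      also have "\<dots> \<le> B * (cmod (h (y + s n *\<^sub>R v) - h y) * gauss_weight v)"
        using B[of y] by (simp only: complex_mod_cnj mult.assoc) (intro mult_right_mono, auto)
      finally show "ennreal (cmod (Z y v - Y y v)) \<le> ennreal B * (ennreal (cmod (h (y + s n *\<^sub>R v) - h y)) * ennreal (gauss_weight v))"
        using B0 by (simp add: ennreal_leI flip: ennreal_mult)
    qed
    also have "\<dots> = ennreal B * gauss_osc (s n) h"
      unfolding gauss_osc_def by (simp add: nn_integral_cmult)
    finally show ?thesis using K0 B0 by (simp add: ennreal_mult mult.assoc mult_left_mono)
  qed
  have "(\<lambda>n. ennreal (K * B) * gauss_osc (s n) h) \<longlonglongrightarrow> ennreal (K * B) * 0"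
    by (intro ennreal_tendsto_cmult gauss_osc_tendsto[OF h s0]) auto
  then have "(\<lambda>n. ennreal \<bar>R n - C\<bar>) \<longlonglongrightarrow> 0"
    by (intro tendsto_zero_le_ennreal[OF _ est]) simp
  then have "(\<lambda>n. \<bar>R n - C\<bar>) \<longlonglongrightarrow> 0"
    using tendsto_ennrealD[of "\<lambda>n. \<bar>R n - C\<bar>" 0 sequentially] by simp
  then have "R \<longlonglongrightarrow> C" by (simp add: LIM_zero_cancel tendsto_rabs_zero_iff)
  then show ?thesis using R1 LIMSEQ_unique unfolding C_def by blast
qed

text \<open>Values of \<open>h\<close> above height \<open>n\<close> are replaced by 0. The cut
  functions are covered by \<open>FT_sq_eq_bounded\<close>, they converge to \<open>h\<close> in
  norm, and \<open>FT_sq_le\<close> carries this convergence over to the transforms.\<close>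

theorem plancherel:
  fixes h :: "'a::euclidean_space \<Rightarrow> complex"
  assumes h: "integrable lborel h" and h2: "sqint lborel h"
  shows "nrm2 lborel (FT h) = sqrt ((2 * pi) ^ DIM('a)) * nrm2 lborel h"
proof -
  have [measurable]: "h \<in> borel_measurable borel"
    using h by (auto dest: borel_measurable_integrable)
  define c where "c = sqrt ((2 * pi) ^ DIM('a))"
  define g where "g n x = (if cmod (h x) \<le> real n then h x else 0)" for n x
  have gm[measurable]: "g n \<in> borel_measurable borel" for n unfolding g_def by measurable
  have gi: "integrable lborel (g n)" for n
    by (rule Bochner_Integration.integrable_bound[OF h]) (auto simp: g_def)
  have g2: "sqint lborel (g n)" for n
    unfolding sqint_def
    by (auto intro!: Bochner_Integration.integrable_bound[OF sqint_integrable[OF h2]] simp: g_def)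
  have eq: "nrm2 lborel (FT (g n)) = c * nrm2 lborel (g n)" for n
  proof -
    have "(nrm2 lborel (FT (g n)))\<^sup>2 = (c * nrm2 lborel (g n))\<^sup>2"
      using FT_sq_eq_bounded[OF gi, of n "real n"] by (simp add: g_def c_def power_mult_distrib)
    then show ?thesis by (simp add: c_def power2_eq_iff_nonneg)
  qed
  have le: "nrm2 lborel (FT f) \<le> c * nrm2 lborel f" if "integrable lborel f" "sqint lborel f" for f :: "'a \<Rightarrow> complex"
  proof (rule power2_le_imp_le)
    show "(nrm2 lborel (FT f))\<^sup>2 \<le> (c * nrm2 lborel f)\<^sup>2"
      using FT_sq_le(2)[OF that] by (simp add: c_def power_mult_distrib)
  qed (simp add: c_def)
  have d0: "(\<lambda>n. nrm2 lborel (\<lambda>x. h x - g n x)) \<longlonglongrightarrow> 0"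
  proof -
    have "(\<lambda>n. \<integral>x. (cmod (h x - g n x))\<^sup>2 \<partial>lborel) \<longlonglongrightarrow> (\<integral>(x::'a). 0 \<partial>lborel)"
    proof (rule integral_dominated_convergence[where w="\<lambda>x. (cmod (h x))\<^sup>2"])
      show "AE x in lborel. (\<lambda>n. (cmod (h x - g n x))\<^sup>2) \<longlonglongrightarrow> 0"
      proof (intro AE_I2 tendsto_eventually)
        fix x
        obtain N where "cmod (h x) \<le> real N" using real_arch_simple by blast
        then show "\<forall>\<^sub>F n in sequentially. (cmod (h x - g n x))\<^sup>2 = 0"
          by (intro eventually_sequentiallyI[of N]) (auto simp: g_def)
      qed
    qed (use sqint_integrable[OF h2] in \<open>auto simp: g_def\<close>)
    then have "(\<lambda>n. sqrt (\<integral>x. (cmod (h x - g n x))\<^sup>2 \<partial>lborel)) \<longlonglongrightarrow> sqrt 0"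
      by (intro tendsto_real_sqrt) simp
    then show ?thesis by (simp add: nrm2_def)
  qed
  have 1: "(\<lambda>n. nrm2 lborel (g n)) \<longlonglongrightarrow> nrm2 lborel h"
  proof (rule LIM_zero_cancel, rule Lim_null_comparison[OF _ d0])
    show "\<forall>\<^sub>F n in sequentially. norm (nrm2 lborel (g n) - nrm2 lborel h) \<le> nrm2 lborel (\<lambda>x. h x - g n x)"
      using nrm2_diff_abs[OF h2 g2] by (simp add: abs_minus_commute)
  qed
  have 2: "(\<lambda>n. nrm2 lborel (FT (g n))) \<longlonglongrightarrow> nrm2 lborel (FT h)"
  proof (rule LIM_zero_cancel, rule Lim_null_comparison)
    show "(\<lambda>n. c * nrm2 lborel (\<lambda>x. h x - g n x)) \<longlonglongrightarrow> 0"
      using tendsto_mult_right_zero[OF d0] .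
    show "\<forall>\<^sub>F n in sequentially. norm (nrm2 lborel (FT (g n)) - nrm2 lborel (FT h)) \<le> c * nrm2 lborel (\<lambda>x. h x - g n x)"
    proof (intro always_eventually allI)
      fix n
      have "\<bar>nrm2 lborel (FT h) - nrm2 lborel (FT (g n))\<bar> \<le> nrm2 lborel (\<lambda>\<xi>. FT h \<xi> - FT (g n) \<xi>)"
        by (intro nrm2_diff_abs FT_sq_le(1) h h2 gi g2)
      also have "\<dots> = nrm2 lborel (FT (\<lambda>x. h x - g n x))"
        by (intro arg_cong[where f="nrm2 lborel"] ext) (simp add: FT_diff[OF h gi])
      also have "\<dots> \<le> c * nrm2 lborel (\<lambda>x. h x - g n x)"
        by (rule le[OF Bochner_Integration.integrable_diff[OF h gi] sqint_diff[OF h2 g2]])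
      finally show "norm (nrm2 lborel (FT (g n)) - nrm2 lborel (FT h)) \<le> c * nrm2 lborel (\<lambda>x. h x - g n x)"
        by (simp add: abs_minus_commute)
    qed
  qed
  have "(\<lambda>n. nrm2 lborel (FT (g n))) \<longlonglongrightarrow> c * nrm2 lborel h"
    unfolding eq by (intro tendsto_intros 1)
  then show ?thesis using 2 LIMSEQ_unique unfolding c_def by blast
qed

section \<open>The Fourier-Plancherel transform of square-integrable functions\<close>

definition trunc :: "nat \<Rightarrow> ('a::euclidean_space \<Rightarrow> complex) \<Rightarrow> 'a \<Rightarrow> complex" where
  "trunc n f x = indicator (cball 0 (real n)) x * f x"

text \<open>\<open>has_L2_fourier\<close> for Borel functions, with the convergence expressed by
  \<open>nrm2\<close>; \<open>has_L2_fourier_pair\<close> passes from one to the other.\<close>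

definition fourier_pair :: "('a::euclidean_space \<Rightarrow> complex) \<Rightarrow> ('a \<Rightarrow> complex) \<Rightarrow> bool" where
  "fourier_pair g G \<longleftrightarrow> sqint lborel g \<and> sqint lborel G \<and>
     (\<lambda>n. nrm2 lborel (\<lambda>\<xi>. G \<xi> - FT (trunc n g) \<xi>)) \<longlonglongrightarrow> 0"

definition IFT :: "('a::euclidean_space \<Rightarrow> complex) \<Rightarrow> 'a \<Rightarrow> complex" where
  "IFT H x = complex_of_real (1 / (2 * pi) ^ DIM('a)) * FT H (- x)"

abbreviation fourier_const :: "'a::euclidean_space itself \<Rightarrow> real" where
  "fourier_const _ \<equiv> sqrt ((2 * pi) ^ DIM('a))"

lemma trunc_measurable [measurable]:
  assumes [measurable]: "f \<in> borel_measurable borel"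
  shows "trunc n f \<in> borel_measurable borel"
proof -
  have [measurable]: "cball (0::'a) (real n) \<in> sets borel" by simp
  show ?thesis unfolding trunc_def[abs_def] by measurable
qed

lemma cmod_trunc_le: "cmod (trunc n f x) \<le> cmod (f x)"
  by (auto simp: trunc_def split: split_indicator)

lemma trunc_sqint: 
  fixes g :: "'a::euclidean_space \<Rightarrow> complex"
  assumes g: "sqint lborel g"
  shows "sqint lborel (trunc n g)" "integrable lborel (trunc n g)"
proof -
  have [measurable]: "g \<in> borel_measurable borel" using g by (simp add: sqint_def)
  show 1: "sqint lborel (trunc n g)"
    unfolding sqint_def
    by (auto intro!: Bochner_Integration.integrable_bound[OF sqint_integrable[OF g]] power_mono cmod_trunc_le)
  have "sqint lborel (\<lambda>x::'a. indicator (cball 0 (real n)) x :: complex)"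
  proof -
    have "(\<lambda>x::'a. (cmod (indicator (cball 0 (real n)) x))\<^sup>2) = indicator (cball 0 (real n))"
      by (auto simp: fun_eq_iff split: split_indicator)
    moreover have [measurable]: "cball (0::'a) (real n) \<in> sets borel" by simp
    moreover have "integrable lborel (indicator (cball (0::'a) (real n)) :: 'a \<Rightarrow> real)"
      using emeasure_lborel_cball_finite[of "0::'a" "real n"] by (intro integrable_real_indicator) auto
    ultimately show ?thesis unfolding sqint_def by simp
  qed
  from sqint_mult_integrable[OF this g] show "integrable lborel (trunc n g)"
    unfolding trunc_def[abs_def] .
qed

lemma trunc_tendsto:
  fixes g :: "'a::euclidean_space \<Rightarrow> complex"
  assumes g: "sqint lborel g"
  shows "(\<lambda>n. nrm2 lborel (\<lambda>x. trunc n g x - g x)) \<longlonglongrightarrow> 0"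
proof -
  have [measurable]: "g \<in> borel_measurable borel" "\<And>n. trunc n g \<in> borel_measurable borel"
    using g trunc_sqint[OF g] by (auto simp add: sqint_def)
  have "(\<lambda>n. \<integral>x. (cmod (trunc n g x - g x))\<^sup>2 \<partial>lborel) \<longlonglongrightarrow> (\<integral>(x::'a). 0 \<partial>lborel)"
  proof (rule integral_dominated_convergence[where w="\<lambda>x. (cmod (g x))\<^sup>2"])
    show "AE x in lborel. (\<lambda>n. (cmod (trunc n g x - g x))\<^sup>2) \<longlonglongrightarrow> 0"
    proof (intro AE_I2 tendsto_eventually)
      fix x :: 'a
      obtain N where "norm x \<le> real N" using real_arch_simple by blast
      then show "\<forall>\<^sub>F n in sequentially. (cmod (trunc n g x - g x))\<^sup>2 = 0"
        by (intro eventually_sequentiallyI[of N]) (auto simp: trunc_def)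
    qed
    show "AE x in lborel. norm ((cmod (trunc n g x - g x))\<^sup>2) \<le> (cmod (g x))\<^sup>2" for n
      by (intro AE_I2) (auto simp: trunc_def split: split_indicator)
  qed (use sqint_integrable[OF g] in simp_all)
  then have "(\<lambda>n. sqrt (\<integral>x. (cmod (trunc n g x - g x))\<^sup>2 \<partial>lborel)) \<longlonglongrightarrow> sqrt 0"
    by (intro tendsto_real_sqrt) simp
  then show ?thesis by (simp add: nrm2_def)
qed

lemma nrm2_tendsto:
  assumes "\<And>n. sqint M (f n)" "sqint M g" "(\<lambda>n. nrm2 M (\<lambda>x. f n x - g x)) \<longlonglongrightarrow> 0"
  shows "(\<lambda>n. nrm2 M (f n)) \<longlonglongrightarrow> nrm2 M g"
  by (rule LIM_zero_cancel, rule Lim_null_comparison[OF _ assms(3)])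
     (use nrm2_diff_abs[OF assms(1,2)] in auto)

lemma inner_tendsto:
  assumes f: "\<And>n. sqint M (f n)" and g: "sqint M g" and k: "sqint M k"
    and l: "(\<lambda>n. nrm2 M (\<lambda>x. f n x - g x)) \<longlonglongrightarrow> 0"
  shows "(\<lambda>n. \<integral>x. f n x * k x \<partial>M) \<longlonglongrightarrow> (\<integral>x. g x * k x \<partial>M)"
proof (rule LIM_zero_cancel, rule Lim_null_comparison)
  show "(\<lambda>n. nrm2 M (\<lambda>x. f n x - g x) * nrm2 M k) \<longlonglongrightarrow> 0"
    using tendsto_mult_left_zero[OF l] .
  show "\<forall>\<^sub>F n in sequentially. norm ((\<integral>x. f n x * k x \<partial>M) - (\<integral>x. g x * k x \<partial>M)) \<le> nrm2 M (\<lambda>x. f n x - g x) * nrm2 M k"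
  proof (intro always_eventually allI)
    fix n
    have "(\<integral>x. f n x * k x \<partial>M) - (\<integral>x. g x * k x \<partial>M) = (\<integral>x. f n x * k x - g x * k x \<partial>M)"
      by (rule Bochner_Integration.integral_diff[symmetric]) (intro sqint_mult_integrable f g k)+
    also have "\<dots> = (\<integral>x. (f n x - g x) * k x \<partial>M)" by (simp add: left_diff_distrib)
    finally show "norm ((\<integral>x. f n x * k x \<partial>M) - (\<integral>x. g x * k x \<partial>M)) \<le> nrm2 M (\<lambda>x. f n x - g x) * nrm2 M k"
      using cauchy_schwarz[OF sqint_diff[OF f[of n] g] k] by simp
  qed
qed

lemma fourier_pair_norm:
  fixes g :: "'a::euclidean_space \<Rightarrow> complex"
  assumes "fourier_pair g G"
  shows "nrm2 lborel G = fourier_const TYPE('a) * nrm2 lborel g"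
proof -
  have g: "sqint lborel g" and G: "sqint lborel G"
    and l: "(\<lambda>n. nrm2 lborel (\<lambda>\<xi>. G \<xi> - FT (trunc n g) \<xi>)) \<longlonglongrightarrow> 0"
    using assms by (auto simp: fourier_pair_def)
  note t = trunc_sqint[OF g]
  have "(\<lambda>n. nrm2 lborel (FT (trunc n g))) \<longlonglongrightarrow> nrm2 lborel G"
    by (rule nrm2_tendsto[OF FT_sq_le(1)[OF t(2,1)] G]) (use l in \<open>simp add: nrm2_minus_commute\<close>)
  moreover have "(\<lambda>n. nrm2 lborel (FT (trunc n g))) \<longlonglongrightarrow> fourier_const TYPE('a) * nrm2 lborel g"
    unfolding plancherel[OF t(2,1)]
    by (intro tendsto_mult tendsto_const nrm2_tendsto t g trunc_tendsto)
  ultimately show ?thesis by (rule LIMSEQ_unique)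
qed

lemma
  fixes H :: "'a::euclidean_space \<Rightarrow> complex"
  assumes H: "integrable lborel H" and H2: "sqint lborel H"
  shows IFT_sqint: "sqint lborel (IFT H)"
    and IFT_norm: "nrm2 lborel (IFT H) = nrm2 lborel H / fourier_const TYPE('a)"
proof -
  have [measurable]: "FT H \<in> borel_measurable borel"
    using H by (intro FT_measurable) (auto dest: borel_measurable_integrable)
  have e: "(\<integral>\<^sup>+x. ennreal ((cmod (FT H (- x)))\<^sup>2) \<partial>lborel) = (\<integral>\<^sup>+x. ennreal ((cmod (FT H x))\<^sup>2) \<partial>lborel)"
    using nn_integral_affine[of "\<lambda>x. ennreal ((cmod (FT H x))\<^sup>2)" "-1" 0] by simp
  have s: "sqint lborel (\<lambda>x. FT H (- x))"
    unfolding sqint_iff_nn e using FT_sq_le(1)[OF H H2] by (simp add: sqint_iff_nn)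
  have "ennreal ((nrm2 lborel (\<lambda>x. FT H (- x)))\<^sup>2) = ennreal ((nrm2 lborel (FT H))\<^sup>2)"
    using nn_integral_sqint[OF s] nn_integral_sqint[OF FT_sq_le(1)[OF H H2]] e by simp
  then have n: "nrm2 lborel (\<lambda>x. FT H (- x)) = nrm2 lborel (FT H)"
    by (simp add: power2_eq_iff_nonneg)
  show "sqint lborel (IFT H)" unfolding IFT_def[abs_def] by (rule sqint_cmult[OF s])
  define c where "c = fourier_const TYPE('a)"
  have c: "c > 0" "1 / (2 * pi) ^ DIM('a) = 1 / c\<^sup>2" by (simp_all add: c_def)
  have "nrm2 lborel (IFT H) = cmod (complex_of_real (1 / c\<^sup>2)) * (c * nrm2 lborel H)"
    unfolding IFT_def[abs_def] nrm2_cmult n plancherel[OF H H2] c(2) c_def[symmetric] ..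
  also have "\<dots> = nrm2 lborel H / c"
    unfolding norm_of_real using c(1) by (simp add: power2_eq_square)
  finally show "nrm2 lborel (IFT H) = nrm2 lborel H / fourier_const TYPE('a)" unfolding c_def .
qed

text \<open>Fubini for the kernel \<open>cis (- (x \<bullet> \<xi>))\<close>: up to the factor
  \<open>(2 * pi) ^ DIM('a)\<close>, \<open>IFT\<close> is the adjoint of \<open>FT\<close>.\<close>

lemma IFT_duality:
  fixes h H :: "'a::euclidean_space \<Rightarrow> complex"
  assumes h: "integrable lborel h" and H: "integrable lborel H"
  shows "(\<integral>x. h x * cnj (IFT H x) \<partial>lborel) = complex_of_real (1 / (2 * pi) ^ DIM('a)) * (\<integral>\<xi>. FT h \<xi> * cnj (H \<xi>) \<partial>lborel)"
proof -
  define k where "k = complex_of_real (1 / (2 * pi) ^ DIM('a))"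
  have kc: "cnj k = k" by (simp add: k_def)
  have [measurable]: "h \<in> borel_measurable borel" "H \<in> borel_measurable borel"
    using h H by (auto dest: borel_measurable_integrable)
  have Hc: "integrable lborel (\<lambda>x. cnj (H x))" by (rule integrable_cnj[OF H])
  have int: "integrable (lborel \<Otimes>\<^sub>M lborel) (\<lambda>(x, \<xi>). cis (- (x \<bullet> \<xi>)) * (h x * cnj (H \<xi>)))"
  proof -
    have "integrable (lborel \<Otimes>\<^sub>M lborel) (\<lambda>p. cis (- (fst p \<bullet> snd p)) * (case p of (x, \<xi>) \<Rightarrow> h x * cnj (H \<xi>)))"
      by (intro cis_mult_integrable integrable_prod_pair h Hc) measurable
    then show ?thesis by (simp add: case_prod_beta')
  qed
  have 1: "cnj (IFT H x) = k * (\<integral>\<xi>. cis (- (x \<bullet> \<xi>)) * cnj (H \<xi>) \<partial>lborel)" for x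
  proof -
    have "cnj (IFT H x) = k * cnj (FT H (- x))" by (simp add: IFT_def k_def)
    also have "cnj (FT H (- x)) = (\<integral>\<xi>. cnj (cis (- (\<xi> \<bullet> - x)) * H \<xi>) \<partial>lborel)"
      unfolding FT_def by (rule Bochner_Integration.integral_cnj[symmetric])
    also have "\<dots> = (\<integral>\<xi>. cis (- (x \<bullet> \<xi>)) * cnj (H \<xi>) \<partial>lborel)"
      by (simp add: cis_cnj inner_commute)
    finally show ?thesis .
  qed
  have "(\<integral>x. h x * cnj (IFT H x) \<partial>lborel) = (\<integral>x. k * (\<integral>\<xi>. cis (- (x \<bullet> \<xi>)) * (h x * cnj (H \<xi>)) \<partial>lborel) \<partial>lborel)"
  proof (rule Bochner_Integration.integral_cong[OF refl])
    fix x
    have "h x * cnj (IFT H x) = k * (h x * (\<integral>\<xi>. cis (- (x \<bullet> \<xi>)) * cnj (H \<xi>) \<partial>lborel))"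
      unfolding 1 by (simp add: mult_ac)
    also have "h x * (\<integral>\<xi>. cis (- (x \<bullet> \<xi>)) * cnj (H \<xi>) \<partial>lborel) = (\<integral>\<xi>. h x * (cis (- (x \<bullet> \<xi>)) * cnj (H \<xi>)) \<partial>lborel)"
      by (rule integral_mult_right_zero[symmetric])
    finally show "h x * cnj (IFT H x) = k * (\<integral>\<xi>. cis (- (x \<bullet> \<xi>)) * (h x * cnj (H \<xi>)) \<partial>lborel)"
      by (simp add: mult.left_commute)
  qed
  also have "\<dots> = k * (\<integral>x. (\<integral>\<xi>. cis (- (x \<bullet> \<xi>)) * (h x * cnj (H \<xi>)) \<partial>lborel) \<partial>lborel)"
    by (rule integral_mult_right_zero)
  also have "(\<integral>x. (\<integral>\<xi>. cis (- (x \<bullet> \<xi>)) * (h x * cnj (H \<xi>)) \<partial>lborel) \<partial>lborel)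
     = (\<integral>\<xi>. (\<integral>x. cis (- (x \<bullet> \<xi>)) * (h x * cnj (H \<xi>)) \<partial>lborel) \<partial>lborel)"
    by (rule lborel_pair.Fubini_integral[OF int, symmetric])
  also have "\<dots> = (\<integral>\<xi>. FT h \<xi> * cnj (H \<xi>) \<partial>lborel)"
  proof (rule Bochner_Integration.integral_cong[OF refl])
    fix \<xi>
    show "(\<integral>x. cis (- (x \<bullet> \<xi>)) * (h x * cnj (H \<xi>)) \<partial>lborel) = FT h \<xi> * cnj (H \<xi>)"
      unfolding FT_def mult.assoc[symmetric] by (rule integral_mult_left_zero)
  qed
  finally show ?thesis unfolding k_def .
qed

text \<open>When both squared distances are expanded, the norms match by Plancherel and the mixed
  terms by \<open>IFT_duality\<close> in the limit of truncations. Distances are thus compared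
  without passing through Fourier inversion.\<close>

lemma fourier_pair_dist:
  fixes g :: "'a::euclidean_space \<Rightarrow> complex"
  assumes gG: "fourier_pair g G" and H: "integrable lborel H" and H2: "sqint lborel H"
  shows "nrm2 lborel (\<lambda>x. g x - IFT H x) = nrm2 lborel (\<lambda>\<xi>. G \<xi> - H \<xi>) / fourier_const TYPE('a)"
proof -
  have g: "sqint lborel g" and G: "sqint lborel G"
    and l: "(\<lambda>n. nrm2 lborel (\<lambda>\<xi>. G \<xi> - FT (trunc n g) \<xi>)) \<longlonglongrightarrow> 0"
    using gG by (auto simp: fourier_pair_def)
  note t = trunc_sqint[OF g]
  define k where "k = 1 / (2 * pi) ^ DIM('a)"
  define c where "c = fourier_const TYPE('a)"
  have fck: "c > 0" "c\<^sup>2 * k = 1" by (simp_all add: k_def c_def)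
  have kc: "k = 1 / c\<^sup>2" using fck by (simp add: field_simps)
  have "(\<lambda>n. \<integral>x. trunc n g x * cnj (IFT H x) \<partial>lborel) \<longlonglongrightarrow> (\<integral>x. g x * cnj (IFT H x) \<partial>lborel)"
    by (intro inner_tendsto t g trunc_tendsto sqint_cnj IFT_sqint H H2)
  moreover have "(\<lambda>n. \<integral>x. trunc n g x * cnj (IFT H x) \<partial>lborel) \<longlonglongrightarrow> complex_of_real k * (\<integral>\<xi>. G \<xi> * cnj (H \<xi>) \<partial>lborel)"
    unfolding IFT_duality[OF t(2) H] k_def
    by (intro tendsto_mult tendsto_const inner_tendsto FT_sq_le(1) t G sqint_cnj H2)
       (use l in \<open>simp add: nrm2_minus_commute\<close>)
  ultimately have inner: "(\<integral>x. g x * cnj (IFT H x) \<partial>lborel) = complex_of_real k * (\<integral>\<xi>. G \<xi> * cnj (H \<xi>) \<partial>lborel)"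
    by (rule LIMSEQ_unique)
  have "nrm2 lborel G = c * nrm2 lborel g" unfolding c_def by (rule fourier_pair_norm[OF gG])
  then have gn: "(nrm2 lborel g)\<^sup>2 = k * (nrm2 lborel G)\<^sup>2"
    using fck(1) unfolding kc by (simp add: power_mult_distrib)
  have "nrm2 lborel (IFT H) = nrm2 lborel H / c" unfolding c_def by (rule IFT_norm[OF H H2])
  then have Hn: "(nrm2 lborel (IFT H))\<^sup>2 = k * (nrm2 lborel H)\<^sup>2"
    unfolding kc by (simp add: power_divide)
  have "(nrm2 lborel (\<lambda>x. g x - IFT H x))\<^sup>2 = k * (nrm2 lborel (\<lambda>\<xi>. G \<xi> - H \<xi>))\<^sup>2"
  proof -
    have "Re (complex_of_real k * z) = k * Re z" for z by simp
    then show ?thesis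
      unfolding nrm2_diff_sq[OF g IFT_sqint[OF H H2]] nrm2_diff_sq[OF G H2] gn Hn inner
      by (simp only: right_diff_distrib distrib_left mult.left_commute[of k 2])
  qed
  also have "\<dots> = (nrm2 lborel (\<lambda>\<xi>. G \<xi> - H \<xi>) / c)\<^sup>2"
    unfolding kc by (simp add: power_divide)
  finally have "nrm2 lborel (\<lambda>x. g x - IFT H x) = nrm2 lborel (\<lambda>\<xi>. G \<xi> - H \<xi>) / c"
    using fck(1) by (subst (asm) power2_eq_iff_nonneg) auto
  then show ?thesis unfolding c_def .
qed

section \<open>The defect of a profile\<close>

definition split_prod :: "(real \<Rightarrow> complex) \<Rightarrow> real \<Rightarrow> real \<Rightarrow> complex" where
  "split_prod \<phi> S r = \<phi> r * \<phi> (S - r)"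

text \<open>The double integral vanishes iff \<open>\<phi> r * \<phi> (S - r)\<close> does not depend on \<open>r\<close>; for all \<open>S\<close> this
  characterises exponentials, that is, Gaussians in \<open>\<xi>\<close> when \<open>r\<close> stands for \<open>\<bar>\<xi>\<bar>\<^sup>2\<close>.\<close>

definition slice_defect :: "(real \<Rightarrow> complex) \<Rightarrow> real \<Rightarrow> ennreal" where
  "slice_defect \<phi> S = (\<integral>\<^sup>+r. \<integral>\<^sup>+r'. ennreal ((cmod (split_prod \<phi> S r - split_prod \<phi> S r'))\<^sup>2) * (indicator {0<..<S} r * indicator {0<..<S} r') \<partial>lborel \<partial>lborel)"

text \<open>The weight \<open>1 / S\<close> turns one of the two inner integrals into an average
  over the slice, and it is the weight with which the variances over the circles dominate the slice
  integrals (\<open>arc_variance_slice\<close>).\<close>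

definition defect :: "(real \<Rightarrow> complex) \<Rightarrow> ennreal" where
  "defect \<phi> = (\<integral>\<^sup>+S. ennreal (1 / S) * slice_defect \<phi> S * indicator {0<..} S \<partial>lborel)"

lemma split_prod_measurable [measurable]:
  assumes [measurable]: "\<phi> \<in> borel_measurable borel" "f \<in> borel_measurable M" "g \<in> borel_measurable M"
  shows "(\<lambda>p. split_prod \<phi> (f p) (g p)) \<in> borel_measurable M"
  unfolding split_prod_def by measurable

lemma indicator_lessThan_measurable [measurable]:
  assumes [measurable]: "f \<in> borel_measurable M" "g \<in> borel_measurable M"
  shows "(\<lambda>p. indicator {0<..<f p} (g p :: real) :: ennreal) \<in> borel_measurable M"
proof -
  have "(\<lambda>p. indicator {0<..<f p} (g p :: real) :: ennreal) = (\<lambda>p. if 0 < g p \<and> g p < f p then 1 else 0)"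
    by (auto simp: fun_eq_iff)
  then show ?thesis by simp
qed

lemma indicator_greaterThan_measurable [measurable]:
  assumes [measurable]: "f \<in> borel_measurable M" "g \<in> borel_measurable M"
  shows "(\<lambda>p. indicator {f p<..} (g p :: real) :: ennreal) \<in> borel_measurable M"
proof -
  have "(\<lambda>p. indicator {f p<..} (g p :: real) :: ennreal) = (\<lambda>p. if f p < g p then 1 else 0)"
    by (auto simp: fun_eq_iff)
  then show ?thesis by simp
qed

lemma slice_defect_measurable [measurable]:
  assumes [measurable]: "\<phi> \<in> borel_measurable borel"
  shows "slice_defect \<phi> \<in> borel_measurable borel"
  unfolding slice_defect_def[abs_def] by measurable

section \<open>Comparison of a profile with its translates\<close>

lemma sq_diff_le: "(cmod (a - b))\<^sup>2 \<le> 2 * (cmod (a - c))\<^sup>2 + 2 * (cmod (b - c))\<^sup>2"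
proof -
  have "cmod (a - b) \<le> cmod (a - c) + cmod (b - c)"
    by (metis dist_complex_def dist_triangle2)
  then have "(cmod (a - b))\<^sup>2 \<le> (cmod (a - c) + cmod (b - c))\<^sup>2" by (intro power_mono) auto
  also have "\<dots> \<le> 2 * (cmod (a - c))\<^sup>2 + 2 * (cmod (b - c))\<^sup>2"
    using sum_squares_bound[of "cmod (a - c)" "cmod (b - c)"] by (simp add: power2_sum)
  finally show ?thesis .
qed

lemma nn_integral_real_translate:
  fixes f :: "real \<Rightarrow> ennreal"
  assumes [measurable]: "f \<in> borel_measurable borel"
  shows "(\<integral>\<^sup>+x. f (x + t) \<partial>lborel) = (\<integral>\<^sup>+x. f x \<partial>lborel)"
  by (rule nn_integral_translate) measurable

text \<open>The bracket is the difference of \<open>split_prod \<phi> (r + s + h)\<close> at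
  \<open>r + h\<close> and at \<open>r\<close>. It vanishes when the shift by \<open>h\<close>
  multiplies \<open>\<phi>\<close> by a constant.\<close>

definition translation_defect :: "(real \<Rightarrow> complex) \<Rightarrow> real \<Rightarrow> ennreal" where
  "translation_defect \<phi> h = (\<integral>\<^sup>+r. \<integral>\<^sup>+s. ennreal ((cmod (\<phi> (r + h) * \<phi> s - \<phi> r * \<phi> (s + h)))\<^sup>2) * (indicator {0<..} r * indicator {0<..} s) \<partial>lborel \<partial>lborel)"

text \<open>With \<open>S = r + s + h\<close> both products lie on the same slice. Each is compared
  with a third point \<open>r'\<close>, and averaging over \<open>r'\<close> produces the weight
  \<open>1 / S\<close>. The constant 4 is 2 from squaring a sum, times 2 for the two comparisons,
  which have equal bounds after the translation by \<open>h\<close>.\<close>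

lemma translation_defect_le:
  assumes [measurable]: "\<phi> \<in> borel_measurable borel" and h: "h \<ge> 0"
  shows "translation_defect \<phi> h \<le> 4 * defect \<phi>"
proof -
  define q where "q S r r' = ennreal ((cmod (split_prod \<phi> S r - split_prod \<phi> S r'))\<^sup>2)" for S r r'
  have [measurable]: "(\<lambda>p. q (a p) (b p) (c p)) \<in> borel_measurable M"
    if [measurable]: "a \<in> borel_measurable M" "b \<in> borel_measurable M" "c \<in> borel_measurable M" for M :: "'b measure" and a b c
    unfolding q_def by measurable
  have "translation_defect \<phi> h = (\<integral>\<^sup>+r. \<integral>\<^sup>+S. q S (r + h) r * (indicator {0<..} r * indicator {r + h<..} S) \<partial>lborel \<partial>lborel)"
    unfolding translation_defect_def
  proof (rule nn_integral_cong)
    fix r :: real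
    have "(\<integral>\<^sup>+s. ennreal ((cmod (\<phi> (r + h) * \<phi> s - \<phi> r * \<phi> (s + h)))\<^sup>2) * (indicator {0<..} r * indicator {0<..} s) \<partial>lborel)
      = (\<integral>\<^sup>+s. q (s + (r + h)) (r + h) r * (indicator {0<..} r * indicator {r + h<..} (s + (r + h))) \<partial>lborel)"
      by (intro nn_integral_cong) (auto simp: q_def split_prod_def algebra_simps split: split_indicator)
    also have "\<dots> = (\<integral>\<^sup>+S. q S (r + h) r * (indicator {0<..} r * indicator {r + h<..} S) \<partial>lborel)"
      by (rule nn_integral_real_translate[where f="\<lambda>S. q S (r + h) r * (indicator {0<..} r * indicator {r + h<..} S)"]) measurable
    finally show "(\<integral>\<^sup>+s. ennreal ((cmod (\<phi> (r + h) * \<phi> s - \<phi> r * \<phi> (s + h)))\<^sup>2) * (indicator {0<..} r * indicator {0<..} s) \<partial>lborel)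
      = (\<integral>\<^sup>+S. q S (r + h) r * (indicator {0<..} r * indicator {r + h<..} S) \<partial>lborel)" .
  qed
  also have "\<dots> = (\<integral>\<^sup>+S. \<integral>\<^sup>+r. q S (r + h) r * (indicator {0<..} r * indicator {r + h<..} S) \<partial>lborel \<partial>lborel)"
    by (rule lborel_pair.Fubini'[symmetric]) measurable
  also have "\<dots> \<le> (\<integral>\<^sup>+S. 4 * (ennreal (1 / S) * slice_defect \<phi> S * indicator {0<..} S) \<partial>lborel)"
  proof (rule nn_integral_mono)
    fix S :: real
    show "(\<integral>\<^sup>+r. q S (r + h) r * (indicator {0<..} r * indicator {r + h<..} S) \<partial>lborel) \<le> 4 * (ennreal (1 / S) * slice_defect \<phi> S * indicator {0<..} S)"
    proof (cases "S > 0")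
      case False
      then have "(\<integral>\<^sup>+r. q S (r + h) r * (indicator {0<..} r * indicator {r + h<..} S) \<partial>lborel) = (\<integral>\<^sup>+(r::real). 0 \<partial>lborel)"
        using h by (intro nn_integral_cong) (auto split: split_indicator)
      then show ?thesis by simp
    next
      case True
      define I where "I r = (\<integral>\<^sup>+r'. q S r r' * indicator {0<..<S} r' \<partial>lborel)" for r
      have [measurable]: "I \<in> borel_measurable borel" unfolding I_def[abs_def] by measurable
      have ddI: "slice_defect \<phi> S = (\<integral>\<^sup>+r. I r * indicator {0<..<S} r \<partial>lborel)"
        unfolding slice_defect_def I_def q_def[symmetric]
      proof (rule nn_integral_cong)
        fix r
        show "(\<integral>\<^sup>+r'. q S r r' * (indicator {0<..<S} r * indicator {0<..<S} r') \<partial>lborel)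
          = (\<integral>\<^sup>+r'. q S r r' * indicator {0<..<S} r' \<partial>lborel) * indicator {0<..<S} r"
          by (cases "r \<in> {0<..<S}") simp_all
      qed
      have pt: "q S (r + h) r \<le> ennreal (1 / S) * (2 * I (r + h) + 2 * I r)" for r
      proof -
        have "ennreal S * q S (r + h) r = (\<integral>\<^sup>+r'. q S (r + h) r * indicator {0<..<S} r' \<partial>lborel)"
          using True by (subst nn_integral_cmult_indicator) (auto simp: mult.commute)
        also have "\<dots> \<le> (\<integral>\<^sup>+r'. 2 * (q S (r + h) r' * indicator {0<..<S} r') + 2 * (q S r r' * indicator {0<..<S} r') \<partial>lborel)"
        proof (rule nn_integral_mono)
          fix r'
          have "q S (r + h) r \<le> 2 * q S (r + h) r' + 2 * q S r r'"
            unfolding q_def using sq_diff_le[of "split_prod \<phi> S (r + h)" "split_prod \<phi> S r" "split_prod \<phi> S r'"]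
            by (subst ennreal_numeral[symmetric])+ (simp add: ennreal_mult[symmetric] ennreal_plus[symmetric] ennreal_leI del: ennreal_plus ennreal_numeral)
          then show "q S (r + h) r * indicator {0<..<S} r' \<le> 2 * (q S (r + h) r' * indicator {0<..<S} r') + 2 * (q S r r' * indicator {0<..<S} r')"
            by (auto split: split_indicator)
        qed
        also have "\<dots> = 2 * I (r + h) + 2 * I r"
          unfolding I_def by (subst nn_integral_add) (auto simp: nn_integral_cmult)
        finally have "ennreal (1 / S) * (ennreal S * q S (r + h) r) \<le> ennreal (1 / S) * (2 * I (r + h) + 2 * I r)"
          by (rule mult_left_mono) simp
        moreover have "ennreal (1 / S) * (ennreal S * q S (r + h) r) = q S (r + h) r"
          using True by (simp add: mult.assoc[symmetric] ennreal_mult[symmetric])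
        ultimately show ?thesis by simp
      qed
      have "(\<integral>\<^sup>+r. q S (r + h) r * (indicator {0<..} r * indicator {r + h<..} S) \<partial>lborel)
        \<le> (\<integral>\<^sup>+r. ennreal (1 / S) * 2 * (I (r + h) * indicator {0<..<S} (r + h)) + ennreal (1 / S) * 2 * (I r * indicator {0<..<S} r) \<partial>lborel)"
      proof (rule nn_integral_mono)
        fix r
        show "q S (r + h) r * (indicator {0<..} r * indicator {r + h<..} S)
          \<le> ennreal (1 / S) * 2 * (I (r + h) * indicator {0<..<S} (r + h)) + ennreal (1 / S) * 2 * (I r * indicator {0<..<S} r)"
          using pt[of r] h by (cases "0 < r \<and> r + h < S") (auto simp: distrib_left mult.assoc)
      qed
      also have "\<dots> = (\<integral>\<^sup>+r. ennreal (1 / S) * 2 * (I (r + h) * indicator {0<..<S} (r + h)) \<partial>lborel)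
        + (\<integral>\<^sup>+r. ennreal (1 / S) * 2 * (I r * indicator {0<..<S} r) \<partial>lborel)"
        by (rule nn_integral_add) measurable
      also have "(\<integral>\<^sup>+r. ennreal (1 / S) * 2 * (I (r + h) * indicator {0<..<S} (r + h)) \<partial>lborel)
        = (\<integral>\<^sup>+r. ennreal (1 / S) * 2 * (I r * indicator {0<..<S} r) \<partial>lborel)"
        by (rule nn_integral_real_translate[where f="\<lambda>r. ennreal (1 / S) * 2 * (I r * indicator {0<..<S} r)"]) measurable
      also have "(\<integral>\<^sup>+r. ennreal (1 / S) * 2 * (I r * indicator {0<..<S} r) \<partial>lborel) = ennreal (1 / S) * 2 * slice_defect \<phi> S"
        unfolding ddI by (rule nn_integral_cmult) measurable
      also have "ennreal (1 / S) * 2 * slice_defect \<phi> S + ennreal (1 / S) * 2 * slice_defect \<phi> S = 4 * (ennreal (1 / S) * slice_defect \<phi> S)"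
      proof -
        have "(4::ennreal) = 2 + 2" by simp
        then show ?thesis by (simp only: distrib_right distrib_left mult_ac)
      qed
      finally show ?thesis using True by simp
    qed
  qed
  also have "\<dots> = 4 * defect \<phi>"
    unfolding defect_def by (rule nn_integral_cmult) measurable
  finally show ?thesis .
qed

text \<open>A density on the whole line rather than a restricted space, so that its measurable
  functions are the Borel functions on \<open>real\<close>.\<close>

definition half_line :: "real measure" where
  "half_line = density lborel (\<lambda>x. ennreal (indicator {0<..} x))"

lemma sets_half_line [simp, measurable_cong]: "sets half_line = sets borel"
  by (simp add: half_line_def)

lemma space_half_line [simp]: "space half_line = UNIV"
  by (simp add: half_line_def)

lemma nn_integral_half_line:
  assumes [measurable]: "f \<in> borel_measurable borel"
  shows "(\<integral>\<^sup>+x. f x \<partial>half_line) = (\<integral>\<^sup>+x. f x * indicator {0<..} x \<partial>lborel)"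
  unfolding half_line_def by (subst nn_integral_density) (auto simp: ennreal_indicator mult.commute)

lemma integral_half_line:
  fixes f :: "real \<Rightarrow> 'b::{banach, second_countable_topology}"
  assumes [measurable]: "f \<in> borel_measurable borel"
  shows "(\<integral>x. f x \<partial>half_line) = (\<integral>x. indicator {0<..} x *\<^sub>R f x \<partial>lborel)"
  unfolding half_line_def by (rule integral_density) (auto split: split_indicator)

lemma integrable_half_line:
  fixes f :: "real \<Rightarrow> 'b::{banach, second_countable_topology}"
  assumes [measurable]: "f \<in> borel_measurable borel"
  shows "integrable half_line f \<longleftrightarrow> integrable lborel (\<lambda>x. indicator {0<..} x *\<^sub>R f x)"
  unfolding half_line_def by (rule integrable_density) (auto split: split_indicator)

lemma sigma_finite_half_line: "sigma_finite_measure half_line"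
  unfolding half_line_def
  by (subst sigma_finite_measure.sigma_finite_iff_density_finite[OF sigma_finite_lborel]) (auto intro: sigma_finite_lborel split: split_indicator)

interpretation half_line: sigma_finite_measure half_line
  by (rule sigma_finite_half_line)

interpretation half_line_pair: pair_sigma_finite half_line half_line ..

lemma translation_defect_half_line:
  assumes [measurable]: "\<phi> \<in> borel_measurable borel"
  shows "translation_defect \<phi> h = (\<integral>\<^sup>+r. \<integral>\<^sup>+s. ennreal ((cmod (\<phi> (r + h) * \<phi> s - \<phi> r * \<phi> (s + h)))\<^sup>2) \<partial>half_line \<partial>half_line)"
  unfolding translation_defect_def
proof (subst nn_integral_half_line, measurable, rule nn_integral_cong)
  fix r :: real
  show "(\<integral>\<^sup>+s. ennreal ((cmod (\<phi> (r + h) * \<phi> s - \<phi> r * \<phi> (s + h)))\<^sup>2) * (indicator {0<..} r * indicator {0<..} s) \<partial>lborel)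
    = (\<integral>\<^sup>+s. ennreal ((cmod (\<phi> (r + h) * \<phi> s - \<phi> r * \<phi> (s + h)))\<^sup>2) \<partial>half_line) * indicator {0<..} r"
    by (subst nn_integral_half_line, measurable, cases "r > 0") simp_all
qed

lemma exp_half_line:
  assumes y: "y > 0"
  shows "integrable half_line (\<lambda>h. exp (- y * h))" "(\<integral>h. exp (- y * h) \<partial>half_line) = 1 / y"
    and "(\<integral>\<^sup>+h. ennreal (exp (- y * h)) \<partial>half_line) = ennreal (1 / y)"
proof -
  have "(\<integral>\<^sup>+h. ennreal (exp (- y * h)) \<partial>half_line) = (\<integral>\<^sup>+h. ennreal (exp (- y * h)) * indicator {0..} h \<partial>lborel)"
    by (subst nn_integral_half_line, measurable, rule nn_integral_cong_AE, rule AE_I[of _ _ "{0}"])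
       (auto split: split_indicator)
  also have "\<dots> = ennreal (0 - (- exp (- y * 0) / y))"
  proof (rule nn_integral_FTC_atLeast)
    show "((\<lambda>x. - exp (- y * x) / y) \<longlongrightarrow> 0) at_top"
      using y by real_asymp
    show "DERIV (\<lambda>x. - exp (- y * x) / y) x :> exp (- y * x)" for x
      using y by (auto intro!: derivative_eq_intros)
  qed auto
  finally show *: "(\<integral>\<^sup>+h. ennreal (exp (- y * h)) \<partial>half_line) = ennreal (1 / y)" by simp
  show "integrable half_line (\<lambda>h. exp (- y * h))"
    using * by (intro integrableI_bounded) auto
  show "(\<integral>h. exp (- y * h) \<partial>half_line) = 1 / y"
    using * y by (subst integral_eq_nn_integral) auto
qed

section \<open>Profiles, their Laplace transform and their resolvent\<close>

lemma has_vector_derivative_cmod_sq: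
  assumes "(wr has_vector_derivative w') (at x within A)"
  shows "((\<lambda>t. (cmod (wr t))\<^sup>2) has_vector_derivative 2 * Re (cnj (wr x) * w')) (at x within A)"
proof -
  have "((\<lambda>t. wr t * cnj (wr t)) has_vector_derivative (wr x * cnj w' + w' * cnj (wr x))) (at x within A)"
    by (intro has_vector_derivative_mult assms has_vector_derivative_cnj)
  then have "((\<lambda>t. Re (wr t * cnj (wr t))) has_vector_derivative Re (wr x * cnj w' + w' * cnj (wr x))) (at x within A)"
    by (rule bounded_linear.has_vector_derivative[OF bounded_linear_Re])
  moreover have "Re (wr t * cnj (wr t)) = (cmod (wr t))\<^sup>2" for t
    by (metis Re_complex_of_real complex_norm_square of_real_power)
  moreover have "Re (wr x * cnj w' + w' * cnj (wr x)) = 2 * Re (cnj (wr x) * w')"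
    by (simp add: algebra_simps)
  ultimately show ?thesis by (simp only:)
qed

text \<open>The variable stands for the squared frequency. Continuity and bounded support make the
  Laplace transform exist for every \<open>z\<close> and let the fundamental theorem of calculus end
  at \<open>L\<close>; general data are reached through
  \<open>radial_profile_approximation\<close>.\<close>

locale profile =
  fixes \<phi> :: "real \<Rightarrow> complex" and L :: real
  assumes cont: "continuous_on UNIV \<phi>"
    and L: "L > 0"
    and supp: "\<And>r. r \<ge> L \<Longrightarrow> \<phi> r = 0"
begin

lemma phi_measurable [measurable]: "\<phi> \<in> borel_measurable borel"
  using cont by (rule borel_measurable_continuous_onI)

lemma half_line_Icc:
  fixes f :: "real \<Rightarrow> 'b::euclidean_space"
  assumes f: "continuous_on UNIV f" and R: "R \<ge> 0" and z: "\<And>r. r > R \<Longrightarrow> f r = 0"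
  shows "integrable half_line f" "(\<integral>x. f x \<partial>half_line) = (\<integral>x. indicator {0..R} x *\<^sub>R f x \<partial>lborel)"
    "(\<integral>x. f x \<partial>half_line) = integral {0..R} f"
proof -
  have [measurable]: "f \<in> borel_measurable borel"
    using f by (rule borel_measurable_continuous_onI)
  have int: "integrable lborel (\<lambda>x. indicator {0..R} x *\<^sub>R f x)"
    using borel_integrable_compact[of "{0..R}" f] f continuous_on_subset by (auto simp: indicator_def)
  have ae: "AE x in lborel. indicator {0<..} x *\<^sub>R f x = indicator {0..R} x *\<^sub>R f x"
    by (rule AE_I[of _ _ "{0}"]) (use z in \<open>auto simp: not_le split: split_indicator\<close>)
  show "integrable half_line f"
    unfolding integrable_half_line[OF \<open>f \<in> borel_measurable borel\<close>]
    using int integrable_cong_AE[OF _ _ ae] by simp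
  show 1: "(\<integral>x. f x \<partial>half_line) = (\<integral>x. indicator {0..R} x *\<^sub>R f x \<partial>lborel)"
    unfolding integral_half_line[OF \<open>f \<in> borel_measurable borel\<close>]
    by (rule integral_cong_AE[OF _ _ ae]) auto
  have "set_integrable lborel {0..R} f" using int by (simp add: set_integrable_def)
  from set_borel_integral_eq_integral(2)[OF this] show "(\<integral>x. f x \<partial>half_line) = integral {0..R} f"
    unfolding 1 set_lebesgue_integral_def .
qed

lemma sqint_phi: "sqint half_line \<phi>"
  unfolding sqint_def
proof
  have c: "continuous_on UNIV (\<lambda>x. (cmod (\<phi> x))\<^sup>2)" using cont by (intro continuous_intros)
  show "integrable half_line (\<lambda>x. (cmod (\<phi> x))\<^sup>2)"
    by (rule half_line_Icc(1)[OF c, of L]) (use L supp in auto)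
qed simp

definition laplace :: "complex \<Rightarrow> complex" where
  "laplace z = (\<integral>t. exp (- z * complex_of_real t) * \<phi> t \<partial>half_line)"

text \<open>The Laplace transform in \<open>h\<close> of the left translates of
  \<open>\<phi>\<close>, that is, \<open>\<phi>\<close> under the inverse of
  \<open>z - d/dr\<close>. For an exponential \<open>exp (- b * r)\<close> the same integral is the
  exponential divided by \<open>z + b\<close>, and the whole argument tests how far
  \<open>\<phi>\<close> is from such proportionality.\<close>

definition resolvent :: "complex \<Rightarrow> real \<Rightarrow> complex" where
  "resolvent z r = (\<integral>h. exp (- z * complex_of_real h) * \<phi> (r + h) \<partial>half_line)"

lemma resolvent_0: "resolvent z 0 = laplace z"
  by (simp add: resolvent_def laplace_def)

text \<open>The variation-of-constants form with initial value \<open>laplace z\<close>; it can be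
  differentiated directly by the fundamental theorem of calculus.\<close>

definition resolvent_ode :: "complex \<Rightarrow> real \<Rightarrow> complex" where
  "resolvent_ode z r = exp (z * complex_of_real r) * (laplace z - integral {0..r} (\<lambda>t. exp (- z * complex_of_real t) * \<phi> t))"

lemma resolvent_zero: "r \<ge> L \<Longrightarrow> resolvent z r = 0"
proof -
  assume r: "r \<ge> L"
  have "indicator {0<..} h *\<^sub>R (exp (- z * complex_of_real h) * \<phi> (r + h)) = 0" for h
    using r by (cases "h > 0") (auto simp: supp)
  then have e: "(\<lambda>h. indicator {0<..} h *\<^sub>R (exp (- z * complex_of_real h) * \<phi> (r + h))) = (\<lambda>h. 0)"
    by (rule ext)
  show ?thesis unfolding resolvent_def by (subst integral_half_line, measurable) (simp only: e Bochner_Integration.integral_zero)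
qed

text \<open>\<open>laplace z\<close> is the integral over the whole half-line, so subtracting the
  part over \<open>{0..r}\<close> leaves the tail, and the shift by \<open>r\<close> absorbs the
  factor \<open>exp (z * r)\<close>.\<close>

lemma resolvent_eq:
  assumes r: "r \<ge> 0"
  shows "resolvent z r = resolvent_ode z r"
proof -
  define f where "f t = exp (- z * complex_of_real t) * \<phi> t" for t
  have fourier_const: "continuous_on UNIV f" unfolding f_def using cont by (intro continuous_intros)
  have fL: "f t = 0" if "t > L" for t using supp[of t] that by (simp add: f_def)
  define R where "R = max r L"
  have R: "R \<ge> 0" "r \<le> R" "L \<le> R" using L by (auto simp: R_def)
  have "laplace z = integral {0..R} f"
    unfolding laplace_def f_def[symmetric] by (rule half_line_Icc(3)[OF fourier_const R(1)]) (use fL R in auto)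
  moreover have "integral {0..r} f + integral {r..R} f = integral {0..R} f"
    using r R fourier_const by (intro Henstock_Kurzweil_Integration.integral_combine integrable_continuous_interval continuous_on_subset[OF fourier_const]) auto
  ultimately have "resolvent_ode z r = exp (z * complex_of_real r) * integral {r..R} f"
    unfolding resolvent_ode_def f_def[symmetric] by (metis add_diff_cancel_left')
  also have "integral {r..R} f = integral {0..R - r} (\<lambda>h. f (r + h))"
  proof -
    have "((\<lambda>h. f (1 *\<^sub>R h + r)) has_integral (1 / \<bar>1\<bar> ^ DIM(real)) *\<^sub>R integral {r..R} f) ((\<lambda>x. (1 / 1) *\<^sub>R x + - ((1 / 1) *\<^sub>R r)) ` cbox r R)"
      by (rule has_integral_affinity) (use fourier_const in \<open>auto intro!: integrable_integral integrable_continuous_interval intro: continuous_on_subset\<close>)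
    moreover have "(\<lambda>x. (1 / 1) *\<^sub>R x + - ((1 / 1) *\<^sub>R r)) ` cbox r R = {0..R - r}"
      by (auto simp: image_iff intro!: bexI[of _ "_ + r"])
    ultimately show ?thesis by (simp add: integral_unique add.commute)
  qed
  also have "\<dots> = (\<integral>h. f (r + h) \<partial>half_line)"
    by (rule half_line_Icc(3)[symmetric]) (use R fL in \<open>auto intro!: continuous_intros continuous_on_compose2[OF fourier_const]\<close>)
  also have "exp (z * complex_of_real r) * (\<integral>h. f (r + h) \<partial>half_line) = (\<integral>h. exp (z * complex_of_real r) * f (r + h) \<partial>half_line)"
    by (rule integral_mult_right_zero[symmetric])
  also have "\<dots> = resolvent z r"
    unfolding resolvent_def f_def
  proof (intro Bochner_Integration.integral_cong refl)
    fix h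
    have "exp (z * complex_of_real r) * exp (- z * complex_of_real (r + h)) = exp (- z * complex_of_real h)"
      by (simp add: exp_add[symmetric] algebra_simps)
    then show "exp (z * complex_of_real r) * (exp (- z * complex_of_real (r + h)) * \<phi> (r + h)) = exp (- z * complex_of_real h) * \<phi> (r + h)"
      by (simp only: mult.assoc[symmetric])
  qed
  finally show ?thesis by simp
qed

lemma resolvent_ode_deriv:
  assumes r: "r \<in> {0..R}"
  shows "(resolvent_ode z has_vector_derivative z * resolvent_ode z r - \<phi> r) (at r within {0..R})"
proof -
  define f where "f t = exp (- z * complex_of_real t) * \<phi> t" for t
  have fourier_const: "continuous_on UNIV f" unfolding f_def using cont by (intro continuous_intros)
  have 1: "((\<lambda>u. integral {0..u} f) has_vector_derivative f r) (at r within {0..R})"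
    by (rule integral_has_vector_derivative[OF continuous_on_subset[OF fourier_const] r]) simp
  have 2: "((\<lambda>u. exp (z * complex_of_real u)) has_vector_derivative z * exp (z * complex_of_real r)) (at r within {0..R})"
    by (rule derivative_eq_intros refl has_vector_derivative_real_field | simp)+
  have "(resolvent_ode z has_vector_derivative exp (z * complex_of_real r) * (0 - f r) + z * exp (z * complex_of_real r) * (laplace z - integral {0..r} f)) (at r within {0..R})"
    unfolding resolvent_ode_def f_def[symmetric]
    by (intro has_vector_derivative_mult 2 has_vector_derivative_diff has_vector_derivative_const 1)
  moreover have "exp (z * complex_of_real r) * f r = \<phi> r"
    by (simp add: f_def exp_minus)
  ultimately show ?thesis
    unfolding resolvent_ode_def f_def[symmetric] by (simp add: algebra_simps)
qed

lemma resolvent_ode_continuous: "continuous_on {0..R} (resolvent_ode z)"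
  by (rule continuous_on_vector_derivative) (rule resolvent_ode_deriv)

text \<open>The resolvent solves \<open>w' = z * w - \<phi>\<close> on the half-line; it is frozen for \<open>r < 0\<close> to be continuous
  on the whole line.\<close>

definition resolvent_clamped :: "complex \<Rightarrow> real \<Rightarrow> complex" where
  "resolvent_clamped z r = resolvent_ode z (max r 0)"

lemma resolvent_clamped_continuous: "continuous_on UNIV (resolvent_clamped z)"
proof (rule continuous_at_imp_continuous_on, intro ballI)
  fix r :: real
  have "continuous_on {0..max r 0 + 1} (resolvent_ode z)" by (rule resolvent_ode_continuous)
  then have "continuous_on {..<max r 0 + 1} (resolvent_clamped z)"
    unfolding resolvent_clamped_def[abs_def] by (rule continuous_on_compose2) (auto intro!: continuous_intros)
  then show "isCont (resolvent_clamped z) r"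
    by (rule continuous_on_interior) (auto simp: interior_open)
qed

lemma resolvent_clamped_measurable [measurable]: "resolvent_clamped z \<in> borel_measurable borel"
  using resolvent_clamped_continuous by (rule borel_measurable_continuous_onI)

lemma resolvent_clamped_eq_ode: "r \<ge> 0 \<Longrightarrow> resolvent_clamped z r = resolvent_ode z r"
  by (simp add: resolvent_clamped_def)

lemma resolvent_clamped_eq: "r \<ge> 0 \<Longrightarrow> resolvent_clamped z r = resolvent z r"
  by (simp add: resolvent_clamped_def resolvent_eq)

lemma resolvent_clamped_zero: "r \<ge> L \<Longrightarrow> resolvent_clamped z r = 0"
  using L by (simp add: resolvent_clamped_eq resolvent_zero)

lemma resolvent_clamped_0: "resolvent_clamped z 0 = laplace z"
  by (simp add: resolvent_clamped_eq resolvent_0)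

lemma sqint_resolvent_clamped: "sqint half_line (resolvent_clamped z)"
  unfolding sqint_def
proof
  have c: "continuous_on UNIV (\<lambda>x. (cmod (resolvent_clamped z x))\<^sup>2)" using resolvent_clamped_continuous by (intro continuous_intros)
  show "integrable half_line (\<lambda>x. (cmod (resolvent_clamped z x))\<^sup>2)"
    by (rule half_line_Icc(1)[OF c, of L]) (use L resolvent_clamped_zero in auto)
qed simp

text \<open>For the resolvent \<open>w\<close>, the derivative of the squared modulus is
  \<open>2 * Re z * (cmod w)\<^sup>2 - 2 * Re (w * cnj \<phi>)\<close>. Its integral over
  \<open>{0..L}\<close> is minus the value at 0, because \<open>w\<close> vanishes at
  \<open>L\<close> and equals \<open>laplace z\<close> at 0.\<close>

lemma energy_identity:
  "(cmod (laplace z))\<^sup>2 = 2 * Re (\<integral>r. resolvent_clamped z r * cnj (\<phi> r) \<partial>half_line) - 2 * Re z * (nrm2 half_line (resolvent_clamped z))\<^sup>2"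
proof -
  have d: "((\<lambda>t. (cmod (resolvent_clamped z t))\<^sup>2) has_vector_derivative 2 * Re z * (cmod (resolvent_clamped z r))\<^sup>2 - 2 * Re (resolvent_clamped z r * cnj (\<phi> r))) (at r within {0..L})" if "r \<in> {0..L}" for r
  proof -
    have "(resolvent_clamped z has_vector_derivative z * resolvent_clamped z r - \<phi> r) (at r within {0..L})"
      using that resolvent_ode_deriv[OF that, of z]
      by (simp add: resolvent_clamped_eq_ode) (rule has_vector_derivative_transform[where f="resolvent_ode z"], auto simp: resolvent_clamped_eq_ode)
    from has_vector_derivative_cmod_sq[OF this]
    have "((\<lambda>t. (cmod (resolvent_clamped z t))\<^sup>2) has_vector_derivative 2 * Re (cnj (resolvent_clamped z r) * (z * resolvent_clamped z r - \<phi> r))) (at r within {0..L})" .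
    moreover have "2 * Re (cnj a * (z * a - b)) = 2 * Re z * (cmod a)\<^sup>2 - 2 * Re (a * cnj b)" for a b
      unfolding cmod_power2 by (simp add: algebra_simps power2_eq_square)
    ultimately show ?thesis by simp
  qed
  have c: "continuous_on UNIV (\<lambda>r. 2 * Re z * (cmod (resolvent_clamped z r))\<^sup>2 - 2 * Re (resolvent_clamped z r * cnj (\<phi> r)))"
    using resolvent_clamped_continuous cont by (intro continuous_intros)
  have i1: "integrable half_line (\<lambda>r. resolvent_clamped z r * cnj (\<phi> r))"
    by (intro sqint_mult_integrable sqint_resolvent_clamped sqint_cnj sqint_phi)
  have "(\<integral>r. 2 * Re z * (cmod (resolvent_clamped z r))\<^sup>2 - 2 * Re (resolvent_clamped z r * cnj (\<phi> r)) \<partial>half_line)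
     = (\<integral>r. indicator {0..L} r *\<^sub>R (2 * Re z * (cmod (resolvent_clamped z r))\<^sup>2 - 2 * Re (resolvent_clamped z r * cnj (\<phi> r))) \<partial>lborel)"
    by (rule half_line_Icc(2)[OF c]) (use L resolvent_clamped_zero in auto)
  also have "\<dots> = (cmod (resolvent_clamped z L))\<^sup>2 - (cmod (resolvent_clamped z 0))\<^sup>2"
    by (rule integral_FTC_Icc) (use L d c in \<open>auto intro: continuous_on_subset\<close>)
  also have "\<dots> = - (cmod (laplace z))\<^sup>2" by (simp add: resolvent_clamped_zero resolvent_clamped_0)
  also have "(\<integral>r. 2 * Re z * (cmod (resolvent_clamped z r))\<^sup>2 - 2 * Re (resolvent_clamped z r * cnj (\<phi> r)) \<partial>half_line)
    = 2 * Re z * (nrm2 half_line (resolvent_clamped z))\<^sup>2 - 2 * Re (\<integral>r. resolvent_clamped z r * cnj (\<phi> r) \<partial>half_line)"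
    unfolding nrm2_sq using i1 sqint_integrable[OF sqint_resolvent_clamped, of z] integrable_Re[OF i1] integral_Re[OF i1]
    by (simp del: times_complex.sel complex_cnj_cnj)
  finally show ?thesis by simp
qed

text \<open>The commutator is the Laplace transform in \<open>h\<close> of the bracket in
  \<open>translation_defect\<close>. Cauchy-Schwarz in \<open>h\<close> gives one factor
  \<open>1 / Re z\<close>; the integral of the exponential weight against the uniform bound
  \<open>translation_defect_le\<close> gives the other.\<close>

lemma resolvent_commutator:
  assumes y: "Re z > 0"
  shows "(\<integral>\<^sup>+r. \<integral>\<^sup>+s. ennreal ((cmod (resolvent_clamped z r * \<phi> s - \<phi> r * resolvent_clamped z s))\<^sup>2) \<partial>half_line \<partial>half_line) \<le> ennreal (4 / (Re z)\<^sup>2) * defect \<phi>"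
proof -
  define y where "y = Re z"
  have y0: "y > 0" using y by (simp add: y_def)
  define G where "G h r s = cmod (\<phi> (r + h) * \<phi> s - \<phi> r * \<phi> (s + h))" for h r s
  have Gm[measurable]: "(\<lambda>p. G (a p) (b p) (c p)) \<in> borel_measurable M"
    if [measurable]: "a \<in> borel_measurable M" "b \<in> borel_measurable M" "c \<in> borel_measurable M" for M :: "'b measure" and a b c
    unfolding G_def by measurable
  have ei: "integrable half_line (\<lambda>h. exp (- z * complex_of_real h) * \<phi> (r + h))" if "r \<ge> 0" for r
    by (rule half_line_Icc(1)[of _ L]) (use that L supp cont in \<open>auto intro!: continuous_intros continuous_on_compose2[OF cont]\<close>)
  have pt: "ennreal ((cmod (resolvent_clamped z r * \<phi> s - \<phi> r * resolvent_clamped z s))\<^sup>2) \<le> ennreal (1 / y) * (\<integral>\<^sup>+h. ennreal (exp (- y * h)) * ennreal ((G h r s)\<^sup>2) \<partial>half_line)"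
    if rs: "r > 0" "s > 0" for r s
  proof -
    have "resolvent_clamped z r * \<phi> s - \<phi> r * resolvent_clamped z s = (\<integral>h. exp (- z * complex_of_real h) * \<phi> (r + h) * \<phi> s - \<phi> r * (exp (- z * complex_of_real h) * \<phi> (s + h)) \<partial>half_line)"
      using rs ei[of r] ei[of s] by (simp add: resolvent_clamped_eq resolvent_def)
    also have "\<dots> = (\<integral>h. exp (- z * complex_of_real h) * (\<phi> (r + h) * \<phi> s - \<phi> r * \<phi> (s + h)) \<partial>half_line)"
      by (intro Bochner_Integration.integral_cong refl) (simp add: algebra_simps)
    finally have "ennreal (cmod (resolvent_clamped z r * \<phi> s - \<phi> r * resolvent_clamped z s)) \<le> (\<integral>\<^sup>+h. ennreal (cmod (exp (- z * complex_of_real h) * (\<phi> (r + h) * \<phi> s - \<phi> r * \<phi> (s + h)))) \<partial>half_line)"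
      using integral_norm_bound_ennreal_any by simp
    \<comment> \<open>Half of the decay goes to each factor, so that the square of the first one
      integrates to \<open>1 / y\<close>.\<close>
    also have "\<dots> = (\<integral>\<^sup>+h. ennreal (exp (- (y / 2) * h)) * ennreal (exp (- (y / 2) * h) * G h r s) \<partial>half_line)"
    proof (intro nn_integral_cong)
      fix h
      have "exp (- (y / 2) * h) * exp (- (y / 2) * h) = exp (- (y * h))"
        by (simp flip: exp_add)
      then show "ennreal (cmod (exp (- z * complex_of_real h) * (\<phi> (r + h) * \<phi> s - \<phi> r * \<phi> (s + h)))) = ennreal (exp (- (y / 2) * h)) * ennreal (exp (- (y / 2) * h) * G h r s)"
        by (simp add: G_def norm_mult y_def flip: ennreal_mult mult.assoc)
    qed
    finally have "(ennreal (cmod (resolvent_clamped z r * \<phi> s - \<phi> r * resolvent_clamped z s)))\<^sup>2 \<le> (\<integral>\<^sup>+h. ennreal (exp (- (y / 2) * h)) * ennreal (exp (- (y / 2) * h) * G h r s) \<partial>half_line)\<^sup>2"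
      by (rule power_mono) simp
    also have "\<dots> \<le> (\<integral>\<^sup>+h. (ennreal (exp (- (y / 2) * h)))\<^sup>2 \<partial>half_line) * (\<integral>\<^sup>+h. (ennreal (exp (- (y / 2) * h) * G h r s))\<^sup>2 \<partial>half_line)"
      by (rule Cauchy_Schwarz_nn_integral) measurable
    also have "(\<integral>\<^sup>+h. (ennreal (exp (- (y / 2) * h)))\<^sup>2 \<partial>half_line) = ennreal (1 / y)"
      using exp_half_line(3)[OF y0] by (simp add: ennreal_power exp_double[symmetric])
    also have "(\<integral>\<^sup>+h. (ennreal (exp (- (y / 2) * h) * G h r s))\<^sup>2 \<partial>half_line) = (\<integral>\<^sup>+h. ennreal (exp (- y * h)) * ennreal ((G h r s)\<^sup>2) \<partial>half_line)"
      by (intro nn_integral_cong) (simp add: G_def ennreal_power power_mult_distrib exp_double[symmetric] ennreal_mult)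
    finally show ?thesis by (simp add: ennreal_power)
  qed
  have "(\<integral>\<^sup>+r. \<integral>\<^sup>+s. ennreal ((cmod (resolvent_clamped z r * \<phi> s - \<phi> r * resolvent_clamped z s))\<^sup>2) \<partial>half_line \<partial>half_line)
    \<le> (\<integral>\<^sup>+r. \<integral>\<^sup>+s. ennreal (1 / y) * (\<integral>\<^sup>+h. ennreal (exp (- y * h)) * ennreal ((G h r s)\<^sup>2) \<partial>half_line) \<partial>half_line \<partial>half_line)"
  proof -
    have AEp: "AE r in half_line. r > 0"
      unfolding half_line_def by (subst AE_density) (auto split: split_indicator)
    show ?thesis
    proof (rule nn_integral_mono_AE, use AEp in eventually_elim)
      fix r :: real assume r: "0 < r"
      show "(\<integral>\<^sup>+s. ennreal ((cmod (resolvent_clamped z r * \<phi> s - \<phi> r * resolvent_clamped z s))\<^sup>2) \<partial>half_line)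
        \<le> (\<integral>\<^sup>+s. ennreal (1 / y) * (\<integral>\<^sup>+h. ennreal (exp (- y * h)) * ennreal ((G h r s)\<^sup>2) \<partial>half_line) \<partial>half_line)"
        by (rule nn_integral_mono_AE, use AEp in eventually_elim) (rule pt[OF r])
    qed
  qed
  also have "\<dots> = ennreal (1 / y) * (\<integral>\<^sup>+r. \<integral>\<^sup>+s. \<integral>\<^sup>+h. ennreal (exp (- y * h)) * ennreal ((G h r s)\<^sup>2) \<partial>half_line \<partial>half_line \<partial>half_line)"
    by (subst nn_integral_cmult[symmetric], measurable, rule nn_integral_cong, rule nn_integral_cmult, measurable)
  also have "(\<integral>\<^sup>+r. \<integral>\<^sup>+s. \<integral>\<^sup>+h. ennreal (exp (- y * h)) * ennreal ((G h r s)\<^sup>2) \<partial>half_line \<partial>half_line \<partial>half_line)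
    = (\<integral>\<^sup>+r. \<integral>\<^sup>+h. \<integral>\<^sup>+s. ennreal (exp (- y * h)) * ennreal ((G h r s)\<^sup>2) \<partial>half_line \<partial>half_line \<partial>half_line)"
    by (rule nn_integral_cong, rule half_line_pair.Fubini') measurable
  also have "\<dots> = (\<integral>\<^sup>+h. \<integral>\<^sup>+r. \<integral>\<^sup>+s. ennreal (exp (- y * h)) * ennreal ((G h r s)\<^sup>2) \<partial>half_line \<partial>half_line \<partial>half_line)"
    by (rule half_line_pair.Fubini') measurable
  also have "\<dots> = (\<integral>\<^sup>+h. ennreal (exp (- y * h)) * translation_defect \<phi> h \<partial>half_line)"
  proof (rule nn_integral_cong)
    fix h :: real
    show "(\<integral>\<^sup>+r. \<integral>\<^sup>+s. ennreal (exp (- y * h)) * ennreal ((G h r s)\<^sup>2) \<partial>half_line \<partial>half_line) = ennreal (exp (- y * h)) * translation_defect \<phi> h"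
      unfolding translation_defect_half_line[OF phi_measurable] G_def
      by (subst nn_integral_cmult[symmetric], measurable, rule nn_integral_cong, rule nn_integral_cmult, measurable)
  qed
  also have "\<dots> \<le> (\<integral>\<^sup>+h. ennreal (exp (- y * h)) * (4 * defect \<phi>) \<partial>half_line)"
  proof (rule nn_integral_mono_AE)
    have "AE h in half_line. h \<ge> 0"
      unfolding half_line_def by (subst AE_density) (auto split: split_indicator)
    then show "AE h in half_line. ennreal (exp (- y * h)) * translation_defect \<phi> h \<le> ennreal (exp (- y * h)) * (4 * defect \<phi>)"
      by eventually_elim (intro mult_left_mono translation_defect_le phi_measurable, auto)
  qed
  also have "\<dots> = ennreal (1 / y) * (4 * defect \<phi>)"
    by (subst nn_integral_multc) (use exp_half_line(3)[OF y0] in auto)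
  also have "ennreal (1 / y) * (ennreal (1 / y) * (4 * defect \<phi>)) = ennreal (4 / (Re z)\<^sup>2) * defect \<phi>"
  proof -
    have "ennreal (1 / y) * (ennreal (1 / y) * 4) = ennreal (4 / (Re z)\<^sup>2)"
      using y0 by (simp add: y_def[symmetric] ennreal_mult[symmetric] power2_eq_square flip: ennreal_numeral)
    then show ?thesis by (simp add: mult.assoc[symmetric])
  qed
  finally show ?thesis by (simp add: mult_left_mono)
qed

end

context profile
begin

lemma exp_sqint_half_line:
  assumes "Re b > 0"
  shows "sqint half_line (\<lambda>r. a * exp (- b * complex_of_real r))"
proof (rule sqint_cmult)
  have "(cmod (exp (- b * complex_of_real r)))\<^sup>2 = exp (- (2 * Re b) * r)" for r
    by (simp add: exp_double[symmetric])
  then show "sqint half_line (\<lambda>r. exp (- b * complex_of_real r))"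
    unfolding sqint_def using exp_half_line(1)[of "2 * Re b"] assms by simp
qed

text \<open>By the commutator bound the resolvent \<open>w\<close> is close to \<open>\<rho> * \<phi>\<close> with \<open>\<rho> = \<langle>w, \<phi>\<rangle>\<close>, so that
  \<open>w' = z * w - \<phi>\<close> nearly reads \<open>w' = - \<beta> * w\<close> with \<open>\<beta> = 1 / \<rho> - z\<close>.\<close>

lemma near_exponential:
  assumes N: "nrm2 half_line \<phi> = 1" and D: "defect \<phi> \<le> ennreal d" and d: "d \<ge> 0"
    and k: "\<kappa> > 0" and z: "Re z > 0" and big: "Re z * (cmod (laplace z))\<^sup>2 \<ge> \<kappa>"
  shows "\<exists>a b. Re b > 0 \<and> nrm2 half_line (\<lambda>r. \<phi> r - a * exp (- b * complex_of_real r)) \<le> 4 / \<kappa> * (1 + 4 / \<kappa>\<^sup>2) * sqrt d"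
proof -
  define y where "y = Re z"
  have y: "y > 0" using z by (simp add: y_def)
  define \<rho> where "\<rho> = (\<integral>r. resolvent_clamped z r * cnj (\<phi> r) \<partial>half_line)"
  define m where "m = cmod \<rho>"
  define e where "e r = resolvent_clamped z r - \<rho> * \<phi> r" for r
  have se: "sqint half_line e" unfolding e_def[abs_def] by (intro sqint_diff sqint_cmult sqint_resolvent_clamped sqint_phi)
  have econt: "continuous_on UNIV e" unfolding e_def[abs_def] using resolvent_clamped_continuous cont by (intro continuous_intros)
  have em[measurable]: "e \<in> borel_measurable borel" using econt by (rule borel_measurable_continuous_onI)
  \<comment> \<open>Pairing the commutator in the variable \<open>s\<close> with
    \<open>\<phi>\<close>, which has norm 1, gives exactly \<open>e r\<close>. Cauchy-Schwarz in
    \<open>s\<close> and \<open>resolvent_commutator\<close> then bound \<open>e\<close>.\<close>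
  have e_norm: "nrm2 half_line e \<le> 2 * sqrt d / y"
  proof (rule nrm2_le_nnI(2))
    have pt: "ennreal ((cmod (e r))\<^sup>2) \<le> (\<integral>\<^sup>+s. ennreal ((cmod (resolvent_clamped z r * \<phi> s - \<phi> r * resolvent_clamped z s))\<^sup>2) \<partial>half_line)" for r
    proof -
      define f where "f s = resolvent_clamped z r * \<phi> s - \<phi> r * resolvent_clamped z s" for s
      have f: "sqint half_line f" unfolding f_def[abs_def] by (intro sqint_diff sqint_cmult sqint_resolvent_clamped sqint_phi)
      have i1: "integrable half_line (\<lambda>s. \<phi> s * cnj (\<phi> s))" "integrable half_line (\<lambda>s. resolvent_clamped z s * cnj (\<phi> s))"
        by (intro sqint_mult_integrable sqint_resolvent_clamped sqint_phi sqint_cnj)+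
      have n1: "(\<integral>s. \<phi> s * cnj (\<phi> s) \<partial>half_line) = 1"
      proof -
        have "(\<integral>s. \<phi> s * cnj (\<phi> s) \<partial>half_line) = complex_of_real ((nrm2 half_line \<phi>)\<^sup>2)"
          unfolding nrm2_sq complex_norm_square[symmetric] by (rule integral_complex_of_real)
        then show ?thesis by (simp add: N)
      qed
      have "(\<integral>s. f s * cnj (\<phi> s) \<partial>half_line) = (\<integral>s. resolvent_clamped z r * (\<phi> s * cnj (\<phi> s)) - \<phi> r * (resolvent_clamped z s * cnj (\<phi> s)) \<partial>half_line)"
        by (intro Bochner_Integration.integral_cong refl) (simp add: f_def algebra_simps)
      also have "\<dots> = e r"
        using i1 by (simp add: n1 e_def \<rho>_def del: complex_mult_cnj)
      finally have "cmod (e r) \<le> nrm2 half_line f * nrm2 half_line (\<lambda>s. cnj (\<phi> s))"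
        using cauchy_schwarz[OF f sqint_cnj[OF sqint_phi]] by simp
      also have "nrm2 half_line (\<lambda>s. cnj (\<phi> s)) = 1" using N by (simp add: nrm2_def)
      finally have "(cmod (e r))\<^sup>2 \<le> (nrm2 half_line f)\<^sup>2" by (intro power_mono) auto
      then show ?thesis using nn_integral_sqint[OF f] unfolding f_def by (simp add: ennreal_leI)
    qed
    have "(\<integral>\<^sup>+r. ennreal ((cmod (e r))\<^sup>2) \<partial>half_line) \<le> ennreal (4 / (Re z)\<^sup>2) * defect \<phi>"
      by (rule order_trans[OF nn_integral_mono[OF pt] resolvent_commutator[OF z]])
    also have "\<dots> \<le> ennreal (4 / (Re z)\<^sup>2) * ennreal d" by (intro mult_left_mono D) simp
    also have "\<dots> = ennreal ((2 * sqrt d / y)\<^sup>2)"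
      using d y by (simp add: y_def ennreal_mult[symmetric] power_divide power_mult_distrib)
    finally show "(\<integral>\<^sup>+r. ennreal ((cmod (e r))\<^sup>2) \<partial>half_line) \<le> ennreal ((2 * sqrt d / y)\<^sup>2)" .
  qed (use d y in auto)
  have m_le: "m \<le> nrm2 half_line (resolvent_clamped z)"
  proof -
    have "nrm2 half_line (\<lambda>s. cnj (\<phi> s)) = 1" using N by (simp add: nrm2_def)
    then show ?thesis
      using cauchy_schwarz[OF sqint_resolvent_clamped[of z] sqint_cnj[OF sqint_phi]] by (simp add: m_def \<rho>_def)
  qed
  define a where "a = Re \<rho>"
  have am: "a \<le> m" "m \<ge> 0" unfolding a_def m_def by (auto simp: complex_Re_le_cmod)
  \<comment> \<open>\<open>energy_identity\<close> with the norm of the resolvent replaced by the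
    size \<open>m\<close> of its projection to \<open>\<phi>\<close>. This inequality yields all
    three facts below: \<open>m\<close> is at least of order \<open>1 / y\<close>, it is at most
    \<open>1 / y\<close>, and \<open>Re \<beta>\<close> is at least of order
    \<open>y\<close>.\<close>
  have key: "\<kappa> \<le> 2 * (y * a) - 2 * (y * m)\<^sup>2"
  proof -
    have "\<kappa> \<le> y * (2 * a - 2 * y * (nrm2 half_line (resolvent_clamped z))\<^sup>2)"
      using big unfolding energy_identity a_def \<rho>_def y_def by simp
    also have "\<dots> \<le> y * (2 * a - 2 * y * m\<^sup>2)"
      using m_le am(2) y by (intro mult_left_mono diff_left_mono power_mono) auto
    finally show ?thesis by (simp add: power2_eq_square algebra_simps)
  qed
  have ya: "y * a \<ge> \<kappa> / 2" using key zero_le_power2[of "y * m"] by linarith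
  have mpos: "m \<ge> \<kappa> / (2 * y)"
  proof -
    have "y * m \<ge> \<kappa> / 2" using ya mult_left_mono[OF am(1), of y] y by linarith
    then show ?thesis using y by (simp add: field_simps)
  qed
  have m0: "m > 0" 
  proof -
    have "\<kappa> / (2 * y) > 0" using k y by simp
    then show ?thesis using mpos by linarith
  qed
  have rho0: "\<rho> \<noteq> 0" using m0 by (auto simp: m_def)
  have ym1: "y * m \<le> 1"
  proof -
    have "(y * m)\<^sup>2 \<le> y * a" using key k by linarith
    also have "\<dots> \<le> y * m" using am y by simp
    finally have "(y * m) * (y * m) \<le> 1 * (y * m)" by (simp add: power2_eq_square)
    then show ?thesis using y m0 by (metis mult_le_cancel_right mult_pos_pos not_less_iff_gr_or_eq)
  qed
  define \<beta> where "\<beta> = 1 / \<rho> - z"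
  have Reb: "Re \<beta> \<ge> y * \<kappa> / 2"
  proof -
    have "Re (1 / \<rho>) = a / m\<^sup>2"
      by (simp add: a_def m_def Re_divide cmod_power2)
    then have "Re \<beta> = (y * a - (y * m)\<^sup>2) / (y * m\<^sup>2)"
      using y m0 by (simp add: \<beta>_def y_def[symmetric] field_simps power2_eq_square)
    moreover have "(y * a - (y * m)\<^sup>2) / (y * m\<^sup>2) \<ge> (\<kappa> / 2) / (1 / y)"
    proof (rule frac_le)
      show "y * m\<^sup>2 \<le> 1 / y"
      proof -
        have "(y * m)\<^sup>2 \<le> 1" using ym1 y m0 by (simp add: power_le_one)
        then show ?thesis using y by (simp add: field_simps power2_eq_square)
      qed
    qed (use key k y m0 in auto)
    ultimately show ?thesis by (simp add: mult.commute)
  qed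
  have Reb0: "Re \<beta> > 0" 
  proof -
    have "y * \<kappa> / 2 > 0" using k y by simp
    then show ?thesis using Reb by linarith
  qed
  \<comment> \<open>The exponential agrees with the resolvent at 0, so \<open>v\<close> starts at 0
    and solves \<open>v' = - \<beta> * v + e / \<rho>\<close>.\<close>
  define v where "v r = resolvent_clamped z r - laplace z * exp (- \<beta> * complex_of_real r)" for r
  have vcont: "continuous_on UNIV v" unfolding v_def[abs_def] using resolvent_clamped_continuous by (intro continuous_intros)
  have vm[measurable]: "v \<in> borel_measurable borel" using vcont by (rule borel_measurable_continuous_onI)
  have sv: "sqint half_line v" unfolding v_def[abs_def] by (intro sqint_diff sqint_resolvent_clamped exp_sqint_half_line Reb0)
  define c where "c = 1 / (m\<^sup>2 * Re \<beta>)"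
  have vR: "Re \<beta> * (\<integral>r. indicator {0..R} r *\<^sub>R (cmod (v r))\<^sup>2 \<partial>lborel) \<le> c * (nrm2 half_line e)\<^sup>2" if R: "R \<ge> 0" for R
  proof -
    define f where "f r = 2 * Re (cnj (v r) * (- \<beta> * v r + e r / \<rho>))" for r
    have fourier_const: "continuous_on UNIV f" unfolding f_def[abs_def] using vcont econt rho0 by (intro continuous_intros) auto
    have d1: "(v has_vector_derivative - \<beta> * v r + e r / \<rho>) (at r within {0..R})" if r: "r \<in> {0..R}" for r
    proof -
      have "(resolvent_clamped z has_vector_derivative z * resolvent_clamped z r - \<phi> r) (at r within {0..R})"
        using r resolvent_ode_deriv[OF r, of z]
        by (simp add: resolvent_clamped_eq_ode) (rule has_vector_derivative_transform[where f="resolvent_ode z"], auto simp: resolvent_clamped_eq_ode)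
      moreover have "((\<lambda>r. laplace z * exp (- \<beta> * complex_of_real r)) has_vector_derivative laplace z * (- \<beta> * exp (- \<beta> * complex_of_real r))) (at r within {0..R})"
        by (rule derivative_eq_intros refl has_vector_derivative_real_field | simp)+
      ultimately have "(v has_vector_derivative (z * resolvent_clamped z r - \<phi> r) - laplace z * (- \<beta> * exp (- \<beta> * complex_of_real r))) (at r within {0..R})"
        unfolding v_def[abs_def] by (rule has_vector_derivative_diff)
      moreover have "(z * resolvent_clamped z r - \<phi> r) - laplace z * (- \<beta> * exp (- \<beta> * complex_of_real r)) = - \<beta> * v r + e r / \<rho>"
      proof -
        have "\<beta> * resolvent_clamped z r = resolvent_clamped z r / \<rho> - z * resolvent_clamped z r" by (simp add: \<beta>_def left_diff_distrib)
        moreover have "e r / \<rho> = resolvent_clamped z r / \<rho> - \<phi> r" using rho0 by (simp add: e_def diff_divide_distrib)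
        ultimately show ?thesis by (simp add: v_def right_diff_distrib mult.left_commute)
      qed
      ultimately show ?thesis by simp
    qed
    have "(\<integral>r. indicator {0..R} r *\<^sub>R f r \<partial>lborel) = (cmod (v R))\<^sup>2 - (cmod (v 0))\<^sup>2"
    proof (rule integral_FTC_Icc[OF R])
      show "((\<lambda>t. (cmod (v t))\<^sup>2) has_vector_derivative f r) (at r within {0..R})" if "0 \<le> r" "r \<le> R" for r
        unfolding f_def by (rule has_vector_derivative_cmod_sq[OF d1]) (use that in auto)
    qed (rule continuous_on_subset[OF fourier_const], simp)
    also have "v 0 = 0" by (simp add: v_def resolvent_clamped_0)
    \<comment> \<open>Only the sign is kept: \<open>v\<close> vanishes at 0 and the value at
      \<open>R\<close> is a square.\<close>
    finally have ge: "(\<integral>r. indicator {0..R} r *\<^sub>R f r \<partial>lborel) \<ge> 0" by simp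
    have int: "integrable lborel (\<lambda>x. indicator {0..R} x *\<^sub>R g x)" if "continuous_on UNIV g" for g :: "real \<Rightarrow> real"
      using borel_integrable_compact[of "{0..R}" g] that continuous_on_subset by (auto simp: indicator_def)
    \<comment> \<open>Half of the damping \<open>2 * Re \<beta>\<close> is spent on absorbing the
      forcing term by the inequality between a product and the sum of squares; \<open>c\<close> is
      the constant that results.\<close>
    have pt: "f r \<le> - Re \<beta> * (cmod (v r))\<^sup>2 + c * (cmod (e r))\<^sup>2" for r
    proof -
      have 1: "f r = - 2 * Re \<beta> * (cmod (v r))\<^sup>2 + 2 * Re (cnj (v r) * (e r / \<rho>))"
      proof -
        have "2 * Re (cnj p * (- \<beta> * p + q)) = - 2 * Re \<beta> * (cmod p)\<^sup>2 + 2 * Re (cnj p * q)" for p q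
          unfolding cmod_power2 by (simp add: algebra_simps power2_eq_square)
        then show ?thesis unfolding f_def .
      qed
      have "Re (cnj (v r) * (e r / \<rho>)) \<le> cmod (v r) * (cmod (e r) / m)"
        using complex_Re_le_cmod[of "cnj (v r) * (e r / \<rho>)"] by (simp add: norm_mult norm_divide m_def)
      moreover have "2 * (cmod (v r) * (cmod (e r) / m)) \<le> Re \<beta> * (cmod (v r))\<^sup>2 + c * (cmod (e r))\<^sup>2"
      proof -
        define s where "s = sqrt (Re \<beta>)"
        have s: "s > 0" "s\<^sup>2 = Re \<beta>" using Reb0 by (auto simp: s_def)
        have "2 * (s * cmod (v r)) * (cmod (e r) / (m * s)) \<le> (s * cmod (v r))\<^sup>2 + (cmod (e r) / (m * s))\<^sup>2"
          by (rule sum_squares_bound)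
        then show ?thesis using s m0 by (simp add: c_def power_mult_distrib power_divide)
      qed
      ultimately show ?thesis using 1 by linarith
    qed
    have "0 \<le> (\<integral>r. indicator {0..R} r *\<^sub>R (- Re \<beta> * (cmod (v r))\<^sup>2 + c * (cmod (e r))\<^sup>2) \<partial>lborel)"
    proof (rule order_trans[OF ge], rule integral_mono)
      show "integrable lborel (\<lambda>r. indicator {0..R} r *\<^sub>R f r)" by (rule int[OF fourier_const])
      show "integrable lborel (\<lambda>r. indicator {0..R} r *\<^sub>R (- Re \<beta> * (cmod (v r))\<^sup>2 + c * (cmod (e r))\<^sup>2))"
        by (rule int) (use vcont econt in \<open>intro continuous_intros\<close>)
    qed (use pt in \<open>auto split: split_indicator\<close>)
    also have "\<dots> = (\<integral>r. - Re \<beta> * (indicator {0..R} r *\<^sub>R (cmod (v r))\<^sup>2) + c * (indicator {0..R} r *\<^sub>R (cmod (e r))\<^sup>2) \<partial>lborel)"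
      by (intro Bochner_Integration.integral_cong refl) (simp add: algebra_simps)
    also have "\<dots> = - Re \<beta> * (\<integral>r. indicator {0..R} r *\<^sub>R (cmod (v r))\<^sup>2 \<partial>lborel) + c * (\<integral>r. indicator {0..R} r *\<^sub>R (cmod (e r))\<^sup>2 \<partial>lborel)"
    proof -
      have "integrable lborel (\<lambda>r. indicator {0..R} r *\<^sub>R (cmod (v r))\<^sup>2)"
        by (intro int continuous_on_power continuous_on_norm vcont)
      moreover have "integrable lborel (\<lambda>r. indicator {0..R} r *\<^sub>R (cmod (e r))\<^sup>2)"
        by (intro int continuous_on_power continuous_on_norm econt)
      ultimately show ?thesis by simp
    qed
    finally have 1: "Re \<beta> * (\<integral>r. indicator {0..R} r *\<^sub>R (cmod (v r))\<^sup>2 \<partial>lborel) \<le> c * (\<integral>r. indicator {0..R} r *\<^sub>R (cmod (e r))\<^sup>2 \<partial>lborel)"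
      by simp
    also have "\<dots> \<le> c * (nrm2 half_line e)\<^sup>2"
    proof (rule mult_left_mono)
      have ie: "integrable half_line (\<lambda>r. (cmod (e r))\<^sup>2)" using se by (rule sqint_integrable)
      have "(\<integral>r. indicator {0..R} r *\<^sub>R (cmod (e r))\<^sup>2 \<partial>lborel) = (\<integral>r. indicator {0<..} r *\<^sub>R (indicator {0..R} r * (cmod (e r))\<^sup>2) \<partial>lborel)"
        by (rule integral_cong_AE) (auto intro!: AE_I[of _ _ "{0}"] split: split_indicator)
      also have "\<dots> = (\<integral>r. indicator {0..R} r * (cmod (e r))\<^sup>2 \<partial>half_line)"
        by (rule integral_half_line[symmetric]) measurable
      also have "\<dots> \<le> (\<integral>r. (cmod (e r))\<^sup>2 \<partial>half_line)"
        by (rule integral_mono) (use ie in \<open>auto intro: Bochner_Integration.integrable_bound[OF ie] split: split_indicator\<close>)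
      finally show "(\<integral>r. indicator {0..R} r *\<^sub>R (cmod (e r))\<^sup>2 \<partial>lborel) \<le> (nrm2 half_line e)\<^sup>2" by (simp add: nrm2_sq)
      show "0 \<le> c" using Reb0 by (simp add: c_def)
    qed
    finally show ?thesis .
  qed
  have v_norm: "nrm2 half_line v \<le> nrm2 half_line e / (m * Re \<beta>)"
  proof (rule power2_le_imp_le)
    have "(\<lambda>n. \<integral>r. indicator {0..real n} r *\<^sub>R (cmod (v r))\<^sup>2 \<partial>lborel) \<longlonglongrightarrow> (\<integral>r. indicator {0<..} r *\<^sub>R (cmod (v r))\<^sup>2 \<partial>lborel)"
    proof (rule integral_dominated_convergence[where w="\<lambda>r. indicator {0<..} r *\<^sub>R (cmod (v r))\<^sup>2"])
      show "integrable lborel (\<lambda>r. indicator {0<..} r *\<^sub>R (cmod (v r))\<^sup>2)"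
        using sqint_integrable[OF sv] by (subst (asm) integrable_half_line) auto
      show "AE r in lborel. (\<lambda>n. indicator {0..real n} r *\<^sub>R (cmod (v r))\<^sup>2) \<longlonglongrightarrow> indicator {0<..} r *\<^sub>R (cmod (v r))\<^sup>2"
      proof (rule AE_I[of _ _ "{0}"])
        have "(\<lambda>n. indicator {0..real n} r *\<^sub>R (cmod (v r))\<^sup>2) \<longlonglongrightarrow> indicator {0<..} r *\<^sub>R (cmod (v r))\<^sup>2" if "r \<noteq> 0" for r
        proof (rule tendsto_eventually)
          obtain N where "r \<le> real N" using real_arch_simple by blast
          then show "\<forall>\<^sub>F n in sequentially. indicator {0..real n} r *\<^sub>R (cmod (v r))\<^sup>2 = indicator {0<..} r *\<^sub>R (cmod (v r))\<^sup>2"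
            using that by (intro eventually_sequentiallyI[of N]) (auto split: split_indicator)
        qed
        then show "{r \<in> space lborel. \<not> (\<lambda>n. indicator {0..real n} r *\<^sub>R (cmod (v r))\<^sup>2) \<longlonglongrightarrow> indicator {0<..} r *\<^sub>R (cmod (v r))\<^sup>2} \<subseteq> {0}" by auto
      qed auto
      show "AE r in lborel. norm (indicator {0..real n} r *\<^sub>R (cmod (v r))\<^sup>2) \<le> indicator {0<..} r *\<^sub>R (cmod (v r))\<^sup>2" for n
        by (rule AE_I[of _ _ "{0}"]) (auto split: split_indicator)
    qed auto
    then have lim: "(\<lambda>n. \<integral>r. indicator {0..real n} r *\<^sub>R (cmod (v r))\<^sup>2 \<partial>lborel) \<longlonglongrightarrow> (nrm2 half_line v)\<^sup>2"
      unfolding nrm2_sq by (subst integral_half_line) auto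
    have "(\<integral>r. indicator {0..real n} r *\<^sub>R (cmod (v r))\<^sup>2 \<partial>lborel) \<le> (nrm2 half_line e / (m * Re \<beta>))\<^sup>2" for n
    proof -
      have "(\<integral>r. indicator {0..real n} r *\<^sub>R (cmod (v r))\<^sup>2 \<partial>lborel) \<le> c * (nrm2 half_line e)\<^sup>2 / Re \<beta>"
        using vR[of "real n"] Reb0 by (simp add: pos_le_divide_eq mult.commute)
      also have "\<dots> = (nrm2 half_line e / (m * Re \<beta>))\<^sup>2"
        by (simp add: c_def power_divide power_mult_distrib power2_eq_square)
      finally show ?thesis .
    qed
    then show "(nrm2 half_line v)\<^sup>2 \<le> (nrm2 half_line e / (m * Re \<beta>))\<^sup>2"
      by (intro LIMSEQ_le_const2[OF lim]) auto
    show "0 \<le> nrm2 half_line e / (m * Re \<beta>)" using m0 Reb0 by simp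
  qed
  \<comment> \<open>The resolvent is \<open>\<rho> * \<phi> + e\<close> and also \<open>v\<close>
    plus the exponential; equating the two and dividing by \<open>\<rho>\<close> leaves the error
    \<open>(v - e) / \<rho>\<close>.\<close>
  have "nrm2 half_line (\<lambda>r. \<phi> r - (laplace z / \<rho>) * exp (- \<beta> * complex_of_real r)) = nrm2 half_line (\<lambda>r. (1 / \<rho>) * (v r - e r))"
    using rho0 by (intro arg_cong[where f="nrm2 half_line"] ext) (simp add: v_def e_def field_simps)
  also have "\<dots> = 1 / m * nrm2 half_line (\<lambda>r. v r - e r)"
    unfolding nrm2_cmult by (simp add: m_def norm_divide)
  also have "\<dots> \<le> 1 / m * (nrm2 half_line v + nrm2 half_line e)"
  proof (rule mult_left_mono)
    have "nrm2 half_line (\<lambda>x. - e x) = nrm2 half_line e" by (simp add: nrm2_def)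
    then show "nrm2 half_line (\<lambda>r. v r - e r) \<le> nrm2 half_line v + nrm2 half_line e"
      using nrm2_triangle_diff[OF sv sqint_zero se] by simp
  qed (use m0 in simp)
  also have "\<dots> \<le> 1 / m * (nrm2 half_line e / (m * Re \<beta>) + nrm2 half_line e)"
    using v_norm m0 by (intro mult_left_mono) auto
  also have "\<dots> = nrm2 half_line e * (1 / m) * (1 + 1 / (m * Re \<beta>))"
    by (simp add: field_simps)
  \<comment> \<open>The factor \<open>1 / y\<close> in the bound for \<open>e\<close> cancels
    against the lower bound for \<open>m\<close>, so the final constant depends on
    \<open>\<kappa>\<close> alone and not on the scale.\<close>
  also have "\<dots> \<le> (2 * sqrt d / y) * (2 * y / \<kappa>) * (1 + 4 / \<kappa>\<^sup>2)"
  proof (intro mult_mono add_left_mono e_norm)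
    show "1 / m \<le> 2 * y / \<kappa>" using mpos m0 k y by (simp add: field_simps)
    have "m * Re \<beta> \<ge> (\<kappa> / (2 * y)) * (y * \<kappa> / 2)"
      using mpos Reb k y m0 by (intro mult_mono) auto
    then have "m * Re \<beta> \<ge> \<kappa>\<^sup>2 / 4" using y by (simp add: power2_eq_square)
    then have "1 / (m * Re \<beta>) \<le> 1 / (\<kappa>\<^sup>2 / 4)" using k by (intro divide_left_mono) (auto intro!: mult_pos_pos m0 Reb0)
    then show "1 / (m * Re \<beta>) \<le> 4 / \<kappa>\<^sup>2" by simp
  qed (use m0 Reb0 k y d in auto)
  also have "\<dots> = 4 / \<kappa> * (1 + 4 / \<kappa>\<^sup>2) * sqrt d" using y by simp
  finally show ?thesis using Reb0 by blast
qed

end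

section \<open>Lower bound for the Laplace transform\<close>

text \<open>By translation invariance the inner integral over \<open>x\<close> does not depend on
  \<open>t\<close>, so the double integral of the modulus is the product of the two
  \<open>L\<^sup>1\<close> norms.\<close>

lemma integrable_conv_pair:
  fixes g k :: "'a::euclidean_space \<Rightarrow> complex"
  assumes g: "integrable lborel g" and k: "integrable lborel k"
  shows "integrable (lborel \<Otimes>\<^sub>M lborel) (\<lambda>(t, x). g t * k (x - t))"
proof -
  have [measurable]: "g \<in> borel_measurable borel" "k \<in> borel_measurable borel"
    using g k by (auto dest: borel_measurable_integrable)
  have tr: "(\<integral>x. f (x - t) \<partial>lborel) = (\<integral>x. f x \<partial>lborel)" if "f \<in> borel_measurable borel" for f :: "'a \<Rightarrow> complex" and t
    using integral_affine[of "\<lambda>x. f (x - t)" 1 t] that by simp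
  have tri: "integrable lborel (\<lambda>x. k (x - t))" for t
  proof -
    have "integrable (distr lborel borel (\<lambda>x. t + 1 *\<^sub>R x)) (\<lambda>x. k (x - t))"
      by (subst integrable_distr_eq) (use k in auto)
    moreover have "distr lborel borel (\<lambda>x::'a. t + 1 *\<^sub>R x) = lborel"
      using lborel_affine[of 1 t] by (simp add: density_1)
    ultimately show ?thesis by simp
  qed
  have trn: "(\<integral>x. norm (k (x - t)) \<partial>lborel) = (\<integral>x. norm (k x) \<partial>lborel)" for t
    using tr[of "\<lambda>x. complex_of_real (norm (k x))" t] by simp
  show ?thesis
  proof (rule lborel_pair.Fubini_integrable)
    show "integrable lborel (\<lambda>x. \<integral>y. norm (case (x, y) of (t, x) \<Rightarrow> g t * k (x - t)) \<partial>lborel)"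
      using g by (simp add: norm_mult trn)
    show "AE x in lborel. integrable lborel (\<lambda>y. case (x, y) of (t, x) \<Rightarrow> g t * k (x - t))"
      using tri by (intro AE_I2) simp
  qed measurable
qed

definition conv :: "('a::euclidean_space \<Rightarrow> complex) \<Rightarrow> ('a \<Rightarrow> complex) \<Rightarrow> 'a \<Rightarrow> complex" where
  "conv g k x = (\<integral>t. g t * k (x - t) \<partial>lborel)"

lemma conv_integrable:
  assumes "integrable lborel g" "integrable lborel k"
  shows "integrable lborel (conv g k)"
  unfolding conv_def[abs_def]
  by (rule lborel_pair.integrable_snd[OF integrable_conv_pair[OF assms]])

lemma FT_conv:
  fixes g k :: "'a::euclidean_space \<Rightarrow> complex"
  assumes g: "integrable lborel g" and k: "integrable lborel k"
  shows "FT (conv g k) \<xi> = FT g \<xi> * FT k \<xi>"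
proof -
  have [measurable]: "g \<in> borel_measurable borel" "k \<in> borel_measurable borel"
    using g k by (auto dest: borel_measurable_integrable)
  have int: "integrable (lborel \<Otimes>\<^sub>M lborel) (\<lambda>(t, x). cis (- (x \<bullet> \<xi>)) * (g t * k (x - t)))"
    using cis_mult_integrable[OF integrable_conv_pair[OF g k], of "\<lambda>p. - (snd p \<bullet> \<xi>)"]
    by (simp add: case_prod_beta')
  have "FT (conv g k) \<xi> = (\<integral>x. (\<integral>t. cis (- (x \<bullet> \<xi>)) * (g t * k (x - t)) \<partial>lborel) \<partial>lborel)"
    unfolding FT_def conv_def by (simp only: integral_mult_right_zero)
  also have "\<dots> = (\<integral>t. (\<integral>x. cis (- (x \<bullet> \<xi>)) * (g t * k (x - t)) \<partial>lborel) \<partial>lborel)"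
    by (rule lborel_pair.Fubini_integral[OF int])
  also have "\<dots> = (\<integral>t. (cis (- (t \<bullet> \<xi>)) * g t) * FT k \<xi> \<partial>lborel)"
  proof (rule Bochner_Integration.integral_cong[OF refl])
    fix t
    have "(\<integral>x. cis (- (x \<bullet> \<xi>)) * (g t * k (x - t)) \<partial>lborel) = 1 ^ DIM('a) *\<^sub>R (\<integral>x. cis (- ((t + 1 *\<^sub>R x) \<bullet> \<xi>)) * (g t * k (t + 1 *\<^sub>R x - t)) \<partial>lborel)"
      by (rule integral_affine) auto
    also have "\<dots> = (\<integral>x. (cis (- (t \<bullet> \<xi>)) * g t) * (cis (- (x \<bullet> \<xi>)) * k x) \<partial>lborel)"
    proof -
      have "cis (- ((t + x) \<bullet> \<xi>)) = cis (- (t \<bullet> \<xi>)) * cis (- (x \<bullet> \<xi>))" for x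
        by (simp add: cis_mult inner_add_left)
      then show ?thesis by (simp add: mult_ac)
    qed
    also have "\<dots> = (cis (- (t \<bullet> \<xi>)) * g t) * FT k \<xi>"
      unfolding FT_def by (rule integral_mult_right_zero)
    finally show "(\<integral>x. cis (- (x \<bullet> \<xi>)) * (g t * k (x - t)) \<partial>lborel) = (cis (- (t \<bullet> \<xi>)) * g t) * FT k \<xi>" .
  qed
  also have "\<dots> = FT g \<xi> * FT k \<xi>"
    unfolding FT_def[of g] by (rule integral_mult_left_zero)
  finally show ?thesis .
qed

section \<open>Plancherel on vertical lines for the damped profile\<close>

context profile
begin

lemma phi_bounded: "\<exists>B. B \<ge> 0 \<and> (\<forall>r\<ge>0. cmod (\<phi> r) \<le> B)"
proof -
  have "compact (\<phi> ` {0..L})"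
    by (intro compact_continuous_image continuous_on_subset[OF cont]) auto
  then obtain B where B: "\<And>r. r \<in> {0..L} \<Longrightarrow> cmod (\<phi> r) \<le> B"
    by (meson bounded_iff compact_imp_bounded image_eqI)
  have "B \<ge> 0" by (rule order_trans[OF norm_ge_zero B[of 0]]) (use L in auto)
  moreover have "cmod (\<phi> r) \<le> B" if "r \<ge> 0" for r
    using B[of r] supp[of r] that \<open>B \<ge> 0\<close> by (cases "r \<le> L") auto
  ultimately show ?thesis by blast
qed

text \<open>Extended by 0 to the whole line, so that its Fourier transform is the Laplace transform
  of \<open>\<phi>\<close> on the line \<open>Re z = y\<close>.\<close>

definition damped :: "real \<Rightarrow> real \<Rightarrow> complex" where
  "damped y r = indicator {0<..} r * (exp (- complex_of_real (y * r)) * \<phi> r)"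

lemma damped_measurable [measurable]: "damped y \<in> borel_measurable borel"
  unfolding damped_def[abs_def] by measurable

lemma damped_integrable: "integrable lborel (damped y)" and damped_sqint: "sqint lborel (damped y)"
  and FT_gy: "FT (damped y) \<tau> = laplace (Complex y \<tau>)"
proof -
  have c: "continuous_on UNIV (\<lambda>r. exp (- complex_of_real (y * r)) * \<phi> r)"
    using cont by (intro continuous_intros)
  have c2: "continuous_on UNIV (\<lambda>r. (cmod (exp (- complex_of_real (y * r)) * \<phi> r))\<^sup>2)"
    by (intro continuous_on_power continuous_on_norm c)
  have ind: "indicator {0<..} r * a = indicator {0<..} r *\<^sub>R a" for r and a :: complex
    by (auto split: split_indicator)
  have "integrable half_line (\<lambda>r. exp (- complex_of_real (y * r)) * \<phi> r)"
    by (rule half_line_Icc(1)[OF c, of L]) (use L supp in auto)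
  then show "integrable lborel (damped y)"
    unfolding damped_def[abs_def] ind by (subst (asm) integrable_half_line) auto
  have "integrable half_line (\<lambda>r. (cmod (exp (- complex_of_real (y * r)) * \<phi> r))\<^sup>2)"
    by (rule half_line_Icc(1)[OF c2, of L]) (use L supp in auto)
  moreover have "(cmod (damped y r))\<^sup>2 = indicator {0<..} r *\<^sub>R (cmod (exp (- complex_of_real (y * r)) * \<phi> r))\<^sup>2" for r
    by (auto simp: damped_def split: split_indicator)
  ultimately show "sqint lborel (damped y)"
    unfolding sqint_def by (subst (asm) integrable_half_line) auto
  have "FT (damped y) \<tau> = (\<integral>r. indicator {0<..} r *\<^sub>R (cis (- (r * \<tau>)) * (exp (- complex_of_real (y * r)) * \<phi> r)) \<partial>lborel)"
    unfolding FT_def damped_def by (intro Bochner_Integration.integral_cong refl) (auto split: split_indicator)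
  also have "\<dots> = (\<integral>r. cis (- (r * \<tau>)) * (exp (- complex_of_real (y * r)) * \<phi> r) \<partial>half_line)"
    by (rule integral_half_line[symmetric]) measurable
  also have "\<dots> = laplace (Complex y \<tau>)"
    unfolding laplace_def
  proof (intro Bochner_Integration.integral_cong refl)
    fix r
    have "- Complex y \<tau> * complex_of_real r = \<i> * complex_of_real (- (r * \<tau>)) + - complex_of_real (y * r)"
      by (simp add: complex_eq_iff)
    then show "cis (- (r * \<tau>)) * (exp (- complex_of_real (y * r)) * \<phi> r) = exp (- Complex y \<tau> * complex_of_real r) * \<phi> r"
      by (simp only: cis_conv_exp exp_add mult.assoc)
  qed
  finally show "FT (damped y) \<tau> = laplace (Complex y \<tau>)" .
qed

lemma damped_norm_le:
  assumes "y \<ge> 0"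
  shows "nrm2 lborel (damped y) \<le> nrm2 half_line \<phi>"
proof (rule nrm2_le_nnI(2))
  have "(\<integral>\<^sup>+r. ennreal ((cmod (damped y r))\<^sup>2) \<partial>lborel) \<le> (\<integral>\<^sup>+r. ennreal ((cmod (\<phi> r))\<^sup>2) * indicator {0<..} r \<partial>lborel)"
  proof (rule nn_integral_mono)
    fix r
    show "ennreal ((cmod (damped y r))\<^sup>2) \<le> ennreal ((cmod (\<phi> r))\<^sup>2) * indicator {0<..} r"
    proof (cases "r > 0")
      case True
      then have "cmod (damped y r) \<le> cmod (\<phi> r)"
        using assms by (simp add: damped_def norm_mult mult_left_le_one_le)
      then show ?thesis using True by (simp add: ennreal_leI power_mono)
    qed (simp add: damped_def)
  qed
  also have "\<dots> = ennreal ((nrm2 half_line \<phi>)\<^sup>2)"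
    using nn_integral_sqint[OF sqint_phi] by (subst (asm) nn_integral_half_line) auto
  finally show "(\<integral>\<^sup>+r. ennreal ((cmod (damped y r))\<^sup>2) \<partial>lborel) \<le> ennreal ((nrm2 half_line \<phi>)\<^sup>2)" .
qed auto

text \<open>The damping factors of the two arguments multiply to \<open>exp (- y * S)\<close>,
  independent of \<open>r\<close>. What remains is the integral of \<open>split_prod\<close> over
  the slice, whose size a small defect controls from below.\<close>

lemma conv_damped:
  "conv (damped y) (damped y) S = exp (- complex_of_real (y * S)) * (\<integral>r. indicator {0<..<S} r * split_prod \<phi> S r \<partial>lborel)"
proof -
  have "conv (damped y) (damped y) S = (\<integral>r. exp (- complex_of_real (y * S)) * (indicator {0<..<S} r * split_prod \<phi> S r) \<partial>lborel)"
    unfolding conv_def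
  proof (intro Bochner_Integration.integral_cong refl)
    fix r
    have "exp (- complex_of_real (y * r)) * exp (- complex_of_real (y * (S - r))) = exp (- complex_of_real (y * S))"
      by (simp add: exp_add[symmetric] right_diff_distrib)
    then show "damped y r * damped y (S - r) = exp (- complex_of_real (y * S)) * (indicator {0<..<S} r * split_prod \<phi> S r)"
      by (auto simp: damped_def split_prod_def split: split_indicator simp flip: mult.assoc)
  qed
  also have "\<dots> = exp (- complex_of_real (y * S)) * (\<integral>r. indicator {0<..<S} r * split_prod \<phi> S r \<partial>lborel)"
    by (rule integral_mult_right_zero)
  finally show ?thesis .
qed

text \<open>One factor is bounded because \<open>\<phi>\<close> is bounded on the half-line, so the
  convolution is bounded as well as integrable.\<close>

lemma conv_damped_sqint:
  assumes y: "y \<ge> 0"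
  shows "sqint lborel (conv (damped y) (damped y))"
proof -
  define c where "c = conv (damped y) (damped y)"
  have ci: "integrable lborel c" unfolding c_def by (intro conv_integrable damped_integrable)
  have [measurable]: "c \<in> borel_measurable borel" using ci by (auto dest: borel_measurable_integrable)
  obtain B where B: "B \<ge> 0" "\<And>r. r \<ge> 0 \<Longrightarrow> cmod (\<phi> r) \<le> B" using phi_bounded by blast
  have g: "cmod (damped y r) \<le> B" for r
  proof (cases "r > 0")
    case True
    then have "cmod (damped y r) \<le> cmod (\<phi> r)"
      using y by (simp add: damped_def norm_mult mult_left_le_one_le)
    then show ?thesis using B(2)[of r] True by simp
  qed (simp add: damped_def B)
  have cb: "cmod (c S) \<le> B * (\<integral>r. cmod (damped y r) \<partial>lborel)" for S
  proof -
    have "cmod (c S) \<le> (\<integral>r. B * cmod (damped y r) \<partial>lborel)"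
      unfolding c_def conv_def
    proof (rule Bochner_Integration.integral_norm_bound_integral)
      show "integrable lborel (\<lambda>r. B * cmod (damped y r))"
        by (intro integrable_mult_right integrable_norm damped_integrable)
      show "integrable lborel (\<lambda>r. damped y r * damped y (S - r))"
        by (rule Bochner_Integration.integrable_bound[OF integrable_mult_right[OF integrable_norm[OF damped_integrable[of y]], of B]])
           (use B g in \<open>auto simp: norm_mult mult.commute[of B] intro!: AE_I2 mult_left_mono\<close>)
      show "cmod (damped y r * damped y (S - r)) \<le> B * cmod (damped y r)" for r
        using g[of "S - r"] by (simp add: norm_mult mult.commute[of B] mult_left_mono)
    qed
    then show ?thesis by simp
  qed
  define K where "K = B * (\<integral>r. cmod (damped y r) \<partial>lborel)"
  have K0: "K \<ge> 0" using B by (simp add: K_def)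
  show ?thesis
    unfolding c_def[symmetric] sqint_def
  proof
    show "integrable lborel (\<lambda>x. (cmod (c x))\<^sup>2)"
      by (rule Bochner_Integration.integrable_bound[OF integrable_mult_right[OF integrable_norm[OF ci], of K]])
         (use cb K0 in \<open>auto simp: power2_eq_square K_def intro!: AE_I2 mult_right_mono\<close>)
  qed simp
qed

text \<open>Plancherel turns the squared norm of the convolution into the integral of the fourth
  power of the Laplace transform on the line. Two of the four powers are bounded by
  \<open>M\<close>, and Plancherel for \<open>damped y\<close> evaluates the other two.\<close>

lemma conv_damped_norm_le:
  assumes y: "y \<ge> 0" and M: "\<And>\<tau>. (cmod (laplace (Complex y \<tau>)))\<^sup>2 \<le> M"
  shows "(nrm2 lborel (conv (damped y) (damped y)))\<^sup>2 \<le> M * (nrm2 half_line \<phi>)\<^sup>2"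
proof -
  define c where "c = conv (damped y) (damped y)"
  have ci: "integrable lborel c" unfolding c_def by (intro conv_integrable damped_integrable)
  have cs: "sqint lborel c" unfolding c_def by (rule conv_damped_sqint[OF y])
  have M0: "M \<ge> 0" using M[of 0] by (rule order_trans[rotated]) simp
  have s: "sqint lborel (FT (damped y))" by (intro FT_sq_le(1) damped_integrable damped_sqint)
  have Fc: "FT c \<tau> = FT (damped y) \<tau> * FT (damped y) \<tau>" for \<tau>
    unfolding c_def by (rule FT_conv[OF damped_integrable damped_integrable])
  have "2 * pi * (nrm2 lborel c)\<^sup>2 = (nrm2 lborel (FT c))\<^sup>2"
    using plancherel[OF ci cs] by (simp add: power_mult_distrib)
  also have "\<dots> = (\<integral>\<tau>. (cmod (FT (damped y) \<tau>))\<^sup>2 * (cmod (FT (damped y) \<tau>))\<^sup>2 \<partial>lborel)"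
    unfolding nrm2_sq Fc by (simp add: norm_mult power_mult_distrib)
  also have "\<dots> \<le> (\<integral>\<tau>. M * (cmod (FT (damped y) \<tau>))\<^sup>2 \<partial>lborel)"
  proof (rule integral_mono)
    show "integrable lborel (\<lambda>\<tau>. M * (cmod (FT (damped y) \<tau>))\<^sup>2)"
      by (intro integrable_mult_right sqint_integrable s)
    show "integrable lborel (\<lambda>\<tau>. (cmod (FT (damped y) \<tau>))\<^sup>2 * (cmod (FT (damped y) \<tau>))\<^sup>2)"
      using sqint_integrable[OF FT_sq_le(1)[OF ci cs]] unfolding Fc by (simp add: norm_mult power_mult_distrib)
    show "(cmod (FT (damped y) \<tau>))\<^sup>2 * (cmod (FT (damped y) \<tau>))\<^sup>2 \<le> M * (cmod (FT (damped y) \<tau>))\<^sup>2" for \<tau>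
      using M[of \<tau>] by (intro mult_right_mono) (auto simp: FT_gy)
  qed
  also have "\<dots> = M * (2 * pi * (nrm2 lborel (damped y))\<^sup>2)"
    using plancherel[OF damped_integrable[of y] damped_sqint[of y]] by (simp add: nrm2_sq[symmetric] power_mult_distrib)
  also have "\<dots> \<le> M * (2 * pi * (nrm2 half_line \<phi>)\<^sup>2)"
    using damped_norm_le[OF y] M0 by (intro mult_left_mono power_mono) auto
  finally have "2 * pi * (nrm2 lborel c)\<^sup>2 \<le> 2 * pi * (M * (nrm2 half_line \<phi>)\<^sup>2)" by (simp add: mult_ac)
  then show ?thesis unfolding c_def by simp
qed

text \<open>The substitution \<open>S = r + s\<close> maps pairs of positive numbers onto the region
  \<open>0 < r < S\<close> and turns \<open>split_prod\<close> into
  \<open>\<phi> r * \<phi> s\<close>, so integrals over all slices become product integrals.\<close>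

lemma nn_integral_split_mass:
  fixes g :: "real \<Rightarrow> real \<Rightarrow> ennreal"
  assumes [measurable]: "(\<lambda>p. g (fst p) (snd p)) \<in> borel_measurable (borel \<Otimes>\<^sub>M borel)"
  shows "(\<integral>\<^sup>+S. \<integral>\<^sup>+r. g S r * ennreal ((cmod (split_prod \<phi> S r))\<^sup>2) * indicator {0<..<S} r \<partial>lborel \<partial>lborel)
    = (\<integral>\<^sup>+r. ennreal ((cmod (\<phi> r))\<^sup>2) * (\<integral>\<^sup>+s. g (r + s) r * ennreal ((cmod (\<phi> s))\<^sup>2) \<partial>half_line) \<partial>half_line)"
proof -
  have gm[measurable]: "(\<lambda>p. g (a p) (b p)) \<in> borel_measurable M"
    if [measurable]: "a \<in> borel_measurable M" "b \<in> borel_measurable M" for M :: "'b measure" and a b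
  proof -
    have "(\<lambda>p. (a p, b p)) \<in> measurable M (borel \<Otimes>\<^sub>M borel)" by measurable
    from measurable_compose[OF this assms] show ?thesis by simp
  qed
  have "(\<integral>\<^sup>+S. \<integral>\<^sup>+r. g S r * ennreal ((cmod (split_prod \<phi> S r))\<^sup>2) * indicator {0<..<S} r \<partial>lborel \<partial>lborel)
    = (\<integral>\<^sup>+r. \<integral>\<^sup>+S. g S r * ennreal ((cmod (split_prod \<phi> S r))\<^sup>2) * indicator {0<..<S} r \<partial>lborel \<partial>lborel)"
    by (rule lborel_pair.Fubini') measurable
  also have "\<dots> = (\<integral>\<^sup>+r. (ennreal ((cmod (\<phi> r))\<^sup>2) * (\<integral>\<^sup>+s. g (r + s) r * ennreal ((cmod (\<phi> s))\<^sup>2) \<partial>half_line)) * indicator {0<..} r \<partial>lborel)"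
  proof (rule nn_integral_cong)
    fix r :: real
    have "(\<integral>\<^sup>+S. g S r * ennreal ((cmod (split_prod \<phi> S r))\<^sup>2) * indicator {0<..<S} r \<partial>lborel)
      = (\<integral>\<^sup>+s. g (s + r) r * ennreal ((cmod (split_prod \<phi> (s + r) r))\<^sup>2) * indicator {0<..<s + r} r \<partial>lborel)"
      by (rule nn_integral_real_translate[where f="\<lambda>S. g S r * ennreal ((cmod (split_prod \<phi> S r))\<^sup>2) * indicator {0<..<S} r", symmetric]) measurable
    also have "\<dots> = (\<integral>\<^sup>+s. (ennreal ((cmod (\<phi> r))\<^sup>2) * indicator {0<..} r) * (g (r + s) r * ennreal ((cmod (\<phi> s))\<^sup>2) * indicator {0<..} s) \<partial>lborel)"
      by (intro nn_integral_cong)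
         (auto simp: split_prod_def norm_mult power_mult_distrib ennreal_mult add.commute mult_ac split: split_indicator)
    also have "\<dots> = (ennreal ((cmod (\<phi> r))\<^sup>2) * indicator {0<..} r) * (\<integral>\<^sup>+s. g (r + s) r * ennreal ((cmod (\<phi> s))\<^sup>2) \<partial>half_line)"
      by (subst nn_integral_cmult, measurable, subst nn_integral_half_line, measurable)
    finally show "(\<integral>\<^sup>+S. g S r * ennreal ((cmod (split_prod \<phi> S r))\<^sup>2) * indicator {0<..<S} r \<partial>lborel)
      = (ennreal ((cmod (\<phi> r))\<^sup>2) * (\<integral>\<^sup>+s. g (r + s) r * ennreal ((cmod (\<phi> s))\<^sup>2) \<partial>half_line)) * indicator {0<..} r"
      by (simp add: mult_ac)
  qed
  also have "\<dots> = (\<integral>\<^sup>+r. ennreal ((cmod (\<phi> r))\<^sup>2) * (\<integral>\<^sup>+s. g (r + s) r * ennreal ((cmod (\<phi> s))\<^sup>2) \<partial>half_line) \<partial>half_line)"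
    by (rule nn_integral_half_line[symmetric]) measurable
  finally show ?thesis .
qed

end

section \<open>Distribution of the mass along a slice\<close>

context profile
begin

lemma split_prod_integrable: "integrable lborel (\<lambda>r. indicator {0<..<S} r * split_prod \<phi> S r)"
proof -
  have "continuous_on {0..S} (split_prod \<phi> S)"
    unfolding split_prod_def by (intro continuous_intros continuous_on_subset[OF cont] continuous_on_compose2[OF cont]) auto
  then have "integrable lborel (\<lambda>r. indicator {0..S} r *\<^sub>R split_prod \<phi> S r)"
    using borel_integrable_compact[of "{0..S}" "split_prod \<phi> S"] by (auto simp: indicator_def)
  then show ?thesis
    by (rule Bochner_Integration.integrable_bound) (auto split: split_indicator intro!: AE_I2)
qed

definition split_mass :: "real \<Rightarrow> ennreal" where
  "split_mass S = (\<integral>\<^sup>+r. ennreal ((cmod (split_prod \<phi> S r))\<^sup>2) * indicator {0<..<S} r \<partial>lborel)"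

definition split_integral :: "real \<Rightarrow> complex" where
  "split_integral S = (\<integral>r. indicator {0<..<S} r * split_prod \<phi> S r \<partial>lborel)"

lemma split_mass_measurable [measurable]: "split_mass \<in> borel_measurable borel"
  unfolding split_mass_def[abs_def] by measurable

text \<open>Second moment against variance and mean: \<open>S * split_prod \<phi> S r\<close> is
  \<open>split_integral S\<close> plus an integral of differences over the slice, and Cauchy-Schwarz
  bounds the square of that integral. The factors 2 come from squaring a sum of two terms.\<close>

lemma split_mass_le_variance:
  assumes S: "S > 0"
  shows "ennreal S * split_mass S \<le> 2 * slice_defect \<phi> S + 2 * ennreal ((cmod (split_integral S))\<^sup>2)"
proof -
  define V where "V r = (\<integral>\<^sup>+r'. ennreal ((cmod (split_prod \<phi> S r - split_prod \<phi> S r'))\<^sup>2) * indicator {0<..<S} r' \<partial>lborel)" for r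
  have [measurable]: "V \<in> borel_measurable borel" unfolding V_def[abs_def] by measurable
  have pt: "ennreal (S\<^sup>2) * ennreal ((cmod (split_prod \<phi> S r))\<^sup>2) \<le> 2 * (ennreal S * V r) + 2 * ennreal ((cmod (split_integral S))\<^sup>2)" for r
  proof -
    have i1: "integrable lborel (\<lambda>r'. indicator {0<..<S} r' * split_prod \<phi> S r)"
      and i2: "(\<integral>r'. indicator {0<..<S} r' * split_prod \<phi> S r \<partial>lborel) = complex_of_real S * split_prod \<phi> S r"
    proof -
      have e: "(\<lambda>r'. indicator {0<..<S} r' * split_prod \<phi> S r) = (\<lambda>r'. indicator {0<..<S} r' *\<^sub>R split_prod \<phi> S r)"
        by (auto simp: fun_eq_iff split: split_indicator)
      have "has_bochner_integral lborel (\<lambda>r'. indicator {0<..<S} r' *\<^sub>R split_prod \<phi> S r) (measure lborel {0<..<S} *\<^sub>R split_prod \<phi> S r)"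
        using S by (intro has_bochner_integral_indicator) auto
      then show "integrable lborel (\<lambda>r'. indicator {0<..<S} r' * split_prod \<phi> S r)"
        "(\<integral>r'. indicator {0<..<S} r' * split_prod \<phi> S r \<partial>lborel) = complex_of_real S * split_prod \<phi> S r"
        unfolding e using S by (auto simp: has_bochner_integral_iff scaleR_conv_of_real)
    qed
    have "complex_of_real S * split_prod \<phi> S r - split_integral S = (\<integral>r'. indicator {0<..<S} r' * split_prod \<phi> S r - indicator {0<..<S} r' * split_prod \<phi> S r' \<partial>lborel)"
      unfolding split_integral_def i2[symmetric] by (rule Bochner_Integration.integral_diff[OF i1 split_prod_integrable, symmetric])
    then have "ennreal (cmod (complex_of_real S * split_prod \<phi> S r - split_integral S)) \<le> (\<integral>\<^sup>+r'. ennreal (cmod (indicator {0<..<S} r' * split_prod \<phi> S r - indicator {0<..<S} r' * split_prod \<phi> S r')) \<partial>lborel)"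
      using integral_norm_bound_ennreal_any by metis
    also have "\<dots> = (\<integral>\<^sup>+r'. indicator {0<..<S} r' * (ennreal (cmod (split_prod \<phi> S r - split_prod \<phi> S r')) * indicator {0<..<S} r') \<partial>lborel)"
      by (intro nn_integral_cong) (auto split: split_indicator)
    finally have "(ennreal (cmod (complex_of_real S * split_prod \<phi> S r - split_integral S)))\<^sup>2 \<le> (\<integral>\<^sup>+r'. indicator {0<..<S} r' * (ennreal (cmod (split_prod \<phi> S r - split_prod \<phi> S r')) * indicator {0<..<S} r') \<partial>lborel)\<^sup>2"
      by (rule power_mono) simp
    also have "\<dots> \<le> (\<integral>\<^sup>+r'. (indicator {0<..<S} r')\<^sup>2 \<partial>lborel) * (\<integral>\<^sup>+r'. (ennreal (cmod (split_prod \<phi> S r - split_prod \<phi> S r')) * indicator {0<..<S} r')\<^sup>2 \<partial>lborel)"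
      by (rule Cauchy_Schwarz_nn_integral) measurable
    also have "(\<integral>\<^sup>+r'. (indicator {0<..<S} r')\<^sup>2 \<partial>lborel) = (\<integral>\<^sup>+r'. indicator {0<..<S} r' \<partial>lborel)"
      by (intro nn_integral_cong) (auto split: split_indicator)
    also have "\<dots> = ennreal S" using S by simp
    also have "(\<integral>\<^sup>+r'. (ennreal (cmod (split_prod \<phi> S r - split_prod \<phi> S r')) * indicator {0<..<S} r')\<^sup>2 \<partial>lborel) = V r"
      unfolding V_def by (intro nn_integral_cong) (auto simp: ennreal_power split: split_indicator)
    finally have 1: "ennreal ((cmod (complex_of_real S * split_prod \<phi> S r - split_integral S))\<^sup>2) \<le> ennreal S * V r"
      by (simp add: ennreal_power)
    have "S\<^sup>2 * (cmod (split_prod \<phi> S r))\<^sup>2 = (cmod (complex_of_real S * split_prod \<phi> S r - 0))\<^sup>2"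
      by (simp add: norm_mult power_mult_distrib)
    also have "\<dots> \<le> 2 * (cmod (complex_of_real S * split_prod \<phi> S r - split_integral S))\<^sup>2 + 2 * (cmod (split_integral S))\<^sup>2"
      using sq_diff_le[of "complex_of_real S * split_prod \<phi> S r" 0 "split_integral S"] by simp
    finally have "ennreal (S\<^sup>2 * (cmod (split_prod \<phi> S r))\<^sup>2) \<le> 2 * ennreal ((cmod (complex_of_real S * split_prod \<phi> S r - split_integral S))\<^sup>2) + 2 * ennreal ((cmod (split_integral S))\<^sup>2)"
      by (subst ennreal_numeral[symmetric])+ (simp add: ennreal_mult[symmetric] ennreal_plus[symmetric] ennreal_leI del: ennreal_plus ennreal_numeral)
    also have "\<dots> \<le> 2 * (ennreal S * V r) + 2 * ennreal ((cmod (split_integral S))\<^sup>2)"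
      by (intro add_mono mult_left_mono 1) auto
    finally show ?thesis by (simp add: ennreal_mult)
  qed
  have "ennreal (S\<^sup>2) * split_mass S = (\<integral>\<^sup>+r. ennreal (S\<^sup>2) * ennreal ((cmod (split_prod \<phi> S r))\<^sup>2) * indicator {0<..<S} r \<partial>lborel)"
    unfolding split_mass_def by (subst nn_integral_cmult[symmetric]) (auto simp: mult.assoc)
  also have "\<dots> \<le> (\<integral>\<^sup>+r. 2 * ennreal S * (V r * indicator {0<..<S} r) + 2 * ennreal ((cmod (split_integral S))\<^sup>2) * indicator {0<..<S} r \<partial>lborel)"
    by (intro nn_integral_mono) (use pt in \<open>auto simp: mult.assoc split: split_indicator\<close>)
  also have "\<dots> = 2 * ennreal S * (\<integral>\<^sup>+r. V r * indicator {0<..<S} r \<partial>lborel) + 2 * ennreal ((cmod (split_integral S))\<^sup>2) * ennreal S"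
    using S by (subst nn_integral_add) (auto simp: nn_integral_cmult nn_integral_cmult_indicator)
  also have "(\<integral>\<^sup>+r. V r * indicator {0<..<S} r \<partial>lborel) = slice_defect \<phi> S"
    unfolding slice_defect_def V_def
  proof (rule nn_integral_cong)
    fix r
    show "(\<integral>\<^sup>+r'. ennreal ((cmod (split_prod \<phi> S r - split_prod \<phi> S r'))\<^sup>2) * indicator {0<..<S} r' \<partial>lborel) * indicator {0<..<S} r
      = (\<integral>\<^sup>+r'. ennreal ((cmod (split_prod \<phi> S r - split_prod \<phi> S r'))\<^sup>2) * (indicator {0<..<S} r * indicator {0<..<S} r') \<partial>lborel)"
      by (cases "r \<in> {0<..<S}") simp_all
  qed
  finally have "ennreal (1 / S) * (ennreal (S\<^sup>2) * split_mass S) \<le> ennreal (1 / S) * (2 * ennreal S * slice_defect \<phi> S + 2 * ennreal ((cmod (split_integral S))\<^sup>2) * ennreal S)"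
    by (rule mult_left_mono) simp
  moreover have "ennreal (1 / S) * (ennreal (S\<^sup>2) * split_mass S) = ennreal S * split_mass S"
    using S by (simp add: mult.assoc[symmetric] ennreal_mult[symmetric] power2_eq_square)
  moreover have "ennreal (1 / S) * (2 * ennreal S * a + 2 * b * ennreal S) = 2 * a + 2 * b" for a b
  proof -
    have "ennreal (1 / S) * ennreal S = 1" using S by (simp add: ennreal_mult[symmetric])
    moreover have "ennreal (1 / S) * (2 * ennreal S * a + 2 * b * ennreal S) = (ennreal (1 / S) * ennreal S) * (2 * a + 2 * b)"
      by (simp only: distrib_left mult_ac)
    ultimately show ?thesis by simp
  qed
  ultimately show ?thesis by simp
qed

text \<open>The two end pieces make up one eighth of the slice. On the rest of it \<open>r\<close>
  and \<open>S - r\<close> differ at most by a factor 15.\<close>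

definition edge :: "real \<Rightarrow> real \<Rightarrow> ennreal" where
  "edge S r = (if r < S / 16 \<or> r > 15 * S / 16 then 1 else 0)"

definition middle :: "real \<Rightarrow> real \<Rightarrow> ennreal" where
  "middle S r = (if r < S / 16 \<or> r > 15 * S / 16 then 0 else 1)"

lemma edge_middle_measurable [measurable]:
  "(\<lambda>p. edge (fst p) (snd p)) \<in> borel_measurable (borel \<Otimes>\<^sub>M borel)"
  "(\<lambda>p. middle (fst p) (snd p)) \<in> borel_measurable (borel \<Otimes>\<^sub>M borel)"
  "edge S \<in> borel_measurable borel" "middle S \<in> borel_measurable borel"
  unfolding edge_def[abs_def] middle_def[abs_def] by measurable

text \<open>Were \<open>split_prod\<close> constant on the slice, its ends would carry one eighth of
  the mass. Comparing a point with the average over the slice costs a factor 2 in the squares, hence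
  the coefficient 1/4.\<close>

lemma edge_mass_slice:
  assumes S: "S > 0"
  shows "(\<integral>\<^sup>+r. edge S r * ennreal ((cmod (split_prod \<phi> S r))\<^sup>2) * indicator {0<..<S} r \<partial>lborel)
    \<le> 2 * (ennreal (1 / S) * slice_defect \<phi> S) + ennreal (1 / 4) * split_mass S"
proof -
  define V where "V r = (\<integral>\<^sup>+r'. ennreal ((cmod (split_prod \<phi> S r - split_prod \<phi> S r'))\<^sup>2) * indicator {0<..<S} r' \<partial>lborel)" for r
  have [measurable]: "V \<in> borel_measurable borel" unfolding V_def[abs_def] by measurable
  have pt: "ennreal S * ennreal ((cmod (split_prod \<phi> S r))\<^sup>2) \<le> 2 * V r + 2 * split_mass S" for r
  proof -
    have "ennreal S * ennreal ((cmod (split_prod \<phi> S r))\<^sup>2) = (\<integral>\<^sup>+r'. ennreal ((cmod (split_prod \<phi> S r))\<^sup>2) * indicator {0<..<S} r' \<partial>lborel)"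
      using S by (subst nn_integral_cmult_indicator) (auto simp: mult.commute)
    also have "\<dots> \<le> (\<integral>\<^sup>+r'. 2 * (ennreal ((cmod (split_prod \<phi> S r - split_prod \<phi> S r'))\<^sup>2) * indicator {0<..<S} r') + 2 * (ennreal ((cmod (split_prod \<phi> S r'))\<^sup>2) * indicator {0<..<S} r') \<partial>lborel)"
    proof (rule nn_integral_mono)
      fix r'
      have "ennreal ((cmod (split_prod \<phi> S r))\<^sup>2) \<le> 2 * ennreal ((cmod (split_prod \<phi> S r - split_prod \<phi> S r'))\<^sup>2) + 2 * ennreal ((cmod (split_prod \<phi> S r'))\<^sup>2)"
        using sq_diff_le[of "split_prod \<phi> S r" 0 "split_prod \<phi> S r'"]
        by (subst ennreal_numeral[symmetric])+ (simp add: ennreal_mult[symmetric] ennreal_plus[symmetric] ennreal_leI del: ennreal_plus ennreal_numeral)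
      then show "ennreal ((cmod (split_prod \<phi> S r))\<^sup>2) * indicator {0<..<S} r' \<le> 2 * (ennreal ((cmod (split_prod \<phi> S r - split_prod \<phi> S r'))\<^sup>2) * indicator {0<..<S} r') + 2 * (ennreal ((cmod (split_prod \<phi> S r'))\<^sup>2) * indicator {0<..<S} r')"
        by (auto split: split_indicator)
    qed
    also have "\<dots> = 2 * V r + 2 * split_mass S"
      unfolding V_def split_mass_def by (subst nn_integral_add) (auto simp: nn_integral_cmult)
    finally show ?thesis .
  qed
  have off_len: "(\<integral>\<^sup>+r. edge S r * indicator {0<..<S} r \<partial>lborel) \<le> ennreal (S / 8)"
  proof -
    have "(\<integral>\<^sup>+r. edge S r * indicator {0<..<S} r \<partial>lborel) \<le> (\<integral>\<^sup>+r. indicator {0<..<S/16} r + indicator {15*S/16<..<S} r \<partial>lborel)"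
      by (intro nn_integral_mono) (auto simp: edge_def split: split_indicator)
    also have "\<dots> = ennreal (S / 16) + ennreal (S - 15 * S / 16)"
      using S by (subst nn_integral_add) auto
    also have "\<dots> = ennreal (S / 8)" using S by (subst ennreal_plus[symmetric]) auto
    finally show ?thesis .
  qed
  have "ennreal S * (\<integral>\<^sup>+r. edge S r * ennreal ((cmod (split_prod \<phi> S r))\<^sup>2) * indicator {0<..<S} r \<partial>lborel)
    = (\<integral>\<^sup>+r. edge S r * (ennreal S * ennreal ((cmod (split_prod \<phi> S r))\<^sup>2)) * indicator {0<..<S} r \<partial>lborel)"
    by (subst nn_integral_cmult[symmetric]) (auto simp: mult_ac)
  also have "\<dots> \<le> (\<integral>\<^sup>+r. 2 * (V r * indicator {0<..<S} r) + 2 * split_mass S * (edge S r * indicator {0<..<S} r) \<partial>lborel)"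
    by (intro nn_integral_mono) (use pt in \<open>auto simp: edge_def split: split_indicator\<close>)
  also have "\<dots> = 2 * (\<integral>\<^sup>+r. V r * indicator {0<..<S} r \<partial>lborel) + 2 * split_mass S * (\<integral>\<^sup>+r. edge S r * indicator {0<..<S} r \<partial>lborel)"
    by (subst nn_integral_add) (auto simp: nn_integral_cmult)
  also have "(\<integral>\<^sup>+r. V r * indicator {0<..<S} r \<partial>lborel) = slice_defect \<phi> S"
    unfolding slice_defect_def V_def
  proof (rule nn_integral_cong)
    fix r
    show "(\<integral>\<^sup>+r'. ennreal ((cmod (split_prod \<phi> S r - split_prod \<phi> S r'))\<^sup>2) * indicator {0<..<S} r' \<partial>lborel) * indicator {0<..<S} r
      = (\<integral>\<^sup>+r'. ennreal ((cmod (split_prod \<phi> S r - split_prod \<phi> S r'))\<^sup>2) * (indicator {0<..<S} r * indicator {0<..<S} r') \<partial>lborel)"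
      by (cases "r \<in> {0<..<S}") simp_all
  qed
  finally have "ennreal S * (\<integral>\<^sup>+r. edge S r * ennreal ((cmod (split_prod \<phi> S r))\<^sup>2) * indicator {0<..<S} r \<partial>lborel)
    \<le> 2 * slice_defect \<phi> S + 2 * split_mass S * ennreal (S / 8)"
    using off_len by (meson add_left_mono mult_left_mono order_trans zero_le)
  then have "ennreal (1 / S) * (ennreal S * (\<integral>\<^sup>+r. edge S r * ennreal ((cmod (split_prod \<phi> S r))\<^sup>2) * indicator {0<..<S} r \<partial>lborel))
    \<le> ennreal (1 / S) * (2 * slice_defect \<phi> S + 2 * split_mass S * ennreal (S / 8))"
    by (rule mult_left_mono) simp
  moreover have "ennreal (1 / S) * (ennreal S * a) = a" for a
    using S by (simp add: mult.assoc[symmetric] ennreal_mult[symmetric])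
  moreover have "ennreal (1 / S) * (2 * a + 2 * b * ennreal (S / 8)) = 2 * (ennreal (1 / S) * a) + ennreal (1 / 4) * b" for a b
  proof -
    have "2 * ennreal (1 / S) * ennreal (S / 8) = ennreal (1 / 4)"
      using S by (subst ennreal_numeral[symmetric]) (simp add: ennreal_mult[symmetric] del: ennreal_numeral)
    moreover have "ennreal (1 / S) * (2 * a + 2 * b * ennreal (S / 8)) = 2 * (ennreal (1 / S) * a) + (2 * ennreal (1 / S) * ennreal (S / 8)) * b"
      by (simp only: distrib_left mult_ac)
    ultimately show ?thesis by simp
  qed
  ultimately show ?thesis by simp
qed

end

context profile
begin

text \<open>A small defect leaves little mass of \<open>\<phi> r * \<phi> s\<close> where \<open>r\<close> and \<open>s\<close> are not comparable, hence most of the mass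
  of \<open>\<phi>\<close> lies at one scale \<open>1 / y\<close>. The self-convolution of the damped profile is then bounded
  from below, and by Plancherel its \<open>L\<^sup>2\<close> norm is at most \<open>sup\<close> of the Laplace transform on
  \<open>Re z = y\<close> times the norm of the damped profile.\<close>

lemma laplace_large:
  assumes N: "nrm2 half_line \<phi> = 1" and D: "defect \<phi> \<le> ennreal d" and d0: "d \<ge> 0" and d: "d \<le> exp (- 60) / 120"
  shows "\<exists>z. Re z > 0 \<and> Re z * (cmod (laplace z))\<^sup>2 \<ge> exp (- 60) / 120"
proof -
  define \<psi> where "\<psi> r = ennreal ((cmod (\<phi> r))\<^sup>2)" for r
  have [measurable]: "\<psi> \<in> borel_measurable borel" unfolding \<psi>_def[abs_def] by measurable
  have I\<psi>: "(\<integral>\<^sup>+r. \<psi> r \<partial>half_line) = 1"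
    using nn_integral_sqint[OF sqint_phi] N by (simp add: \<psi>_def)
  define m where "m g = (\<integral>\<^sup>+S. \<integral>\<^sup>+r. g S r * ennreal ((cmod (split_prod \<phi> S r))\<^sup>2) * indicator {0<..<S} r \<partial>lborel \<partial>lborel)" for g :: "real \<Rightarrow> real \<Rightarrow> ennreal"
  have total: "m (\<lambda>S r. 1) = 1"
    unfolding m_def by (subst nn_integral_split_mass, measurable) (simp add: \<psi>_def[symmetric] I\<psi>)
  \<comment> \<open>The assumption on \<open>d\<close> gives \<open>d \<le> 1 / 16\<close>, which
    contributes 2/16; a quarter of the total mass 1 is added.\<close>
  have offle: "m edge \<le> ennreal (3 / 8)"
  proof -
    have "m edge \<le> (\<integral>\<^sup>+S. 2 * (ennreal (1 / S) * slice_defect \<phi> S * indicator {0<..} S) + ennreal (1 / 4) * (\<integral>\<^sup>+r. 1 * ennreal ((cmod (split_prod \<phi> S r))\<^sup>2) * indicator {0<..<S} r \<partial>lborel) \<partial>lborel)"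
      unfolding m_def
    proof (rule nn_integral_mono)
      fix S :: real
      show "(\<integral>\<^sup>+r. edge S r * ennreal ((cmod (split_prod \<phi> S r))\<^sup>2) * indicator {0<..<S} r \<partial>lborel)
        \<le> 2 * (ennreal (1 / S) * slice_defect \<phi> S * indicator {0<..} S) + ennreal (1 / 4) * (\<integral>\<^sup>+r. 1 * ennreal ((cmod (split_prod \<phi> S r))\<^sup>2) * indicator {0<..<S} r \<partial>lborel)"
      proof (cases "S > 0")
        case True
        then show ?thesis using edge_mass_slice[OF True] by (simp add: split_mass_def)
      next
        case False
        have "(\<integral>\<^sup>+r. edge S r * ennreal ((cmod (split_prod \<phi> S r))\<^sup>2) * indicator {0<..<S} r \<partial>lborel) = (\<integral>\<^sup>+(r::real). 0 \<partial>lborel)"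
          by (rule nn_integral_cong) (use False in \<open>auto split: split_indicator\<close>)
        then show ?thesis by simp
      qed
    qed
    also have "\<dots> = 2 * defect \<phi> + ennreal (1 / 4) * m (\<lambda>S r. 1)"
      unfolding defect_def m_def
      by (subst nn_integral_add, measurable, subst nn_integral_cmult, measurable, subst nn_integral_cmult, measurable)
    also have "\<dots> \<le> 2 * ennreal (1 / 16) + ennreal (1 / 4)"
    proof -
      have "exp (- 60 :: real) \<le> 1" by simp
      then have "d \<le> 1 / 16" using d by linarith
      then have "defect \<phi> \<le> ennreal (1 / 16)" using D by (meson ennreal_leI order_trans)
      then show ?thesis unfolding total by (intro add_mono mult_left_mono) auto
    qed
    also have "\<dots> = ennreal (3 / 8)"
      by (subst ennreal_numeral[symmetric]) (simp add: ennreal_mult[symmetric] ennreal_plus[symmetric] del: ennreal_numeral ennreal_plus)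
    finally show ?thesis .
  qed
  have split: "m edge + m middle = 1"
  proof -
    have "m edge + m middle = m (\<lambda>S r. 1)"
      unfolding m_def
      by (subst nn_integral_add[symmetric], measurable, rule nn_integral_cong, subst nn_integral_add[symmetric], measurable)
         (auto simp: edge_def middle_def intro!: nn_integral_cong)
    then show ?thesis by (simp add: total)
  qed
  define U where "U r = (\<integral>\<^sup>+s. middle (r + s) r * \<psi> s \<partial>half_line)" for r
  have mon: "m middle = (\<integral>\<^sup>+r. \<psi> r * U r \<partial>half_line)"
    unfolding m_def U_def \<psi>_def by (rule nn_integral_split_mass) measurable
  \<comment> \<open>\<open>edge\<close> and \<open>middle\<close> together carry mass 1. If
    \<open>U\<close> were at most 1/2 everywhere, they would carry at most 3/8 + 1/2.\<close>
  have "\<exists>r>0. U r > ennreal (1 / 2)"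
  proof (rule ccontr)
    assume "\<not> ?thesis"
    then have le: "U r \<le> ennreal (1 / 2)" if "r > 0" for r using that by (meson not_less)
    have "m middle \<le> (\<integral>\<^sup>+r. \<psi> r * ennreal (1 / 2) \<partial>half_line)"
      unfolding mon
    proof (rule nn_integral_mono_AE)
      have "AE r in half_line. r > 0"
        unfolding half_line_def by (subst AE_density) (auto split: split_indicator)
      then show "AE r in half_line. \<psi> r * U r \<le> \<psi> r * ennreal (1 / 2)"
        by eventually_elim (intro mult_left_mono le, auto)
    qed
    also have "\<dots> = ennreal (1 / 2)" by (subst nn_integral_multc) (auto simp: I\<psi>)
    finally have "m edge + m middle \<le> ennreal (3 / 8) + ennreal (1 / 2)" using offle by (rule add_mono[rotated])
    also have "\<dots> = ennreal (7 / 8)" by (subst ennreal_plus[symmetric]) auto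
    also have "\<dots> < 1" by simp
    finally show False using split by simp
  qed
  then obtain r0 where r0: "r0 > 0" "U r0 > ennreal (1 / 2)" by blast
  \<comment> \<open>Exactly the \<open>s\<close> with \<open>middle (r0 + s) r0 = 1\<close>, that
    is, the points comparable with \<open>r0\<close>.\<close>
  define K where "K = {r0 / 15..15 * r0}"
  have [measurable]: "K \<in> sets borel" by (simp add: K_def)
  have massK: "(\<integral>\<^sup>+s. \<psi> s * indicator K s \<partial>half_line) \<ge> ennreal (1 / 2)"
  proof -
    have "U r0 \<le> (\<integral>\<^sup>+s. \<psi> s * indicator K s \<partial>half_line)"
      unfolding U_def by (intro nn_integral_mono) (auto simp: middle_def K_def field_simps split: split_indicator)
    then show ?thesis using r0(2) by simp
  qed
  define y where "y = 1 / r0"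
  have y: "y > 0" using r0 by (simp add: y_def)
  \<comment> \<open>The weight under which two earlier facts meet: the factor \<open>S\<close> is
    the one in \<open>split_mass_le_variance\<close>, and the exponential is the squared modulus of
    the factor in \<open>conv_damped\<close>.\<close>
  define G where "G S r = ennreal (S * exp (- (2 * y) * S))" for S r :: real
  \<comment> \<open>For \<open>r\<close> and \<open>s\<close> in \<open>K\<close> the sum lies
    between \<open>2 * r0 / 15\<close> and \<open>30 * r0\<close>, so the exponent
    \<open>2 * y * (r + s)\<close> is at most 60. This is the origin of
    \<open>exp (- 60)\<close>.\<close>
  define m0 where "m0 = 2 * r0 / 15 * exp (- 60)"
  have m00: "m0 > 0" using r0 by (simp add: m0_def)
  have lower: "ennreal (m0 / 4) \<le> m G"
  proof -
    have "ennreal (m0 / 4) = ennreal (1 / 2) * (ennreal m0 * ennreal (1 / 2))"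
    proof -
      have eq: "m0 / 4 = 1 / 2 * (m0 * (1 / 2))" by simp
      have m0': "0 \<le> m0" "0 \<le> (1 / 2 :: real)" using m00 by auto
      show ?thesis by (subst eq) (simp only: ennreal_mult' m0')
    qed
    also have "\<dots> \<le> (\<integral>\<^sup>+r. \<psi> r * indicator K r \<partial>half_line) * (ennreal m0 * (\<integral>\<^sup>+s. \<psi> s * indicator K s \<partial>half_line))"
      by (intro mult_mono massK) auto
    also have "\<dots> = (\<integral>\<^sup>+r. \<psi> r * indicator K r * (\<integral>\<^sup>+s. ennreal m0 * (\<psi> s * indicator K s) \<partial>half_line) \<partial>half_line)"
      by (subst nn_integral_multc, measurable, subst nn_integral_cmult, measurable)
    also have "\<dots> \<le> (\<integral>\<^sup>+r. \<psi> r * (\<integral>\<^sup>+s. G (r + s) r * \<psi> s \<partial>half_line) \<partial>half_line)"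
    proof (rule nn_integral_mono)
      fix r
      show "\<psi> r * indicator K r * (\<integral>\<^sup>+s. ennreal m0 * (\<psi> s * indicator K s) \<partial>half_line) \<le> \<psi> r * (\<integral>\<^sup>+s. G (r + s) r * \<psi> s \<partial>half_line)"
      proof (cases "r \<in> K")
        case True
        have "(\<integral>\<^sup>+s. ennreal m0 * (\<psi> s * indicator K s) \<partial>half_line) \<le> (\<integral>\<^sup>+s. G (r + s) r * \<psi> s \<partial>half_line)"
        proof (rule nn_integral_mono)
          fix s
          show "ennreal m0 * (\<psi> s * indicator K s) \<le> G (r + s) r * \<psi> s"
          proof (cases "s \<in> K")
            case sK: True
            have "m0 \<le> (r + s) * exp (- (2 * y) * (r + s))"
              unfolding m0_def
            proof (rule mult_mono)
              show "2 * r0 / 15 \<le> r + s" using True sK by (simp add: K_def)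
              have "r + s \<le> 30 * r0" using True sK by (simp add: K_def)
              then have "2 * y * (r + s) \<le> 60" using r0 by (simp add: y_def field_simps)
              then show "exp (- 60) \<le> exp (- (2 * y) * (r + s))" by simp
              show "0 \<le> r + s" using True sK r0(1) by (auto simp: K_def)
            qed simp
            then show ?thesis using sK by (simp add: G_def ennreal_leI mult_right_mono)
          qed simp
        qed
        then show ?thesis using True by (simp add: mult_left_mono)
      qed simp
    qed
    also have "\<dots> = m G"
      unfolding m_def \<psi>_def by (rule nn_integral_split_mass[symmetric]) (unfold G_def, measurable)
    finally show ?thesis .
  qed
  show ?thesis
  proof (rule ccontr)
    assume no: "\<not> ?thesis"
    \<comment> \<open>The negated goal, read as a uniform bound for the Laplace transform on the
      line \<open>Re z = y\<close>.\<close>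
    define M where "M = exp (- 60) / 120 / y"
    have M: "(cmod (laplace (Complex y \<tau>)))\<^sup>2 \<le> M" for \<tau>
    proof -
      have "y * (cmod (laplace (Complex y \<tau>)))\<^sup>2 < exp (- 60) / 120"
        using no y by (metis complex.sel(1) not_le)
      then show ?thesis using y by (simp add: M_def field_simps)
    qed
    define c where "c = conv (damped y) (damped y)"
    have cs: "sqint lborel c" unfolding c_def using y by (intro conv_damped_sqint) simp
    have cn: "(nrm2 lborel c)\<^sup>2 \<le> M"
      using conv_damped_norm_le[of y M] M y N unfolding c_def by simp
    have [measurable]: "c \<in> borel_measurable borel" using cs by (simp add: sqint_def)
    have "m G \<le> (\<integral>\<^sup>+S. ennreal (1 / y) * (ennreal (1 / S) * slice_defect \<phi> S * indicator {0<..} S) + 2 * ennreal ((cmod (c S))\<^sup>2) \<partial>lborel)"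
      unfolding m_def
    proof (rule nn_integral_mono)
      fix S :: real
      show "(\<integral>\<^sup>+r. G S r * ennreal ((cmod (split_prod \<phi> S r))\<^sup>2) * indicator {0<..<S} r \<partial>lborel)
        \<le> ennreal (1 / y) * (ennreal (1 / S) * slice_defect \<phi> S * indicator {0<..} S) + 2 * ennreal ((cmod (c S))\<^sup>2)"
      proof (cases "S > 0")
        case False
        have "(\<integral>\<^sup>+r. G S r * ennreal ((cmod (split_prod \<phi> S r))\<^sup>2) * indicator {0<..<S} r \<partial>lborel) = (\<integral>\<^sup>+(r::real). 0 \<partial>lborel)"
          by (rule nn_integral_cong) (use False in \<open>auto split: split_indicator\<close>)
        then show ?thesis by simp
      next
        case True
        define x where "x = exp (- (2 * y) * S)"
        have x0: "x > 0" by (simp add: x_def)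
        have "(\<integral>\<^sup>+r. G S r * ennreal ((cmod (split_prod \<phi> S r))\<^sup>2) * indicator {0<..<S} r \<partial>lborel) = ennreal (S * x) * split_mass S"
          unfolding split_mass_def G_def x_def[symmetric] by (subst nn_integral_cmult[symmetric]) (auto simp: mult.assoc)
        also have "\<dots> = ennreal x * (ennreal S * split_mass S)"
          using True x0 by (simp add: ennreal_mult mult_ac)
        also have "\<dots> \<le> ennreal x * (2 * slice_defect \<phi> S + 2 * ennreal ((cmod (split_integral S))\<^sup>2))"
          by (intro mult_left_mono split_mass_le_variance True) simp
        also have "\<dots> = (ennreal x * 2) * slice_defect \<phi> S + 2 * (ennreal x * ennreal ((cmod (split_integral S))\<^sup>2))"
          by (simp only: distrib_left mult_ac)
        also have "ennreal x * ennreal ((cmod (split_integral S))\<^sup>2) = ennreal ((cmod (c S))\<^sup>2)"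
        proof -
          have "(cmod (c S))\<^sup>2 = (exp (- (y * S)))\<^sup>2 * (cmod (split_integral S))\<^sup>2"
            unfolding c_def conv_damped split_integral_def[symmetric] by (simp add: norm_mult power_mult_distrib)
          also have "(exp (- (y * S)))\<^sup>2 = x" by (simp add: x_def exp_double[symmetric])
          finally show ?thesis using x0 by (simp add: ennreal_mult)
        qed
        also have "(ennreal x * 2) * slice_defect \<phi> S \<le> (ennreal (1 / y) * ennreal (1 / S)) * slice_defect \<phi> S"
        proof (rule mult_right_mono)
          have m: "ennreal (1 / y * (1 / S)) = ennreal (1 / y) * ennreal (1 / S)"
            using y True by (intro ennreal_mult) auto
          \<comment> \<open>This is \<open>t * exp (- t) \<le> 1\<close> at
            \<open>t = 2 * y * S\<close>; it trades the exponential for the weight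
            \<open>1 / S\<close> in \<open>defect\<close>.\<close>
          have "x * 2 \<le> 1 / y * (1 / S)"
          proof -
            have "2 * y * S \<le> exp (2 * y * S)"
              using exp_ge_add_one_self[of "2 * y * S"] by linarith
            then have "2 * y * S * x \<le> exp (2 * y * S) * x" using x0 by (intro mult_right_mono) auto
            also have "exp (2 * y * S) * x = 1" by (simp add: x_def exp_minus)
            finally show ?thesis using y True by (simp add: field_simps)
          qed
          then have "ennreal (x * 2) \<le> ennreal (1 / y * (1 / S))" by (rule ennreal_leI)
          then show "ennreal x * 2 \<le> ennreal (1 / y) * ennreal (1 / S)" unfolding m using x0 by (simp add: ennreal_mult)
        qed simp
        finally show ?thesis using True by (simp add: mult.assoc add_right_mono)
      qed
    qed
    also have "\<dots> = ennreal (1 / y) * defect \<phi> + 2 * ennreal ((nrm2 lborel c)\<^sup>2)"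
      unfolding defect_def nn_integral_sqint[OF cs, symmetric]
      by (subst nn_integral_add, measurable, subst nn_integral_cmult, measurable, subst nn_integral_cmult, measurable)
    also have "\<dots> \<le> ennreal (1 / y) * ennreal d + 2 * ennreal M"
      by (intro add_mono mult_left_mono D ennreal_leI cn) auto
    also have "\<dots> = ennreal (d / y + 2 * M)"
    proof -
      have M0: "0 \<le> M" using y by (simp add: M_def)
      have 1: "ennreal (1 / y * d) = ennreal (1 / y) * ennreal d" by (rule ennreal_mult) (use y d0 in auto)
      have 2: "ennreal (2 * M) = ennreal 2 * ennreal M" by (rule ennreal_mult) (use M0 in auto)
      have "ennreal (d / y + 2 * M) = ennreal (1 / y * d) + ennreal (2 * M)"
        using y d0 M0 by (subst ennreal_plus[symmetric]) auto
      then show ?thesis unfolding 1 2 by simp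
    qed
    finally have "ennreal (m0 / 4) \<le> ennreal (d / y + 2 * M)" using lower by (rule order_trans[rotated])
    then have "m0 / 4 \<le> d / y + 2 * M"
      using y d0 by (subst (asm) ennreal_le_iff) (auto simp: M_def)
    \<comment> \<open>With \<open>q = exp (- 60) / 120\<close> the left side is
      \<open>4 * q\<close>, whereas the right side is \<open>d + 2 * q\<close>, at most
      \<open>3 * q\<close>. The denominator 120 leaves just this room.\<close>
    then have "y * (m0 / 4) \<le> y * (d / y + 2 * M)" using y by (intro mult_left_mono) auto
    moreover have "y * (m0 / 4) = exp (- 60) / 30" using r0 by (simp add: y_def m0_def)
    moreover have "y * (d / y + 2 * M) = d + 2 * (exp (- 60) / 120)" using y by (simp add: M_def distrib_left)
    ultimately have "exp (- 60) / 30 \<le> 3 * (exp (- 60 :: real) / 120)" using d by linarith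
    moreover have "exp (- 60 :: real) > 0" by simp
    ultimately show False by linarith
  qed
qed

end

text \<open>The first entry covers a large defect, with \<open>a = 0\<close>; the second is the constant of
  \<open>near_exponential\<close> for the lower bound \<open>exp (- 60) / 120\<close> of \<open>laplace_large\<close>.\<close>

definition stab_const :: real where
  "stab_const = max (120 * exp 60) ((4 / (exp (- 60) / 120) * (1 + 4 / (exp (- 60) / 120)\<^sup>2))\<^sup>2)"

lemma stab_const_pos: "stab_const > 0"
  by (simp add: stab_const_def less_max_iff_disj)

lemma (in profile) stability_normalized:
  assumes N: "nrm2 half_line \<phi> = 1" and D: "defect \<phi> \<le> ennreal d" and d0: "d \<ge> 0"
  shows "\<exists>a b. Re b > 0 \<and> (nrm2 half_line (\<lambda>r. \<phi> r - a * exp (- b * complex_of_real r)))\<^sup>2 \<le> stab_const * d"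
proof (cases "d \<le> exp (- 60) / 120")
  case True
  obtain z where z: "Re z > 0" "Re z * (cmod (laplace z))\<^sup>2 \<ge> exp (- 60) / 120"
    using laplace_large[OF N D d0 True] by blast
  define k :: real where "k = exp (- 60) / 120"
  have k: "k > 0" by (simp add: k_def)
  obtain a b where ab: "Re b > 0" "nrm2 half_line (\<lambda>r. \<phi> r - a * exp (- b * complex_of_real r)) \<le> 4 / k * (1 + 4 / k\<^sup>2) * sqrt d"
    using near_exponential[OF N D d0 k z(1)] z(2) unfolding k_def by blast
  have "(nrm2 half_line (\<lambda>r. \<phi> r - a * exp (- b * complex_of_real r)))\<^sup>2 \<le> (4 / k * (1 + 4 / k\<^sup>2) * sqrt d)\<^sup>2"
    by (intro power_mono ab) simp
  also have "\<dots> = (4 / k * (1 + 4 / k\<^sup>2))\<^sup>2 * d"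
    unfolding power_mult_distrib[of _ "sqrt d"] using d0 by simp
  also have "\<dots> \<le> stab_const * d"
    unfolding stab_const_def k_def using d0 by (intro mult_right_mono) auto
  finally show ?thesis using ab(1) by blast
next
  case False
  have "(nrm2 half_line (\<lambda>r. \<phi> r - 0 * exp (- 1 * complex_of_real r)))\<^sup>2 = 1" using N by simp
  also have "1 \<le> 120 * exp 60 * d"
  proof -
    have "120 * exp 60 * (exp (- 60) / 120) \<le> 120 * exp 60 * d"
      using False by (intro mult_left_mono) auto
    moreover have "exp 60 * exp (- 60) = (1::real)" by (simp flip: exp_add)
    ultimately show ?thesis by simp
  qed
  also have "\<dots> \<le> stab_const * d"
    unfolding stab_const_def using d0 by (intro mult_right_mono) auto
  finally show ?thesis by (intro exI[of _ 0] exI[of _ 1]) simp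
qed

section \<open>Averages over arcs\<close>

text \<open>Up to the factor \<open>pi\<close>, the law of one coordinate of a uniformly distributed
  point on the circle of radius \<open>sqrt c\<close>.\<close>

definition arcsine_density :: "real \<Rightarrow> real \<Rightarrow> real" where
  "arcsine_density c x = (if x\<^sup>2 < c then 1 / sqrt (c - x\<^sup>2) else 0)"

lemma arcsine_density_nonneg [simp]: "arcsine_density c x \<ge> 0"
  by (simp add: arcsine_density_def)

lemma arcsine_density_measurable [measurable]:
  assumes [measurable]: "f \<in> borel_measurable M" "g \<in> borel_measurable M"
  shows "(\<lambda>p. arcsine_density (f p) (g p)) \<in> borel_measurable M"
  unfolding arcsine_density_def by measurable

lemma arcsine_density_integral:
  assumes c: "c > 0"
  shows "(\<integral>\<^sup>+x. ennreal (arcsine_density c x) \<partial>lborel) = ennreal pi"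
    and "integrable lborel (arcsine_density c)" "(\<integral>x. arcsine_density c x \<partial>lborel) = pi"
proof -
  define s where "s = sqrt c"
  have s: "s > 0" "s\<^sup>2 = c" using c by (auto simp: s_def)
  have out: "arcsine_density c x = 0" if "x \<notin> {-s..s}" for x
  proof -
    have "\<not> x\<^sup>2 < s\<^sup>2"
      using that s(1) abs_le_square_iff[of s x] by auto
    then show ?thesis using s by (simp add: arcsine_density_def)
  qed
  have "(\<integral>\<^sup>+x. ennreal (arcsine_density c x) \<partial>lborel) = (\<integral>\<^sup>+x. ennreal (arcsine_density c x) * indicator {s * sin (- (pi / 2))..s * sin (pi / 2)} x \<partial>lborel)"
    by (intro nn_integral_cong) (use out in \<open>auto split: split_indicator\<close>)
  also have "\<dots> = (\<integral>\<^sup>+\<theta>. ennreal (arcsine_density c (s * sin \<theta>)) * ennreal (s * cos \<theta>) * indicator {- (pi / 2)..pi / 2} \<theta> \<partial>lborel)"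
  proof (rule nn_integral_substitution_aux)
    show "((\<lambda>\<theta>. s * sin \<theta>) has_real_derivative s * cos x) (at x)" for x
      by (auto intro!: derivative_eq_intros)
    show "0 \<le> s * cos x" if "x \<in> {- (pi / 2)..pi / 2}" for x
      using that s by (auto intro!: mult_nonneg_nonneg cos_ge_zero)
  qed (use pi_gt_zero in \<open>auto intro!: continuous_intros\<close>)
  \<comment> \<open>At the two endpoints the cosine vanishes and the product is 0 instead of 1; they
    form a null set.\<close>
  also have "\<dots> = (\<integral>\<^sup>+\<theta>. indicator {- (pi / 2)..pi / 2} \<theta> \<partial>lborel)"
  proof (rule nn_integral_cong_AE, rule AE_I[of _ _ "{- (pi/2), pi/2}"])
    show "{\<theta> \<in> space lborel. \<not> ennreal (arcsine_density c (s * sin \<theta>)) * ennreal (s * cos \<theta>) * indicator {- (pi / 2)..pi / 2} \<theta> = indicator {- (pi / 2)..pi / 2} \<theta>} \<subseteq> {- (pi/2), pi/2}"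
    proof (rule subsetI, rule ccontr)
      fix \<theta> assume "\<theta> \<in> {\<theta> \<in> space lborel. \<not> ennreal (arcsine_density c (s * sin \<theta>)) * ennreal (s * cos \<theta>) * indicator {- (pi / 2)..pi / 2} \<theta> = indicator {- (pi / 2)..pi / 2} \<theta>}"
        "\<theta> \<notin> {- (pi/2), pi/2}"
      then have *: "ennreal (arcsine_density c (s * sin \<theta>)) * ennreal (s * cos \<theta>) * indicator {- (pi / 2)..pi / 2} \<theta> \<noteq> indicator {- (pi / 2)..pi / 2} \<theta>" "\<theta> \<noteq> pi / 2" "\<theta> \<noteq> - (pi/2)"
        by auto
      have "arcsine_density c (s * sin \<theta>) * (s * cos \<theta>) = 1" if t: "- (pi/2) < \<theta>" "\<theta> < pi / 2"
      proof -
        have cp: "cos \<theta> > 0" using t by (intro cos_gt_zero_pi) auto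
        have e: "c - (s * sin \<theta>)\<^sup>2 = (s * cos \<theta>)\<^sup>2"
          using s by (simp add: power_mult_distrib cos_squared_eq right_diff_distrib)
        moreover have "(s * cos \<theta>)\<^sup>2 > 0" using cp s by simp
        ultimately have "(s * sin \<theta>)\<^sup>2 < c" by linarith
        then show ?thesis unfolding arcsine_density_def e using cp s by simp
      qed
      then have "ennreal (arcsine_density c (s * sin \<theta>)) * ennreal (s * cos \<theta>) = 1" if "- (pi/2) < \<theta>" "\<theta> < pi / 2"
        using that by (metis ennreal_1 ennreal_mult' arcsine_density_nonneg)
      then show False using * by (auto split: split_indicator_asm)
    qed
    show "emeasure lborel {- (pi/2), pi/2} = 0"
      by (rule emeasure_lborel_countable) simp
  qed auto
  also have "\<dots> = ennreal pi" by simp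
  finally show *: "(\<integral>\<^sup>+x. ennreal (arcsine_density c x) \<partial>lborel) = ennreal pi" .
  show "integrable lborel (arcsine_density c)"
    by (rule integrableI_bounded) (use * in auto)
  show "(\<integral>x. arcsine_density c x \<partial>lborel) = pi"
    using * by (subst integral_eq_nn_integral) auto
qed

text \<open>The substitution \<open>u = b\<^sup>2\<close> on positive \<open>b\<close> has Jacobian
  \<open>2 * b\<close>, and its factor 2 accounts for the negative \<open>b\<close>. It is carried
  out on compact intervals, which monotone convergence exhausts.\<close>

lemma nn_integral_square:
  fixes h :: "real \<Rightarrow> ennreal"
  assumes [measurable]: "h \<in> borel_measurable borel"
  shows "(\<integral>\<^sup>+b. h (b\<^sup>2) \<partial>lborel) = (\<integral>\<^sup>+u. h u * ennreal (1 / sqrt u) * indicator {0<..} u \<partial>lborel)"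
proof -
  define f where "f u = h u * ennreal (1 / sqrt u) * indicator {0<..} u" for u
  have [measurable]: "f \<in> borel_measurable borel" unfolding f_def[abs_def] by measurable
  have step: "(\<integral>\<^sup>+u. f u * indicator {0..(real (Suc n))\<^sup>2} u \<partial>lborel) = (\<integral>\<^sup>+b. 2 * h (b\<^sup>2) * indicator {0<..} b * indicator {0..real (Suc n)} b \<partial>lborel)" for n
  proof -
    have "(\<integral>\<^sup>+u. f u * indicator {0\<^sup>2..(real (Suc n))\<^sup>2} u \<partial>lborel) = (\<integral>\<^sup>+b. f (b\<^sup>2) * ennreal (2 * b) * indicator {0..real (Suc n)} b \<partial>lborel)"
      by (rule nn_integral_substitution_aux) (auto intro!: derivative_eq_intros continuous_intros)
    also have "\<dots> = (\<integral>\<^sup>+b. 2 * h (b\<^sup>2) * indicator {0<..} b * indicator {0..real (Suc n)} b \<partial>lborel)"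
    proof (intro nn_integral_cong)
      fix b :: real
      show "f (b\<^sup>2) * ennreal (2 * b) * indicator {0..real (Suc n)} b = 2 * h (b\<^sup>2) * indicator {0<..} b * indicator {0..real (Suc n)} b"
      proof (cases "b > 0")
        case True
        have "ennreal (1 / b) * ennreal (2 * b) = ennreal (1 / b * (2 * b))"
          using True by (intro ennreal_mult[symmetric]) auto
        also have "\<dots> = 2" using True by simp
        finally have eq: "ennreal (1 / b) * ennreal (2 * b) = 2" .
        have "f (b\<^sup>2) * ennreal (2 * b) * indicator {0..real (Suc n)} b = (ennreal (1 / b) * ennreal (2 * b)) * (h (b\<^sup>2) * indicator {0..real (Suc n)} b)"
          using True by (simp add: f_def mult_ac)
        then show ?thesis unfolding eq using True by (simp add: mult.assoc)
      next
        case False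
        then show ?thesis by (cases "b = 0") (auto simp: f_def)
      qed
    qed
    finally show ?thesis by simp
  qed
  have "(\<integral>\<^sup>+u. f u \<partial>lborel) = (SUP n. \<integral>\<^sup>+u. f u * indicator {0..(real (Suc n))\<^sup>2} u \<partial>lborel)"
  proof -
    have "(\<integral>\<^sup>+u. (SUP n. f u * indicator {0..(real (Suc n))\<^sup>2} u) \<partial>lborel) = (SUP n. \<integral>\<^sup>+u. f u * indicator {0..(real (Suc n))\<^sup>2} u \<partial>lborel)"
      by (rule nn_integral_monotone_convergence_SUP)
         (auto intro!: incseq_SucI le_funI mult_left_mono split: split_indicator elim!: order_trans power_mono)
    moreover have "(SUP n. f u * indicator {0..(real (Suc n))\<^sup>2} u) = f u" for u
    proof (rule antisym)
      show "(SUP n. f u * indicator {0..(real (Suc n))\<^sup>2} u) \<le> f u"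
        by (rule SUP_least) (auto split: split_indicator)
      show "f u \<le> (SUP n. f u * indicator {0..(real (Suc n))\<^sup>2} u)"
      proof (cases "u > 0")
        case True
        obtain n where n: "u \<le> real n" using real_arch_simple by blast
        have "real n * 1 \<le> real (Suc n) * real (Suc n)" by (intro mult_mono) auto
        then have "u \<le> (real (Suc n))\<^sup>2" using n by (simp add: power2_eq_square)
        then show ?thesis using True by (intro SUP_upper2[of n]) auto
      qed (simp add: f_def)
    qed
    ultimately show ?thesis by simp
  qed
  also have "\<dots> = (SUP n. \<integral>\<^sup>+b. 2 * h (b\<^sup>2) * indicator {0<..} b * indicator {0..real (Suc n)} b \<partial>lborel)"
    unfolding step ..
  also have "\<dots> = (\<integral>\<^sup>+b. 2 * h (b\<^sup>2) * indicator {0<..} b \<partial>lborel)"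
  proof -
    define k where "k b = 2 * h (b\<^sup>2) * indicator {0<..} b" for b
    have [measurable]: "k \<in> borel_measurable borel" unfolding k_def[abs_def] by measurable
    have "(\<integral>\<^sup>+u. (SUP n. k u * indicator {0..real (Suc n)} u) \<partial>lborel) = (SUP n. \<integral>\<^sup>+u. k u * indicator {0..real (Suc n)} u \<partial>lborel)"
      by (rule nn_integral_monotone_convergence_SUP)
         (auto intro!: incseq_SucI le_funI mult_left_mono split: split_indicator)
    moreover have "(SUP n. k u * indicator {0..real (Suc n)} u) = k u" for u
    proof (rule antisym)
      show "(SUP n. k u * indicator {0..real (Suc n)} u) \<le> k u"
        by (rule SUP_least) (auto split: split_indicator)
      show "k u \<le> (SUP n. k u * indicator {0..real (Suc n)} u)"
      proof (cases "u > 0")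
        case True
        obtain n where n: "u \<le> real n" using real_arch_simple by blast
        then show ?thesis using True by (intro SUP_upper2[of n]) auto
      qed (simp add: k_def)
    qed
    ultimately show ?thesis unfolding k_def by simp
  qed
  also have "\<dots> = 2 * (\<integral>\<^sup>+b. h (b\<^sup>2) * indicator {0<..} b \<partial>lborel)"
    by (subst nn_integral_cmult[symmetric]) (auto simp: mult.assoc)
  also have "\<dots> = (\<integral>\<^sup>+b. h (b\<^sup>2) * indicator {0<..} b \<partial>lborel) + (\<integral>\<^sup>+b. h (b\<^sup>2) * indicator {0<..} (- b) \<partial>lborel)"
    using nn_integral_affine[of "\<lambda>b::real. h (b\<^sup>2) * indicator {0<..} b" "-1" 0] by (simp add: mult_2)
  also have "\<dots> = (\<integral>\<^sup>+b. h (b\<^sup>2) * indicator {0<..} b + h (b\<^sup>2) * indicator {0<..} (- b) \<partial>lborel)"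
    by (rule nn_integral_add[symmetric]) measurable
  also have "\<dots> = (\<integral>\<^sup>+b. h (b\<^sup>2) \<partial>lborel)"
    by (rule nn_integral_cong_AE, rule AE_I[of _ _ "{0}"]) (auto split: split_indicator)
  finally show ?thesis unfolding f_def by simp
qed

section \<open>Coordinates on the plane adapted to a fixed vector\<close>

definition pair_to_vec :: "real \<times> real \<Rightarrow> real^2" where
  "pair_to_vec p = vector [fst p, snd p]"

lemma pair_to_vec_measurable [measurable]: "pair_to_vec \<in> borel_measurable borel"
proof -
  have "continuous_on UNIV pair_to_vec"
    unfolding pair_to_vec_def[abs_def]
    by (rule continuous_on_componentwise[THEN iffD2]) (auto simp: Basis_vec_def inner_axis forall_2 exhaust_2 intro!: continuous_intros)
  then show ?thesis by (rule borel_measurable_continuous_onI)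
qed

lemma distr_pair_to_vec: "distr lborel borel pair_to_vec = (lborel :: (real^2) measure)"
proof (rule lborel_eqI[symmetric])
  fix l u :: "real^2"
  assume le: "\<And>b. b \<in> Basis \<Longrightarrow> l \<bullet> b \<le> u \<bullet> b"
  have B2: "(Basis :: (real^2) set) = {axis 1 1, axis 2 1}"
    by (auto simp: Basis_vec_def UNIV_2)
  have ne: "axis 1 1 \<noteq> (axis 2 1 :: real^2)" by (simp add: axis_eq_axis)
  have le': "l $ 1 \<le> u $ 1" "l $ 2 \<le> u $ 2" using le[of "axis 1 1"] le[of "axis 2 1"] by (auto simp: B2 inner_axis)
  have "pair_to_vec -` box l u = box (l $ 1, l $ 2) (u $ 1, u $ 2)"
    by (auto simp: pair_to_vec_def box_def B2 inner_axis Basis_prod_def)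
  then have "emeasure (distr lborel borel pair_to_vec) (box l u) = emeasure lborel (box (l $ 1, l $ 2) (u $ 1, u $ 2))"
    by (subst emeasure_distr) auto
  also have "\<dots> = ennreal (\<Prod>b\<in>Basis. ((u $ 1, u $ 2) - (l $ 1, l $ 2)) \<bullet> b)"
    using le' by (intro emeasure_lborel_box) (auto simp: Basis_prod_def)
  also have "(\<Prod>b\<in>Basis. ((u $ 1, u $ 2) - (l $ 1, l $ 2)) \<bullet> b) = (\<Prod>b\<in>Basis. (u - l) \<bullet> b)"
    using ne by (simp add: Basis_prod_def B2 inner_axis)
  finally show "emeasure (distr lborel borel pair_to_vec) (box l u) = ennreal (\<Prod>b\<in>Basis. (u - l) \<bullet> b)" .
qed simp

lemma nn_integral_pair_to_vec:
  fixes f :: "real^2 \<Rightarrow> ennreal"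
  assumes [measurable]: "f \<in> borel_measurable borel"
  shows "(\<integral>\<^sup>+q. f q \<partial>lborel) = (\<integral>\<^sup>+a. \<integral>\<^sup>+b. f (pair_to_vec (a, b)) \<partial>lborel \<partial>lborel)"
proof -
  have "(\<integral>\<^sup>+q. f q \<partial>lborel) = (\<integral>\<^sup>+p. f (pair_to_vec p) \<partial>lborel)"
    by (subst distr_pair_to_vec[symmetric], subst nn_integral_distr) auto
  also have "\<dots> = (\<integral>\<^sup>+a. \<integral>\<^sup>+b. f (pair_to_vec (a, b)) \<partial>lborel \<partial>lborel)"
  proof -
    have "(\<lambda>p. f (pair_to_vec p)) \<in> borel_measurable (borel \<Otimes>\<^sub>M borel)"
      unfolding borel_prod by measurable
    then have "(\<lambda>p. f (pair_to_vec p)) \<in> borel_measurable (lborel \<Otimes>\<^sub>M lborel)" by simp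
    from lborel.nn_integral_fst[OF this] show ?thesis by (simp add: lborel_prod)
  qed
  finally show ?thesis .
qed

lemma distr_orthogonal:
  fixes T :: "real^2 \<Rightarrow> real^2"
  assumes T: "orthogonal_transformation T"
  shows "distr lborel borel T = lborel"
proof (rule lborel_eqI[symmetric])
  have lin: "linear T" using T by (rule orthogonal_transformation_linear)
  have cont: "continuous_on UNIV T" using lin by (rule linear_continuous_on[OF linear_conv_bounded_linear[THEN iffD1]])
  have [measurable]: "T \<in> borel_measurable borel" using cont by (rule borel_measurable_continuous_onI)
  have bij: "bij T" using T by (rule orthogonal_transformation_bij)
  have iT: "orthogonal_transformation (inv T)" using T by (rule orthogonal_transformation_inv)
  fix l u :: "real^2"
  assume le: "\<And>b. b \<in> Basis \<Longrightarrow> l \<bullet> b \<le> u \<bullet> b"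
  have "emeasure (distr lborel borel T) (box l u) = emeasure lborel (T -` box l u)"
    by (subst emeasure_distr) auto
  also have "T -` box l u = inv T ` box l u" by (rule bij_vimage_eq_inv_image[OF bij])
  also have "emeasure lborel (inv T ` box l u) = emeasure lebesgue (inv T ` box l u)"
  proof -
    have "inv T ` box l u = T -` box l u" by (rule bij_vimage_eq_inv_image[OF bij, symmetric])
    moreover have "T -` box l u \<in> sets borel" using measurable_sets[of T borel borel "box l u"] by simp
    ultimately show ?thesis by simp
  qed
  also have "\<dots> = ennreal (measure lebesgue (inv T ` box l u))"
    using measurable_orthogonal_image[OF iT, of "box l u"] by (intro emeasure_eq_measure2) auto
  also have "measure lebesgue (inv T ` box l u) = measure lebesgue (box l u)"
    by (rule measure_orthogonal_image[OF iT]) auto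
  also have "ennreal (measure lebesgue (box l u)) = (\<Prod>b\<in>Basis. (u - l) \<bullet> b)"
    using le by (simp add: emeasure_eq_measure2[symmetric])
  finally show "emeasure (distr lborel borel T) (box l u) = ennreal (\<Prod>b\<in>Basis. (u - l) \<bullet> b)" .
qed simp

text \<open>For \<open>w = \<xi> + \<eta>\<close> and \<open>q = \<xi> - \<eta>\<close> the first
  entry is the difference of the squared norms of \<open>\<xi>\<close> and \<open>\<eta>\<close>,
  and the second is twice their sum minus the squared norm of \<open>w\<close>. A product of radial
  functions of \<open>\<xi>\<close> and \<open>\<eta>\<close> depends on \<open>q\<close> through
  these two numbers only.\<close>

definition inner_normsq :: "real^2 \<Rightarrow> real^2 \<Rightarrow> real \<times> real" where
  "inner_normsq w q = (w \<bullet> q, (norm q)\<^sup>2)"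

lemma inner_normsq_measurable [measurable]: "inner_normsq w \<in> measurable borel (borel \<Otimes>\<^sub>M borel)"
  unfolding inner_normsq_def[abs_def] by measurable

text \<open>The rotation \<open>T\<close> takes the first axis to the direction of \<open>w\<close>.
  Then \<open>x = m * a\<close> and \<open>\<rho> = a\<^sup>2 + b\<^sup>2\<close>, and for fixed
  \<open>a\<close> the substitution \<open>u = b\<^sup>2\<close> gives the density
  \<open>1 / sqrt u\<close>, where
  \<open>m\<^sup>2 * u = m\<^sup>2 * \<rho> - x\<^sup>2\<close>.\<close>

lemma nn_integral_inner_normsq:
  fixes g :: "real \<times> real \<Rightarrow> ennreal" and w :: "real^2"
  assumes g: "g \<in> borel_measurable (borel \<Otimes>\<^sub>M borel)" and w: "w \<noteq> 0"
  shows "(\<integral>\<^sup>+q. g (inner_normsq w q) \<partial>lborel) = (\<integral>\<^sup>+x. \<integral>\<^sup>+\<rho>. g (x, \<rho>) * ennreal (arcsine_density ((norm w)\<^sup>2 * \<rho>) x) \<partial>lborel \<partial>lborel)"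
proof -
  have gm[measurable]: "(\<lambda>p. g (a p, b p)) \<in> borel_measurable M"
    if [measurable]: "a \<in> borel_measurable M" "b \<in> borel_measurable M" for M :: "'b measure" and a b
  proof -
    have "(\<lambda>p. (a p, b p)) \<in> measurable M (borel \<Otimes>\<^sub>M borel)" by measurable
    from measurable_compose[OF this g] show ?thesis .
  qed
  define m where "m = norm w"
  have m: "m > 0" using w by (simp add: m_def)
  define c where "c = w $ 1 / m"
  define s where "s = w $ 2 / m"
  have mm: "m\<^sup>2 = (w $ 1)\<^sup>2 + (w $ 2)\<^sup>2"
    unfolding m_def power2_norm_eq_inner by (simp add: inner_vec_def sum_2 power2_eq_square)
  have cs: "c\<^sup>2 + s\<^sup>2 = 1"
  proof -
    have "c\<^sup>2 + s\<^sup>2 = m\<^sup>2 / m\<^sup>2"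
      unfolding mm by (simp add: c_def s_def power_divide add_divide_distrib[symmetric] mm)
    then show ?thesis using m by simp
  qed
  have wcs: "w $ 1 = m * c" "w $ 2 = m * s" using m by (auto simp: c_def s_def)
  define T :: "real^2 \<Rightarrow> real^2" where "T q = pair_to_vec (c * q $ 1 - s * q $ 2, s * q $ 1 + c * q $ 2)" for q
  have T1: "T q $ 1 = c * q $ 1 - s * q $ 2" "T q $ 2 = s * q $ 1 + c * q $ 2" for q
    by (simp_all add: T_def pair_to_vec_def)
  have innerT: "T p \<bullet> T q = p \<bullet> q" for p q
  proof -
    have "T p \<bullet> T q = (c * p $ 1 - s * p $ 2) * (c * q $ 1 - s * q $ 2) + (s * p $ 1 + c * p $ 2) * (s * q $ 1 + c * q $ 2)"
      by (simp add: inner_vec_def sum_2 T1)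
    also have "\<dots> = (c\<^sup>2 + s\<^sup>2) * (p $ 1 * q $ 1) + (c\<^sup>2 + s\<^sup>2) * (p $ 2 * q $ 2)"
      by (simp add: power2_eq_square algebra_simps)
    also have "\<dots> = p \<bullet> q" unfolding cs by (simp add: inner_vec_def sum_2)
    finally show ?thesis .
  qed
  have linT: "linear T"
    by (rule linearI) (simp_all add: vec_eq_iff forall_2 T1 algebra_simps)
  have oT: "orthogonal_transformation T"
    unfolding orthogonal_transformation_def using linT innerT by blast
  have [measurable]: "T \<in> borel_measurable borel"
    using linT by (intro borel_measurable_continuous_onI linear_continuous_on) (simp add: linear_conv_bounded_linear)
  have pfT: "inner_normsq w (T (pair_to_vec (a, b))) = (m * a, a\<^sup>2 + b\<^sup>2)" for a b
  proof -
    have "w \<bullet> T (pair_to_vec (a, b)) = m * c * (c * a - s * b) + m * s * (s * a + c * b)"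
      by (simp add: inner_vec_def sum_2 T1 wcs pair_to_vec_def)
    also have "\<dots> = m * a * (c\<^sup>2 + s\<^sup>2)" by (simp add: power2_eq_square algebra_simps)
    finally have 1: "w \<bullet> T (pair_to_vec (a, b)) = m * a" by (simp add: cs)
    have "(norm (T (pair_to_vec (a, b))))\<^sup>2 = pair_to_vec (a, b) \<bullet> pair_to_vec (a, b)"
      unfolding power2_norm_eq_inner by (rule innerT)
    also have "\<dots> = a\<^sup>2 + b\<^sup>2" by (simp add: inner_vec_def sum_2 pair_to_vec_def power2_eq_square)
    finally show ?thesis using 1 by (simp add: inner_normsq_def)
  qed
  have gpf[measurable]: "(\<lambda>q. g (inner_normsq w q)) \<in> borel_measurable borel"
    by (rule measurable_compose[OF inner_normsq_measurable g])
  have "(\<integral>\<^sup>+q. g (inner_normsq w q) \<partial>lborel) = (\<integral>\<^sup>+q. g (inner_normsq w (T q)) \<partial>lborel)"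
    by (subst distr_orthogonal[OF oT, symmetric], subst nn_integral_distr) auto
  also have "\<dots> = (\<integral>\<^sup>+a. \<integral>\<^sup>+b. g (m * a, a\<^sup>2 + b\<^sup>2) \<partial>lborel \<partial>lborel)"
    by (subst nn_integral_pair_to_vec) (simp_all add: pfT)
  also have "\<dots> = (\<integral>\<^sup>+a. \<integral>\<^sup>+\<rho>. g (m * a, \<rho>) * ennreal (m * arcsine_density (m\<^sup>2 * \<rho>) (m * a)) \<partial>lborel \<partial>lborel)"
  proof (rule nn_integral_cong)
    fix a :: real
    have "(\<integral>\<^sup>+b. g (m * a, a\<^sup>2 + b\<^sup>2) \<partial>lborel) = (\<integral>\<^sup>+u. g (m * a, a\<^sup>2 + u) * ennreal (1 / sqrt u) * indicator {0<..} u \<partial>lborel)"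
      by (rule nn_integral_square[where h="\<lambda>u. g (m * a, a\<^sup>2 + u)"]) measurable
    also have "\<dots> = (\<integral>\<^sup>+u. g (m * a, u + a\<^sup>2) * ennreal (m * arcsine_density (m\<^sup>2 * (u + a\<^sup>2)) (m * a)) \<partial>lborel)"
    proof (rule nn_integral_cong)
      fix u :: real
      have "m * arcsine_density (m\<^sup>2 * (u + a\<^sup>2)) (m * a) = (if u > 0 then 1 / sqrt u else 0)"
      proof -
        have "m\<^sup>2 * (u + a\<^sup>2) - (m * a)\<^sup>2 = m\<^sup>2 * u" by (simp add: power_mult_distrib algebra_simps)
        moreover have "(m * a)\<^sup>2 < m\<^sup>2 * (u + a\<^sup>2) \<longleftrightarrow> u > 0"
          using m by (simp add: power_mult_distrib)
        ultimately show ?thesis using m by (simp add: arcsine_density_def real_sqrt_mult)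
      qed
      then show "g (m * a, a\<^sup>2 + u) * ennreal (1 / sqrt u) * indicator {0<..} u = g (m * a, u + a\<^sup>2) * ennreal (m * arcsine_density (m\<^sup>2 * (u + a\<^sup>2)) (m * a))"
        by (simp add: add.commute)
    qed
    also have "\<dots> = (\<integral>\<^sup>+\<rho>. g (m * a, \<rho>) * ennreal (m * arcsine_density (m\<^sup>2 * \<rho>) (m * a)) \<partial>lborel)"
      by (rule nn_integral_real_translate[where f="\<lambda>\<rho>. g (m * a, \<rho>) * ennreal (m * arcsine_density (m\<^sup>2 * \<rho>) (m * a))"]) measurable
    finally show "(\<integral>\<^sup>+b. g (m * a, a\<^sup>2 + b\<^sup>2) \<partial>lborel) = (\<integral>\<^sup>+\<rho>. g (m * a, \<rho>) * ennreal (m * arcsine_density (m\<^sup>2 * \<rho>) (m * a)) \<partial>lborel)" .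
  qed
  also have "\<dots> = (\<integral>\<^sup>+a. ennreal m * (\<integral>\<^sup>+\<rho>. g (m * a, \<rho>) * ennreal (arcsine_density (m\<^sup>2 * \<rho>) (m * a)) \<partial>lborel) \<partial>lborel)"
    using m by (intro nn_integral_cong) (simp add: ennreal_mult mult.left_commute nn_integral_cmult)
  also have "\<dots> = ennreal m * (\<integral>\<^sup>+a. (\<integral>\<^sup>+\<rho>. g (m * a, \<rho>) * ennreal (arcsine_density (m\<^sup>2 * \<rho>) (m * a)) \<partial>lborel) \<partial>lborel)"
    by (rule nn_integral_cmult) measurable
  also have "\<dots> = (\<integral>\<^sup>+x. \<integral>\<^sup>+\<rho>. g (x, \<rho>) * ennreal (arcsine_density (m\<^sup>2 * \<rho>) x) \<partial>lborel \<partial>lborel)"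
    using nn_integral_affine[of "\<lambda>x::real. \<integral>\<^sup>+\<rho>. g (x, \<rho>) * ennreal (arcsine_density (m\<^sup>2 * \<rho>) x) \<partial>lborel" m 0] m by simp
  finally show ?thesis unfolding m_def .
qed

text \<open>As an identity of measures the formula extends to complex integrands, for which the
  oscillating phase of the evolution is needed.\<close>

lemma distr_inner_normsq:
  assumes w: "w \<noteq> 0"
  shows "distr lborel (borel \<Otimes>\<^sub>M borel) (inner_normsq w) = density (lborel \<Otimes>\<^sub>M lborel) (\<lambda>(x, \<rho>). ennreal (arcsine_density ((norm w)\<^sup>2 * \<rho>) x))"
proof (rule measure_eqI)
  fix A assume "A \<in> sets (distr lborel (borel \<Otimes>\<^sub>M borel) (inner_normsq w))"
  then have A[measurable]: "A \<in> sets (borel \<Otimes>\<^sub>M borel)" by simp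
  then have A'[measurable]: "A \<in> sets (lborel \<Otimes>\<^sub>M lborel)" by (metis sets_lborel sets_pair_measure_cong)
  have "emeasure (distr lborel (borel \<Otimes>\<^sub>M borel) (inner_normsq w)) A = (\<integral>\<^sup>+q. indicator A (inner_normsq w q) \<partial>lborel)"
    using A by (subst nn_integral_distr[of "inner_normsq w" lborel "borel \<Otimes>\<^sub>M borel" "indicator A", symmetric]) auto
  also have "\<dots> = (\<integral>\<^sup>+x. \<integral>\<^sup>+\<rho>. indicator A (x, \<rho>) * ennreal (arcsine_density ((norm w)\<^sup>2 * \<rho>) x) \<partial>lborel \<partial>lborel)"
    by (rule nn_integral_inner_normsq[OF _ w]) simp
  also have "\<dots> = (\<integral>\<^sup>+p. ennreal (arcsine_density ((norm w)\<^sup>2 * snd p) (fst p)) * indicator A p \<partial>(lborel \<Otimes>\<^sub>M lborel))"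
    by (subst lborel.nn_integral_fst[symmetric]) (auto simp: mult.commute)
  also have "\<dots> = emeasure (density (lborel \<Otimes>\<^sub>M lborel) (\<lambda>(x, \<rho>). ennreal (arcsine_density ((norm w)\<^sup>2 * \<rho>) x))) A"
    by (subst emeasure_density) (auto simp: case_prod_beta)
  finally show "emeasure (distr lborel (borel \<Otimes>\<^sub>M borel) (inner_normsq w)) A = emeasure (density (lborel \<Otimes>\<^sub>M lborel) (\<lambda>(x, \<rho>). ennreal (arcsine_density ((norm w)\<^sup>2 * \<rho>) x))) A" .
qed simp

lemma integral_inner_normsq:
  fixes g :: "real \<times> real \<Rightarrow> complex"
  assumes g[measurable]: "g \<in> borel_measurable (borel \<Otimes>\<^sub>M borel)" and w: "w \<noteq> 0"
    and int: "integrable lborel (\<lambda>q. g (inner_normsq w q))"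
  shows "integrable (lborel \<Otimes>\<^sub>M lborel) (\<lambda>(x, \<rho>). arcsine_density ((norm w)\<^sup>2 * \<rho>) x *\<^sub>R g (x, \<rho>))"
    and "(\<integral>q. g (inner_normsq w q) \<partial>lborel) = (\<integral>\<rho>. (\<integral>x. arcsine_density ((norm w)\<^sup>2 * \<rho>) x *\<^sub>R g (x, \<rho>) \<partial>lborel) \<partial>lborel)"
proof -
  have g'[measurable]: "g \<in> borel_measurable (lborel \<Otimes>\<^sub>M lborel)"
    using g by (metis measurable_cong_sets sets_lborel sets_pair_measure_cong)
  have 1: "integrable (distr lborel (borel \<Otimes>\<^sub>M borel) (inner_normsq w)) g"
    by (subst integrable_distr_eq) (use int in auto)
  have eq: "density (lborel \<Otimes>\<^sub>M lborel) (\<lambda>(x, \<rho>). ennreal (arcsine_density ((norm w)\<^sup>2 * \<rho>) x))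
    = density (lborel \<Otimes>\<^sub>M lborel) (\<lambda>p. ennreal (arcsine_density ((norm w)\<^sup>2 * snd p) (fst p)))"
    by (simp add: case_prod_beta')
  have 2: "integrable (lborel \<Otimes>\<^sub>M lborel) (\<lambda>p. arcsine_density ((norm w)\<^sup>2 * snd p) (fst p) *\<^sub>R g p)"
    using 1 unfolding distr_inner_normsq[OF w] eq by (subst (asm) integrable_density) auto
  then show 3: "integrable (lborel \<Otimes>\<^sub>M lborel) (\<lambda>(x, \<rho>). arcsine_density ((norm w)\<^sup>2 * \<rho>) x *\<^sub>R g (x, \<rho>))"
    by (simp add: case_prod_beta')
  have "(\<integral>q. g (inner_normsq w q) \<partial>lborel) = (\<integral>p. g p \<partial>distr lborel (borel \<Otimes>\<^sub>M borel) (inner_normsq w))"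
    by (subst integral_distr) auto
  also have "\<dots> = (\<integral>p. arcsine_density ((norm w)\<^sup>2 * snd p) (fst p) *\<^sub>R g p \<partial>(lborel \<Otimes>\<^sub>M lborel))"
    unfolding distr_inner_normsq[OF w] eq by (subst integral_density) auto
  also have "\<dots> = (\<integral>\<rho>. (\<integral>x. arcsine_density ((norm w)\<^sup>2 * \<rho>) x *\<^sub>R g (x, \<rho>) \<partial>lborel) \<partial>lborel)"
    using lborel_pair.integral_snd[OF 3] by (simp add: case_prod_beta')
  finally show "(\<integral>q. g (inner_normsq w q) \<partial>lborel) = (\<integral>\<rho>. (\<integral>x. arcsine_density ((norm w)\<^sup>2 * \<rho>) x *\<^sub>R g (x, \<rho>) \<partial>lborel) \<partial>lborel)" .
qed

text \<open>Integrating out the inner product with a unit vector leaves the mass \<open>pi\<close>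
  of the arcsine density: polar coordinates in the squared radius.\<close>

lemma nn_integral_radial:
  fixes g :: "real \<Rightarrow> ennreal"
  assumes [measurable]: "g \<in> borel_measurable borel"
  shows "(\<integral>\<^sup>+q. g ((norm (q::real^2))\<^sup>2) \<partial>lborel) = ennreal pi * (\<integral>\<^sup>+\<rho>. g \<rho> * indicator {0<..} \<rho> \<partial>lborel)"
proof -
  define w :: "real^2" where "w = axis 1 1"
  have w: "norm w = 1" "w \<noteq> 0" by (auto simp: w_def axis_eq_0_iff)
  have "(\<integral>\<^sup>+q. g ((norm (q::real^2))\<^sup>2) \<partial>lborel) = (\<integral>\<^sup>+q. g (snd (inner_normsq w q)) \<partial>lborel)"
    by (simp add: inner_normsq_def)
  also have "\<dots> = (\<integral>\<^sup>+x. \<integral>\<^sup>+\<rho>. g \<rho> * ennreal (arcsine_density \<rho> x) \<partial>lborel \<partial>lborel)"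
    by (subst nn_integral_inner_normsq[OF _ w(2)]) (auto simp: w(1))
  also have "\<dots> = (\<integral>\<^sup>+\<rho>. \<integral>\<^sup>+x. g \<rho> * ennreal (arcsine_density \<rho> x) \<partial>lborel \<partial>lborel)"
    by (rule lborel_pair.Fubini'[symmetric]) measurable
  also have "\<dots> = (\<integral>\<^sup>+\<rho>. ennreal pi * (g \<rho> * indicator {0<..} \<rho>) \<partial>lborel)"
  proof (rule nn_integral_cong)
    fix \<rho> :: real
    show "(\<integral>\<^sup>+x. g \<rho> * ennreal (arcsine_density \<rho> x) \<partial>lborel) = ennreal pi * (g \<rho> * indicator {0<..} \<rho>)"
    proof (cases "\<rho> > 0")
      case True
      then show ?thesis by (simp add: nn_integral_cmult arcsine_density_integral mult.commute)
    next
      case False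
      then have "arcsine_density \<rho> x = 0" for x
      proof -
        have "\<not> x\<^sup>2 < \<rho>" using False zero_le_power2[of x] by linarith
        then show ?thesis by (simp add: arcsine_density_def)
      qed
      then show ?thesis using False by simp
    qed
  qed
  also have "\<dots> = ennreal pi * (\<integral>\<^sup>+\<rho>. g \<rho> * indicator {0<..} \<rho> \<partial>lborel)"
    by (rule nn_integral_cmult) measurable
  finally show ?thesis .
qed

section \<open>Mean and variance of an average\<close>

lemma bounded_integrable_sqint:
  fixes f :: "'a \<Rightarrow> complex"
  assumes f: "integrable M f" and K: "\<And>x. cmod (f x) \<le> K"
  shows "sqint M f"
  unfolding sqint_def
proof
  have [measurable]: "f \<in> borel_measurable M" using f by (rule borel_measurable_integrable)
  show "f \<in> borel_measurable M" by measurable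
  show "integrable M (\<lambda>x. (cmod (f x))\<^sup>2)"
    by (rule Bochner_Integration.integrable_bound[OF integrable_mult_right[OF integrable_norm[OF f], of K]])
       (auto simp: power2_eq_square intro!: AE_I2 order_trans[OF mult_right_mono[OF K]] mult_right_mono)
qed

text \<open>Expanding the squared difference gives twice the mass times the second moment, minus
  twice the squared mean. Being an equality, it keeps the Cauchy-Schwarz constant and names what is
  lost. Boundedness of \<open>k\<close> where \<open>n\<close> is nonzero makes every term
  finite.\<close>

lemma variance_identity:
  fixes k :: "real \<Rightarrow> complex"
  assumes n: "integrable lborel n" "\<And>x. n x \<ge> (0::real)" "(\<integral>x. n x \<partial>lborel) = c"
    and k[measurable]: "k \<in> borel_measurable borel" and K: "\<And>x. n x \<noteq> 0 \<Longrightarrow> cmod (k x) \<le> K"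
  shows "ennreal ((cmod (\<integral>x. n x *\<^sub>R k x \<partial>lborel))\<^sup>2)
      + ennreal (1 / 2) * (\<integral>\<^sup>+x. \<integral>\<^sup>+x'. ennreal (n x) * ennreal (n x') * ennreal ((cmod (k x - k x'))\<^sup>2) \<partial>lborel \<partial>lborel)
    = ennreal c * (\<integral>\<^sup>+x. ennreal (n x) * ennreal ((cmod (k x))\<^sup>2) \<partial>lborel)"
proof -
  have [measurable]: "n \<in> borel_measurable borel" using n(1) by (auto dest: borel_measurable_integrable)
  have c0: "c \<ge> 0" using n(2,3) by (metis integral_nonneg_AE AE_I2)
  have i1: "integrable lborel (\<lambda>x. n x *\<^sub>R k x)"
  proof (rule Bochner_Integration.integrable_bound[OF integrable_mult_right[OF n(1), of K]])
    have "n x * cmod (k x) \<le> \<bar>K * n x\<bar>" for x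
    proof (cases "n x = 0")
      case False
      then have "cmod (k x) * n x \<le> K * n x" using K[of x] n(2)[of x] by (intro mult_right_mono) auto
      then show ?thesis by (simp add: mult.commute)
    qed simp
    then show "AE x in lborel. norm (n x *\<^sub>R k x) \<le> norm (K * n x)" using n(2) by (intro AE_I2) simp
  qed measurable
  have i2: "integrable lborel (\<lambda>x. n x * (cmod (k x))\<^sup>2)"
  proof (rule Bochner_Integration.integrable_bound[OF integrable_mult_right[OF n(1), of "K\<^sup>2"]])
    have "n x * (cmod (k x))\<^sup>2 \<le> \<bar>K\<^sup>2 * n x\<bar>" for x
    proof (cases "n x = 0")
      case False
      then have "(cmod (k x))\<^sup>2 * n x \<le> K\<^sup>2 * n x" using K[of x] n(2)[of x] by (intro mult_right_mono power_mono) auto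
      then show ?thesis by (simp add: mult.commute)
    qed simp
    then show "AE x in lborel. norm (n x * (cmod (k x))\<^sup>2) \<le> norm (K\<^sup>2 * n x)" using n(2) by (intro AE_I2) (simp add: abs_mult)
  qed measurable
  define m where "m = (\<integral>x. n x *\<^sub>R k x \<partial>lborel)"
  define q where "q = (\<integral>x. n x * (cmod (k x))\<^sup>2 \<partial>lborel)"
  have q0: "q \<ge> 0" unfolding q_def using n(2) by (intro integral_nonneg_AE AE_I2) simp
  define f where "f x x' = n x * (n x' * (cmod (k x - k x'))\<^sup>2)" for x x'
  have fe: "f x x' = n x * (n x' * (cmod (k x'))\<^sup>2) + (n x * (cmod (k x))\<^sup>2) * n x' - 2 * Re ((n x *\<^sub>R k x) * cnj (n x' *\<^sub>R k x'))" for x x'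
    unfolding f_def cmod_power2 by (simp add: power2_eq_square algebra_simps)
  have i1c: "integrable lborel (\<lambda>x. cnj (n x *\<^sub>R k x))" using i1 by (rule integrable_cnj)
  have iRe: "integrable lborel (\<lambda>x'. Re (a * cnj (n x' *\<^sub>R k x')))" for a
    by (rule integrable_Re[OF integrable_mult_right[OF i1c]])
  have inner: "integrable lborel (f x)" "(\<integral>x'. f x x' \<partial>lborel) = n x * q + (n x * (cmod (k x))\<^sup>2) * c - 2 * Re ((n x *\<^sub>R k x) * cnj m)" for x
  proof -
    show "integrable lborel (f x)"
      unfolding fe by (intro Bochner_Integration.integrable_diff Bochner_Integration.integrable_add integrable_mult_right i2 n(1) iRe)
    have "(\<integral>x'. f x x' \<partial>lborel) = (\<integral>x'. n x * (n x' * (cmod (k x'))\<^sup>2) \<partial>lborel) + (\<integral>x'. (n x * (cmod (k x))\<^sup>2) * n x' \<partial>lborel)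
      - (\<integral>x'. 2 * Re ((n x *\<^sub>R k x) * cnj (n x' *\<^sub>R k x')) \<partial>lborel)"
      unfolding fe
      by (subst Bochner_Integration.integral_diff, intro Bochner_Integration.integrable_add integrable_mult_right i2 n(1), intro integrable_mult_right iRe,
          subst Bochner_Integration.integral_add, intro integrable_mult_right i2, intro integrable_mult_right n(1)) (rule refl)
    also have "(\<integral>x'. 2 * Re ((n x *\<^sub>R k x) * cnj (n x' *\<^sub>R k x')) \<partial>lborel) = 2 * Re (\<integral>x'. (n x *\<^sub>R k x) * cnj (n x' *\<^sub>R k x') \<partial>lborel)"
      using integral_Re[OF integrable_mult_right[OF i1c, of "n x *\<^sub>R k x"]] by (simp only: integral_mult_right_zero)
    also have "(\<integral>x'. (n x *\<^sub>R k x) * cnj (n x' *\<^sub>R k x') \<partial>lborel) = (n x *\<^sub>R k x) * cnj m"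
      unfolding m_def Bochner_Integration.integral_cnj[symmetric] by (rule integral_mult_right_zero)
    finally show "(\<integral>x'. f x x' \<partial>lborel) = n x * q + (n x * (cmod (k x))\<^sup>2) * c - 2 * Re ((n x *\<^sub>R k x) * cnj m)"
      by (simp only: integral_mult_right_zero n(3) q_def)
  qed
  have iReo: "integrable lborel (\<lambda>x. Re ((n x *\<^sub>R k x) * cnj m))"
    by (rule integrable_Re[OF integrable_mult_left[OF i1]])
  have io: "integrable lborel (\<lambda>x. n x * q + (n x * (cmod (k x))\<^sup>2) * c - 2 * Re ((n x *\<^sub>R k x) * cnj m))"
    by (intro Bochner_Integration.integrable_diff Bochner_Integration.integrable_add integrable_mult_left integrable_mult_right i2 n(1) iReo)
  have "(\<integral>x. n x * q + (n x * (cmod (k x))\<^sup>2) * c - 2 * Re ((n x *\<^sub>R k x) * cnj m) \<partial>lborel)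
    = c * q + q * c - 2 * Re (m * cnj m)"
  proof -
    have "(\<integral>x. n x * q + (n x * (cmod (k x))\<^sup>2) * c - 2 * Re ((n x *\<^sub>R k x) * cnj m) \<partial>lborel)
      = (\<integral>x. n x * q \<partial>lborel) + (\<integral>x. (n x * (cmod (k x))\<^sup>2) * c \<partial>lborel) - (\<integral>x. 2 * Re ((n x *\<^sub>R k x) * cnj m) \<partial>lborel)"
      by (subst Bochner_Integration.integral_diff, intro Bochner_Integration.integrable_add integrable_mult_left i2 n(1), intro integrable_mult_right iReo,
          subst Bochner_Integration.integral_add, intro integrable_mult_left n(1), intro integrable_mult_left i2) (rule refl)
    also have "(\<integral>x. 2 * Re ((n x *\<^sub>R k x) * cnj m) \<partial>lborel) = 2 * Re (\<integral>x. (n x *\<^sub>R k x) * cnj m \<partial>lborel)"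
      using integral_Re[OF integrable_mult_left[OF i1, of "cnj m"]] by (simp only: integral_mult_right_zero)
    also have "(\<integral>x. (n x *\<^sub>R k x) * cnj m \<partial>lborel) = m * cnj m"
      unfolding m_def by (rule integral_mult_left_zero)
    finally show ?thesis by (simp only: integral_mult_left_zero n(3) q_def)
  qed
  moreover have "Re (m * cnj m) = (cmod m)\<^sup>2" unfolding cmod_power2 by (simp add: power2_eq_square)
  ultimately have outer: "(\<integral>x. (\<integral>x'. f x x' \<partial>lborel) \<partial>lborel) = 2 * c * q - 2 * (cmod m)\<^sup>2"
    unfolding inner(2) by simp
  have f0: "f x x' \<ge> 0" for x x' using n(2) by (simp add: f_def)
  have "(\<integral>\<^sup>+x. \<integral>\<^sup>+x'. ennreal (n x) * ennreal (n x') * ennreal ((cmod (k x - k x'))\<^sup>2) \<partial>lborel \<partial>lborel)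
    = (\<integral>\<^sup>+x. \<integral>\<^sup>+x'. ennreal (f x x') \<partial>lborel \<partial>lborel)"
    using n(2) by (intro nn_integral_cong) (simp add: f_def ennreal_mult mult.assoc)
  also have "\<dots> = (\<integral>\<^sup>+x. ennreal (\<integral>x'. f x x' \<partial>lborel) \<partial>lborel)"
    by (intro nn_integral_cong nn_integral_eq_integral inner) (use f0 in auto)
  also have "\<dots> = ennreal (2 * c * q - 2 * (cmod m)\<^sup>2)"
    unfolding outer[symmetric]
  proof (rule nn_integral_eq_integral)
    show "integrable lborel (\<lambda>x. \<integral>x'. f x x' \<partial>lborel)" unfolding inner(2) by (rule io)
    show "AE x in lborel. 0 \<le> (\<integral>x'. f x x' \<partial>lborel)" using f0 by (intro AE_I2 integral_nonneg_AE) auto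
  qed
  finally have A: "(\<integral>\<^sup>+x. \<integral>\<^sup>+x'. ennreal (n x) * ennreal (n x') * ennreal ((cmod (k x - k x'))\<^sup>2) \<partial>lborel \<partial>lborel) = ennreal (2 * c * q - 2 * (cmod m)\<^sup>2)" .
  have pos: "2 * c * q - 2 * (cmod m)\<^sup>2 \<ge> 0"
    unfolding outer[symmetric] using f0 by (intro integral_nonneg_AE AE_I2) auto
  have B: "(\<integral>\<^sup>+x. ennreal (n x) * ennreal ((cmod (k x))\<^sup>2) \<partial>lborel) = ennreal q"
    unfolding q_def using n(2) i2 by (subst nn_integral_eq_integral[symmetric]) (auto simp: ennreal_mult)
  have "ennreal (1 / 2) * ennreal (2 * c * q - 2 * (cmod m)\<^sup>2) = ennreal (c * q - (cmod m)\<^sup>2)"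
    using pos by (subst ennreal_mult[symmetric]) (auto simp: field_simps)
  then have "ennreal ((cmod m)\<^sup>2) + ennreal (1 / 2) * ennreal (2 * c * q - 2 * (cmod m)\<^sup>2) = ennreal ((cmod m)\<^sup>2 + (c * q - (cmod m)\<^sup>2))"
    using pos by (simp del: ennreal_plus add: ennreal_plus[symmetric])
  also have "\<dots> = ennreal c * ennreal q" using c0 q0 by (simp add: ennreal_mult)
  finally show ?thesis unfolding A B m_def .
qed

text \<open>The substitution \<open>W = S + v\<close>, \<open>\<rho> = S - v\<close> has Jacobian 2
  and takes the cone of \<open>v\<close> between \<open>- S\<close> and \<open>S\<close> to the
  quadrant.\<close>

lemma nn_integral_sum_diff:
  fixes G :: "real \<Rightarrow> real \<Rightarrow> ennreal"
  assumes G: "(\<lambda>p. G (fst p) (snd p)) \<in> borel_measurable (borel \<Otimes>\<^sub>M borel)"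
  shows "(\<integral>\<^sup>+W. \<integral>\<^sup>+\<rho>. G W \<rho> * (indicator {0<..} W * indicator {0<..} \<rho>) \<partial>lborel \<partial>lborel)
    = 2 * (\<integral>\<^sup>+S. \<integral>\<^sup>+v. G (S + v) (S - v) * indicator {-S<..<S} v \<partial>lborel \<partial>lborel)"
proof -
  have [measurable]: "(\<lambda>p. G (a p) (b p)) \<in> borel_measurable M"
    if [measurable]: "a \<in> borel_measurable M" "b \<in> borel_measurable M" for M :: "'b measure" and a b
  proof -
    have "(\<lambda>p. (a p, b p)) \<in> measurable M (borel \<Otimes>\<^sub>M borel)" by measurable
    from measurable_compose[OF this G] show ?thesis by simp
  qed
  have "(\<integral>\<^sup>+W. \<integral>\<^sup>+\<rho>. G W \<rho> * (indicator {0<..} W * indicator {0<..} \<rho>) \<partial>lborel \<partial>lborel)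
    = (\<integral>\<^sup>+W. 2 * (\<integral>\<^sup>+S. G W (2 * S - W) * (indicator {0<..} W * indicator {0<..} (2 * S - W)) \<partial>lborel) \<partial>lborel)"
  proof (rule nn_integral_cong)
    fix W :: real
    show "(\<integral>\<^sup>+\<rho>. G W \<rho> * (indicator {0<..} W * indicator {0<..} \<rho>) \<partial>lborel)
      = 2 * (\<integral>\<^sup>+S. G W (2 * S - W) * (indicator {0<..} W * indicator {0<..} (2 * S - W)) \<partial>lborel)"
      using nn_integral_affine[of "\<lambda>\<rho>::real. G W \<rho> * (indicator {0<..} W * indicator {0<..} \<rho>)" 2 "- W"] by (simp add: mult.commute)
  qed
  also have "\<dots> = 2 * (\<integral>\<^sup>+W. \<integral>\<^sup>+S. G W (2 * S - W) * (indicator {0<..} W * indicator {0<..} (2 * S - W)) \<partial>lborel \<partial>lborel)"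
    by (rule nn_integral_cmult) measurable
  also have "(\<integral>\<^sup>+W. \<integral>\<^sup>+S. G W (2 * S - W) * (indicator {0<..} W * indicator {0<..} (2 * S - W)) \<partial>lborel \<partial>lborel)
    = (\<integral>\<^sup>+S. \<integral>\<^sup>+W. G W (2 * S - W) * (indicator {0<..} W * indicator {0<..} (2 * S - W)) \<partial>lborel \<partial>lborel)"
    by (rule lborel_pair.Fubini'[symmetric]) measurable
  also have "\<dots> = (\<integral>\<^sup>+S. \<integral>\<^sup>+v. G (S + v) (S - v) * indicator {-S<..<S} v \<partial>lborel \<partial>lborel)"
  proof (rule nn_integral_cong)
    fix S :: real
    have "(\<integral>\<^sup>+W. G W (2 * S - W) * (indicator {0<..} W * indicator {0<..} (2 * S - W)) \<partial>lborel)
      = (\<integral>\<^sup>+v. G (v + S) (2 * S - (v + S)) * (indicator {0<..} (v + S) * indicator {0<..} (2 * S - (v + S))) \<partial>lborel)"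
      by (rule nn_integral_real_translate[where f="\<lambda>W. G W (2 * S - W) * (indicator {0<..} W * indicator {0<..} (2 * S - W))", symmetric]) measurable
    also have "\<dots> = (\<integral>\<^sup>+v. G (S + v) (S - v) * indicator {-S<..<S} v \<partial>lborel)"
      by (intro nn_integral_cong) (auto simp: add.commute split: split_indicator)
    finally show "(\<integral>\<^sup>+W. G W (2 * S - W) * (indicator {0<..} W * indicator {0<..} (2 * S - W)) \<partial>lborel)
      = (\<integral>\<^sup>+v. G (S + v) (S - v) * indicator {-S<..<S} v \<partial>lborel)" .
  qed
  finally show ?thesis .
qed

section \<open>Second moments and variances over the arcs\<close>

context profile
begin

text \<open>\<open>S\<close> is the sum of the two squared frequencies and \<open>x\<close> is their
  difference, the first entry of \<open>inner_normsq\<close>.\<close>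

definition split_prod_sym :: "real \<Rightarrow> real \<Rightarrow> complex" where
  "split_prod_sym S x = split_prod \<phi> S ((S + x) / 2)"

lemma split_prod_sym_measurable [measurable]:
  assumes [measurable]: "f \<in> borel_measurable M" "g \<in> borel_measurable M"
  shows "(\<lambda>p. split_prod_sym (f p) (g p)) \<in> borel_measurable M"
  unfolding split_prod_sym_def by measurable

text \<open>\<open>W\<close> and \<open>\<rho>\<close> stand for the squared norms of
  \<open>\<xi> + \<eta>\<close> and \<open>\<xi> - \<eta>\<close>; fixing them also fixes the sum of
  the squared frequencies, \<open>(W + \<rho>) / 2\<close>.\<close>

definition arc_mass :: "real \<Rightarrow> real \<Rightarrow> ennreal" where
  "arc_mass W \<rho> = (\<integral>\<^sup>+x. ennreal (arcsine_density (W * \<rho>) x) * ennreal ((cmod (split_prod_sym ((W + \<rho>) / 2) x))\<^sup>2) \<partial>lborel)"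

definition arc_variance :: "real \<Rightarrow> real \<Rightarrow> ennreal" where
  "arc_variance W \<rho> = (\<integral>\<^sup>+x. \<integral>\<^sup>+x'. ennreal (arcsine_density (W * \<rho>) x) * ennreal (arcsine_density (W * \<rho>) x') * ennreal ((cmod (split_prod_sym ((W + \<rho>) / 2) x - split_prod_sym ((W + \<rho>) / 2) x'))\<^sup>2) \<partial>lborel \<partial>lborel)"

lemma arc_measurable [measurable]:
  "(\<lambda>p. arc_mass (fst p) (snd p)) \<in> borel_measurable (borel \<Otimes>\<^sub>M borel)"
  "(\<lambda>p. arc_variance (fst p) (snd p)) \<in> borel_measurable (borel \<Otimes>\<^sub>M borel)"
  unfolding arc_mass_def arc_variance_def by measurable

lemma arcsine_density_swap: "arcsine_density (S\<^sup>2 - v\<^sup>2) x = arcsine_density (S\<^sup>2 - x\<^sup>2) v"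
  by (auto simp: arcsine_density_def algebra_simps)

text \<open>The density depends on \<open>x\<close> and \<open>v\<close> through
  \<open>S\<^sup>2 - v\<^sup>2 - x\<^sup>2\<close> only, so integration in \<open>v\<close> is again
  the integral of an arcsine density. Summed over all circles with the same \<open>S\<close>, the
  result is uniform in \<open>x\<close>; this is why the sharp constant is reached.\<close>

lemma arcsine_density_diff_integral:
  "(\<integral>\<^sup>+v. ennreal (arcsine_density (S\<^sup>2 - v\<^sup>2) x) * indicator {-S<..<S} v \<partial>lborel) = ennreal pi * indicator {-S<..<S} x"
proof (cases "S > 0")
  case S: True
  have "(\<integral>\<^sup>+v. ennreal (arcsine_density (S\<^sup>2 - v\<^sup>2) x) * indicator {-S<..<S} v \<partial>lborel) = (\<integral>\<^sup>+v. ennreal (arcsine_density (S\<^sup>2 - x\<^sup>2) v) \<partial>lborel)"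
  proof (rule nn_integral_cong)
    fix v
    have "arcsine_density (S\<^sup>2 - x\<^sup>2) v = 0" if "v \<notin> {-S<..<S}"
    proof -
      have "\<bar>S\<bar> \<le> \<bar>v\<bar>" using that S by auto
      then have "S\<^sup>2 \<le> v\<^sup>2" by (simp add: abs_le_square_iff)
      then have "\<not> v\<^sup>2 < S\<^sup>2 - x\<^sup>2" using zero_le_power2[of x] by linarith
      then show ?thesis by (simp add: arcsine_density_def)
    qed
    then show "ennreal (arcsine_density (S\<^sup>2 - v\<^sup>2) x) * indicator {-S<..<S} v = ennreal (arcsine_density (S\<^sup>2 - x\<^sup>2) v)"
      unfolding arcsine_density_swap[of S v x] by (auto split: split_indicator)
  qed
  also have "\<dots> = ennreal pi * indicator {-S<..<S} x"
  proof (cases "x \<in> {-S<..<S}")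
    case True
    then have "\<bar>x\<bar> < \<bar>S\<bar>" using S by auto
    then have "x\<^sup>2 < S\<^sup>2"
      using power_strict_mono[of "\<bar>x\<bar>" "\<bar>S\<bar>" 2] by simp
    then show ?thesis using True by (subst arcsine_density_integral) auto
  next
    case False
    then have "\<bar>S\<bar> \<le> \<bar>x\<bar>" using S by auto
    then have "S\<^sup>2 \<le> x\<^sup>2" by (simp add: abs_le_square_iff)
    then have "\<not> v\<^sup>2 < S\<^sup>2 - x\<^sup>2" for v
      using zero_le_power2[of v] by linarith
    then show ?thesis using False by (simp add: arcsine_density_def)
  qed
  finally show ?thesis .
next
  case False
  then have "{-S<..<S} = {}" by auto
  then show ?thesis by simp
qed

lemma nn_integral_split_subst:
  fixes f :: "real \<Rightarrow> ennreal"
  assumes [measurable]: "f \<in> borel_measurable borel"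
  shows "(\<integral>\<^sup>+x. f ((S + x) / 2) * indicator {-S<..<S} x \<partial>lborel) = 2 * (\<integral>\<^sup>+r. f r * indicator {0<..<S} r \<partial>lborel)"
proof -
  have "(\<integral>\<^sup>+x. f ((S + x) / 2) * indicator {-S<..<S} x \<partial>lborel)
    = ennreal (\<bar>2\<bar> ^ DIM(real)) * (\<integral>\<^sup>+r. f ((S + (- S + 2 *\<^sub>R r)) / 2) * indicator {-S<..<S} (- S + 2 *\<^sub>R r) \<partial>lborel)"
    by (rule nn_integral_affine) auto
  also have "(\<integral>\<^sup>+r. f ((S + (- S + 2 *\<^sub>R r)) / 2) * indicator {-S<..<S} (- S + 2 *\<^sub>R r) \<partial>lborel) = (\<integral>\<^sup>+r. f r * indicator {0<..<S} r \<partial>lborel)"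
    by (intro nn_integral_cong) (auto split: split_indicator)
  finally show ?thesis by simp
qed

text \<open>The arcs with the same \<open>S\<close> add up to a multiple of Lebesgue measure on the
  slice, and the slices add up to the square of the mass of \<open>\<phi>\<close>. The constant is 2
  from \<open>nn_integral_sum_diff\<close>, \<open>pi\<close> from the density, and 2 from
  \<open>r = (S + x) / 2\<close>.\<close>

lemma arc_mass_total:
  "(\<integral>\<^sup>+W. \<integral>\<^sup>+\<rho>. arc_mass W \<rho> * (indicator {0<..} W * indicator {0<..} \<rho>) \<partial>lborel \<partial>lborel) = ennreal (4 * pi) * ennreal ((nrm2 half_line \<phi>)^4)"
proof -
  have "(\<integral>\<^sup>+W. \<integral>\<^sup>+\<rho>. arc_mass W \<rho> * (indicator {0<..} W * indicator {0<..} \<rho>) \<partial>lborel \<partial>lborel)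
    = 2 * (\<integral>\<^sup>+S. \<integral>\<^sup>+v. arc_mass (S + v) (S - v) * indicator {-S<..<S} v \<partial>lborel \<partial>lborel)"
    by (rule nn_integral_sum_diff) measurable
  also have "(\<integral>\<^sup>+S. \<integral>\<^sup>+v. arc_mass (S + v) (S - v) * indicator {-S<..<S} v \<partial>lborel \<partial>lborel) = (\<integral>\<^sup>+S. ennreal (2 * pi) * split_mass S \<partial>lborel)"
  proof (rule nn_integral_cong)
    fix S :: real
    have e: "(S + v) * (S - v) = S\<^sup>2 - v\<^sup>2" "(S + v + (S - v)) / 2 = S" for v by (simp_all add: power2_eq_square algebra_simps)
    have "(\<integral>\<^sup>+v. arc_mass (S + v) (S - v) * indicator {-S<..<S} v \<partial>lborel)
      = (\<integral>\<^sup>+v. \<integral>\<^sup>+x. ennreal (arcsine_density (S\<^sup>2 - v\<^sup>2) x) * ennreal ((cmod (split_prod_sym S x))\<^sup>2) * indicator {-S<..<S} v \<partial>lborel \<partial>lborel)"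
      unfolding arc_mass_def e by (intro nn_integral_cong nn_integral_multc[symmetric]) measurable
    also have "\<dots> = (\<integral>\<^sup>+x. \<integral>\<^sup>+v. ennreal (arcsine_density (S\<^sup>2 - v\<^sup>2) x) * ennreal ((cmod (split_prod_sym S x))\<^sup>2) * indicator {-S<..<S} v \<partial>lborel \<partial>lborel)"
      by (rule lborel_pair.Fubini') measurable
    also have "\<dots> = (\<integral>\<^sup>+x. ennreal ((cmod (split_prod_sym S x))\<^sup>2) * (ennreal pi * indicator {-S<..<S} x) \<partial>lborel)"
    proof (rule nn_integral_cong)
      fix x
      have "(\<integral>\<^sup>+v. ennreal (arcsine_density (S\<^sup>2 - v\<^sup>2) x) * ennreal ((cmod (split_prod_sym S x))\<^sup>2) * indicator {-S<..<S} v \<partial>lborel)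
        = (\<integral>\<^sup>+v. ennreal ((cmod (split_prod_sym S x))\<^sup>2) * (ennreal (arcsine_density (S\<^sup>2 - v\<^sup>2) x) * indicator {-S<..<S} v) \<partial>lborel)"
        by (simp only: mult_ac)
      also have "\<dots> = ennreal ((cmod (split_prod_sym S x))\<^sup>2) * (\<integral>\<^sup>+v. ennreal (arcsine_density (S\<^sup>2 - v\<^sup>2) x) * indicator {-S<..<S} v \<partial>lborel)"
        by (rule nn_integral_cmult) measurable
      finally show "(\<integral>\<^sup>+v. ennreal (arcsine_density (S\<^sup>2 - v\<^sup>2) x) * ennreal ((cmod (split_prod_sym S x))\<^sup>2) * indicator {-S<..<S} v \<partial>lborel)
        = ennreal ((cmod (split_prod_sym S x))\<^sup>2) * (ennreal pi * indicator {-S<..<S} x)"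
        unfolding arcsine_density_diff_integral .
    qed
    also have "\<dots> = ennreal pi * (\<integral>\<^sup>+x. ennreal ((cmod (split_prod \<phi> S ((S + x) / 2)))\<^sup>2) * indicator {-S<..<S} x \<partial>lborel)"
      unfolding split_prod_sym_def by (subst nn_integral_cmult[symmetric]) (auto simp: mult_ac)
    also have "\<dots> = ennreal pi * (2 * split_mass S)"
      unfolding split_mass_def by (subst nn_integral_split_subst[where f="\<lambda>r. ennreal ((cmod (split_prod \<phi> S r))\<^sup>2)"]) auto
    also have "\<dots> = ennreal (2 * pi) * split_mass S"
      by (simp add: ennreal_mult mult_ac)
    finally show "(\<integral>\<^sup>+v. arc_mass (S + v) (S - v) * indicator {-S<..<S} v \<partial>lborel) = ennreal (2 * pi) * split_mass S" .
  qed
  also have "\<dots> = ennreal (2 * pi) * (\<integral>\<^sup>+S. split_mass S \<partial>lborel)"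
    by (rule nn_integral_cmult) measurable
  also have "(\<integral>\<^sup>+S. split_mass S \<partial>lborel) = ennreal ((nrm2 half_line \<phi>)^4)"
  proof -
    have "(\<integral>\<^sup>+S. split_mass S \<partial>lborel) = (\<integral>\<^sup>+S. \<integral>\<^sup>+r. (\<lambda>S r. 1) S r * ennreal ((cmod (split_prod \<phi> S r))\<^sup>2) * indicator {0<..<S} r \<partial>lborel \<partial>lborel)"
      by (simp add: split_mass_def)
    also have "\<dots> = (\<integral>\<^sup>+r. ennreal ((cmod (\<phi> r))\<^sup>2) * (\<integral>\<^sup>+s. (\<lambda>S r. 1) (r + s) r * ennreal ((cmod (\<phi> s))\<^sup>2) \<partial>half_line) \<partial>half_line)"
      by (rule nn_integral_split_mass) measurable
    also have "\<dots> = ennreal ((nrm2 half_line \<phi>)\<^sup>2) * ennreal ((nrm2 half_line \<phi>)\<^sup>2)"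
      by (simp add: nn_integral_multc nn_integral_sqint[OF sqint_phi])
    finally show ?thesis by (simp add: ennreal_mult[symmetric] power_add[symmetric])
  qed
  also have "2 * (ennreal (2 * pi) * ennreal ((nrm2 half_line \<phi>)^4)) = ennreal (4 * pi) * ennreal ((nrm2 half_line \<phi>)^4)"
  proof -
    have "ennreal (4 * pi) = ennreal 2 * ennreal (2 * pi)" by (subst ennreal_mult[symmetric]) auto
    then show ?thesis by (simp add: mult.assoc)
  qed
  finally show ?thesis .
qed

text \<open>One of the two arcsine densities is replaced by its lower bound \<open>1 / S\<close>,
  the other is integrated in \<open>v\<close> exactly. The lower bound holds only on the arc; when
  the modulus of \<open>x'\<close> is at most that of \<open>x\<close>, the point \<open>x'\<close>
  lies on every arc that contains \<open>x\<close>, so the replacement is made at \<open>x'\<close>.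
  By symmetry these ordered pairs carry at least half of the double integral.\<close>

lemma arc_variance_slice:
  assumes S: "S > 0"
  shows "ennreal (2 * pi) * (ennreal (1 / S) * slice_defect \<phi> S) \<le> (\<integral>\<^sup>+v. arc_variance (S + v) (S - v) * indicator {-S<..<S} v \<partial>lborel)"
proof -
  define \<kappa> where "\<kappa> x x' = ennreal ((cmod (split_prod_sym S x - split_prod_sym S x'))\<^sup>2)" for x x'
  have [measurable]: "(\<lambda>p. \<kappa> (a p) (b p)) \<in> borel_measurable M"
    if [measurable]: "a \<in> borel_measurable M" "b \<in> borel_measurable M" for M :: "'b measure" and a b
    unfolding \<kappa>_def by measurable
  have sym: "\<kappa> x x' = \<kappa> x' x" for x x' by (simp add: \<kappa>_def norm_minus_commute)
  define le :: "real \<Rightarrow> real \<Rightarrow> ennreal" where "le x x' = (if \<bar>x'\<bar> \<le> \<bar>x\<bar> then 1 else 0)" for x x'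
  have [measurable]: "(\<lambda>p. le (a p) (b p)) \<in> borel_measurable M"
    if [measurable]: "a \<in> borel_measurable M" "b \<in> borel_measurable M" for M :: "'b measure" and a b
    unfolding le_def by measurable
  have e: "(S + v) * (S - v) = S\<^sup>2 - v\<^sup>2" "(S + v + (S - v)) / 2 = S" for v by (simp_all add: power2_eq_square algebra_simps)
  define A where "A x = (\<integral>\<^sup>+x'. le x x' * \<kappa> x x' \<partial>lborel)" for x
  have [measurable]: "A \<in> borel_measurable borel" unfolding A_def[abs_def] by measurable
  have lower: "ennreal (1 / S) * (ennreal (arcsine_density (S\<^sup>2 - v\<^sup>2) x) * A x) \<le> (\<integral>\<^sup>+x'. ennreal (arcsine_density (S\<^sup>2 - v\<^sup>2) x) * ennreal (arcsine_density (S\<^sup>2 - v\<^sup>2) x') * \<kappa> x x' \<partial>lborel)" for v x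
  proof -
    have "ennreal (1 / S) * (ennreal (arcsine_density (S\<^sup>2 - v\<^sup>2) x) * A x) = (\<integral>\<^sup>+x'. ennreal (1 / S) * (ennreal (arcsine_density (S\<^sup>2 - v\<^sup>2) x) * (le x x' * \<kappa> x x')) \<partial>lborel)"
      unfolding A_def by (subst nn_integral_cmult, measurable, subst nn_integral_cmult, measurable)
    also have "\<dots> \<le> (\<integral>\<^sup>+x'. ennreal (arcsine_density (S\<^sup>2 - v\<^sup>2) x) * ennreal (arcsine_density (S\<^sup>2 - v\<^sup>2) x') * \<kappa> x x' \<partial>lborel)"
    proof (rule nn_integral_mono)
      fix x'
      show "ennreal (1 / S) * (ennreal (arcsine_density (S\<^sup>2 - v\<^sup>2) x) * (le x x' * \<kappa> x x')) \<le> ennreal (arcsine_density (S\<^sup>2 - v\<^sup>2) x) * ennreal (arcsine_density (S\<^sup>2 - v\<^sup>2) x') * \<kappa> x x'"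
      proof (cases "\<bar>x'\<bar> \<le> \<bar>x\<bar> \<and> x\<^sup>2 < S\<^sup>2 - v\<^sup>2")
        case True
        then have x': "x'\<^sup>2 < S\<^sup>2 - v\<^sup>2" using abs_le_square_iff[of x' x] by linarith
        have "sqrt (S\<^sup>2 - v\<^sup>2 - x'\<^sup>2) \<le> sqrt (S\<^sup>2)"
          using zero_le_power2[of v] zero_le_power2[of x'] by (intro real_sqrt_le_mono) linarith
        then have "sqrt (S\<^sup>2 - v\<^sup>2 - x'\<^sup>2) \<le> S" using S by simp
        then have "1 / S \<le> arcsine_density (S\<^sup>2 - v\<^sup>2) x'"
          using x' S by (simp add: arcsine_density_def frac_le)
        then have 1: "ennreal (1 / S) \<le> ennreal (arcsine_density (S\<^sup>2 - v\<^sup>2) x')" by (rule ennreal_leI)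
        have "ennreal (1 / S) * (ennreal (arcsine_density (S\<^sup>2 - v\<^sup>2) x) * (le x x' * \<kappa> x x')) = ennreal (1 / S) * (ennreal (arcsine_density (S\<^sup>2 - v\<^sup>2) x) * \<kappa> x x')"
          using True by (simp add: le_def)
        also have "\<dots> \<le> ennreal (arcsine_density (S\<^sup>2 - v\<^sup>2) x') * (ennreal (arcsine_density (S\<^sup>2 - v\<^sup>2) x) * \<kappa> x x')"
          by (rule mult_right_mono[OF 1]) simp
        finally show ?thesis by (simp only: mult_ac)
      next
        case False
        then show ?thesis by (auto simp: le_def arcsine_density_def)
      qed
    qed
    finally show ?thesis .
  qed
  have "ennreal (2 * pi) * (ennreal (1 / S) * slice_defect \<phi> S) \<le> ennreal (1 / S) * (ennreal pi * (\<integral>\<^sup>+x. A x * indicator {-S<..<S} x \<partial>lborel))"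
  proof -
    define T where "T = (\<integral>\<^sup>+x. \<integral>\<^sup>+x'. \<kappa> x x' * (indicator {-S<..<S} x * indicator {-S<..<S} x') \<partial>lborel \<partial>lborel)"
    have "T \<le> (\<integral>\<^sup>+x. \<integral>\<^sup>+x'. le x x' * \<kappa> x x' * indicator {-S<..<S} x + le x' x * \<kappa> x' x * indicator {-S<..<S} x' \<partial>lborel \<partial>lborel)"
      unfolding T_def
    proof (intro nn_integral_mono)
      fix x x' :: real
      show "\<kappa> x x' * (indicator {-S<..<S} x * indicator {-S<..<S} x') \<le> le x x' * \<kappa> x x' * indicator {-S<..<S} x + le x' x * \<kappa> x' x * indicator {-S<..<S} x'"
        by (cases "\<bar>x'\<bar> \<le> \<bar>x\<bar>") (auto simp: le_def sym[of x' x] split: split_indicator)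
    qed
    also have "\<dots> = (\<integral>\<^sup>+x. (\<integral>\<^sup>+x'. le x x' * \<kappa> x x' * indicator {-S<..<S} x \<partial>lborel) + (\<integral>\<^sup>+x'. le x' x * \<kappa> x' x * indicator {-S<..<S} x' \<partial>lborel) \<partial>lborel)"
      by (rule nn_integral_cong, rule nn_integral_add) measurable
    also have "\<dots> = (\<integral>\<^sup>+x. \<integral>\<^sup>+x'. le x x' * \<kappa> x x' * indicator {-S<..<S} x \<partial>lborel \<partial>lborel) + (\<integral>\<^sup>+x. \<integral>\<^sup>+x'. le x' x * \<kappa> x' x * indicator {-S<..<S} x' \<partial>lborel \<partial>lborel)"
      by (rule nn_integral_add) measurable
    also have "(\<integral>\<^sup>+x. \<integral>\<^sup>+x'. le x' x * \<kappa> x' x * indicator {-S<..<S} x' \<partial>lborel \<partial>lborel) = (\<integral>\<^sup>+x'. \<integral>\<^sup>+x. le x' x * \<kappa> x' x * indicator {-S<..<S} x' \<partial>lborel \<partial>lborel)"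
      by (rule lborel_pair.Fubini') measurable
    also have "(\<integral>\<^sup>+x. \<integral>\<^sup>+x'. le x x' * \<kappa> x x' * indicator {-S<..<S} x \<partial>lborel \<partial>lborel) = (\<integral>\<^sup>+x. A x * indicator {-S<..<S} x \<partial>lborel)"
      unfolding A_def by (intro nn_integral_cong nn_integral_multc) measurable
    finally have Tle: "T \<le> 2 * (\<integral>\<^sup>+x. A x * indicator {-S<..<S} x \<partial>lborel)" by (simp add: mult_2)
    \<comment> \<open>Each of the two substitutions of type \<open>r = (S + x) / 2\<close>
      contributes a factor 2.\<close>
    have "T = 4 * slice_defect \<phi> S"
    proof -
      define F where "F r r' = ennreal ((cmod (split_prod \<phi> S r - split_prod \<phi> S r'))\<^sup>2)" for r r'
      have [measurable]: "(\<lambda>p. F (a p) (b p)) \<in> borel_measurable M"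
        if [measurable]: "a \<in> borel_measurable M" "b \<in> borel_measurable M" for M :: "'b measure" and a b
        unfolding F_def by measurable
      define I where "I r = (\<integral>\<^sup>+r'. F r r' * indicator {0<..<S} r' \<partial>lborel)" for r
      have [measurable]: "I \<in> borel_measurable borel" unfolding I_def[abs_def] by measurable
      have "T = (\<integral>\<^sup>+x. 2 * (I ((S + x) / 2) * indicator {-S<..<S} x) \<partial>lborel)"
        unfolding T_def
      proof (rule nn_integral_cong)
        fix x
        have "(\<integral>\<^sup>+x'. \<kappa> x x' * (indicator {-S<..<S} x * indicator {-S<..<S} x') \<partial>lborel) = (\<integral>\<^sup>+x'. F ((S + x) / 2) ((S + x') / 2) * indicator {-S<..<S} x' \<partial>lborel) * indicator {-S<..<S} x"
          unfolding \<kappa>_def F_def split_prod_sym_def by (cases "x \<in> {-S<..<S}") simp_all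
        also have "(\<integral>\<^sup>+x'. F ((S + x) / 2) ((S + x') / 2) * indicator {-S<..<S} x' \<partial>lborel) = 2 * I ((S + x) / 2)"
        proof -
          have "(\<lambda>r'. F ((S + x) / 2) r') \<in> borel_measurable borel"
            unfolding F_def by measurable
          from nn_integral_split_subst[OF this] show ?thesis unfolding I_def .
        qed
        finally show "(\<integral>\<^sup>+x'. \<kappa> x x' * (indicator {-S<..<S} x * indicator {-S<..<S} x') \<partial>lborel) = 2 * (I ((S + x) / 2) * indicator {-S<..<S} x)"
          by (simp only: mult.assoc)
      qed
      also have "\<dots> = 2 * (2 * (\<integral>\<^sup>+r. I r * indicator {0<..<S} r \<partial>lborel))"
        by (subst nn_integral_cmult, measurable) (simp only: nn_integral_split_subst[OF \<open>I \<in> borel_measurable borel\<close>])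
      also have "(\<integral>\<^sup>+r. I r * indicator {0<..<S} r \<partial>lborel) = slice_defect \<phi> S"
        unfolding slice_defect_def I_def F_def
      proof (rule nn_integral_cong)
        fix r
        show "(\<integral>\<^sup>+r'. ennreal ((cmod (split_prod \<phi> S r - split_prod \<phi> S r'))\<^sup>2) * indicator {0<..<S} r' \<partial>lborel) * indicator {0<..<S} r
          = (\<integral>\<^sup>+r'. ennreal ((cmod (split_prod \<phi> S r - split_prod \<phi> S r'))\<^sup>2) * (indicator {0<..<S} r * indicator {0<..<S} r') \<partial>lborel)"
          by (cases "r \<in> {0<..<S}") simp_all
      qed
      finally have T1: "T = 2 * (2 * slice_defect \<phi> S)" .
      have "(4::ennreal) * d = 2 * (2 * d)" for d
        by (simp only: mult.assoc[symmetric]) simp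
      then show ?thesis unfolding T1 by simp
    qed
    moreover have "(4::ennreal) * d = 2 * (2 * d)" for d
      by (simp only: mult.assoc[symmetric]) simp
    ultimately have "2 * (2 * slice_defect \<phi> S) \<le> 2 * (\<integral>\<^sup>+x. A x * indicator {-S<..<S} x \<partial>lborel)"
      using Tle by (simp only:)
    then have "2 * slice_defect \<phi> S \<le> (\<integral>\<^sup>+x. A x * indicator {-S<..<S} x \<partial>lborel)"
      by (subst (asm) ennreal_mult_le_mult_iff) auto
    then have "ennreal (1 / S) * (ennreal pi * (2 * slice_defect \<phi> S)) \<le> ennreal (1 / S) * (ennreal pi * (\<integral>\<^sup>+x. A x * indicator {-S<..<S} x \<partial>lborel))"
      by (intro mult_left_mono) auto
    moreover have "ennreal (2 * pi) * (ennreal (1 / S) * slice_defect \<phi> S) = ennreal (1 / S) * (ennreal pi * (2 * slice_defect \<phi> S))"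
    proof -
      have "ennreal (2 * pi) = 2 * ennreal pi" by (subst ennreal_mult) auto
      then show ?thesis by (simp only: mult_ac)
    qed
    ultimately show ?thesis by simp
  qed
  also have "\<dots> = ennreal (1 / S) * (\<integral>\<^sup>+x. A x * (ennreal pi * indicator {-S<..<S} x) \<partial>lborel)"
    by (subst nn_integral_cmult[symmetric]) (auto simp: mult_ac)
  also have "\<dots> = ennreal (1 / S) * (\<integral>\<^sup>+x. \<integral>\<^sup>+v. A x * (ennreal (arcsine_density (S\<^sup>2 - v\<^sup>2) x) * indicator {-S<..<S} v) \<partial>lborel \<partial>lborel)"
    unfolding arcsine_density_diff_integral[symmetric]
    by (intro arg_cong2[where f="(*)"] refl nn_integral_cong nn_integral_cmult[symmetric]) measurable
  also have "\<dots> = ennreal (1 / S) * (\<integral>\<^sup>+v. \<integral>\<^sup>+x. A x * (ennreal (arcsine_density (S\<^sup>2 - v\<^sup>2) x) * indicator {-S<..<S} v) \<partial>lborel \<partial>lborel)"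
    by (intro arg_cong2[where f="(*)"] refl lborel_pair.Fubini') measurable
  also have "\<dots> = (\<integral>\<^sup>+v. \<integral>\<^sup>+x. ennreal (1 / S) * (A x * (ennreal (arcsine_density (S\<^sup>2 - v\<^sup>2) x) * indicator {-S<..<S} v)) \<partial>lborel \<partial>lborel)"
    by (subst nn_integral_cmult[symmetric], measurable, rule nn_integral_cong, rule nn_integral_cmult[symmetric], measurable)
  also have "\<dots> \<le> (\<integral>\<^sup>+v. arc_variance (S + v) (S - v) * indicator {-S<..<S} v \<partial>lborel)"
  proof (rule nn_integral_mono)
    fix v
    show "(\<integral>\<^sup>+x. ennreal (1 / S) * (A x * (ennreal (arcsine_density (S\<^sup>2 - v\<^sup>2) x) * indicator {-S<..<S} v)) \<partial>lborel) \<le> arc_variance (S + v) (S - v) * indicator {-S<..<S} v"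
    proof (cases "v \<in> {-S<..<S}")
      case True
      have "(\<integral>\<^sup>+x. ennreal (1 / S) * (A x * ennreal (arcsine_density (S\<^sup>2 - v\<^sup>2) x)) \<partial>lborel) \<le> arc_variance (S + v) (S - v)"
        unfolding arc_variance_def e \<kappa>_def[symmetric] using lower[of v] by (intro nn_integral_mono) (simp add: mult_ac)
      then show ?thesis using True by simp
    qed simp
  qed
  finally show ?thesis .
qed

lemma arc_variance_total:
  "ennreal (4 * pi) * defect \<phi> \<le> (\<integral>\<^sup>+W. \<integral>\<^sup>+\<rho>. arc_variance W \<rho> * (indicator {0<..} W * indicator {0<..} \<rho>) \<partial>lborel \<partial>lborel)"
proof -
  have "ennreal (4 * pi) * defect \<phi> = 2 * (\<integral>\<^sup>+S. ennreal (2 * pi) * (ennreal (1 / S) * slice_defect \<phi> S * indicator {0<..} S) \<partial>lborel)"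
  proof -
    have "ennreal (4 * pi) = 2 * ennreal (2 * pi)"
    proof -
      have "ennreal (4 * pi) = ennreal 2 * ennreal (2 * pi)" by (subst ennreal_mult[symmetric]) auto
      then show ?thesis by simp
    qed
    then show ?thesis unfolding defect_def by (subst nn_integral_cmult) (auto simp: mult.assoc)
  qed
  also have "\<dots> \<le> 2 * (\<integral>\<^sup>+S. \<integral>\<^sup>+v. arc_variance (S + v) (S - v) * indicator {-S<..<S} v \<partial>lborel \<partial>lborel)"
  proof (intro mult_left_mono nn_integral_mono)
    fix S :: real
    show "ennreal (2 * pi) * (ennreal (1 / S) * slice_defect \<phi> S * indicator {0<..} S) \<le> (\<integral>\<^sup>+v. arc_variance (S + v) (S - v) * indicator {-S<..<S} v \<partial>lborel)"
      using arc_variance_slice[of S] by (cases "S > 0") auto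
  qed simp
  also have "\<dots> = (\<integral>\<^sup>+W. \<integral>\<^sup>+\<rho>. arc_variance W \<rho> * (indicator {0<..} W * indicator {0<..} \<rho>) \<partial>lborel \<partial>lborel)"
    by (rule nn_integral_sum_diff[symmetric]) measurable
  finally show ?thesis .
qed

end

section \<open>The Strichartz inequality for profiles\<close>

lemma integrable_affine:
  fixes f :: "'a::euclidean_space \<Rightarrow> complex"
  assumes f: "integrable lborel f" and c: "c \<noteq> 0"
  shows "integrable lborel (\<lambda>x. f (t + c *\<^sub>R x))"
proof -
  have [measurable]: "f \<in> borel_measurable borel" using f by (auto dest: borel_measurable_integrable)
  have "(\<integral>\<^sup>+x. ennreal (cmod (f x)) \<partial>lborel) = ennreal (\<bar>c\<bar> ^ DIM('a)) * (\<integral>\<^sup>+x. ennreal (cmod (f (t + c *\<^sub>R x))) \<partial>lborel)"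
    by (rule nn_integral_affine) (use c in auto)
  moreover have "(\<integral>\<^sup>+x. ennreal (cmod (f x)) \<partial>lborel) < \<infinity>" using f by (simp add: integrable_iff_bounded)
  ultimately have "(\<integral>\<^sup>+x. ennreal (cmod (f (t + c *\<^sub>R x))) \<partial>lborel) < \<infinity>"
    using c by (auto simp: ennreal_mult_less_top)
  then show ?thesis by (simp add: integrable_iff_bounded)
qed

section \<open>The evolution of a profile and its fourth power\<close>

context profile
begin

definition H :: "real^2 \<Rightarrow> complex" where
  "H \<xi> = \<phi> ((norm \<xi>)\<^sup>2)"

definition Ht :: "real \<Rightarrow> real^2 \<Rightarrow> complex" where
  "Ht t \<xi> = cis (- t * (norm \<xi>)\<^sup>2) * H \<xi>"

text \<open>The density has total mass \<open>pi\<close>, so this is \<open>pi\<close> times the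
  mean over the circle when \<open>a * \<rho>\<close> is positive.\<close>

definition arc_mean :: "real \<Rightarrow> real \<Rightarrow> complex" where
  "arc_mean a \<rho> = (\<integral>x. arcsine_density (a * \<rho>) x *\<^sub>R split_prod_sym ((a + \<rho>) / 2) x \<partial>lborel)"

lemma H_measurable [measurable]: "H \<in> borel_measurable borel"
  unfolding H_def[abs_def] by measurable

lemma Ht_measurable [measurable]:
  assumes [measurable]: "f \<in> borel_measurable M" "g \<in> borel_measurable M"
  shows "(\<lambda>p. Ht (f p) (g p)) \<in> borel_measurable M"
  unfolding Ht_def by measurable

lemma arc_mean_measurable [measurable]:
  assumes [measurable]: "f \<in> borel_measurable M" "g \<in> borel_measurable M"
  shows "(\<lambda>p. arc_mean (f p) (g p)) \<in> borel_measurable M"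
  unfolding arc_mean_def by (intro lborel.borel_measurable_lebesgue_integral) measurable

lemma cmod_Ht [simp]: "cmod (Ht t \<xi>) = cmod (H \<xi>)"
  by (simp add: Ht_def norm_mult)

lemma H_integrable: "integrable lborel H"
proof -
  obtain B where B: "B \<ge> 0" "\<And>r. r \<ge> 0 \<Longrightarrow> cmod (\<phi> r) \<le> B" using phi_bounded by blast
  have "integrable lborel (\<lambda>x::real^2. B * indicator (cball 0 (sqrt L)) x)"
    using emeasure_lborel_cball_finite[of "0::real^2" "sqrt L"]
    by (intro integrable_mult_right integrable_real_indicator) auto
  then show ?thesis
  proof (rule Bochner_Integration.integrable_bound)
    show "AE x in lborel. norm (H x) \<le> norm (B * indicator (cball 0 (sqrt L)) x)"
    proof (intro AE_I2)
      fix x :: "real^2"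
      show "norm (H x) \<le> norm (B * indicator (cball 0 (sqrt L)) x)"
      proof (cases "x \<in> cball 0 (sqrt L)")
        case True
        then show ?thesis using B by (simp add: H_def)
      next
        case False
        then have "sqrt L < norm x" by simp
        then have "(sqrt L)\<^sup>2 \<le> (norm x)\<^sup>2" using L by (intro power_mono) auto
        then show ?thesis using L supp by (simp add: H_def)
      qed
    qed
  qed measurable
qed

lemma Ht_integrable: "integrable lborel (Ht t)"
  unfolding Ht_def[abs_def] by (rule cis_mult_integrable[OF H_integrable]) measurable

lemma H_bounded: "\<exists>B. B \<ge> 0 \<and> (\<forall>\<xi>. cmod (H \<xi>) \<le> B)"
  using phi_bounded by (auto simp: H_def)

lemma H_sqint: "sqint lborel H"
  using H_bounded bounded_integrable_sqint[OF H_integrable] by blast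

lemma Ht_sqint: "sqint lborel (Ht t)"
  using H_bounded bounded_integrable_sqint[OF Ht_integrable] by (metis cmod_Ht)

lemma H_norm: "(nrm2 lborel H)\<^sup>2 = pi * (nrm2 half_line \<phi>)\<^sup>2"
proof -
  have "ennreal ((nrm2 lborel H)\<^sup>2) = (\<integral>\<^sup>+\<xi>. ennreal ((cmod (\<phi> ((norm (\<xi>::real^2))\<^sup>2)))\<^sup>2) \<partial>lborel)"
    unfolding nn_integral_sqint[OF H_sqint, symmetric] H_def ..
  also have "\<dots> = ennreal pi * (\<integral>\<^sup>+r. ennreal ((cmod (\<phi> r))\<^sup>2) * indicator {0<..} r \<partial>lborel)"
    by (rule nn_integral_radial[where g="\<lambda>r. ennreal ((cmod (\<phi> r))\<^sup>2)"]) measurable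
  also have "(\<integral>\<^sup>+r. ennreal ((cmod (\<phi> r))\<^sup>2) * indicator {0<..} r \<partial>lborel) = ennreal ((nrm2 half_line \<phi>)\<^sup>2)"
    unfolding nn_integral_sqint[OF sqint_phi, symmetric] by (rule nn_integral_half_line[symmetric]) measurable
  also have "ennreal pi * ennreal ((nrm2 half_line \<phi>)\<^sup>2) = ennreal (pi * (nrm2 half_line \<phi>)\<^sup>2)"
    by (simp add: ennreal_mult)
  finally show ?thesis by (subst (asm) ennreal_inj) auto
qed

lemma conv_Ht_sqint: "sqint lborel (conv (Ht t) (Ht t))"
proof -
  obtain B where B: "B \<ge> 0" "\<And>\<xi>. cmod (H \<xi>) \<le> B" using H_bounded by blast
  have "cmod (conv (Ht t) (Ht t) w) \<le> (\<integral>\<xi>. B * cmod (H \<xi>) \<partial>lborel)" for w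
    unfolding conv_def
  proof (rule Bochner_Integration.integral_norm_bound_integral)
    show i: "integrable lborel (\<lambda>\<xi>. B * cmod (H \<xi>))"
      by (intro integrable_mult_right integrable_norm H_integrable)
    show le: "cmod (Ht t \<xi> * Ht t (w - \<xi>)) \<le> B * cmod (H \<xi>)" for \<xi>
      using B(2)[of "w - \<xi>"] by (simp add: norm_mult mult.commute[of B] mult_left_mono)
    show "integrable lborel (\<lambda>\<xi>. Ht t \<xi> * Ht t (w - \<xi>))"
      by (rule Bochner_Integration.integrable_bound[OF i]) (use le B(1) in \<open>auto simp: abs_mult\<close>)
  qed
  then show ?thesis
    by (intro bounded_integrable_sqint[OF conv_integrable[OF Ht_integrable Ht_integrable]])
qed

text \<open>With \<open>\<xi> = (w + q) / 2\<close> and \<open>\<eta> = (w - q) / 2\<close> the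
  phase depends on the sum of the squared norms only, which is half the sum of those of
  \<open>w\<close> and \<open>q\<close>. It is therefore constant on each circle in \<open>q\<close>
  and splits into a unimodular factor in \<open>w\<close> and a character of frequency
  \<open>t / 2\<close> in \<open>\<rho>\<close>.\<close>

lemma Ht_product:
  "Ht t ((1/2) *\<^sub>R w + (1/2) *\<^sub>R q) * Ht t (w - ((1/2) *\<^sub>R w + (1/2) *\<^sub>R q))
    = cis (- t * (norm w)\<^sup>2 / 2) * (cis (- (snd (inner_normsq w q) * (t / 2))) * split_prod_sym (((norm w)\<^sup>2 + snd (inner_normsq w q)) / 2) (fst (inner_normsq w q)))"
proof -
  define S where "S = ((norm w)\<^sup>2 + (norm q)\<^sup>2) / 2"
  define x where "x = w \<bullet> q"
  have n1: "(norm ((1/2) *\<^sub>R w + (1/2) *\<^sub>R q))\<^sup>2 = (S + x) / 2"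
    unfolding power2_norm_eq_inner S_def x_def
    by (simp add: inner_add_left inner_add_right inner_commute[of q w] field_simps)
  have n2: "(norm (w - ((1/2) *\<^sub>R w + (1/2) *\<^sub>R q)))\<^sup>2 = S - (S + x) / 2"
  proof -
    have e: "w - ((1/2) *\<^sub>R w + (1/2) *\<^sub>R q) = (1/2) *\<^sub>R w - (1/2) *\<^sub>R q"
    proof -
      have "w - ((1/2) *\<^sub>R w + (1/2) *\<^sub>R q) = ((1/2) *\<^sub>R w + (1/2) *\<^sub>R w) - ((1/2) *\<^sub>R w + (1/2) *\<^sub>R q)"
        by (simp flip: scaleR_add_left)
      then show ?thesis by (simp only: add_diff_cancel_left)
    qed
    show ?thesis
      unfolding e power2_norm_eq_inner S_def x_def
      by (simp add: inner_diff_left inner_diff_right inner_commute[of q w] field_simps)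
  qed
  have "cis (- t * ((S + x) / 2)) * cis (- t * (S - (S + x) / 2)) = cis (- t * S)"
    by (simp add: cis_mult algebra_simps)
  also have "\<dots> = cis (- t * (norm w)\<^sup>2 / 2) * cis (- ((norm q)\<^sup>2 * (t / 2)))"
    by (simp add: cis_mult S_def algebra_simps add_divide_distrib)
  finally have c: "cis (- t * ((S + x) / 2)) * cis (- t * (S - (S + x) / 2)) = cis (- t * (norm w)\<^sup>2 / 2) * cis (- ((norm q)\<^sup>2 * (t / 2)))" .
  have "Ht t ((1/2) *\<^sub>R w + (1/2) *\<^sub>R q) * Ht t (w - ((1/2) *\<^sub>R w + (1/2) *\<^sub>R q))
    = (cis (- t * ((S + x) / 2)) * cis (- t * (S - (S + x) / 2))) * split_prod_sym S x"
    unfolding Ht_def H_def n1 n2 split_prod_sym_def split_prod_def by (simp only: mult_ac)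
  then show ?thesis unfolding c by (simp add: inner_normsq_def S_def x_def mult.assoc)
qed

text \<open>Averaging \<open>Ht_product\<close> over circles leaves time as the frequency variable
  of a one-dimensional Fourier integral in \<open>\<rho>\<close>, which makes Plancherel in time
  possible. The factor 1/4 is the Jacobian of the substitution in the plane.\<close>

lemma conv_arc_mean:
  assumes w: "w \<noteq> 0"
  shows "integrable lborel (arc_mean ((norm w)\<^sup>2))"
    and "conv (Ht t) (Ht t) w = complex_of_real (1 / 4) * (cis (- t * (norm w)\<^sup>2 / 2) * FT (arc_mean ((norm w)\<^sup>2)) (t / 2))"
proof -
  define g where "g t p = cis (- (snd p * (t / 2))) * split_prod_sym (((norm w)\<^sup>2 + snd p) / 2) (fst p)" for t :: real and p :: "real \<times> real"
  have gm[measurable]: "g t \<in> borel_measurable (borel \<Otimes>\<^sub>M borel)" for t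
    unfolding g_def[abs_def] by measurable
  obtain B where B: "B \<ge> 0" "\<And>\<xi>. cmod (H \<xi>) \<le> B" using H_bounded by blast
  have i: "integrable lborel (\<lambda>\<xi>. Ht t \<xi> * Ht t (w - \<xi>))" for t
  proof (rule Bochner_Integration.integrable_bound)
    show "integrable lborel (\<lambda>\<xi>. B * cmod (H \<xi>))"
      by (intro integrable_mult_right integrable_norm H_integrable)
    have "cmod (Ht t \<xi> * Ht t (w - \<xi>)) \<le> B * cmod (H \<xi>)" for \<xi>
      using B(2)[of "w - \<xi>"] by (simp add: norm_mult mult.commute[of B] mult_left_mono)
    then show "AE \<xi> in lborel. norm (Ht t \<xi> * Ht t (w - \<xi>)) \<le> norm (B * cmod (H \<xi>))"
      using B(1) by (auto simp: abs_mult)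
  qed measurable
  have ig: "integrable lborel (\<lambda>q. g t (inner_normsq w q))" for t
  proof -
    have "integrable lborel (\<lambda>q. Ht t ((1/2) *\<^sub>R w + (1/2) *\<^sub>R q) * Ht t (w - ((1/2) *\<^sub>R w + (1/2) *\<^sub>R q)))"
      by (rule integrable_affine[OF i]) simp
    then have "integrable lborel (\<lambda>q. cis (t * (norm w)\<^sup>2 / 2) * (cis (- t * (norm w)\<^sup>2 / 2) * g t (inner_normsq w q)))"
      unfolding Ht_product g_def by (rule integrable_mult_right)
    moreover have "cis (t * (norm w)\<^sup>2 / 2) * (cis (- t * (norm w)\<^sup>2 / 2) * z) = z" for z
      by (simp add: mult.assoc[symmetric] cis_mult)
    ultimately show ?thesis by (simp only:)
  qed
  have pull: "(\<integral>x. arcsine_density ((norm w)\<^sup>2 * \<rho>) x *\<^sub>R g t (x, \<rho>) \<partial>lborel) = cis (- (\<rho> * (t / 2))) * arc_mean ((norm w)\<^sup>2) \<rho>" for \<rho> t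
    unfolding g_def arc_mean_def fst_conv snd_conv
    by (simp only: mult_scaleR_right[symmetric] integral_mult_right_zero)
  \<comment> \<open>At \<open>t = 0\<close> the phase is 1, so this is the integrability of
    \<open>arc_mean\<close> itself.\<close>
  have "integrable lborel (\<lambda>\<rho>. \<integral>x. arcsine_density ((norm w)\<^sup>2 * \<rho>) x *\<^sub>R g 0 (x, \<rho>) \<partial>lborel)"
    by (rule lborel_pair.integrable_snd[OF integral_inner_normsq(1)[OF gm w ig]])
  then show "integrable lborel (arc_mean ((norm w)\<^sup>2))"
    unfolding pull by simp
  have "conv (Ht t) (Ht t) w = (1/2) ^ DIM(real^2) *\<^sub>R (\<integral>q. Ht t ((1/2) *\<^sub>R w + (1/2) *\<^sub>R q) * Ht t (w - ((1/2) *\<^sub>R w + (1/2) *\<^sub>R q)) \<partial>lborel)"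
    unfolding conv_def by (rule integral_affine) auto
  also have "(\<integral>q. Ht t ((1/2) *\<^sub>R w + (1/2) *\<^sub>R q) * Ht t (w - ((1/2) *\<^sub>R w + (1/2) *\<^sub>R q)) \<partial>lborel)
    = cis (- t * (norm w)\<^sup>2 / 2) * (\<integral>q. g t (inner_normsq w q) \<partial>lborel)"
    unfolding Ht_product g_def by (rule integral_mult_right_zero)
  also have "(\<integral>q. g t (inner_normsq w q) \<partial>lborel) = FT (arc_mean ((norm w)\<^sup>2)) (t / 2)"
    unfolding integral_inner_normsq(2)[OF gm w ig] pull FT_def by simp
  finally show "conv (Ht t) (Ht t) w = complex_of_real (1 / 4) * (cis (- t * (norm w)\<^sup>2 / 2) * FT (arc_mean ((norm w)\<^sup>2)) (t / 2))"
    by (simp add: scaleR_conv_of_real power2_eq_square)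
qed

text \<open>Where the density is nonzero, \<open>x\<^sup>2 < a * \<rho>\<close>, and the
  arithmetic-geometric mean inequality bounds the modulus of \<open>x\<close> by
  \<open>(a + \<rho>) / 2\<close>. Both arguments of \<open>\<phi>\<close> are then nonnegative, and
  there \<open>\<phi>\<close> is bounded.\<close>

lemma split_prod_sym_bound:
  obtains B where "B \<ge> 0" "\<And>a \<rho> x. a > 0 \<Longrightarrow> arcsine_density (a * \<rho>) x \<noteq> 0 \<Longrightarrow> cmod (split_prod_sym ((a + \<rho>) / 2) x) \<le> B"
proof -
  obtain B where B: "B \<ge> 0" "\<And>r. r \<ge> 0 \<Longrightarrow> cmod (\<phi> r) \<le> B" using phi_bounded by blast
  have "cmod (split_prod_sym ((a + \<rho>) / 2) x) \<le> B * B" if a: "a > 0" and nz: "arcsine_density (a * \<rho>) x \<noteq> 0" for a \<rho> x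
  proof -
    have lt: "x\<^sup>2 < a * \<rho>" using nz by (auto simp: arcsine_density_def split: if_splits)
    then have "0 < a * \<rho>" using zero_le_power2[of x] by linarith
    then have r: "\<rho> > 0" using a by (simp add: zero_less_mult_iff)
    have "a * \<rho> \<le> ((a + \<rho>) / 2)\<^sup>2"
      using zero_le_power2[of "a - \<rho>"] by (simp add: power2_eq_square algebra_simps)
    then have "\<bar>x\<bar> \<le> \<bar>(a + \<rho>) / 2\<bar>" using lt abs_le_square_iff[of x "(a + \<rho>) / 2"] by linarith
    then have x: "x \<le> (a + \<rho>) / 2" "- x \<le> (a + \<rho>) / 2" using a r by auto
    have "cmod (split_prod_sym ((a + \<rho>) / 2) x) = cmod (\<phi> (((a + \<rho>) / 2 + x) / 2)) * cmod (\<phi> ((a + \<rho>) / 2 - ((a + \<rho>) / 2 + x) / 2))"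
      by (simp add: split_prod_sym_def split_prod_def norm_mult)
    also have "\<dots> \<le> B * B"
    proof -
      have "0 \<le> (m + x) / 2" "0 \<le> m - (m + x) / 2" if "x \<le> m" "- x \<le> m" for m
        using that by (simp_all add: field_simps)
      note 1 = this(1)[OF x] and 2 = this(2)[OF x]
      from mult_mono[OF B(2)[OF 1] B(2)[OF 2] B(1) norm_ge_zero] show ?thesis .
    qed
    finally show ?thesis .
  qed
  then show ?thesis using that[of "B * B"] B(1) by simp
qed

lemma arc_mean_sqint:
  fixes w :: "real^2"
  assumes w: "w \<noteq> 0"
  shows "sqint lborel (arc_mean ((norm w)\<^sup>2))"
proof -
  obtain B where B: "B \<ge> 0" "\<And>a \<rho> x. a > 0 \<Longrightarrow> arcsine_density (a * \<rho>) x \<noteq> 0 \<Longrightarrow> cmod (split_prod_sym ((a + \<rho>) / 2) x) \<le> B"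
    by (rule split_prod_sym_bound) blast
  define a where "a = (norm w)\<^sup>2"
  have a: "a > 0" using w by (simp add: a_def)
  have "cmod (arc_mean a \<rho>) \<le> B * pi" for \<rho>
  proof (cases "a * \<rho> > 0")
    case True
    have "ennreal (cmod (arc_mean a \<rho>)) \<le> (\<integral>\<^sup>+x. ennreal (cmod (arcsine_density (a * \<rho>) x *\<^sub>R split_prod_sym ((a + \<rho>) / 2) x)) \<partial>lborel)"
      unfolding arc_mean_def by (rule integral_norm_bound_ennreal_any)
    also have "\<dots> \<le> (\<integral>\<^sup>+x. ennreal B * ennreal (arcsine_density (a * \<rho>) x) \<partial>lborel)"
    proof (rule nn_integral_mono)
      fix x
      have "arcsine_density (a * \<rho>) x * cmod (split_prod_sym ((a + \<rho>) / 2) x) \<le> B * arcsine_density (a * \<rho>) x"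
        using B(2)[OF a, of \<rho> x] by (cases "arcsine_density (a * \<rho>) x = 0") (auto simp: mult.commute[of B] mult_left_mono)
      then show "ennreal (cmod (arcsine_density (a * \<rho>) x *\<^sub>R split_prod_sym ((a + \<rho>) / 2) x)) \<le> ennreal B * ennreal (arcsine_density (a * \<rho>) x)"
        using B(1) by (simp add: ennreal_leI flip: ennreal_mult)
    qed
    also have "\<dots> = ennreal (B * pi)"
      using True B(1) by (simp add: nn_integral_cmult arcsine_density_integral ennreal_mult)
    finally show ?thesis using B(1) by (subst (asm) ennreal_le_iff) auto
  next
    case False
    have "arcsine_density (a * \<rho>) x = 0" for x
    proof -
      have "\<not> x\<^sup>2 < a * \<rho>" using False zero_le_power2[of x] by linarith
      then show ?thesis by (simp add: arcsine_density_def)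
    qed
    then show ?thesis using B(1) by (simp add: arc_mean_def)
  qed
  then show ?thesis unfolding a_def[symmetric]
    by (intro bounded_integrable_sqint[of _ _ "B * pi"] conv_arc_mean(1)[OF w, folded a_def])
qed

text \<open>Plancherel in \<open>\<rho>\<close>. The constant is the square of 1/4, times 2 for the
  rescaling \<open>t / 2\<close>, times \<open>2 * pi\<close>.\<close>

lemma conv_time_norm:
  fixes w :: "real^2"
  assumes w: "w \<noteq> 0"
  shows "(\<integral>\<^sup>+t. ennreal ((cmod (conv (Ht t) (Ht t) w))\<^sup>2) \<partial>lborel) = ennreal (pi / 4) * (\<integral>\<^sup>+\<rho>. ennreal ((cmod (arc_mean ((norm w)\<^sup>2) \<rho>))\<^sup>2) \<partial>lborel)"
proof -
  define b where "b = arc_mean ((norm w)\<^sup>2)"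
  have bi: "integrable lborel b" unfolding b_def by (rule conv_arc_mean(1)[OF w])
  have bs: "sqint lborel b" unfolding b_def by (rule arc_mean_sqint[OF w])
  have [measurable]: "b \<in> borel_measurable borel" using bi by (auto dest: borel_measurable_integrable)
  have "(\<integral>\<^sup>+t. ennreal ((cmod (conv (Ht t) (Ht t) w))\<^sup>2) \<partial>lborel) = (\<integral>\<^sup>+t. ennreal (1 / 16) * ennreal ((cmod (FT b (t / 2)))\<^sup>2) \<partial>lborel)"
    unfolding conv_arc_mean(2)[OF w] b_def[symmetric]
    by (intro nn_integral_cong) (simp add: norm_mult power_mult_distrib power_divide flip: ennreal_mult)
  also have "\<dots> = ennreal (1 / 16) * (\<integral>\<^sup>+t. ennreal ((cmod (FT b (t / 2)))\<^sup>2) \<partial>lborel)"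
    by (rule nn_integral_cmult) measurable
  also have "(\<integral>\<^sup>+t. ennreal ((cmod (FT b (t / 2)))\<^sup>2) \<partial>lborel) = ennreal 2 * (\<integral>\<^sup>+t. ennreal ((cmod (FT b t))\<^sup>2) \<partial>lborel)"
    using nn_integral_affine[of "\<lambda>t::real. ennreal ((cmod (FT b (t / 2)))\<^sup>2)" 2 0] by simp
  also have "(\<integral>\<^sup>+t. ennreal ((cmod (FT b t))\<^sup>2) \<partial>lborel) = ennreal (2 * pi) * (\<integral>\<^sup>+\<rho>. ennreal ((cmod (b \<rho>))\<^sup>2) \<partial>lborel)"
    unfolding nn_integral_sqint[OF bs] nn_integral_sqint[OF FT_sq_le(1)[OF bi bs]] plancherel[OF bi bs]
    by (simp add: power_mult_distrib flip: ennreal_mult)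
  also have "ennreal (1 / 16) * (ennreal 2 * (ennreal (2 * pi) * X)) = ennreal (pi / 4) * X" for X
  proof -
    have "ennreal (1 / 16) * (ennreal 2 * ennreal (2 * pi)) = ennreal (pi / 4)"
      by (subst ennreal_mult[symmetric], simp, simp, subst ennreal_mult[symmetric], simp, simp, rule arg_cong[where f=ennreal], simp)
    then show ?thesis by (simp only: mult.assoc[symmetric])
  qed
  finally show ?thesis unfolding b_def .
qed

text \<open>The square of \<open>FT (Ht t)\<close> is the transform of a convolution, so Plancherel
  in space and \<open>conv_time_norm\<close> in time give \<open>pi^4\<close> times the integral of
  the squared arc means. Half the arc variance completes these to \<open>pi * arc_mass\<close>;
  \<open>arc_mass_total\<close> evaluates the sum, and \<open>arc_variance_total\<close> bounds the
  variance below by the defect.\<close>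

lemma strichartz_profile:
  "(\<integral>\<^sup>+t. \<integral>\<^sup>+x. ennreal ((cmod (FT (Ht t) (- x)))^4) \<partial>lborel \<partial>lborel) + ennreal (2 * pi^5) * defect \<phi>
    \<le> ennreal (4 * pi^6 * (nrm2 half_line \<phi>)^4)"
proof -
  define V where "V a \<rho> = ennreal ((cmod (arc_mean a \<rho>))\<^sup>2)" for a \<rho>
  have [measurable]: "(\<lambda>p. V (f p) (g p)) \<in> borel_measurable M"
    if [measurable]: "f \<in> borel_measurable M" "g \<in> borel_measurable M" for M :: "'b measure" and f g
    unfolding V_def by measurable
  have cm[measurable]: "(\<lambda>p. conv (Ht (fst p)) (Ht (fst p)) (snd p)) \<in> borel_measurable (borel \<Otimes>\<^sub>M borel)"
    unfolding conv_def by (intro lborel.borel_measurable_lebesgue_integral) measurable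
  have slice: "(\<integral>\<^sup>+x. ennreal ((cmod (FT (Ht t) (- x)))^4) \<partial>lborel) = ennreal ((2 * pi)\<^sup>2) * (\<integral>\<^sup>+w. ennreal ((cmod (conv (Ht t) (Ht t) w))\<^sup>2) \<partial>lborel)" for t
  proof -
    define c where "c = conv (Ht t) (Ht t)"
    have ci: "integrable lborel c" unfolding c_def by (intro conv_integrable Ht_integrable)
    have cs: "sqint lborel c" unfolding c_def by (rule conv_Ht_sqint)
    have [measurable]: "Ht t \<in> borel_measurable borel" by measurable
    have "(\<integral>\<^sup>+x. ennreal ((cmod (FT (Ht t) (- x)))^4) \<partial>lborel) = (\<integral>\<^sup>+x. ennreal ((cmod (FT (Ht t) x))^4) \<partial>lborel)"
      using nn_integral_affine[of "\<lambda>x. ennreal ((cmod (FT (Ht t) x))^4)" "-1" 0] by simp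
    also have "\<dots> = (\<integral>\<^sup>+x. ennreal ((cmod (FT c x))\<^sup>2) \<partial>lborel)"
      unfolding c_def FT_conv[OF Ht_integrable Ht_integrable]
      by (intro nn_integral_cong) (simp add: norm_mult power_mult_distrib flip: power_add)
    also have "\<dots> = ennreal ((2 * pi)\<^sup>2) * (\<integral>\<^sup>+w. ennreal ((cmod (c w))\<^sup>2) \<partial>lborel)"
      unfolding nn_integral_sqint[OF cs] nn_integral_sqint[OF FT_sq_le(1)[OF ci cs]] plancherel[OF ci cs]
      by (simp add: power_mult_distrib flip: ennreal_mult)
    finally show ?thesis unfolding c_def .
  qed
  have "(\<integral>\<^sup>+t. \<integral>\<^sup>+x. ennreal ((cmod (FT (Ht t) (- x)))^4) \<partial>lborel \<partial>lborel)
    = (\<integral>\<^sup>+t. ennreal ((2 * pi)\<^sup>2) * (\<integral>\<^sup>+w. ennreal ((cmod (conv (Ht t) (Ht t) w))\<^sup>2) \<partial>lborel) \<partial>lborel)"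
    unfolding slice ..
  also have "\<dots> = ennreal ((2 * pi)\<^sup>2) * (\<integral>\<^sup>+t. \<integral>\<^sup>+w. ennreal ((cmod (conv (Ht t) (Ht t) w))\<^sup>2) \<partial>lborel \<partial>lborel)"
    by (rule nn_integral_cmult) (use cm in measurable)
  also have "(\<integral>\<^sup>+t. \<integral>\<^sup>+w. ennreal ((cmod (conv (Ht t) (Ht t) w))\<^sup>2) \<partial>lborel \<partial>lborel)
    = (\<integral>\<^sup>+w. \<integral>\<^sup>+t. ennreal ((cmod (conv (Ht t) (Ht t) w))\<^sup>2) \<partial>lborel \<partial>lborel)"
    by (rule lborel_pair.Fubini'[symmetric]) (use cm in measurable)
  also have "\<dots> = (\<integral>\<^sup>+w. ennreal (pi / 4) * (\<integral>\<^sup>+\<rho>. V ((norm (w::real^2))\<^sup>2) \<rho> \<partial>lborel) \<partial>lborel)"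
  proof (rule nn_integral_cong_AE)
    \<comment> \<open>At \<open>w = 0\<close> the circles have no distinguished direction; that
      point is a null set.\<close>
    show "AE w in lborel. (\<integral>\<^sup>+t. ennreal ((cmod (conv (Ht t) (Ht t) w))\<^sup>2) \<partial>lborel) = ennreal (pi / 4) * (\<integral>\<^sup>+\<rho>. V ((norm w)\<^sup>2) \<rho> \<partial>lborel)"
      using AE_lborel_singleton[of "0::real^2"] by eventually_elim (simp add: conv_time_norm V_def)
  qed
  also have "\<dots> = ennreal (pi / 4) * (\<integral>\<^sup>+w. (\<integral>\<^sup>+\<rho>. V ((norm (w::real^2))\<^sup>2) \<rho> \<partial>lborel) \<partial>lborel)"
    by (rule nn_integral_cmult) measurable
  also have "(\<integral>\<^sup>+w. (\<integral>\<^sup>+\<rho>. V ((norm (w::real^2))\<^sup>2) \<rho> \<partial>lborel) \<partial>lborel) = ennreal pi * (\<integral>\<^sup>+W. (\<integral>\<^sup>+\<rho>. V W \<rho> \<partial>lborel) * indicator {0<..} W \<partial>lborel)"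
    by (rule nn_integral_radial[where g="\<lambda>W. \<integral>\<^sup>+\<rho>. V W \<rho> \<partial>lborel"]) measurable
  also have "(\<integral>\<^sup>+W. (\<integral>\<^sup>+\<rho>. V W \<rho> \<partial>lborel) * indicator {0<..} W \<partial>lborel)
    = (\<integral>\<^sup>+W. \<integral>\<^sup>+\<rho>. V W \<rho> * (indicator {0<..} W * indicator {0<..} \<rho>) \<partial>lborel \<partial>lborel)"
  proof (rule nn_integral_cong)
    fix a :: real
    show "(\<integral>\<^sup>+\<rho>. V a \<rho> \<partial>lborel) * indicator {0<..} a = (\<integral>\<^sup>+\<rho>. V a \<rho> * (indicator {0<..} a * indicator {0<..} \<rho>) \<partial>lborel)"
    proof (cases "a > 0")
      case True
      have "V a \<rho> = V a \<rho> * indicator {0<..} \<rho>" for \<rho>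
      proof (cases "\<rho> > 0")
        case False
        have "a * \<rho> \<le> 0" using True False by (simp add: mult_nonneg_nonpos)
        then have "arcsine_density (a * \<rho>) x = 0" for x
        proof -
          have "\<not> x\<^sup>2 < a * \<rho>" using \<open>a * \<rho> \<le> 0\<close> zero_le_power2[of x] by linarith
          then show ?thesis by (simp add: arcsine_density_def)
        qed
        then show ?thesis by (simp add: V_def arc_mean_def)
      qed simp
      then show ?thesis using True by (simp cong: nn_integral_cong)
    qed simp
  qed
  finally have I: "(\<integral>\<^sup>+t. \<integral>\<^sup>+x. ennreal ((cmod (FT (Ht t) (- x)))^4) \<partial>lborel \<partial>lborel)
    = ennreal ((2 * pi)\<^sup>2) * (ennreal (pi / 4) * (ennreal pi * (\<integral>\<^sup>+W. \<integral>\<^sup>+\<rho>. V W \<rho> * (indicator {0<..} W * indicator {0<..} \<rho>) \<partial>lborel \<partial>lborel)))" .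
  define IV where "IV = (\<integral>\<^sup>+W. \<integral>\<^sup>+\<rho>. V W \<rho> * (indicator {0<..} W * indicator {0<..} \<rho>) \<partial>lborel \<partial>lborel)"
  \<comment> \<open>\<open>(2 * pi)\<^sup>2\<close> is Plancherel in the plane,
    \<open>pi / 4\<close> the time integral, and \<open>pi\<close> comes from polar coordinates in
    \<open>w\<close>.\<close>
  have I': "(\<integral>\<^sup>+t. \<integral>\<^sup>+x. ennreal ((cmod (FT (Ht t) (- x)))^4) \<partial>lborel \<partial>lborel) = ennreal (pi^4) * IV"
  proof -
    have "ennreal ((2 * pi)\<^sup>2) * (ennreal (pi / 4) * ennreal pi) = ennreal (pi^4)"
      by (subst ennreal_mult[symmetric], simp, simp, subst ennreal_mult[symmetric], simp, simp, rule arg_cong[where f=ennreal])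
         (simp add: power2_eq_square power4_eq_xxxx)
    then show ?thesis unfolding I IV_def[symmetric] by (simp only: mult.assoc[symmetric])
  qed
  obtain B where B: "B \<ge> 0" "\<And>a \<rho> x. a > 0 \<Longrightarrow> arcsine_density (a * \<rho>) x \<noteq> 0 \<Longrightarrow> cmod (split_prod_sym ((a + \<rho>) / 2) x) \<le> B"
    by (rule split_prod_sym_bound) blast
  have var: "V a \<rho> + ennreal (1 / 2) * arc_variance a \<rho> = ennreal pi * arc_mass a \<rho>" if "a > 0" "\<rho> > 0" for a \<rho>
    unfolding V_def arc_mean_def arc_variance_def arc_mass_def
    by (rule variance_identity[where K=B]) (use that B in \<open>auto intro: arcsine_density_integral\<close>)
  define IP2 where "IP2 = (\<integral>\<^sup>+W. \<integral>\<^sup>+\<rho>. arc_variance W \<rho> * (indicator {0<..} W * indicator {0<..} \<rho>) \<partial>lborel \<partial>lborel)"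
  have [measurable]: "(\<lambda>p. arc_mass (f p) (g p)) \<in> borel_measurable M" "(\<lambda>p. arc_variance (f p) (g p)) \<in> borel_measurable M"
    if [measurable]: "f \<in> borel_measurable M" "g \<in> borel_measurable M" for M :: "'b measure" and f g
  proof -
    have "(\<lambda>p. (f p, g p)) \<in> measurable M (borel \<Otimes>\<^sub>M borel)" by measurable
    from measurable_compose[OF this arc_measurable(1)] measurable_compose[OF this arc_measurable(2)]
    show "(\<lambda>p. arc_mass (f p) (g p)) \<in> borel_measurable M" "(\<lambda>p. arc_variance (f p) (g p)) \<in> borel_measurable M" by simp_all
  qed
  have "IV + ennreal (1 / 2) * IP2 = (\<integral>\<^sup>+W. (\<integral>\<^sup>+\<rho>. V W \<rho> * (indicator {0<..} W * indicator {0<..} \<rho>) \<partial>lborel)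
      + ennreal (1 / 2) * (\<integral>\<^sup>+\<rho>. arc_variance W \<rho> * (indicator {0<..} W * indicator {0<..} \<rho>) \<partial>lborel) \<partial>lborel)"
    unfolding IV_def IP2_def by (subst nn_integral_cmult[symmetric], measurable, rule nn_integral_add[symmetric]) measurable
  also have "\<dots> = (\<integral>\<^sup>+W. ennreal pi * (\<integral>\<^sup>+\<rho>. arc_mass W \<rho> * (indicator {0<..} W * indicator {0<..} \<rho>) \<partial>lborel) \<partial>lborel)"
  proof (rule nn_integral_cong)
    fix a :: real
    have "(\<integral>\<^sup>+\<rho>. V a \<rho> * (indicator {0<..} a * indicator {0<..} \<rho>) \<partial>lborel)
      + ennreal (1 / 2) * (\<integral>\<^sup>+\<rho>. arc_variance a \<rho> * (indicator {0<..} a * indicator {0<..} \<rho>) \<partial>lborel)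
      = (\<integral>\<^sup>+\<rho>. V a \<rho> * (indicator {0<..} a * indicator {0<..} \<rho>) + ennreal (1 / 2) * (arc_variance a \<rho> * (indicator {0<..} a * indicator {0<..} \<rho>)) \<partial>lborel)"
      by (subst nn_integral_cmult[symmetric], measurable, rule nn_integral_add[symmetric]) measurable
    also have "\<dots> = (\<integral>\<^sup>+\<rho>. ennreal pi * (arc_mass a \<rho> * (indicator {0<..} a * indicator {0<..} \<rho>)) \<partial>lborel)"
      by (rule nn_integral_cong) (use var in \<open>auto split: split_indicator\<close>)
    also have "\<dots> = ennreal pi * (\<integral>\<^sup>+\<rho>. arc_mass a \<rho> * (indicator {0<..} a * indicator {0<..} \<rho>) \<partial>lborel)"
      by (rule nn_integral_cmult) measurable
    finally show "(\<integral>\<^sup>+\<rho>. V a \<rho> * (indicator {0<..} a * indicator {0<..} \<rho>) \<partial>lborel)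
      + ennreal (1 / 2) * (\<integral>\<^sup>+\<rho>. arc_variance a \<rho> * (indicator {0<..} a * indicator {0<..} \<rho>) \<partial>lborel)
      = ennreal pi * (\<integral>\<^sup>+\<rho>. arc_mass a \<rho> * (indicator {0<..} a * indicator {0<..} \<rho>) \<partial>lborel)" .
  qed
  also have "\<dots> = ennreal pi * (ennreal (4 * pi) * ennreal ((nrm2 half_line \<phi>)^4))"
    unfolding arc_mass_total[symmetric] by (rule nn_integral_cmult) measurable
  finally have eq: "IV + ennreal (1 / 2) * IP2 = ennreal pi * (ennreal (4 * pi) * ennreal ((nrm2 half_line \<phi>)^4))" .
  have "IV + ennreal (1 / 2) * (ennreal (4 * pi) * defect \<phi>) \<le> IV + ennreal (1 / 2) * IP2"
    unfolding IP2_def by (intro add_left_mono mult_left_mono arc_variance_total) simp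
  then have "ennreal (pi^4) * (IV + ennreal (1 / 2) * (ennreal (4 * pi) * defect \<phi>)) \<le> ennreal (pi^4) * (ennreal pi * (ennreal (4 * pi) * ennreal ((nrm2 half_line \<phi>)^4)))"
    unfolding eq by (rule mult_left_mono) simp
  moreover have "ennreal (pi^4) * (ennreal pi * (ennreal (4 * pi) * ennreal ((nrm2 half_line \<phi>)^4))) = ennreal (4 * pi^6 * (nrm2 half_line \<phi>)^4)"
  proof -
    have e: "4 * pi^6 * (nrm2 half_line \<phi>)^4 = pi^4 * (pi * ((4 * pi) * (nrm2 half_line \<phi>)^4))" by (simp add: power_numeral_reduce)
    show ?thesis unfolding e by (subst ennreal_mult, simp, simp, subst ennreal_mult, simp, simp, subst ennreal_mult, simp, simp) (rule refl)
  qed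
  moreover have "ennreal (pi^4) * (IV + ennreal (1 / 2) * (ennreal (4 * pi) * defect \<phi>)) = ennreal (pi^4) * IV + ennreal (2 * pi^5) * defect \<phi>"
  proof -
    have e: "2 * pi^5 = pi^4 * (1 / 2 * (4 * pi))" by (simp add: power_numeral_reduce)
    have "ennreal (2 * pi^5) = ennreal (pi^4) * (ennreal (1 / 2) * ennreal (4 * pi))"
      unfolding e by (subst ennreal_mult, simp, simp, subst ennreal_mult, simp, simp) (rule refl)
    then show ?thesis by (simp only: distrib_left mult.assoc)
  qed
  ultimately show ?thesis unfolding I' by simp
qed

end

section \<open>Scaling, and Gaussians on both sides of the Fourier transform\<close>

lemma slice_defect_scale:
  assumes [measurable]: "\<phi> \<in> borel_measurable borel"
  shows "slice_defect (\<lambda>r. c * \<phi> r) S = ennreal ((cmod c)^4) * slice_defect \<phi> S"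
proof -
  define q where "q r r' = ennreal ((cmod (split_prod \<phi> S r - split_prod \<phi> S r'))\<^sup>2) * (indicator {0<..<S} r * indicator {0<..<S} r')" for r r'
  have [measurable]: "(\<lambda>p. q (a p) (b p)) \<in> borel_measurable M"
    if [measurable]: "a \<in> borel_measurable M" "b \<in> borel_measurable M" for M :: "'b measure" and a b
    unfolding q_def by measurable
  have "ennreal ((cmod (split_prod (\<lambda>r. c * \<phi> r) S r - split_prod (\<lambda>r. c * \<phi> r) S r'))\<^sup>2)
    = ennreal ((cmod c)^4) * ennreal ((cmod (split_prod \<phi> S r - split_prod \<phi> S r'))\<^sup>2)" for r r'
  proof -
    have "split_prod (\<lambda>r. c * \<phi> r) S r - split_prod (\<lambda>r. c * \<phi> r) S r' = c\<^sup>2 * (split_prod \<phi> S r - split_prod \<phi> S r')"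
      by (simp add: split_prod_def power2_eq_square right_diff_distrib mult_ac)
    then show ?thesis
      by (simp add: norm_mult norm_power power_mult_distrib flip: ennreal_mult power_mult)
  qed
  then have "slice_defect (\<lambda>r. c * \<phi> r) S = (\<integral>\<^sup>+r. \<integral>\<^sup>+r'. ennreal ((cmod c)^4) * q r r' \<partial>lborel \<partial>lborel)"
    unfolding slice_defect_def q_def by (simp only: mult.assoc)
  also have "\<dots> = (\<integral>\<^sup>+r. ennreal ((cmod c)^4) * (\<integral>\<^sup>+r'. q r r' \<partial>lborel) \<partial>lborel)"
    by (intro nn_integral_cong nn_integral_cmult) measurable
  also have "\<dots> = ennreal ((cmod c)^4) * slice_defect \<phi> S"
    unfolding slice_defect_def q_def[symmetric] by (rule nn_integral_cmult) measurable
  finally show ?thesis .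
qed

lemma defect_scale:
  assumes [measurable]: "\<phi> \<in> borel_measurable borel"
  shows "defect (\<lambda>r. c * \<phi> r) = ennreal ((cmod c)^4) * defect \<phi>"
proof -
  have "defect (\<lambda>r. c * \<phi> r) = (\<integral>\<^sup>+S. ennreal ((cmod c)^4) * (ennreal (1 / S) * slice_defect \<phi> S * indicator {0<..} S) \<partial>lborel)"
    unfolding defect_def slice_defect_scale[OF assms] by (simp only: mult_ac)
  also have "\<dots> = ennreal ((cmod c)^4) * defect \<phi>"
    unfolding defect_def by (rule nn_integral_cmult) measurable
  finally show ?thesis .
qed

lemma radial_norm:
  assumes [measurable]: "g \<in> borel_measurable borel"
    and s: "sqint lborel (\<lambda>\<xi>::real^2. g ((norm \<xi>)\<^sup>2))"
  shows "(nrm2 lborel (\<lambda>\<xi>::real^2. g ((norm \<xi>)\<^sup>2)))\<^sup>2 = pi * (nrm2 half_line g)\<^sup>2"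
proof -
  have e: "ennreal ((nrm2 lborel (\<lambda>\<xi>::real^2. g ((norm \<xi>)\<^sup>2)))\<^sup>2) = ennreal pi * (\<integral>\<^sup>+r. ennreal ((cmod (g r))\<^sup>2) \<partial>half_line)"
    unfolding nn_integral_sqint[OF s, symmetric]
    by (subst nn_integral_radial[where g="\<lambda>r. ennreal ((cmod (g r))\<^sup>2)"], measurable, subst nn_integral_half_line, measurable)
  have "sqint half_line g"
    unfolding sqint_iff_nn
  proof (rule conjI, measurable)
    have "ennreal pi * (\<integral>\<^sup>+r. ennreal ((cmod (g r))\<^sup>2) \<partial>half_line) < \<infinity>" unfolding e[symmetric] by simp
    then show "(\<integral>\<^sup>+r. ennreal ((cmod (g r))\<^sup>2) \<partial>half_line) < \<infinity>" by (auto simp: ennreal_mult_less_top)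
  qed
  from e[unfolded nn_integral_sqint[OF this]] show ?thesis
    by (simp flip: ennreal_mult)
qed

lemma gaussian_integrable_sqint:
  fixes a b :: complex
  assumes b: "Re b > 0"
  shows "integrable lborel (\<lambda>\<xi>::'a::euclidean_space. a * exp (- b * complex_of_real ((norm \<xi>)\<^sup>2)))"
    and "sqint lborel (\<lambda>\<xi>::'a. a * exp (- b * complex_of_real ((norm \<xi>)\<^sup>2)))"
proof -
  have "integrable lborel (\<lambda>\<xi>::'a. exp (- b * complex_of_real ((norm \<xi>)\<^sup>2)))"
    using gauss_ft(1)[OF b, of "0::'a"] by simp
  then show i: "integrable lborel (\<lambda>\<xi>::'a. a * exp (- b * complex_of_real ((norm \<xi>)\<^sup>2)))"
    by (rule integrable_mult_right)
  have "exp (- (Re b * (norm \<xi>)\<^sup>2)) \<le> 1" for \<xi> :: 'a using b by simp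
  then have "cmod (a * exp (- b * complex_of_real ((norm \<xi>)\<^sup>2))) \<le> cmod a" for \<xi> :: 'a
    by (simp add: norm_mult mult_left_le flip: of_real_power)
  then show "sqint lborel (\<lambda>\<xi>::'a. a * exp (- b * complex_of_real ((norm \<xi>)\<^sup>2)))"
    by (rule bounded_integrable_sqint[OF i])
qed

text \<open>The parameter \<open>b\<close> goes to \<open>1 / (4 * b)\<close>, and inversion
  preserves the right half-plane.\<close>

lemma IFT_gaussian:
  fixes a b :: complex
  assumes b: "Re b > 0"
  shows "IFT (\<lambda>\<xi>. a * exp (- b * complex_of_real ((norm \<xi>)\<^sup>2))) \<in> (radial_gaussians :: ('a::euclidean_space \<Rightarrow> complex) set)"
proof -
  define k where "k = complex_of_real (1 / (2 * pi) ^ DIM('a)) * (a * gauss_const b ^ DIM('a))"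
  have bn: "b \<noteq> 0" using b by auto
  have "IFT (\<lambda>\<xi>. a * exp (- b * complex_of_real ((norm \<xi>)\<^sup>2))) x = k * exp (- (1 / (4 * b)) * complex_of_real ((norm x)\<^sup>2))" for x :: 'a
  proof -
    have "FT (\<lambda>\<xi>. a * exp (- b * complex_of_real ((norm \<xi>)\<^sup>2))) (- x)
      = (\<integral>\<xi>. a * (exp (- b * complex_of_real ((norm \<xi>)\<^sup>2)) * cis (- (\<xi> \<bullet> (- x)))) \<partial>lborel)"
      unfolding FT_def by (simp only: mult_ac)
    also have "\<dots> = a * (gauss_const b ^ DIM('a) * exp (- complex_of_real ((norm (- x))\<^sup>2) / (4 * b)))"
      unfolding integral_mult_right_zero gauss_ft(2)[OF b] ..
    finally show ?thesis by (simp add: IFT_def k_def)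
  qed
  moreover have "Re (1 / (4 * b)) > 0"
    using b by (simp add: Re_divide power2_eq_square add_pos_nonneg)
  ultimately show ?thesis unfolding radial_gaussians_def by blast
qed

context profile
begin

text \<open>The defect and the product on the left are both homogeneous of degree 4 in
  \<open>\<phi>\<close>, so \<open>stability_normalized\<close> applies after division by the
  norm.\<close>

lemma stability:
  assumes D: "defect \<phi> \<le> ennreal d" and d: "d \<ge> 0"
  shows "\<exists>a b. Re b > 0 \<and> (nrm2 half_line \<phi>)\<^sup>2 * (nrm2 half_line (\<lambda>r. \<phi> r - a * exp (- b * complex_of_real r)))\<^sup>2 \<le> stab_const * d"
proof (cases "nrm2 half_line \<phi> = 0")
  case True
  then show ?thesis using d stab_const_pos by (intro exI[of _ 0] exI[of _ 1]) simp
next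
  case False
  define N where "N = nrm2 half_line \<phi>"
  have N: "N > 0" using False nrm2_nonneg[of half_line \<phi>] by (simp add: N_def less_le)
  then have Nn: "N \<noteq> 0" by simp
  define \<psi> where "\<psi> = (\<lambda>r. complex_of_real (1 / N) * \<phi> r)"
  have cm: "cmod (complex_of_real (1 / N)) = 1 / N" using N by (simp only: norm_of_real) simp
  interpret p: profile \<psi> L
    by unfold_locales (auto simp: \<psi>_def L supp Nn intro!: continuous_intros cont)
  have 1: "nrm2 half_line \<psi> = 1"
    unfolding \<psi>_def nrm2_cmult cm using Nn by (simp flip: N_def)
  have m: "\<phi> \<in> borel_measurable borel" by measurable
  have "defect \<psi> = ennreal ((1 / N)^4) * defect \<phi>"
    unfolding \<psi>_def defect_scale[OF m] cm ..
  also have "\<dots> \<le> ennreal ((1 / N)^4) * ennreal d" by (intro mult_left_mono D) simp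
  also have "\<dots> = ennreal ((1 / N)^4 * d)" using d N by (simp add: ennreal_mult)
  finally obtain a b where b: "Re b > 0"
    and le: "(nrm2 half_line (\<lambda>r. \<psi> r - a * exp (- b * complex_of_real r)))\<^sup>2 \<le> stab_const * ((1 / N)^4 * d)"
    using p.stability_normalized[OF 1] d N by (meson mult_nonneg_nonneg zero_le_power divide_nonneg_pos zero_le_one)
  have "nrm2 half_line (\<lambda>r. \<phi> r - (complex_of_real N * a) * exp (- b * complex_of_real r))
    = nrm2 half_line (\<lambda>r. complex_of_real N * (\<psi> r - a * exp (- b * complex_of_real r)))"
    using Nn by (simp add: \<psi>_def right_diff_distrib mult.assoc)
  also have "\<dots> = N * nrm2 half_line (\<lambda>r. \<psi> r - a * exp (- b * complex_of_real r))"
    unfolding nrm2_cmult using N by simp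
  finally have e: "nrm2 half_line (\<lambda>r. \<phi> r - (complex_of_real N * a) * exp (- b * complex_of_real r)) = N * nrm2 half_line (\<lambda>r. \<psi> r - a * exp (- b * complex_of_real r))" .
  have "N^4 * (nrm2 half_line (\<lambda>r. \<psi> r - a * exp (- b * complex_of_real r)))\<^sup>2 \<le> N^4 * (stab_const * ((1 / N)^4 * d))"
    using le N by (intro mult_left_mono) auto
  also have "\<dots> = stab_const * d" using Nn by (simp add: power_one_over)
  finally have "(nrm2 half_line \<phi>)\<^sup>2 * (nrm2 half_line (\<lambda>r. \<phi> r - (complex_of_real N * a) * exp (- b * complex_of_real r)))\<^sup>2 \<le> stab_const * d"
    unfolding e N_def[symmetric] by (simp add: power_mult_distrib power2_eq_square power4_eq_xxxx mult_ac)
  with b show ?thesis by blast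
qed

text \<open>\<open>stability\<close> bounds the defect in \<open>strichartz_profile\<close> from
  below; the result is rewritten in planar norms, each square of which is \<open>pi\<close> times
  its value on the half-line. Division by \<open>(2 * pi)^8\<close>, the fourth power of the
  normalisation of \<open>IFT\<close> in the plane, produces \<open>64 * pi^4\<close>.\<close>

lemma strichartz_stability:
  "\<exists>a b. Re b > 0 \<and>
    (\<integral>\<^sup>+t. \<integral>\<^sup>+x. ennreal ((cmod (IFT (Ht t) x))^4) \<partial>lborel \<partial>lborel)
    \<le> ennreal (((nrm2 lborel H)^4 - 1 / (2 * pi * stab_const) * (nrm2 lborel H)\<^sup>2 *
        (nrm2 lborel (\<lambda>\<xi>. H \<xi> - a * exp (- b * complex_of_real ((norm \<xi>)\<^sup>2))))\<^sup>2) / (64 * pi^4))"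
proof -
  define N where "N = nrm2 half_line \<phi>"
  define I where "I = (\<integral>\<^sup>+t. \<integral>\<^sup>+x. ennreal ((cmod (FT (Ht t) (- x)))^4) \<partial>lborel \<partial>lborel)"
  have S: "I + ennreal (2 * pi^5) * defect \<phi> \<le> ennreal (4 * pi^6 * N^4)"
    unfolding I_def N_def by (rule strichartz_profile)
  \<comment> \<open>The right side is finite, hence so are both terms on the left; only then can the
    defect be subtracted, in the reals.\<close>
  have "ennreal (2 * pi^5) * defect \<phi> \<le> I + ennreal (2 * pi^5) * defect \<phi>" by simp
  also note S
  finally have "ennreal (2 * pi^5) * defect \<phi> < \<top>" by (rule le_less_trans) simp
  then have "defect \<phi> < \<top>" by (auto simp: ennreal_mult_less_top)
  moreover have "I < \<top>" using S by (cases "I = \<top>") (auto simp: less_top top_unique)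
  ultimately obtain d i where d: "d \<ge> 0" "defect \<phi> = ennreal d" and i: "i \<ge> 0" "I = ennreal i"
    by (metis ennreal_cases less_irrefl infinity_ennreal_def top_neq_ennreal)
  have re: "i + 2 * pi^5 * d \<le> 4 * pi^6 * N^4"
  proof -
    have "ennreal (i + 2 * pi^5 * d) \<le> ennreal (4 * pi^6 * N^4)"
      using S d i by (simp add: ennreal_mult)
    then show ?thesis by (subst (asm) ennreal_le_iff) auto
  qed
  obtain a b where b: "Re b > 0" and ab: "N\<^sup>2 * (nrm2 half_line (\<lambda>r. \<phi> r - a * exp (- b * complex_of_real r)))\<^sup>2 \<le> stab_const * d"
    using stability[of d] d unfolding N_def by auto
  define G where "G = (\<lambda>\<xi>::real^2. a * exp (- b * complex_of_real ((norm \<xi>)\<^sup>2)))"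
  define m where "m = (nrm2 half_line (\<lambda>r. \<phi> r - a * exp (- b * complex_of_real r)))\<^sup>2"
  have "sqint lborel (\<lambda>\<xi>. H \<xi> - G \<xi>)"
    unfolding G_def by (intro sqint_diff H_sqint gaussian_integrable_sqint b)
  then have m: "(nrm2 lborel (\<lambda>\<xi>. H \<xi> - G \<xi>))\<^sup>2 = pi * m"
    unfolding H_def G_def m_def by (intro radial_norm[where g="\<lambda>r. \<phi> r - a * exp (- b * complex_of_real r)"]) measurable
  have h: "(nrm2 lborel H)\<^sup>2 = pi * N\<^sup>2" unfolding N_def by (rule H_norm)
  have h4: "(nrm2 lborel H)^4 = pi\<^sup>2 * N^4"
  proof -
    have "(nrm2 lborel H)^4 = ((nrm2 lborel H)\<^sup>2)\<^sup>2" by simp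
    then show ?thesis unfolding h by (simp add: power_mult_distrib)
  qed
  have sp: "stab_const > 0" by (rule stab_const_pos)
  have "N\<^sup>2 * m / stab_const \<le> d" using ab sp by (simp add: m_def field_simps)
  then have "2 * pi^5 * (N\<^sup>2 * m / stab_const) \<le> 2 * pi^5 * d" by (intro mult_left_mono) auto
  with re have "i \<le> 4 * pi^6 * N^4 - 2 * pi^5 * (N\<^sup>2 * m / stab_const)" by linarith
  then have "i / (2 * pi)^8 \<le> (4 * pi^6 * N^4 - 2 * pi^5 * (N\<^sup>2 * m / stab_const)) / (2 * pi)^8"
    by (intro divide_right_mono) auto
  also have "\<dots> = ((nrm2 lborel H)^4 - 1 / (2 * pi * stab_const) * (nrm2 lborel H)\<^sup>2 * (nrm2 lborel (\<lambda>\<xi>. H \<xi> - G \<xi>))\<^sup>2) / (64 * pi^4)"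
    unfolding h h4 m using sp by (simp add: field_simps power_numeral_reduce)
  finally have r: "i / (2 * pi)^8 \<le> ((nrm2 lborel H)^4 - 1 / (2 * pi * stab_const) * (nrm2 lborel H)\<^sup>2 * (nrm2 lborel (\<lambda>\<xi>. H \<xi> - G \<xi>))\<^sup>2) / (64 * pi^4)" .
  have fm: "(\<lambda>p. FT (Ht (fst p)) (- snd p)) \<in> borel_measurable (borel \<Otimes>\<^sub>M borel)"
    unfolding FT_def by (intro lborel.borel_measurable_lebesgue_integral) measurable
  have ft: "(\<lambda>x. FT (Ht t) (- x)) \<in> borel_measurable borel" for t by measurable
  have "ennreal ((cmod (IFT (Ht t) x))^4) = ennreal (1 / (2 * pi)^8) * ennreal ((cmod (FT (Ht t) (- x)))^4)" for t x
    by (simp add: IFT_def norm_mult norm_divide norm_power power_mult_distrib power_divide flip: ennreal_mult power_mult)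
  then have "(\<integral>\<^sup>+t. \<integral>\<^sup>+x. ennreal ((cmod (IFT (Ht t) x))^4) \<partial>lborel \<partial>lborel)
    = (\<integral>\<^sup>+t. ennreal (1 / (2 * pi)^8) * (\<integral>\<^sup>+x. ennreal ((cmod (FT (Ht t) (- x)))^4) \<partial>lborel) \<partial>lborel)"
    using ft by (simp add: nn_integral_cmult)
  also have "\<dots> = ennreal (1 / (2 * pi)^8) * I"
    unfolding I_def by (rule nn_integral_cmult) (use fm in measurable)
  also have "\<dots> = ennreal (i / (2 * pi)^8)"
    unfolding i(2) using i(1) by (simp flip: ennreal_mult)
  also have "\<dots> \<le> ennreal (((nrm2 lborel H)^4 - 1 / (2 * pi * stab_const) * (nrm2 lborel H)\<^sup>2 * (nrm2 lborel (\<lambda>\<xi>. H \<xi> - G \<xi>))\<^sup>2) / (64 * pi^4))"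
    by (rule ennreal_leI[OF r])
  finally show ?thesis using b unfolding G_def by blast
qed

end

section \<open>Reduction to profiles\<close>

lemma lebesgue_borel_representative:
  fixes f :: "'a::euclidean_space \<Rightarrow> complex"
  assumes f: "f \<in> borel_measurable lebesgue"
  obtains f' where "f' \<in> borel_measurable borel" "AE x in lborel. f x = f' x"
proof -
  have "(\<lambda>x. Re (f x)) \<in> borel_measurable lebesgue" "(\<lambda>x. Im (f x)) \<in> borel_measurable lebesgue"
    using f by measurable
  then obtain p q where p: "p \<in> borel_measurable lborel" "AE x in lborel. Re (f x) = p x"
    and q: "q \<in> borel_measurable lborel" "AE x in lborel. Im (f x) = q x"
    using completion_ex_borel_measurable_real by metis
  show ?thesis
  proof (rule that[of "\<lambda>x. Complex (p x) (q x)"])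
    have "(\<lambda>x. complex_of_real (p x) + \<i> * complex_of_real (q x)) \<in> borel_measurable borel"
      using p(1) q(1) by measurable
    then show "(\<lambda>x. Complex (p x) (q x)) \<in> borel_measurable borel" by (simp add: Complex_eq)
    show "AE x in lborel. f x = Complex (p x) (q x)"
      using p(2) q(2) by eventually_elim (simp add: complex_eq_iff)
  qed
qed

lemma lebesgue_measurableI:
  "f \<in> borel_measurable borel \<Longrightarrow> f \<in> borel_measurable lebesgue"
  by (rule measurable_completion) simp

text \<open>If the integral is infinite, \<open>enn2real\<close> and the Bochner integral both
  return 0, so the second equation holds in every case.\<close>

lemma Lp_norm_representative:
  fixes f f' :: "'a::euclidean_space \<Rightarrow> complex"
  assumes f: "f \<in> borel_measurable lebesgue" and f': "f' \<in> borel_measurable borel"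
    and ae: "AE x in lborel. f x = f' x" and p: "p \<noteq> 0"
  shows "f \<in> Lp_space (real p) lebesgue \<longleftrightarrow> (\<integral>\<^sup>+x. ennreal (cmod (f' x) ^ p) \<partial>lborel) < \<infinity>"
    and "Lp_norm (real p) lebesgue f = enn2real (\<integral>\<^sup>+x. ennreal (cmod (f' x) ^ p) \<partial>lborel) powr (1 / real p)"
proof -
  have "(\<integral>\<^sup>+x. ennreal (cmod (f x) powr real p) \<partial>lebesgue) = (\<integral>\<^sup>+x. ennreal (cmod (f' x) ^ p) \<partial>lborel)"
    unfolding nn_integral_completion
    by (rule nn_integral_cong_AE) (use ae in \<open>eventually_elim, simp add: powr_realpow' p\<close>)
  moreover have "(\<lambda>x. cmod (f x) powr real p) \<in> borel_measurable lebesgue" using f by measurable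
  ultimately show "f \<in> Lp_space (real p) lebesgue \<longleftrightarrow> (\<integral>\<^sup>+x. ennreal (cmod (f' x) ^ p) \<partial>lborel) < \<infinity>"
    and "Lp_norm (real p) lebesgue f = enn2real (\<integral>\<^sup>+x. ennreal (cmod (f' x) ^ p) \<partial>lborel) powr (1 / real p)"
    using f by (simp_all add: Lp_space_def Lp_norm_def integrable_iff_bounded integral_eq_nn_integral)
qed

lemma L2_representative:
  fixes f f' :: "'a::euclidean_space \<Rightarrow> complex"
  assumes f: "f \<in> borel_measurable lebesgue" and f': "f' \<in> borel_measurable borel"
    and ae: "AE x in lborel. f x = f' x"
  shows "f \<in> L2 \<longleftrightarrow> sqint lborel f'" and "L2_norm f = nrm2 lborel f'"
proof -
  note r = Lp_norm_representative[OF f f' ae, of 2, simplified]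
  show "f \<in> L2 \<longleftrightarrow> sqint lborel f'"
    using r(1) f' by (simp add: sqint_iff_nn)
  show "L2_norm f = nrm2 lborel f'"
    unfolding r(2) nrm2_def using f' by (subst integral_eq_nn_integral) (auto simp: powr_half_sqrt)
qed

lemma fourier_L1_truncation:
  fixes f f' :: "'a::euclidean_space \<Rightarrow> complex"
  assumes f: "f \<in> borel_measurable lebesgue" and f': "f' \<in> borel_measurable borel"
    and ae: "AE x in lborel. f x = f' x"
  shows "fourier_L1 (\<lambda>x. indicator (cball 0 (real n)) x * f x) \<xi> = FT (trunc n f') \<xi>"
proof -
  have m: "(\<lambda>x. cis (- (x \<bullet> \<xi>)) * trunc n f' x) \<in> borel_measurable borel"
    using f' by measurable
  have i: "(indicator (cball 0 (real n)) :: 'a \<Rightarrow> complex) \<in> borel_measurable lebesgue"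
    by (intro lebesgue_measurableI borel_measurable_indicator) simp
  have c: "(\<lambda>x. cis (- (x \<bullet> \<xi>))) \<in> borel_measurable lebesgue"
    by (rule lebesgue_measurableI) measurable
  have "fourier_L1 (\<lambda>x. indicator (cball 0 (real n)) x * f x) \<xi> = (\<integral>x. cis (- (x \<bullet> \<xi>)) * trunc n f' x \<partial>lebesgue)"
    unfolding fourier_L1_def
  proof (rule integral_cong_AE)
    show "(\<lambda>x. cis (- (x \<bullet> \<xi>)) * (indicator (cball 0 (real n)) x * f x)) \<in> borel_measurable lebesgue"
      by (intro borel_measurable_times c i f)
    show "(\<lambda>x. cis (- (x \<bullet> \<xi>)) * trunc n f' x) \<in> borel_measurable lebesgue"
      by (rule lebesgue_measurableI[OF m])
    show "AE x in lebesgue. cis (- (x \<bullet> \<xi>)) * (indicator (cball 0 (real n)) x * f x) = cis (- (x \<bullet> \<xi>)) * trunc n f' x"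
      unfolding AE_completion_iff using ae by eventually_elim (simp add: trunc_def)
  qed
  also have "\<dots> = FT (trunc n f') \<xi>"
    unfolding FT_def by (rule integral_completion) (use m in simp)
  finally show ?thesis .
qed

section \<open>Fourier transforms of the datum and of the time slices\<close>

lemma has_L2_fourier_pair:
  fixes f f' :: "'a::euclidean_space \<Rightarrow> complex"
  assumes h: "has_L2_fourier f F"
    and f': "f' \<in> borel_measurable borel" and ae: "AE x in lborel. f x = f' x"
    and F': "F' \<in> borel_measurable borel" and aF: "AE x in lborel. F x = F' x"
  shows "fourier_pair f' F'"
proof -
  have f: "f \<in> borel_measurable lebesgue" and F: "F \<in> borel_measurable lebesgue"
    using h by (auto simp: has_L2_fourier_def Lp_space_def)
  have s: "sqint lborel f'" "sqint lborel F'"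
    using h L2_representative(1)[OF f f' ae] L2_representative(1)[OF F F' aF] by (auto simp: has_L2_fourier_def)
  note t = trunc_sqint[OF s(1)]
  have d: "sqint lborel (\<lambda>\<xi>. F' \<xi> - FT (trunc n f') \<xi>)" for n
    by (intro sqint_diff s FT_sq_le(1) t)
  have "(\<integral>\<^sup>+\<xi>. ennreal ((cmod (F \<xi> - fourier_L1 (\<lambda>x. indicator (cball 0 (real n)) x * f x) \<xi>))\<^sup>2) \<partial>lebesgue)
    = (\<integral>\<^sup>+\<xi>. ennreal ((cmod (F' \<xi> - FT (trunc n f') \<xi>))\<^sup>2) \<partial>lborel)" for n
    unfolding nn_integral_completion fourier_L1_truncation[OF f f' ae]
    by (rule nn_integral_cong_AE) (use aF in \<open>eventually_elim, simp\<close>)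
  then have "(\<integral>\<^sup>+\<xi>. ennreal ((cmod (F \<xi> - fourier_L1 (\<lambda>x. indicator (cball 0 (real n)) x * f x) \<xi>))\<^sup>2) \<partial>lebesgue)
    = ennreal ((nrm2 lborel (\<lambda>\<xi>. F' \<xi> - FT (trunc n f') \<xi>))\<^sup>2)" for n
    unfolding nn_integral_sqint[OF d] .
  then have "(\<lambda>n. ennreal ((nrm2 lborel (\<lambda>\<xi>. F' \<xi> - FT (trunc n f') \<xi>))\<^sup>2)) \<longlonglongrightarrow> ennreal 0"
    using h by (simp add: has_L2_fourier_def)
  then have "(\<lambda>n. (nrm2 lborel (\<lambda>\<xi>. F' \<xi> - FT (trunc n f') \<xi>))\<^sup>2) \<longlonglongrightarrow> 0"
    by (subst (asm) tendsto_ennreal_iff) auto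
  then have "(\<lambda>n. sqrt ((nrm2 lborel (\<lambda>\<xi>. F' \<xi> - FT (trunc n f') \<xi>))\<^sup>2)) \<longlonglongrightarrow> sqrt 0"
    by (rule tendsto_real_sqrt)
  then show ?thesis using s by (simp add: fourier_pair_def)
qed

lemma fourier_pair_unique:
  assumes "fourier_pair g G1" "fourier_pair g G2"
  shows "AE x in lborel. G1 x = G2 x"
proof -
  have g: "sqint lborel g" and G: "sqint lborel G1" "sqint lborel G2"
    and l: "(\<lambda>n. nrm2 lborel (\<lambda>\<xi>. G1 \<xi> - FT (trunc n g) \<xi>)) \<longlonglongrightarrow> 0"
      "(\<lambda>n. nrm2 lborel (\<lambda>\<xi>. G2 \<xi> - FT (trunc n g) \<xi>)) \<longlonglongrightarrow> 0"
    using assms by (auto simp: fourier_pair_def)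
  have "nrm2 lborel (\<lambda>\<xi>. G1 \<xi> - G2 \<xi>) \<le> nrm2 lborel (\<lambda>\<xi>. G1 \<xi> - FT (trunc n g) \<xi>) + nrm2 lborel (\<lambda>\<xi>. G2 \<xi> - FT (trunc n g) \<xi>)" for n
    using nrm2_triangle_diff[OF G(1) FT_sq_le(1)[OF trunc_sqint(2,1)[OF g]] G(2)]
    by (simp add: nrm2_minus_commute[of _ G2])
  then have "nrm2 lborel (\<lambda>\<xi>. G1 \<xi> - G2 \<xi>) \<le> 0"
    using LIMSEQ_le_const[OF tendsto_add[OF l]] by (metis add_0)
  then show ?thesis
    using sqint_eq_0_AE[OF sqint_diff[OF G]] nrm2_nonneg[of lborel "\<lambda>\<xi>. G1 \<xi> - G2 \<xi>"] by (simp add: order_antisym)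
qed

text \<open>\<open>schroedinger_propagator\<close> supplies a transform of \<open>f\<close> for each
  time separately. By \<open>fourier_pair_unique\<close> they agree almost everywhere, so that one
  \<open>F\<close> serves for all times.\<close>

lemma solution_fourier_pair:
  fixes f :: "'a::euclidean_space \<Rightarrow> complex"
  assumes u: "schroedinger_solution f u"
  obtains F where "\<And>f'. f' \<in> borel_measurable borel \<Longrightarrow> AE x in lborel. f x = f' x \<Longrightarrow> fourier_pair f' F"
    and "\<And>t v. v \<in> borel_measurable borel \<Longrightarrow> AE x in lborel. u (x, t) = v x \<Longrightarrow>
      fourier_pair v (\<lambda>\<xi>. cis (- t * (norm \<xi>)\<^sup>2) * F \<xi>)"
proof -
  have "\<forall>t. \<exists>F. has_L2_fourier f F \<and> has_L2_fourier (\<lambda>x. u (x, t)) (\<lambda>\<xi>. cis (- t * (norm \<xi>)\<^sup>2) * F \<xi>)"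
    using u by (simp add: schroedinger_solution_def schroedinger_propagator_def)
  then obtain F where F: "\<And>t. has_L2_fourier f (F t)"
      "\<And>t. has_L2_fourier (\<lambda>x. u (x, t)) (\<lambda>\<xi>. cis (- t * (norm \<xi>)\<^sup>2) * F t \<xi>)" by metis
  have "f \<in> borel_measurable lebesgue" using F(1)[of 0] by (simp add: has_L2_fourier_def Lp_space_def)
  then obtain f0 where f0: "f0 \<in> borel_measurable borel" "AE x in lborel. f x = f0 x"
    by (rule lebesgue_borel_representative)
  have "\<exists>F'. F' \<in> borel_measurable borel \<and> (AE \<xi> in lborel. F t \<xi> = F' \<xi>)" for t
    using lebesgue_borel_representative[of "F t"] F(1)[of t] by (auto simp: has_L2_fourier_def Lp_space_def)
  then obtain F' where F': "\<And>t. F' t \<in> borel_measurable borel" "\<And>t. AE \<xi> in lborel. F t \<xi> = F' t \<xi>" by metis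
  have p: "fourier_pair f' (F' t)" if "f' \<in> borel_measurable borel" "AE x in lborel. f x = f' x" for f' t
    by (rule has_L2_fourier_pair[OF F(1) that F'])
  have eq: "AE \<xi> in lborel. F t \<xi> = F' 0 \<xi>" for t
    using F'(2)[of t] fourier_pair_unique[OF p[OF f0, of t] p[OF f0, of 0]] by eventually_elim simp
  show ?thesis
  proof (rule that[of "F' 0"])
    show "fourier_pair f' (F' 0)" if "f' \<in> borel_measurable borel" "AE x in lborel. f x = f' x" for f'
      by (rule p[OF that])
    show "fourier_pair v (\<lambda>\<xi>. cis (- t * (norm \<xi>)\<^sup>2) * F' 0 \<xi>)"
      if "v \<in> borel_measurable borel" "AE x in lborel. u (x, t) = v x" for t v
    proof (rule has_L2_fourier_pair[OF F(2) that])
      show "(\<lambda>\<xi>. cis (- t * (norm \<xi>)\<^sup>2) * F' 0 \<xi>) \<in> borel_measurable borel"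
        using F'(1)[of 0] by measurable
      show "AE \<xi> in lborel. cis (- t * (norm \<xi>)\<^sup>2) * F t \<xi> = cis (- t * (norm \<xi>)\<^sup>2) * F' 0 \<xi>"
        using eq[of t] by eventually_elim simp
    qed
  qed
qed

text \<open>A rotation taking \<open>\<xi>\<close> to \<open>\<eta>\<close> preserves
  \<open>lborel\<close> and inner products. The Borel representative \<open>h\<close> need not be
  radial pointwise, so the invariance is borrowed from \<open>g\<close> almost everywhere.\<close>

lemma FT_radial:
  fixes h g :: "real^2 \<Rightarrow> complex"
  assumes h: "h \<in> borel_measurable borel" and g: "radial g" and ae: "AE x in lborel. h x = g x"
    and n: "norm \<xi> = norm \<eta>"
  shows "FT h \<eta> = FT h \<xi>"
proof -
  obtain T where T: "orthogonal_transformation T" "T \<xi> = \<eta>"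
    using orthogonal_transformation_exists[OF n] by metis
  have [measurable]: "T \<in> borel_measurable borel"
    by (intro borel_measurable_continuous_onI linear_continuous_on linear_linear[THEN iffD2] orthogonal_transformation_linear T)
  have [measurable]: "h \<in> borel_measurable borel" by (rule h)
  have aeT: "AE x in lborel. h (T x) = g (T x)"
    using AE_distrD[of T lborel borel "\<lambda>x. h x = g x"] ae unfolding distr_orthogonal[OF T(1)] by simp
  have gT: "g (T x) = g x" for x
    using g orthogonal_transformation_norm[OF T(1)] unfolding radial_def by blast
  have "FT h \<eta> = (\<integral>x. cis (- (x \<bullet> \<eta>)) * h x \<partial>distr lborel borel T)"
    unfolding FT_def distr_orthogonal[OF T(1)] ..
  also have "\<dots> = (\<integral>x. cis (- (T x \<bullet> \<eta>)) * h (T x) \<partial>lborel)"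
    by (rule integral_distr) measurable
  also have "\<dots> = (\<integral>x. cis (- (x \<bullet> \<xi>)) * h x \<partial>lborel)"
  proof (rule integral_cong_AE)
    show "AE x in lborel. cis (- (T x \<bullet> \<eta>)) * h (T x) = cis (- (x \<bullet> \<xi>)) * h x"
      using aeT ae
    proof eventually_elim
      case (elim x)
      have "T x \<bullet> \<eta> = x \<bullet> \<xi>"
        using T unfolding orthogonal_transformation_def by metis
      then show ?case using elim gT[of x] by simp
    qed
  qed measurable
  finally show ?thesis unfolding FT_def .
qed

text \<open>Truncating \<open>f\<close> to a ball makes its transform continuous and keeps it
  radial; a continuous cutoff in frequency then gives bounded support. Each of the two steps costs
  at most \<open>e / 2\<close>.\<close>

lemma radial_profile_approximation:
  fixes f :: "real^2 \<Rightarrow> complex"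
  assumes r: "radial f" and ae: "AE x in lborel. f x = f' x" and p: "fourier_pair f' F" and e: "e > 0"
  obtains \<phi> L where "profile \<phi> L" "nrm2 lborel (\<lambda>\<xi>. F \<xi> - \<phi> ((norm \<xi>)\<^sup>2)) < e"
proof -
  have f': "sqint lborel f'" and F: "sqint lborel F"
    and l: "(\<lambda>n. nrm2 lborel (\<lambda>\<xi>. F \<xi> - FT (trunc n f') \<xi>)) \<longlonglongrightarrow> 0"
    using p by (auto simp: fourier_pair_def)
  obtain n where n: "nrm2 lborel (\<lambda>\<xi>. F \<xi> - FT (trunc n f') \<xi>) < e / 2"
    using LIMSEQ_D[OF l, of "e / 2"] e by fastforce
  define A where "A = FT (trunc n f')"
  note t = trunc_sqint[OF f', of n]
  have A: "sqint lborel A" unfolding A_def by (rule FT_sq_le(1)[OF t(2,1)])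
  obtain m where m: "nrm2 lborel (\<lambda>x. trunc m A x - A x) < e / 2"
    using LIMSEQ_D[OF trunc_tendsto[OF A], of "e / 2"] e by fastforce
  have Ac: "continuous_on UNIV A" unfolding A_def by (rule FT_continuous[OF t(2)])
  have [measurable]: "A \<in> borel_measurable borel" using A by (simp add: sqint_def)
  have rad: "A \<eta> = A \<xi>" if "norm \<xi> = norm \<eta>" for \<xi> \<eta>
    unfolding A_def
  proof (rule FT_radial[OF _ _ _ that])
    show "trunc n f' \<in> borel_measurable borel" using t(1) by (simp add: sqint_def)
    show "radial (\<lambda>x. indicator (cball 0 (real n)) x * f x)"
    proof (unfold radial_def, intro allI impI)
      fix x y :: "real^2"
      assume xy: "norm x = norm y"
      then have "f x = f y" using r unfolding radial_def by blast
      with xy show "indicator (cball 0 (real n)) x * f x = indicator (cball 0 (real n)) y * f y"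
        by (simp add: indicator_def)
    qed
    show "AE x in lborel. trunc n f' x = indicator (cball 0 (real n)) x * f x"
      using ae by eventually_elim (simp add: trunc_def)
  qed
  define v :: "real^2" where "v = axis 1 1"
  have v: "norm v = 1" by (simp add: v_def)
  \<comment> \<open>Equal to 1 up to \<open>m\<close> and to 0 from \<open>m + 1\<close> on for
    nonnegative arguments, so the loss is at most that of \<open>trunc m\<close>, while continuity
    is kept.\<close>
  define cut where "cut s = max 0 (min 1 (real m + 1 - s))" for s :: real
  \<comment> \<open>Clamping at 0 extends the profile continuously to negative arguments;
    \<open>v\<close> fixes the ray on which the radial function \<open>A\<close> is read.\<close>
  define \<phi> where "\<phi> r = complex_of_real (cut (sqrt (max r 0))) * A (sqrt (max r 0) *\<^sub>R v)" for r
  have H: "\<phi> ((norm \<xi>)\<^sup>2) = complex_of_real (cut (norm \<xi>)) * A \<xi>" for \<xi>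
    using rad[of "norm \<xi> *\<^sub>R v" \<xi>] by (simp add: \<phi>_def v)
  have prof: "profile \<phi> ((real m + 1)\<^sup>2)"
  proof
    show "continuous_on UNIV \<phi>"
      unfolding \<phi>_def[abs_def] cut_def
      by (intro continuous_intros continuous_on_compose2[OF Ac]) auto
    show "0 < (real m + 1)\<^sup>2" by simp
    show "\<phi> r = 0" if "(real m + 1)\<^sup>2 \<le> r" for r
    proof -
      have "real m + 1 \<le> sqrt r" using that by (intro real_le_rsqrt)
      moreover have "r \<ge> 0" using that zero_le_power2[of "real m + 1"] by linarith
      ultimately show ?thesis by (simp add: \<phi>_def cut_def)
    qed
  qed
  have sH: "sqint lborel (\<lambda>\<xi>::real^2. \<phi> ((norm \<xi>)\<^sup>2))"
    using profile.H_sqint[OF prof] unfolding profile.H_def[OF prof, abs_def] .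
  have le: "(cmod (A \<xi> - \<phi> ((norm \<xi>)\<^sup>2)))\<^sup>2 \<le> (cmod (trunc m A \<xi> - A \<xi>))\<^sup>2" for \<xi>
  proof -
    have "cmod (A \<xi> - \<phi> ((norm \<xi>)\<^sup>2)) = (1 - cut (norm \<xi>)) * cmod (A \<xi>)"
    proof -
      have "A \<xi> - \<phi> ((norm \<xi>)\<^sup>2) = complex_of_real (1 - cut (norm \<xi>)) * A \<xi>"
        unfolding H by (simp add: left_diff_distrib)
      moreover have "cut (norm \<xi>) \<le> 1" by (simp add: cut_def)
      ultimately show ?thesis by (simp add: norm_mult del: of_real_diff)
    qed
    also have "\<dots> \<le> cmod (trunc m A \<xi> - A \<xi>)"
    proof (cases "norm \<xi> \<le> real m")
      case True
      then show ?thesis by (simp add: cut_def trunc_def)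
    next
      case False
      have "cut (norm \<xi>) \<ge> 0" by (simp add: cut_def)
      with False show ?thesis by (simp add: trunc_def mult_left_le_one_le mult_right_le_one_le cut_def)
    qed
    finally show ?thesis by (intro power_mono) auto
  qed
  have "nrm2 lborel (\<lambda>\<xi>. A \<xi> - \<phi> ((norm \<xi>)\<^sup>2)) \<le> nrm2 lborel (\<lambda>x. trunc m A x - A x)"
    unfolding nrm2_def
    by (intro real_sqrt_le_mono integral_mono sqint_integrable sqint_diff A sH trunc_sqint le)
  with m n nrm2_triangle_diff[OF F A sH] have "nrm2 lborel (\<lambda>\<xi>. F \<xi> - \<phi> ((norm \<xi>)\<^sup>2)) < e"
    unfolding A_def by linarith
  with prof show ?thesis by (rule that)
qed

text \<open>Geometric decay makes the squared differences summable in \<open>L\<^sup>1\<close>,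
  hence summable at almost every point. The whole sequence converges, so no subsequence depending on
  the time has to be chosen later.\<close>

lemma AE_tendsto_of_summable_nrm2:
  assumes s: "\<And>k. sqint M (\<lambda>x. f k x - g x)" and e: "\<And>k. nrm2 M (\<lambda>x. f k x - g x) \<le> c * (1 / 2) ^ k"
  shows "AE x in M. (\<lambda>k. f k x) \<longlonglongrightarrow> g x"
proof -
  have m: "(\<lambda>x. ennreal ((cmod (f k x - g x))\<^sup>2)) \<in> borel_measurable M" for k
  proof -
    have [measurable]: "(\<lambda>x. f k x - g x) \<in> borel_measurable M" using s[of k] by (simp add: sqint_def)
    show ?thesis by measurable
  qed
  have "(\<integral>\<^sup>+x. (\<Sum>k. ennreal ((cmod (f k x - g x))\<^sup>2)) \<partial>M) = (\<Sum>k. \<integral>\<^sup>+x. ennreal ((cmod (f k x - g x))\<^sup>2) \<partial>M)"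
    by (rule nn_integral_suminf[OF m])
  also have "\<dots> \<le> (\<Sum>k. ennreal (c\<^sup>2 * (1 / 4) ^ k))"
  proof (rule suminf_le)
    fix k
    have "(nrm2 M (\<lambda>x. f k x - g x))\<^sup>2 \<le> (c * (1 / 2) ^ k)\<^sup>2" by (intro power_mono e) simp
    also have "\<dots> = c\<^sup>2 * (1 / 4) ^ k"
      by (simp add: power_mult_distrib power2_eq_square flip: power_mult_distrib)
    finally show "(\<integral>\<^sup>+x. ennreal ((cmod (f k x - g x))\<^sup>2) \<partial>M) \<le> ennreal (c\<^sup>2 * (1 / 4) ^ k)"
      unfolding nn_integral_sqint[OF s] by (rule ennreal_leI)
  qed auto
  also have "\<dots> = ennreal (\<Sum>k. c\<^sup>2 * (1 / 4) ^ k)"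
    by (rule suminf_ennreal2) (auto intro!: summable_mult summable_geometric)
  also have "\<dots> < \<infinity>" by simp
  finally have "(\<integral>\<^sup>+x. (\<Sum>k. ennreal ((cmod (f k x - g x))\<^sup>2)) \<partial>M) \<noteq> \<infinity>" by simp
  then have "AE x in M. (\<Sum>k. ennreal ((cmod (f k x - g x))\<^sup>2)) \<noteq> \<infinity>"
    by (intro nn_integral_PInf_AE) (use m in measurable)
  then show ?thesis
  proof eventually_elim
    case (elim x)
    then have "summable (\<lambda>k. (cmod (f k x - g x))\<^sup>2)"
      by (intro summable_suminf_not_top) auto
    then have "(\<lambda>k. sqrt ((cmod (f k x - g x))\<^sup>2)) \<longlonglongrightarrow> sqrt 0"
      by (intro tendsto_real_sqrt summable_LIMSEQ_zero)
    then have "(\<lambda>k. norm (f k x - g x)) \<longlonglongrightarrow> 0" by simp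
    then show ?case by (rule LIM_zero_cancel[OF tendsto_norm_zero_cancel])
  qed
qed

section \<open>Distance to the Gaussians\<close>

lemma Lp_norm_nonneg: "Lp_norm p M f \<ge> 0"
  by (simp add: Lp_norm_def)

lemma L2_Dist_le: "g \<in> S \<Longrightarrow> L2_Dist f S \<le> L2_norm (\<lambda>x. f x - g x)"
  unfolding L2_Dist_def by (intro cINF_lower bdd_belowI[of _ 0]) (auto simp: Lp_norm_nonneg)

lemma L2_Dist_nonneg: "S \<noteq> {} \<Longrightarrow> L2_Dist f S \<ge> 0"
  unfolding L2_Dist_def by (intro cINF_greatest Lp_norm_nonneg)

text \<open>The coefficient \<open>a = 0\<close> is allowed; consequently the distance never exceeds
  the norm.\<close>

lemma zero_in_radial_gaussians: "(\<lambda>x. 0) \<in> radial_gaussians"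
  unfolding radial_gaussians_def by (rule CollectI, rule exI[of _ 0], rule exI[of _ 1]) simp

text \<open>\<open>IFT\<close> maps Gaussians to Gaussians and scales distances by a fixed constant,
  so each Gaussian on the frequency side gives a competitor for the distance of
  \<open>f\<close>.\<close>

lemma fourier_pair_dist_gaussians:
  fixes f :: "'a::euclidean_space \<Rightarrow> complex"
  assumes f: "f \<in> borel_measurable lebesgue" and f': "f' \<in> borel_measurable borel"
    and ae: "AE x in lborel. f x = f' x" and p: "fourier_pair f' F" and b: "Re b > 0"
  shows "fourier_const TYPE('a) * L2_Dist f radial_gaussians
    \<le> nrm2 lborel (\<lambda>\<xi>. F \<xi> - a * exp (- b * complex_of_real ((norm \<xi>)\<^sup>2)))"
proof -
  define G where "G = (\<lambda>\<xi>::'a. a * exp (- b * complex_of_real ((norm \<xi>)\<^sup>2)))"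
  have G: "integrable lborel G" "sqint lborel G"
    unfolding G_def by (rule gaussian_integrable_sqint[OF b])+
  have im: "IFT G \<in> borel_measurable borel" using IFT_sqint[OF G] by (simp add: sqint_def)
  have "L2_Dist f radial_gaussians \<le> L2_norm (\<lambda>x. f x - IFT G x)"
    unfolding G_def by (rule L2_Dist_le[OF IFT_gaussian[OF b]])
  also have "\<dots> = nrm2 lborel (\<lambda>x. f' x - IFT G x)"
  proof (rule L2_representative(2))
    show "(\<lambda>x. f x - IFT G x) \<in> borel_measurable lebesgue"
      by (intro borel_measurable_diff f lebesgue_measurableI im)
    show "(\<lambda>x. f' x - IFT G x) \<in> borel_measurable borel"
      by (intro borel_measurable_diff f' im)
    show "AE x in lborel. f x - IFT G x = f' x - IFT G x"
      using ae by eventually_elim simp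
  qed
  also have "\<dots> = nrm2 lborel (\<lambda>\<xi>. F \<xi> - G \<xi>) / fourier_const TYPE('a)"
    by (rule fourier_pair_dist[OF p G])
  finally show ?thesis unfolding G_def by (simp add: field_simps)
qed

lemma powr_quarter:
  fixes y :: real
  assumes "y \<ge> 0"
  shows "y powr (1 / 4) = root 4 y"
  using assms by (cases "y = 0") (simp_all add: root_powr_inverse)

lemma root4_quarter: "root 4 (1 / 4) = 1 / sqrt 2"
  by (rule real_root_pos_unique) (auto simp: power_divide power4_eq_xxxx)

text \<open>The Gaussian found by \<open>strichartz_stability\<close> changes with the approximating
  profile and need not converge. Only the distance to the whole family is retained, and this passes
  to the limit. Membership in \<open>Lp_space\<close> accompanies the bound so that
  \<open>Lp_norm\<close> is not a default value.\<close>

theorem corollary2: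
  "\<exists>\<Gamma>::real. \<Gamma> > 0 \<and>
     (\<forall>(f :: real^2 \<Rightarrow> complex) (u :: (real^2) \<times> real \<Rightarrow> complex).
        f \<in> L2_rad \<longrightarrow> \<not> (AE x in lebesgue. f x = 0) \<longrightarrow> schroedinger_solution f u \<longrightarrow>
        u \<in> Lp_space 4 lebesgue \<and>
        Lp_norm 4 lebesgue u \<le>
          1 / sqrt 2 * L2_norm f *
            root 4 (1 - \<Gamma> * ((L2_Dist f radial_gaussians)\<^sup>2 / (L2_norm f)\<^sup>2)))"
proof -
  define \<kappa> where "\<kappa> = 1 / (2 * pi * stab_const)"
  have \<kappa>: "\<kappa> > 0" using stab_const_pos by (simp add: \<kappa>_def)
  show ?thesis
  \<comment> \<open>The minimum with 1 keeps the argument of the root nonnegative, since the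
    distance is at most the norm.\<close>
  proof (intro exI[of _ "min \<kappa> 1"] conjI allI impI)
    show "min \<kappa> 1 > 0" using \<kappa> by simp
  next
    fix f :: "real^2 \<Rightarrow> complex" and u :: "(real^2) \<times> real \<Rightarrow> complex"
    assume fr: "f \<in> L2_rad" and nz: "\<not> (AE x in lebesgue. f x = 0)" and sol: "schroedinger_solution f u"
    have f: "f \<in> L2" "radial f" and fm: "f \<in> borel_measurable lebesgue"
      using fr by (auto simp: L2_rad_def Lp_space_def)
    obtain f' where f': "f' \<in> borel_measurable borel" and ae: "AE x in lborel. f x = f' x"
      using lebesgue_borel_representative[OF fm] .
    obtain F where fF: "fourier_pair f' F"
      and ut: "\<And>t v. v \<in> borel_measurable borel \<Longrightarrow> AE x in lborel. u (x, t) = v x \<Longrightarrow>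
        fourier_pair v (\<lambda>\<xi>. cis (- t * (norm \<xi>)\<^sup>2) * F \<xi>)"
    proof (rule solution_fourier_pair[OF sol])
      fix F
      assume 1: "\<And>f'. f' \<in> borel_measurable borel \<Longrightarrow> AE x in lborel. f x = f' x \<Longrightarrow> fourier_pair f' F"
        and 2: "\<And>t v. v \<in> borel_measurable borel \<Longrightarrow> AE x in lborel. u (x, t) = v x \<Longrightarrow>
          fourier_pair v (\<lambda>\<xi>. cis (- t * (norm \<xi>)\<^sup>2) * F \<xi>)"
      show thesis by (rule that[OF 1[OF f' ae]]) (rule 2)
    qed
    have F: "sqint lborel F" using fF by (simp add: fourier_pair_def)
    have fc2: "fourier_const TYPE(real^2) = 2 * pi" by (simp add: power_mult_distrib real_sqrt_mult)
    define n where "n = L2_norm f"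
    define d where "d = L2_Dist f radial_gaussians"
    have nf: "n = nrm2 lborel f'" unfolding n_def by (rule L2_representative(2)[OF fm f' ae])
    have NF: "nrm2 lborel F = 2 * pi * n" using fourier_pair_norm[OF fF] fc2 nf by simp
    have n: "n > 0"
    proof -
      have "n \<noteq> 0"
      proof
        assume "n = 0"
        then have "AE x in lborel. f' x = 0"
          using fF unfolding nf fourier_pair_def by (intro sqint_eq_0_AE) auto
        with ae have "AE x in lborel. f x = 0" by eventually_elim simp
        with nz show False by (simp add: AE_completion_iff)
      qed
      then show ?thesis using Lp_norm_nonneg[of 2 lebesgue f] by (simp add: n_def)
    qed
    have d0: "d \<ge> 0" unfolding d_def using zero_in_radial_gaussians by (intro L2_Dist_nonneg) auto
    have dn: "d \<le> n" unfolding d_def n_def using L2_Dist_le[OF zero_in_radial_gaussians, of f] by simp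

    \<comment> \<open>The geometric rate is the one that \<open>AE_tendsto_of_summable_nrm2\<close>
      asks for.\<close>
    have "\<exists>\<phi> L. profile \<phi> L \<and> nrm2 lborel (\<lambda>\<xi>. F \<xi> - \<phi> ((norm \<xi>)\<^sup>2)) < (1 / 2) ^ k" for k :: nat
      by (rule radial_profile_approximation[OF f(2) ae fF, of "(1 / 2) ^ k"]) auto
    then obtain \<phi> L where prof: "\<And>k. profile (\<phi> k) (L k)"
      and ap: "\<And>k. nrm2 lborel (\<lambda>\<xi>. F \<xi> - \<phi> k ((norm \<xi>)\<^sup>2)) < (1 / 2) ^ k" by metis
    define H where "H k = profile.H (\<phi> k)" for k
    define Ht where "Ht k = profile.Ht (\<phi> k)" for k
    have Hn: "nrm2 lborel (\<lambda>\<xi>. F \<xi> - H k \<xi>) < (1 / 2) ^ k" for k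
      using ap[of k] by (simp add: H_def profile.H_def[OF prof])
    have HtH: "Ht k t \<xi> = cis (- t * (norm \<xi>)\<^sup>2) * H k \<xi>" for k t \<xi>
      by (simp add: H_def Ht_def profile.Ht_def[OF prof])
    have Hs: "sqint lborel (H k)" for k unfolding H_def by (rule profile.H_sqint[OF prof])
    have Hti: "integrable lborel (Ht k t)" and Hts: "sqint lborel (Ht k t)" for k t
      unfolding Ht_def by (rule profile.Ht_integrable[OF prof] profile.Ht_sqint[OF prof])+
    have e0: "(\<lambda>k. nrm2 lborel (\<lambda>\<xi>. F \<xi> - H k \<xi>)) \<longlonglongrightarrow> 0"
      by (rule tendsto_sandwich[OF _ _ tendsto_const LIMSEQ_realpow_zero[of "1/2"]])
         (auto intro: always_eventually less_imp_le[OF Hn])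
    have hN: "(\<lambda>k. nrm2 lborel (H k)) \<longlonglongrightarrow> 2 * pi * n"
      unfolding NF[symmetric] by (rule nrm2_tendsto[OF Hs F]) (use e0 in \<open>simp add: nrm2_minus_commute\<close>)

    define J where "J k t = (\<integral>\<^sup>+x. ennreal ((cmod (IFT (Ht k t) x))^4) \<partial>lborel)" for k t
    \<comment> \<open>The distance of \<open>H k\<close> from any Gaussian is at least
      \<open>2 * pi * d\<close> minus the approximation error; the maximum with 0 makes squaring
      monotone. This bound does not involve the Gaussian attached to \<open>H k\<close>, so
      \<open>S\<close> has a limit.\<close>
    define S where "S k = ((nrm2 lborel (H k))^4 - \<kappa> * (nrm2 lborel (H k))\<^sup>2 *
      (max 0 (2 * pi * d - nrm2 lborel (\<lambda>\<xi>. F \<xi> - H k \<xi>)))\<^sup>2) / (64 * pi^4)" for k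
    have JS: "(\<integral>\<^sup>+t. J k t \<partial>lborel) \<le> ennreal (S k)" for k
    proof -
      obtain a b where b: "Re b > 0" and le: "(\<integral>\<^sup>+t. J k t \<partial>lborel) \<le> ennreal (((nrm2 lborel (H k))^4 - \<kappa> * (nrm2 lborel (H k))\<^sup>2 *
        (nrm2 lborel (\<lambda>\<xi>. H k \<xi> - a * exp (- b * complex_of_real ((norm \<xi>)\<^sup>2))))\<^sup>2) / (64 * pi^4))"
        using profile.strichartz_stability[OF prof, of k] unfolding J_def H_def Ht_def \<kappa>_def by blast
      define D where "D = nrm2 lborel (\<lambda>\<xi>. H k \<xi> - a * exp (- b * complex_of_real ((norm \<xi>)\<^sup>2)))"
      have "2 * pi * d \<le> nrm2 lborel (\<lambda>\<xi>. F \<xi> - a * exp (- b * complex_of_real ((norm \<xi>)\<^sup>2)))"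
        using fourier_pair_dist_gaussians[OF fm f' ae fF b, of a] unfolding fc2 d_def .
      also have "\<dots> \<le> nrm2 lborel (\<lambda>\<xi>. F \<xi> - H k \<xi>) + D"
        unfolding D_def by (intro nrm2_triangle_diff F Hs gaussian_integrable_sqint b)
      finally have "max 0 (2 * pi * d - nrm2 lborel (\<lambda>\<xi>. F \<xi> - H k \<xi>)) \<le> D" by (simp add: D_def)
      then have "(max 0 (2 * pi * d - nrm2 lborel (\<lambda>\<xi>. F \<xi> - H k \<xi>)))\<^sup>2 \<le> D\<^sup>2" by (intro power_mono) auto
      then have "((nrm2 lborel (H k))^4 - \<kappa> * (nrm2 lborel (H k))\<^sup>2 * D\<^sup>2) / (64 * pi^4) \<le> S k"
        unfolding S_def using \<kappa> by (intro divide_right_mono diff_left_mono mult_left_mono) auto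
      with le show ?thesis unfolding D_def[symmetric] by (meson ennreal_leI order_trans)
    qed
    have "S \<longlonglongrightarrow> ((2 * pi * n)^4 - \<kappa> * (2 * pi * n)\<^sup>2 * (max 0 (2 * pi * d - 0))\<^sup>2) / (64 * pi^4)"
      unfolding S_def[abs_def] by (intro tendsto_intros hN e0) simp
    moreover have "((2 * pi * n)^4 - \<kappa> * (2 * pi * n)\<^sup>2 * (max 0 (2 * pi * d - 0))\<^sup>2) / (64 * pi^4) = (n^4 - \<kappa> * n\<^sup>2 * d\<^sup>2) / 4"
      using d0 by (simp add: power_mult_distrib field_simps power4_eq_xxxx power2_eq_square)
    ultimately have Slim: "S \<longlonglongrightarrow> (n^4 - \<kappa> * n\<^sup>2 * d\<^sup>2) / 4" by (simp only:)

    have um: "u \<in> borel_measurable lebesgue" using sol by (simp add: schroedinger_solution_def)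
    obtain u' where u': "u' \<in> borel_measurable borel" and aeu: "AE z in lborel. u z = u' z"
      using lebesgue_borel_representative[OF um] .
    have u'm[measurable]: "u' \<in> borel_measurable (borel \<Otimes>\<^sub>M borel)" using u' by (simp add: borel_prod)
    \<comment> \<open>For almost every \<open>t\<close> the slice of the Borel function
      \<open>u'\<close> represents the slice of \<open>u\<close>, so that \<open>ut\<close> applies
      to it.\<close>
    have aet: "AE t in lborel. AE x in lborel. u (x, t) = u' (x, t)"
    proof -
      have sw: "(\<lambda>p. (snd p, fst p)) \<in> measurable (borel \<Otimes>\<^sub>M borel) (borel \<Otimes>\<^sub>M (borel :: (real^2) measure))"
        by measurable
      have "AE p in (lborel :: (real^2) measure) \<Otimes>\<^sub>M (lborel :: real measure). u p = u' p"
        unfolding lborel_prod by (rule aeu)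
      then have "AE p in distr ((lborel :: real measure) \<Otimes>\<^sub>M (lborel :: (real^2) measure)) (lborel \<Otimes>\<^sub>M lborel) (\<lambda>(x, y). (y, x)). u p = u' p"
        by (subst lborel_pair.distr_pair_swap[symmetric])
      then have "AE p in (lborel :: real measure) \<Otimes>\<^sub>M (lborel :: (real^2) measure). u (snd p, fst p) = u' (snd p, fst p)"
        by (rule AE_distrD[rotated, THEN AE_mp]) (auto simp: case_prod_beta)
      from lborel_pair.AE_pair[OF this] show ?thesis by simp
    qed
    \<comment> \<open>The isometry and the geometric rate show that the evolved profiles converge
      almost everywhere to the time slice; Fatou's lemma then needs no bound on their fourth
      powers.\<close>
    have slice: "(\<integral>\<^sup>+x. ennreal ((cmod (u' (x, t)))^4) \<partial>lborel) \<le> liminf (\<lambda>k. J k t)"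
      if t: "AE x in lborel. u (x, t) = u' (x, t)" for t
    proof -
      have vm: "(\<lambda>x. u' (x, t)) \<in> borel_measurable borel" by measurable
      note fp = ut[OF vm t]
      have s: "sqint lborel (\<lambda>x. IFT (Ht k t) x - u' (x, t))" for k
        using fp IFT_sqint[OF Hti Hts] by (auto simp: fourier_pair_def intro!: sqint_diff)
      have "nrm2 lborel (\<lambda>x. IFT (Ht k t) x - u' (x, t)) \<le> 1 / (2 * pi) * (1 / 2) ^ k" for k
      proof -
        have "nrm2 lborel (\<lambda>x. IFT (Ht k t) x - u' (x, t)) = nrm2 lborel (\<lambda>\<xi>. cis (- t * (norm \<xi>)\<^sup>2) * F \<xi> - Ht k t \<xi>) / (2 * pi)"
          using fourier_pair_dist[OF fp Hti Hts] fc2 by (simp add: nrm2_minus_commute)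
        also have "nrm2 lborel (\<lambda>\<xi>. cis (- t * (norm \<xi>)\<^sup>2) * F \<xi> - Ht k t \<xi>) = nrm2 lborel (\<lambda>\<xi>. F \<xi> - H k \<xi>)"
          unfolding HtH right_diff_distrib[symmetric] nrm2_def norm_mult by simp
        also have "nrm2 lborel (\<lambda>\<xi>. F \<xi> - H k \<xi>) / (2 * pi) \<le> (1 / 2) ^ k / (2 * pi)"
          by (intro divide_right_mono less_imp_le[OF Hn]) simp
        finally show ?thesis by simp
      qed
      note conv = AE_tendsto_of_summable_nrm2[OF s this]
      have im: "IFT (Ht k t) \<in> borel_measurable borel" for k
        using IFT_sqint[OF Hti Hts] by (simp add: sqint_def)
      have "(\<integral>\<^sup>+x. ennreal ((cmod (u' (x, t)))^4) \<partial>lborel) = (\<integral>\<^sup>+x. liminf (\<lambda>k. ennreal ((cmod (IFT (Ht k t) x))^4)) \<partial>lborel)"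
      proof (rule nn_integral_cong_AE)
        show "AE x in lborel. ennreal ((cmod (u' (x, t)))^4) = liminf (\<lambda>k. ennreal ((cmod (IFT (Ht k t) x))^4))"
          using conv
        proof eventually_elim
          case (elim x)
          then have "(\<lambda>k. ennreal ((cmod (IFT (Ht k t) x))^4)) \<longlonglongrightarrow> ennreal ((cmod (u' (x, t)))^4)"
            by (intro tendsto_ennrealI tendsto_intros)
          then show ?case by (intro lim_imp_Liminf[symmetric]) simp_all
        qed
      qed
      also have "\<dots> \<le> liminf (\<lambda>k. J k t)"
        unfolding J_def by (rule nn_integral_liminf) (use im in measurable)
      finally show ?thesis .
    qed
    have Jm[measurable]: "J k \<in> borel_measurable borel" for k
    proof -
      have "(\<lambda>p. Ht k (fst p) (snd p)) \<in> borel_measurable (borel \<Otimes>\<^sub>M borel)"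
        unfolding Ht_def by (rule profile.Ht_measurable[OF prof]) measurable
      note [measurable] = measurable_compose[OF measurable_Pair this, simplified]
      have [measurable]: "(\<lambda>p. IFT (Ht k (fst p)) (snd p)) \<in> borel_measurable (borel \<Otimes>\<^sub>M borel)"
        unfolding IFT_def FT_def by (intro borel_measurable_times borel_measurable_const lborel.borel_measurable_lebesgue_integral) measurable
      show ?thesis unfolding J_def by measurable
    qed
    define I where "I = (\<integral>\<^sup>+z. ennreal ((cmod (u' z))^4) \<partial>lborel)"
    have "I = (\<integral>\<^sup>+z. ennreal ((cmod (u' z))^4) \<partial>((lborel :: (real^2) measure) \<Otimes>\<^sub>M (lborel :: real measure)))"
      unfolding I_def lborel_prod ..
    also have "\<dots> = (\<integral>\<^sup>+t. \<integral>\<^sup>+x. ennreal ((cmod (u' (x, t)))^4) \<partial>lborel \<partial>lborel)"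
      by (rule lborel_pair.nn_integral_snd[symmetric]) measurable
    also have "\<dots> \<le> (\<integral>\<^sup>+t. liminf (\<lambda>k. J k t) \<partial>lborel)"
    proof (rule nn_integral_mono_AE)
      show "AE t in lborel. (\<integral>\<^sup>+x. ennreal ((cmod (u' (x, t)))^4) \<partial>lborel) \<le> liminf (\<lambda>k. J k t)"
        using aet by (rule AE_mp) (rule AE_I2, rule impI, rule slice)
    qed
    also have "\<dots> \<le> liminf (\<lambda>k. \<integral>\<^sup>+t. J k t \<partial>lborel)"
      by (rule nn_integral_liminf) measurable
    also have "\<dots> \<le> liminf (\<lambda>k. ennreal (S k))"
      by (intro Liminf_mono always_eventually allI JS)
    also have "\<dots> = ennreal ((n^4 - \<kappa> * n\<^sup>2 * d\<^sup>2) / 4)"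
      by (intro lim_imp_Liminf tendsto_ennrealI Slim) simp
    also have "\<dots> \<le> ennreal (n^4 * (1 / 4) * (1 - min \<kappa> 1 * (d\<^sup>2 / n\<^sup>2)))"
    proof (rule ennreal_leI)
      have 1: "n^4 * (1 / 4) * (1 - m * q) = (n^4 - m * (n^4 * q)) / 4" for m q :: real
        by (simp add: algebra_simps)
      have "min \<kappa> 1 * (n\<^sup>2 * d\<^sup>2) \<le> \<kappa> * (n\<^sup>2 * d\<^sup>2)" by (intro mult_right_mono) auto
      moreover have 2: "n^4 * (d\<^sup>2 / n\<^sup>2) = n\<^sup>2 * d\<^sup>2" using n by (simp add: power2_eq_square power4_eq_xxxx)
      ultimately show "(n^4 - \<kappa> * n\<^sup>2 * d\<^sup>2) / 4 \<le> n^4 * (1 / 4) * (1 - min \<kappa> 1 * (d\<^sup>2 / n\<^sup>2))"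
        unfolding 1 2 by (simp add: mult.assoc mult.commute[of "d\<^sup>2"])
    qed
    finally have I: "I \<le> ennreal (n^4 * (1 / 4) * (1 - min \<kappa> 1 * (d\<^sup>2 / n\<^sup>2)))" .
    have q: "0 \<le> 1 - min \<kappa> 1 * (d\<^sup>2 / n\<^sup>2)"
    proof -
      have "d\<^sup>2 / n\<^sup>2 \<le> 1" using n dn d0 by (simp add: power_mono)
      then have "min \<kappa> 1 * (d\<^sup>2 / n\<^sup>2) \<le> 1 * 1" using \<kappa> by (intro mult_mono) auto
      then show ?thesis by simp
    qed
    note r = Lp_norm_representative[OF um u' aeu, of 4, simplified, folded I_def]
    show "u \<in> Lp_space 4 lebesgue"
      unfolding r(1) using I by (rule le_less_trans) simp
    have "Lp_norm 4 lebesgue u = root 4 (enn2real I)"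
      unfolding r(2) by (simp add: powr_quarter)
    also have "\<dots> \<le> root 4 (n^4 * (1 / 4) * (1 - min \<kappa> 1 * (d\<^sup>2 / n\<^sup>2)))"
      using I q by (intro real_root_le_mono enn2real_leI) auto
    also have "\<dots> = 1 / sqrt 2 * n * root 4 (1 - min \<kappa> 1 * (d\<^sup>2 / n\<^sup>2))"
      unfolding real_root_mult root4_quarter using n by (simp add: real_root_power_cancel)
    finally show "Lp_norm 4 lebesgue u \<le> 1 / sqrt 2 * L2_norm f *
      root 4 (1 - min \<kappa> 1 * ((L2_Dist f radial_gaussians)\<^sup>2 / (L2_norm f)\<^sup>2))"
      unfolding n_def d_def .
  qed
qed

end
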